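(* Let $\mu\subseteq\lambda$ be any pair of partitions and let $\mathbf{z}=(z_1,\dots,z_r)$, $\mathbf{w}=(w_1,\dots,w_r)$. Then $$\langle\mu|e^{L_+(\mathbf{z})}e^{-L_+(\mathbf{w})}|\lambda\rangle=\mathcal{G}^n_{\lambda/\mu}(\mathbf{z}|\mathbf{w};q),\qquad L_+(\mathbf{z})=\sum_{k=1}^\infty\frac1k\Big(\sum_iz_i^k\Big)J_k.$$ Moreover $\mathcal{G}^n_{\lambda/\mu}(\mathbf{z}|\mathbf{w};q)$ vanishes unless $\lambda$ and $\mu$ have the same $n$-core.
   Context: Fix an integer $n\ge1$ and $q\in\mathbb{C}^\times$ not a root of unity; put $v=q^2$, $\sqrt v=q$, and let $g:\mathbb{Z}/n\mathbb{Z}\to\mathbb{C}$ be $g(0)=-v$, $g(a)=-\sqrt v=-q$ for $a\not\equiv0$ (the case without Drinfeld twisting). Quantum Fock space. $\mathfrak{F}_0$ is the complex vector space spanned by semi-infinite wedges $u_{i_0}\wedge u_{i_{-1}}\wedge\cdots$ ($i_k\in\mathbb{Z}$, $i_k=k$ for $k\ll0$) modulo the following relations in every pair of adjacent factors: for $l\equiv p$ mod $n$, $u_l\wedge u_p=-u_p\wedge u_l$; and for $p>l$, $p\not\equiv l$ mod $n$, with $0<i<n$, $i\equiv p-l$ mod $n$, $$u_l\wedge u_p=g(l-p)\,u_p\wedge u_l+(v-1)\sum_{t\ge0}v^t\big(u_{p-tn-i}\wedge u_{l+tn+i}+g(l-p)\,u_{p-(t+1)n}\wedge u_{l+(t+1)n}\big),$$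 keeping on the right only terms $u_a\wedge u_b$ with $a>b$. A basis is given by $|\lambda\rangle=u_{\lambda_1}\wedge u_{\lambda_2-1}\wedge u_{\lambda_3-2}\wedge\cdots$, $\lambda$ a partition. $\langle\mu|A|\lambda\rangle$ is the coefficient of $|\mu\rangle$ in $A|\lambda\rangle$. For $k\ne0$, $J_k$ is the (well-defined) operator sending $u_{i_0}\wedge u_{i_{-1}}\wedge\cdots$ to the sum over $j\le0$ of the wedge with $u_{i_j}$ replaced by $u_{i_j-nk}$ (all but finitely many summands vanish). Ribbons (English convention). An $n$-ribbon is a connected skew shape with $n$ boxes containing no $2\times2$ block; its spin is its height (number of rows it occupies) minus $1$. A horizontal $n$-ribbon strip is a skew shape $\lambda/\mu$ that can be decomposed into disjoint $n$-ribbons, each of whose top-right-most box either is adjacent to $\mu$ (directly below a box of $\mu$) or lies in the first row. Vertical $n$-ribbon strips are defined similarly: a skew shape whose conjugate is a horizontal $n$-ribbon strip, decomposed into $n$-ribbons by conjugating. The spin of a strip is the sum of the spins of the ribbons in its decomposition. The $n$-core of $\lambda$ is the unique smallest partition obtainable from $\lambda$ by successively removing $n$-ribbons. A super ribbon tableau $T$ of shape $\lambda/\mu$ is a chain $\mu=\lambda_{r+1}\subset\lambda_{r'}\subset\lambda_r\subset\cdots\subset\lambda_{1'}\subset\lambda_1=\lambda$ of partitions (inclusions not necessarily strict) with each $\lambda_i/\lambda_{i'}$ a horizontal $n$-ribbon strip and each $\lambda_{i'}/\lambda_{i+1}$ a vertical $n$-ribbon strip. $s(T)$ is the sum of the spins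 of all these strips; $\mathrm{wt}(T)=(\nu_1,\dots,\nu_r)$ and $\mathrm{wt}'(T)=(\nu_1',\dots,\nu_r')$, with $\nu_i=|\lambda_i/\lambda_{i'}|/n$ and $\nu'_i=|\lambda_{i'}/\lambda_{i+1}|/n$ the numbers of ribbons. The super ribbon function is $\mathcal{G}^n_{\lambda/\mu}(\mathbf{z}|\mathbf{w};q)=\sum_Tq^{s(T)}\mathbf{z}^{\mathrm{wt}(T)}(-\mathbf{w})^{\mathrm{wt}'(T)}$, the sum over super ribbon tableaux of shape $\lambda/\mu$.
   Formalization: With the stated conventions the identity fails (n=2, λ=(1,1), μ=∅: left side −qΣ(z_i−w_i), right side +qΣ(z_i−w_i)), so it is proved with G^n_{λ/μ}(z|w;−q) on the right, for complex numbers z_i, w_i. *)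

theory Defs
  imports "HOL-Library.Poly_Mapping" "HOL-Number_Theory.Cong" Complex_Main
begin

section \<open>Partitions and diagrams\<close>

text \<open>
  Parts are indexed from \<open>0\<close>: \<open>part lam i\<close> is the part usually written \<open>lam\<^sub>i\<^sub>+\<^sub>1\<close>.
\<close>

typedef int_partition = "{f :: nat \<Rightarrow> nat. antimono f \<and> finite {i. f i \<noteq> 0}}"
  morphisms part Abs_int_partition
  by (rule exI[of _ "\<lambda>_. 0"]) (simp add: antimono_def)

setup_lifting type_definition_int_partition

text \<open>English convention: box \<open>(i, j)\<close> is in row \<open>i\<close> (counted downwards) and column \<open>j\<close>.\<close>

definition diagram :: "int_partition \<Rightarrow> (nat \<times> nat) set" where
  "diagram lam = {(i, j). j < part lam i}"

definition skew_shape :: "(nat \<times> nat) set \<Rightarrow> bool" where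
  "skew_shape S \<longleftrightarrow> (\<exists>\<alpha> \<beta>. diagram \<beta> \<subseteq> diagram \<alpha> \<and> S = diagram \<alpha> - diagram \<beta>)"


section \<open>Ribbons and ribbon strips\<close>

definition adjacent_boxes :: "nat \<times> nat \<Rightarrow> nat \<times> nat \<Rightarrow> bool" where
  "adjacent_boxes a b \<longleftrightarrow>
     (fst a = fst b \<and> (snd a = Suc (snd b) \<or> snd b = Suc (snd a))) \<or>
     (snd a = snd b \<and> (fst a = Suc (fst b) \<or> fst b = Suc (fst a)))"

definition connected_boxes :: "(nat \<times> nat) set \<Rightarrow> bool" where
  "connected_boxes S \<longleftrightarrow>
     (\<forall>a\<in>S. \<forall>b\<in>S. (\<lambda>x y. x \<in> S \<and> y \<in> S \<and> adjacent_boxes x y)\<^sup>*\<^sup>* a b)"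

definition ribbon :: "nat \<Rightarrow> (nat \<times> nat) set \<Rightarrow> bool" where
  "ribbon n S \<longleftrightarrow> skew_shape S \<and> connected_boxes S \<and> card S = n \<and>
     (\<nexists>i j. {(i, j), (i, Suc j), (Suc i, j), (Suc i, Suc j)} \<subseteq> S)"

definition ribbon_spin :: "(nat \<times> nat) set \<Rightarrow> nat" where
  "ribbon_spin S = card (fst ` S) - 1"

definition top_right_box :: "(nat \<times> nat) set \<Rightarrow> nat \<times> nat \<Rightarrow> bool" where
  "top_right_box S b \<longleftrightarrow> b \<in> S \<and> (\<forall>c\<in>S. fst b \<le> fst c \<and> snd c \<le> snd b)"

text \<open>
  \<open>hstrip_decomp n L M D\<close>: \<open>D\<close> is a decomposition exhibiting \<open>L/M\<close>, for diagrams
  \<open>M\<close> and \<open>L\<close>, as a horizontal \<open>n\<close>-ribbon strip. For given \<open>n \<ge> 1\<close>, \<open>L\<close> and \<open>M\<close> there is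
  at most one such \<open>D\<close>. Working with diagrams rather than partitions makes conjugation
  the image under \<^const>\<open>prod.swap\<close>.
\<close>

definition hstrip_decomp ::
    "nat \<Rightarrow> (nat \<times> nat) set \<Rightarrow> (nat \<times> nat) set \<Rightarrow> (nat \<times> nat) set set \<Rightarrow> bool" where
  "hstrip_decomp n L M D \<longleftrightarrow>
     M \<subseteq> L \<and> \<Union>D = L - M \<and> pairwise disjnt D \<and>
     (\<forall>R\<in>D. ribbon n R \<and>
        (\<exists>i j. top_right_box R (i, j) \<and> (i = 0 \<or> (i - 1, j) \<in> M)))"

definition vstrip_decomp ::
    "nat \<Rightarrow> (nat \<times> nat) set \<Rightarrow> (nat \<times> nat) set \<Rightarrow> (nat \<times> nat) set set \<Rightarrow> bool" where
  "vstrip_decomp n L M D \<longleftrightarrow>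
     hstrip_decomp n (prod.swap ` L) (prod.swap ` M) ((`) prod.swap ` D)"

definition horizontal_strip :: "nat \<Rightarrow> int_partition \<Rightarrow> int_partition \<Rightarrow> bool" where
  "horizontal_strip n lam \<mu> \<longleftrightarrow> (\<exists>D. hstrip_decomp n (diagram lam) (diagram \<mu>) D)"

definition vertical_strip :: "nat \<Rightarrow> int_partition \<Rightarrow> int_partition \<Rightarrow> bool" where
  "vertical_strip n lam \<mu> \<longleftrightarrow> (\<exists>D. vstrip_decomp n (diagram lam) (diagram \<mu>) D)"

definition hstrip_spin :: "nat \<Rightarrow> int_partition \<Rightarrow> int_partition \<Rightarrow> nat" where
  "hstrip_spin n lam \<mu> =
     (\<Sum>R \<in> (THE D. hstrip_decomp n (diagram lam) (diagram \<mu>) D). ribbon_spin R)"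

definition vstrip_spin :: "nat \<Rightarrow> int_partition \<Rightarrow> int_partition \<Rightarrow> nat" where
  "vstrip_spin n lam \<mu> =
     (\<Sum>R \<in> (THE D. vstrip_decomp n (diagram lam) (diagram \<mu>) D). ribbon_spin R)"

definition removes_ribbon :: "nat \<Rightarrow> int_partition \<Rightarrow> int_partition \<Rightarrow> bool" where
  "removes_ribbon n lam \<kappa> \<longleftrightarrow>
     diagram \<kappa> \<subseteq> diagram lam \<and> ribbon n (diagram lam - diagram \<kappa>)"

definition n_core :: "nat \<Rightarrow> int_partition \<Rightarrow> int_partition" where
  "n_core n lam = (THE \<kappa>. (removes_ribbon n)\<^sup>*\<^sup>* lam \<kappa> \<and>
     (\<forall>\<nu>. (removes_ribbon n)\<^sup>*\<^sup>* lam \<nu> \<longrightarrow> diagram \<kappa> \<subseteq> diagram \<nu>))"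


section \<open>Super ribbon functions\<close>

text \<open>
  A chain \<open>lam = lam\<^sub>1 \<supseteq> lam\<^sub>1\<^sub>' \<supseteq> lam\<^sub>2 \<supseteq> \<dots> \<supseteq> lam\<^sub>r\<^sub>' \<supseteq> lam\<^sub>r\<^sub>+\<^sub>1 = \<mu>\<close> is stored as a list of length
  \<open>2 r + 1\<close>, largest partition first; entry \<open>2 i\<close> is \<open>lam\<^sub>i\<^sub>+\<^sub>1\<close> and entry \<open>2 i + 1\<close> is \<open>lam\<^sub>(\<^sub>i\<^sub>+\<^sub>1\<^sub>)\<^sub>'\<close>.
  Likewise \<open>z i\<close> and \<open>w i\<close> with \<open>i < r\<close> stand for \<open>z\<^sub>i\<^sub>+\<^sub>1\<close> and \<open>w\<^sub>i\<^sub>+\<^sub>1\<close>.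
\<close>

definition super_ribbon_tableau ::
    "nat \<Rightarrow> nat \<Rightarrow> int_partition \<Rightarrow> int_partition \<Rightarrow> int_partition list \<Rightarrow> bool" where
  "super_ribbon_tableau n r lam \<mu> T \<longleftrightarrow>
     length T = 2 * r + 1 \<and> T ! 0 = lam \<and> T ! (2 * r) = \<mu> \<and>
     (\<forall>i<r. horizontal_strip n (T ! (2 * i)) (T ! (2 * i + 1)) \<and>
            vertical_strip n (T ! (2 * i + 1)) (T ! (2 * i + 2)))"

definition tableau_spin :: "nat \<Rightarrow> nat \<Rightarrow> int_partition list \<Rightarrow> nat" where
  "tableau_spin n r T =
     (\<Sum>i<r. hstrip_spin n (T ! (2 * i)) (T ! (2 * i + 1)) +
             vstrip_spin n (T ! (2 * i + 1)) (T ! (2 * i + 2)))"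

definition ribbon_count :: "nat \<Rightarrow> int_partition \<Rightarrow> int_partition \<Rightarrow> nat" where
  "ribbon_count n lam \<mu> = card (diagram lam - diagram \<mu>) div n"

definition tableau_wt :: "nat \<Rightarrow> int_partition list \<Rightarrow> nat \<Rightarrow> nat" where
  "tableau_wt n T i = ribbon_count n (T ! (2 * i)) (T ! (2 * i + 1))"

definition tableau_wt' :: "nat \<Rightarrow> int_partition list \<Rightarrow> nat \<Rightarrow> nat" where
  "tableau_wt' n T i = ribbon_count n (T ! (2 * i + 1)) (T ! (2 * i + 2))"

definition super_ribbon_function ::
    "nat \<Rightarrow> nat \<Rightarrow> int_partition \<Rightarrow> int_partition \<Rightarrow>
      (nat \<Rightarrow> complex) \<Rightarrow> (nat \<Rightarrow> complex) \<Rightarrow> complex \<Rightarrow> complex" where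
  "super_ribbon_function n r lam \<mu> z w q =
     (\<Sum>T | super_ribbon_tableau n r lam \<mu> T.
        q ^ tableau_spin n r T *
        (\<Prod>i<r. z i ^ tableau_wt n T i) * (\<Prod>i<r. (- w i) ^ tableau_wt' n T i))"


section \<open>The quantum Fock space\<close>

text \<open>
  The factors are numbered from the left: the factor of index \<open>i\<^sub>-\<^sub>j\<close>, \<open>j \<ge> 0\<close>, is at
  position \<open>j\<close>, so that \<open>i\<^sub>k = k\<close> for \<open>k \<lless> 0\<close> says that the entry at position \<open>j\<close> is
  eventually \<open>- j\<close>.
\<close>

typedef wedge_seq = "{i :: nat \<Rightarrow> int. \<forall>\<^sub>F j in sequentially. i j = - int j}"
  morphisms entry Abs_wedge_seq
  by (rule exI[of _ "\<lambda>j. - int j"]) simp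

setup_lifting type_definition_wedge_seq

lift_definition set_entry :: "wedge_seq \<Rightarrow> nat \<Rightarrow> int \<Rightarrow> wedge_seq"
  is "\<lambda>i j a. i(j := a)"
proof -
  fix i :: "nat \<Rightarrow> int" and j :: nat and a :: int
  assume "\<forall>\<^sub>F k in sequentially. i k = - int k"
  with eventually_gt_at_top[of j] show "\<forall>\<^sub>F k in sequentially. (i(j := a)) k = - int k"
    by eventually_elim simp
qed

lift_definition partition_seq :: "int_partition \<Rightarrow> wedge_seq"
  is "\<lambda>f j. int (f j) - int j"
proof -
  fix f :: "nat \<Rightarrow> nat"
  assume "antimono f \<and> finite {i. f i \<noteq> 0}"
  then have "\<forall>\<^sub>F j in cofinite. f j = 0"
    by (simp add: eventually_cofinite)
  then have "\<forall>\<^sub>F j in sequentially. f j = 0"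
    by (simp add: cofinite_eq_sequentially)
  then show "\<forall>\<^sub>F j in sequentially. int (f j) - int j = - int j"
    by eventually_elim simp
qed

text \<open>The free complex vector space on the symbols \<open>u\<^bsub>i_0\<^esub> \<and> u\<^bsub>i_(-1)\<^esub> \<and> \<dots>\<close>.\<close>

type_synonym wedge_vec = "wedge_seq \<Rightarrow>\<^sub>0 complex"

definition scale_wedge :: "complex \<Rightarrow> wedge_vec \<Rightarrow> wedge_vec" (infixr \<open>*\<^sub>W\<close> 75) where
  "c *\<^sub>W x = Poly_Mapping.map ((*) c) x"

lemma lookup_scale_wedge [simp]:
  "Poly_Mapping.lookup (c *\<^sub>W x) i = c * Poly_Mapping.lookup x i"
  by (simp add: scale_wedge_def Poly_Mapping.map.rep_eq when_def)

interpretation wedge_space: vector_space scale_wedge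
  by unfold_locales (auto intro!: poly_mapping_eqI simp: lookup_add algebra_simps)

definition wedge :: "wedge_seq \<Rightarrow> wedge_vec" where
  "wedge i = Poly_Mapping.single i 1"

definition wedge_with_pair :: "wedge_seq \<Rightarrow> nat \<Rightarrow> int \<Rightarrow> int \<Rightarrow> wedge_vec" where
  "wedge_with_pair i j a b = wedge (set_entry (set_entry i j a) (Suc j) b)"

definition twist_g :: "nat \<Rightarrow> complex \<Rightarrow> int \<Rightarrow> complex" where
  "twist_g n q a = (if [a = 0] (mod int n) then - (q\<^sup>2) else - q)"

text \<open>Left-hand side minus right-hand side of the two kinds of relations, with \<open>v = q\<^sup>2\<close>.\<close>

definition congruent_relator :: "wedge_seq \<Rightarrow> nat \<Rightarrow> wedge_vec" where
  "congruent_relator i j =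
     (let l = entry i j; p = entry i (Suc j)
      in wedge_with_pair i j l p - (- wedge_with_pair i j p l))"

definition straightening_relator :: "nat \<Rightarrow> complex \<Rightarrow> wedge_seq \<Rightarrow> nat \<Rightarrow> wedge_vec" where
  "straightening_relator n q i j =
     (let l = entry i j; p = entry i (Suc j); d = (p - l) mod int n;
          v = q\<^sup>2; g = twist_g n q (l - p); N = int n
      in wedge_with_pair i j l p -
         (g *\<^sub>W wedge_with_pair i j p l +
          (v - 1) *\<^sub>W
            ((\<Sum>t | l + int t * N + d < p - int t * N - d.
                v ^ t *\<^sub>W wedge_with_pair i j (p - int t * N - d) (l + int t * N + d)) +
             (\<Sum>t | l + (int t + 1) * N < p - (int t + 1) * N.
                (v ^ t * g) *\<^sub>W wedge_with_pair i j (p - (int t + 1) * N) (l + (int t + 1) * N)))))"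

definition fock_relators :: "nat \<Rightarrow> complex \<Rightarrow> wedge_vec set" where
  "fock_relators n q =
     {congruent_relator i j | i j. [entry i j = entry i (Suc j)] (mod int n)} \<union>
     {straightening_relator n q i j | i j.
        entry i j < entry i (Suc j) \<and> \<not> [entry i j = entry i (Suc j)] (mod int n)}"

text \<open>
  The Fock space is the quotient of \<^typ>\<open>wedge_vec\<close> by the subspace \<open>fock_null n q\<close>. Its vectors
  are denoted by representatives throughout: \<open>x\<close> and \<open>y\<close> denote the same vector iff
  \<open>x - y \<in> fock_null n q\<close>, and an operator is given by its effect on representatives.
\<close>

definition fock_null :: "nat \<Rightarrow> complex \<Rightarrow> wedge_vec set" where
  "fock_null n q = wedge_space.span (fock_relators n q)"

text \<open>
  Sum of a family of vectors of the Fock space of which all but finitely many are zero (zero in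
  the quotient; the representatives \<open>f a\<close> themselves need not vanish).
\<close>

definition fock_sum :: "nat \<Rightarrow> complex \<Rightarrow> ('a \<Rightarrow> wedge_vec) \<Rightarrow> 'a set \<Rightarrow> wedge_vec" where
  "fock_sum n q f A = (\<Sum>a | a \<in> A \<and> f a \<notin> fock_null n q. f a)"

definition ket :: "int_partition \<Rightarrow> wedge_vec" where
  "ket lam = wedge (partition_seq lam)"

text \<open>Coordinates with respect to the basis of the Fock space formed by the \<open>ket lam\<close>.\<close>

definition fock_coords :: "nat \<Rightarrow> complex \<Rightarrow> wedge_vec \<Rightarrow> (int_partition \<Rightarrow>\<^sub>0 complex)" where
  "fock_coords n q x =
     (THE c. x - (\<Sum>lam\<in>Poly_Mapping.keys c. Poly_Mapping.lookup c lam *\<^sub>W ket lam) \<in> fock_null n q)"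

definition matrix_coeff ::
    "nat \<Rightarrow> complex \<Rightarrow> int_partition \<Rightarrow> (wedge_vec \<Rightarrow> wedge_vec) \<Rightarrow> int_partition \<Rightarrow> complex" where
  "matrix_coeff n q \<mu> A lam = Poly_Mapping.lookup (fock_coords n q (A (ket lam))) \<mu>"

definition J_op :: "nat \<Rightarrow> complex \<Rightarrow> int \<Rightarrow> wedge_vec \<Rightarrow> wedge_vec" where
  "J_op n q k x =
     (\<Sum>i\<in>Poly_Mapping.keys x. Poly_Mapping.lookup x i *\<^sub>W
        fock_sum n q (\<lambda>j. wedge (set_entry i j (entry i j - int n * k))) UNIV)"

definition L_plus ::
    "nat \<Rightarrow> complex \<Rightarrow> nat \<Rightarrow> (nat \<Rightarrow> complex) \<Rightarrow> wedge_vec \<Rightarrow> wedge_vec" where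
  "L_plus n q r z x =
     fock_sum n q (\<lambda>k. (1 / of_nat k * (\<Sum>i<r. z i ^ k)) *\<^sub>W J_op n q (int k) x) {1..}"

definition exp_op ::
    "nat \<Rightarrow> complex \<Rightarrow> (wedge_vec \<Rightarrow> wedge_vec) \<Rightarrow> wedge_vec \<Rightarrow> wedge_vec" where
  "exp_op n q A x = fock_sum n q (\<lambda>m. (1 / fact m) *\<^sub>W (A ^^ m) x) UNIV"

text \<open>
  Sign convention: with \<open>g(a) = - q\<close> for \<open>a\<close> not divisible by \<open>n\<close>, moving a factor past \<open>h\<close> others
  produces \<open>(- q) ^ h\<close>, so a ribbon of spin \<open>h\<close> contributes \<open>(- q) ^ h\<close> to the matrix coefficients
  of \<open>J_op n q 1\<close>. For example, for \<open>n = 2\<close> it maps the ket of the partition \<open>(1, 1)\<close>, that is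
  \<open>u\<^sub>1 \<and> u\<^sub>0 \<and> u\<^sub>-\<^sub>2 \<and> \<dots>\<close>, to \<open>u\<^sub>-\<^sub>1 \<and> u\<^sub>0 \<and> u\<^sub>-\<^sub>2 \<and> \<dots> = - q (u\<^sub>0 \<and> u\<^sub>-\<^sub>1 \<and> u\<^sub>-\<^sub>2 \<and> \<dots>)\<close>, while the
  vertical domino has spin \<open>1\<close>. Matrix coefficients for the parameter \<open>q\<close> are therefore
  super ribbon functions evaluated at the square root \<open>- q\<close> of \<open>v\<close>.
\<close>

end

theory Submission
  imports Defs
begin

text \<open>
  Identify \<open>u\<^bsub>a + n s\<^esub>\<close> with \<open>u\<^sub>a X ^ s\<close>. The affine Hecke algebra acts on tensors of the \<open>u\<^sub>i\<close>, and the wedge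
  relations span the image of the operators \<open>T\<^sub>i + 1\<close>. The antisymmetrizer kills this image and
  is unitriangular on decreasing sequences; together with straightening this makes the kets a basis.
  The operator \<open>J\<^sub>k\<close> is the power sum in the commuting shifts of the factors by \<open>- n k\<close>, which
  descends to the quotient since symmetric functions in the shifts are central.

  The generating function \<open>V(z)\<close> of the elementary symmetric functions in the shifts lowers
  disjoint sets of factors by \<open>n\<close>. On a ket this produces only inversions with gap less than \<open>n\<close>, so
  sorting multiplies by a power of \<open>- q\<close>, and \<open>V(z)\<close> adds up vertical strips. The operator \<open>H(z)\<close>
  defined by horizontal strips satisfies \<open>V(- z) H(z) = 1\<close>, by a sign-reversing involution on
  pairs of strips. Thus the super ribbon functions are the coefficients of the product of all
  \<open>V(- w\<^sub>i) H(z\<^sub>i)\<close>.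

  Finally, let \<open>D\<close> multiply a ket by the size of its partition. By Newton's identities, both this
  product and the product of the two exponentials solve the equation
  \<open>D X = X D - n (\<Sum>k. p\<^sub>k J\<^sub>k) X\<close> with \<open>p\<^sub>k = (\<Sum>i. z\<^sub>i ^ k) - (\<Sum>i. w\<^sub>i ^ k)\<close>. Both are unitriangular with
  respect to the size, so they coincide.
\<close>

section \<open>Beads of partitions\<close>

text \<open>A ribbon is one step of a bead from x to x - n, and a strip is handled as the set of
  starting points of its steps. The two kinds of strips then differ only in a condition on the beads
  of the smaller partition, and spins count positions strictly between the ends of a step, just as
  sorting a wedge does. The straightening rule has weights v^t, the Demazure-Lusztig operator has
  constant weights; relators and images of T + 1 therefore do not match one by one. They are
  compared by moving both entries of a pair inwards by n: the two recursions have the same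
  right-hand side. Passing between them divides by q and by 1 + v. An antisymmetrizer acts on
  finitely many factors only and kills a relation only once it covers its two places, so
  independence of the kets is tested with large M. V(z) is explicit on kets only, and therefore its
  commutation with J_k is not immediate from commuting shifts. It is obtained from uniqueness of
  solutions of an equation with D, in the same way as the final comparison.\<close>

lemma part_antimono: "i \<le> j \<Longrightarrow> part lam j \<le> part lam i"
  using part[of lam] by (auto simp: antimono_def)

lemma part_eventually_0:
  fixes lam obtains m where "\<And>i. i \<ge> m \<Longrightarrow> part lam i = 0"
proof -
  have "finite {i. part lam i \<noteq> 0}"
    using part[of lam] by auto
  then obtain m where "\<And>i. i \<in> {i. part lam i \<noteq> 0} \<Longrightarrow> i < m"
    using finite_nat_set_iff_bounded by meson
  then show ?thesis
    using that[of m] by (metis (mono_tags, lifting) linorder_not_less mem_Collect_eq)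
qed

definition bead :: "int_partition \<Rightarrow> int \<Rightarrow> bool" where
  "bead lam x \<longleftrightarrow> (\<exists>i. x = int (part lam i) - int i)"

text \<open>For negative \<open>c\<close> the count includes the \<open>- c\<close> rows above the
  first box of the diagonal \<open>c\<close>. This lets \<open>mem_diagram_iff\<close> hold without
  a case split on the sign of the content.\<close>

definition beads_above :: "int_partition \<Rightarrow> int \<Rightarrow> nat" where
  "beads_above lam c = card {i. c < int (part lam i) - int i}"

lemma down_closed_eq_lessThan_card:
  fixes S :: "nat set"
  assumes "finite S" and "\<And>i j. j \<in> S \<Longrightarrow> i \<le> j \<Longrightarrow> i \<in> S"
  shows "S = {..<card S}"
proof (cases "S = {}")
  case False
  then have "S = {..Max S}"
    using assms by (auto intro: Max_in Max_ge)
  then have "S = {..<Suc (Max S)}"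
    by (simp add: lessThan_Suc_atMost)
  then show ?thesis
    by (metis card_lessThan)
qed simp

lemma less_beads_above_iff: "i < beads_above lam c \<longleftrightarrow> c < int (part lam i) - int i"
proof -
  let ?S = "{i. c < int (part lam i) - int i}"
  have "?S \<subseteq> {..nat (int (part lam 0) - c)}"
  proof
    fix i assume "i \<in> ?S"
    moreover have "part lam i \<le> part lam 0" by (simp add: part_antimono)
    ultimately show "i \<in> {..nat (int (part lam 0) - c)}" by simp
  qed
  then have "finite ?S" by (rule finite_subset) simp
  moreover have "i \<in> ?S" if "j \<in> ?S" "i \<le> j" for i j
    using that part_antimono[of i j lam] by simp
  ultimately have "?S = {..<card ?S}" by (rule down_closed_eq_lessThan_card)
  then show ?thesis unfolding beads_above_def by blast
qed

lemma mem_diagram_iff: "(i, j) \<in> diagram lam \<longleftrightarrow> i < beads_above lam (int j - int i)"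
  by (simp add: diagram_def less_beads_above_iff)

text \<open>Distinct rows give distinct beads, so lowering the threshold by one gains at most a
  single row.\<close>

lemma beads_above_step: "beads_above lam (c - 1) = beads_above lam c + of_bool (bead lam c)"
proof -
  have inj: "i = j" if "int (part lam i) - int i = int (part lam j) - int j" for i j
    using that part_antimono[of i j lam] part_antimono[of j i lam] by linarith
  have "\<exists>i. {i. c - 1 < int (part lam i) - int i} = insert i {i. c < int (part lam i) - int i}
      \<and> i \<notin> {i. c < int (part lam i) - int i}" if b: "bead lam c"
  proof -
    from b obtain i where i: "c = int (part lam i) - int i" by (auto simp: bead_def)
    have "{i. c - 1 < int (part lam i) - int i} = insert i {i. c < int (part lam i) - int i}"
      using i inj by (force simp: order.strict_iff_order)
    then show ?thesis using i by blast
  qed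
  moreover have "finite {i. c < int (part lam i) - int i}" for c
  proof -
    have "{i. c < int (part lam i) - int i} = {..<beads_above lam c}"
      by (auto simp: less_beads_above_iff)
    then show ?thesis by simp
  qed
  moreover have "{i. c - 1 < int (part lam i) - int i} = {i. c < int (part lam i) - int i}"
    if "\<not> bead lam c"
    using that by (auto simp: bead_def order.strict_iff_order zle_diff1_eq[symmetric])
  ultimately show ?thesis
    unfolding beads_above_def by (auto simp: card_insert_if)
qed

lemma antitone_int:
  fixes N :: "int \<Rightarrow> 'a :: preorder"
  assumes "\<And>c. N c \<le> N (c - 1)" and "c \<le> d"
  shows "N d \<le> N c"
  using assms(2)
proof (induction d rule: int_ge_induct)
  case (step i)
  then show ?case using assms(1)[of "i + 1"] by (auto intro: order_trans)
qed simp

lemma beads_above_eq_0: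
  fixes lam obtains C where "\<And>c. c \<ge> C \<Longrightarrow> beads_above lam c = 0"
proof
  fix c assume "c \<ge> int (part lam 0)"
  then have "\<not> 0 < beads_above lam c" by (subst less_beads_above_iff) auto
  then show "beads_above lam c = 0" by simp
qed

text \<open>Far to the left the count agrees with that of the empty partition; this is the
  normalisation to charge 0.\<close>

lemma beads_above_eq_uminus:
  fixes lam obtains C where "\<And>c. c \<le> C \<Longrightarrow> int (beads_above lam c) = - c"
proof -
  obtain m where m: "\<And>i. i \<ge> m \<Longrightarrow> part lam i = 0"
    using part_eventually_0[of lam] by metis
  show ?thesis
  proof
    fix c assume c: "c \<le> - int m - 1"
    have "\<not> nat (- c) < beads_above lam c"
      using c m[of "nat (-c)"] by (subst less_beads_above_iff) auto
    moreover have "nat (- c - 1) < beads_above lam c"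
      using c m[of "nat (-c-1)"] by (subst less_beads_above_iff) auto
    ultimately show "int (beads_above lam c) = - c" using c by linarith
  qed
qed

lemma beads_above_ge: "- c \<le> int (beads_above lam c)"
proof (rule ccontr)
  assume "\<not> - c \<le> int (beads_above lam c)"
  then have "beads_above lam c \<le> nat (- c - 1)" and "c < 0" by linarith+
  moreover have "nat (- c - 1) < beads_above lam c"
    using \<open>c < 0\<close> by (subst less_beads_above_iff) simp
  ultimately show False by simp
qed

lemma diagram_inject: "diagram lam = diagram \<mu> \<longleftrightarrow> lam = \<mu>"
proof
  assume "diagram lam = diagram \<mu>"
  then have "{j. (i, j) \<in> diagram lam} = {j. (i, j) \<in> diagram \<mu>}" for i by simp
  then have "{..<part lam i} = {..<part \<mu> i}" for i
    by (simp add: diagram_def lessThan_def)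
  then have "part lam = part \<mu>" by (simp add: fun_eq_iff)
  then show "lam = \<mu>" by (simp add: part_inject)
qed simp

lemma eq_of_beads_above: "(\<And>c. beads_above lam c = beads_above \<mu> c) \<Longrightarrow> lam = \<mu>"
  by (subst diagram_inject[symmetric]) (auto simp: mem_diagram_iff)

text \<open>Steps of 0 or 1 make \<open>N\<close> the counting function of a bead set, and the
  condition at the far left fixes its charge. Conjugates, truncated strips and single bead moves are
  all built with this lemma.\<close>

lemma partition_of_beads_above:
  fixes N :: "int \<Rightarrow> nat"
  assumes step: "\<And>c. N c \<le> N (c - 1)" "\<And>c. N (c - 1) \<le> N c + 1"
    and top: "\<And>c. c \<ge> C \<Longrightarrow> N c = 0" and bot: "\<And>c. c \<le> D \<Longrightarrow> int (N c) = - c"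
  obtains lam where "\<And>c. beads_above lam c = N c"
proof -
  have anti: "N d \<le> N c" if "c \<le> d" for c d
    using antitone_int[of N, OF step(1) that] .
  \<comment> \<open>\<open>N c + c\<close> is 0 far to the left and never decreases to the
    right.\<close>
  have ge: "- c \<le> int (N c)" for c
  proof -
    have "- (int (N c) + c) \<le> - (int (N (min c D)) + min c D)"
    proof (rule antitone_int[where N = "\<lambda>c. - (int (N c) + c)"])
      show "- (int (N c) + c) \<le> - (int (N (c - 1)) + (c - 1))" for c
        using step(2)[of c] by linarith
    qed simp
    then show ?thesis using bot[of "min c D"] by linarith
  qed
  define f where "f i = card {j. i < N (int j - int i)}" for i :: nat
  have less_f: "j < f i \<longleftrightarrow> i < N (int j - int i)" for i j
  proof -
    let ?S = "{j. i < N (int j - int i)}"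
    have "?S \<subseteq> {..<nat (C + int i)}"
    proof
      fix j assume "j \<in> ?S"
      then have "\<not> int j - int i \<ge> C" using top[of "int j - int i"] by auto
      then show "j \<in> {..<nat (C + int i)}" by auto
    qed
    then have "finite ?S" by (rule finite_subset) simp
    moreover have "j \<in> ?S" if "j' \<in> ?S" "j \<le> j'" for j j'
      using that anti[of "int j - int i" "int j' - int i"] by simp
    ultimately have "?S = {..<card ?S}" by (rule down_closed_eq_lessThan_card)
    then show ?thesis unfolding f_def by blast
  qed
  have "antimono f"
  proof (rule antimono_iff_le_Suc[THEN iffD2], rule allI, rule ccontr)
    fix i assume "\<not> f (Suc i) \<le> f i"
    then have "Suc i < N (int (f i) - int (Suc i))" using less_f not_le by blast
    then have "i < N (int (f i) - int i)"
      using step(2)[of "int (f i) - int i"] by (simp add: algebra_simps)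
    then show False using less_f by blast
  qed
  moreover have "finite {i. f i \<noteq> 0}"
  proof (rule finite_subset)
    show "{i. f i \<noteq> 0} \<subseteq> {..<nat (- D)}"
    proof
      fix i assume "i \<in> {i. f i \<noteq> 0}"
      then have "i < N (- int i)" using less_f[of 0 i] by simp
      then have "\<not> - int i \<le> D" using bot[of "- int i"] by auto
      then show "i \<in> {..<nat (- D)}" by auto
    qed
  qed simp
  ultimately have p: "part (Abs_int_partition f) = f"
    by (intro Abs_int_partition_inverse) simp
  have "beads_above (Abs_int_partition f) c = N c" for c
  proof -
    have "i < beads_above (Abs_int_partition f) c \<longleftrightarrow> i < N c" for i
    proof (cases "c + int i \<ge> 0")
      case True
      then have "c < int (f i) - int i \<longleftrightarrow> nat (c + int i) < f i" by linarith
      then show ?thesis using True by (simp add: less_beads_above_iff p less_f)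
    next
      case False
      then show ?thesis using ge[of c] by (simp add: less_beads_above_iff p)
    qed
    then show ?thesis by (meson linorder_neqE_nat less_irrefl)
  qed
  then show ?thesis by (rule that)
qed

definition content :: "nat \<times> nat \<Rightarrow> int" where
  "content b = int (snd b) - int (fst b)"

text \<open>The truncation by \<open>nat\<close> is faithful only if the column is nonnegative,
  hence the condition \<open>0 \<le> int (\<rho> c) + c\<close> in
  \<open>ribbon_rows\<close>.\<close>

definition box :: "nat \<Rightarrow> int \<Rightarrow> nat \<times> nat" where
  "box r c = (r, nat (int r + c))"

lemma fst_box [simp]: "fst (box r c) = r"
  by (simp add: box_def)

lemma content_box [simp]: "0 \<le> int r + c \<Longrightarrow> content (box r c) = c"
  by (simp add: box_def content_def)

lemma box_content [simp]: "box (fst b) (content b) = b"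
  by (cases b) (simp add: box_def content_def)

lemma mem_diagram_content: "b \<in> diagram lam \<longleftrightarrow> fst b < beads_above lam (content b)"
  by (cases b) (simp add: mem_diagram_iff content_def)

lemma bead_iff: "bead lam c \<longleftrightarrow> beads_above lam (c - 1) = Suc (beads_above lam c)"
  by (simp add: beads_above_step)

lemma eq_of_bead:
  assumes "\<And>c. bead lam c = bead \<mu> c"
  shows "lam = \<mu>"
proof (rule eq_of_beads_above)
  fix c
  obtain C where C: "\<And>c. c \<ge> C \<Longrightarrow> beads_above lam c = 0"
    using beads_above_eq_0[of lam] by metis
  obtain D where D: "\<And>c. c \<ge> D \<Longrightarrow> beads_above \<mu> c = 0"
    using beads_above_eq_0[of \<mu>] by metis
  have "c \<le> max c (max C D)" by simp
  then show "beads_above lam c = beads_above \<mu> c"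
  proof (induction c rule: int_le_induct)
    case base
    then show ?case using C D by simp
  next
    case (step i)
    then show ?case using assms by (simp add: beads_above_step)
  qed
qed

section \<open>Ribbons\<close>

lemma skew_shape_convex:
  assumes "skew_shape S" "(i, j) \<in> S" "(i', j') \<in> S" "i \<le> a" "a \<le> i'" "j \<le> b" "b \<le> j'"
  shows "(a, b) \<in> S"
proof -
  from assms(1) obtain \<alpha> \<beta> where S: "S = diagram \<alpha> - diagram \<beta>"
    by (auto simp: skew_shape_def)
  have "b < part \<alpha> a"
    using assms S part_antimono[of a i' \<alpha>] by (auto simp: diagram_def)
  moreover have "\<not> b < part \<beta> a"
    using assms S part_antimono[of i a \<beta>] by (auto simp: diagram_def)
  ultimately show ?thesis using S by (simp add: diagram_def)
qed

text \<open>By convexity of skew shapes, two boxes on one diagonal span a rectangle that contains a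
  2 x 2 block.\<close>

lemma ribbon_content_inj:
  assumes "ribbon n S"
  shows "inj_on content S"
proof -
  have False if "(i, j) \<in> S" "(i', j') \<in> S" "i < i'" "content (i, j) = content (i', j')" for i j i' j'
  proof -
    have "j < j'" using that by (simp add: content_def)
    then have "{(i, j), (i, Suc j), (Suc i, j), (Suc i, Suc j)} \<subseteq> S"
      using that assms skew_shape_convex[of S i j i' j'] by (auto simp: ribbon_def)
    then show False using assms by (auto simp: ribbon_def)
  qed
  then have "i = i'" if "(i, j) \<in> S" "(i', j') \<in> S" "content (i, j) = content (i', j')" for i j i' j'
    using that by (metis nat_neq_iff)
  then have "i = i' \<and> j = j'"
    if "(i, j) \<in> S" "(i', j') \<in> S" "content (i, j) = content (i', j')" for i j i' j'
    using that by (force simp: content_def)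
  then show ?thesis unfolding inj_on_def by (metis surj_pair)
qed

text \<open>A discrete intermediate value property: adjacent boxes differ in content by exactly
  one.\<close>

lemma connected_boxes_crossing:
  assumes "connected_boxes S" "a \<in> S" "b \<in> S" "content a \<le> c" "c < content b"
  shows "\<exists>x\<in>S. \<exists>y\<in>S. adjacent_boxes x y \<and> content x = c \<and> content y = c + 1"
proof -
  have "(\<lambda>x y. x \<in> S \<and> y \<in> S \<and> adjacent_boxes x y)\<^sup>*\<^sup>* a b"
    using assms by (auto simp: connected_boxes_def)
  then show ?thesis using assms(5)
  proof (induction rule: rtranclp_induct)
    case base
    then show ?case using assms(4) by simp
  next
    case (step x y)
    show ?case
    proof (cases "c < content x")
      case False
      then have "content x = c" "content y = c + 1"
        using step by (auto simp: adjacent_boxes_def content_def)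
      then show ?thesis using step by blast
    qed (use step in blast)
  qed
qed

text \<open>
  A ribbon has exactly one box on each diagonal that it meets, hence is encoded by its head (one
  plus the largest content) and the rows of its boxes as a function of the content.
\<close>

definition ribbon_set :: "nat \<Rightarrow> int \<Rightarrow> (int \<Rightarrow> nat) \<Rightarrow> (nat \<times> nat) set" where
  "ribbon_set n x \<rho> = (\<lambda>c. box (\<rho> c) c) ` {x - int n..<x}"

definition ribbon_rows :: "nat \<Rightarrow> int \<Rightarrow> (int \<Rightarrow> nat) \<Rightarrow> bool" where
  "ribbon_rows n x \<rho> \<longleftrightarrow> (\<forall>c\<in>{x - int n..<x}. 0 \<le> int (\<rho> c) + c) \<and>
     (\<forall>c\<in>{x - int n<..<x}. \<rho> (c - 1) = \<rho> c \<or> \<rho> (c - 1) = Suc (\<rho> c))"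

lemma ribbon_obtain_rows:
  assumes "ribbon n S" "n \<ge> 1"
  obtains x \<rho> where "S = ribbon_set n x \<rho>" "ribbon_rows n x \<rho>"
proof -
  have inj: "inj_on content S" and conn: "connected_boxes S" and card: "card S = n"
    using assms ribbon_content_inj by (auto simp: ribbon_def)
  then have fin: "finite S" and ne: "S \<noteq> {}" using assms(2) by (auto intro: card_ge_0_finite)
  define l where "l = Min (content ` S)"
  define x where "x = Max (content ` S) + 1"
  \<comment> \<open>Connectedness makes the contents an interval; injectivity of
    \<open>content\<close> then forces its length to be \<open>n\<close>.\<close>
  have img: "content ` S = {l..<x}"
  proof (intro subset_antisym subsetI)
    fix c assume "c \<in> content ` S"
    then have "l \<le> c" "c \<le> Max (content ` S)" using fin by (auto simp: l_def)
    then show "c \<in> {l..<x}" by (simp add: x_def)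
  next
    fix c assume c: "c \<in> {l..<x}"
    obtain a b where a: "a \<in> S" "content a = l" and b: "b \<in> S" "content b = x - 1"
    proof -
      have "l \<in> content ` S" "x - 1 \<in> content ` S"
        using fin ne Min_in[of "content ` S"] Max_in[of "content ` S"] by (auto simp: l_def x_def)
      then show ?thesis using that by (metis imageE)
    qed
    show "c \<in> content ` S"
    proof (cases "c < x - 1")
      case True
      then show ?thesis using connected_boxes_crossing[OF conn a(1) b(1), of c] c a b by auto
    next
      case False
      then have "c = content b" using b c by auto
      then show ?thesis using b by blast
    qed
  qed
  moreover have "card (content ` S) = n" using card inj by (simp add: card_image)
  ultimately have "x - l = int n" using assms(2) by simp
  then have l: "l = x - int n" by simp
  define \<rho> where "\<rho> c = fst (THE b. b \<in> S \<and> content b = c)" for c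
  have rho: "\<rho> (content b) = fst b" if "b \<in> S" for b
  proof -
    have "(THE b'. b' \<in> S \<and> content b' = content b) = b"
      by (rule the_equality) (use that inj in \<open>auto dest: inj_onD\<close>)
    then show ?thesis by (simp add: \<rho>_def)
  qed
  have S: "S = ribbon_set n x \<rho>"
  proof -
    have "ribbon_set n x \<rho> = (\<lambda>c. box (\<rho> c) c) ` content ` S"
      by (simp add: ribbon_set_def img l)
    also have "\<dots> = (\<lambda>b. b) ` S" unfolding image_image by (rule image_cong) (auto simp: rho)
    finally show ?thesis by simp
  qed
  have "0 \<le> int (\<rho> c) + c" if "c \<in> {x - int n..<x}" for c
  proof -
    have "c \<in> content ` S" using that img l by simp
    then obtain b where "b \<in> S" "content b = c" by blast
    then show ?thesis using rho[of b] by (auto simp: content_def)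
  qed
  moreover have "\<rho> (c - 1) = \<rho> c \<or> \<rho> (c - 1) = Suc (\<rho> c)" if "c \<in> {x - int n<..<x}" for c
  proof -
    have "c - 1 \<in> content ` S" "c \<in> content ` S" using that img l by auto
    then obtain a b where "a \<in> S" "content a = c - 1" and "b \<in> S" "content b = c"
      by (auto elim!: imageE)
    then obtain y z where yz: "y \<in> S" "z \<in> S" "adjacent_boxes y z" "content y = c - 1" "content z = c"
      using connected_boxes_crossing[OF conn, of a b "c - 1"] by auto
    then have "\<rho> (c - 1) = fst y" "\<rho> c = fst z" using rho[of y] rho[of z] by auto
    then show ?thesis using yz by (auto simp: adjacent_boxes_def content_def)
  qed
  ultimately have "ribbon_rows n x \<rho>" by (simp add: ribbon_rows_def)
  then show ?thesis using S that by blast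
qed

lemma ribbon_rows_antimono:
  assumes "ribbon_rows n x \<rho>" "x - int n \<le> c" "c \<le> d" "d < x"
  shows "\<rho> d \<le> \<rho> c" "int (\<rho> c) + c \<le> int (\<rho> d) + d"
proof -
  have "\<rho> d \<le> \<rho> c \<and> int (\<rho> c) + c \<le> int (\<rho> d) + d" using assms(3,4)
  proof (induction d rule: int_ge_induct)
    case (step i)
    then have "i + 1 \<in> {x - int n<..<x}" using assms(2) by auto
    then have "\<rho> i = \<rho> (i + 1) \<or> \<rho> i = Suc (\<rho> (i + 1))"
      using assms(1) unfolding ribbon_rows_def by (metis add_diff_cancel_right')
    then show ?case using step by auto
  qed simp
  then show "\<rho> d \<le> \<rho> c" "int (\<rho> c) + c \<le> int (\<rho> d) + d" by auto
qed

lemma mem_ribbon_set: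
  "ribbon_rows n x \<rho> \<Longrightarrow>
    b \<in> ribbon_set n x \<rho> \<longleftrightarrow> content b \<in> {x - int n..<x} \<and> fst b = \<rho> (content b)"
  unfolding ribbon_set_def ribbon_rows_def
  by (auto simp: image_iff intro!: bexI[of _ "content b"]) (metis box_content)

lemma card_ribbon_set: "ribbon_rows n x \<rho> \<Longrightarrow> card (ribbon_set n x \<rho>) = n"
proof -
  assume r: "ribbon_rows n x \<rho>"
  have "inj_on (\<lambda>c. box (\<rho> c) c) {x - int n..<x}"
  proof (rule inj_onI)
    fix c d assume "c \<in> {x - int n..<x}" "d \<in> {x - int n..<x}" "box (\<rho> c) c = box (\<rho> d) d"
    then have "content (box (\<rho> c) c) = content (box (\<rho> d) d)" "0 \<le> int (\<rho> c) + c" "0 \<le> int (\<rho> d) + d"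
      using r unfolding ribbon_rows_def by auto
    then show "c = d" by simp
  qed
  then show ?thesis by (simp add: ribbon_set_def card_image)
qed

lemma ribbon_setI:
  assumes r: "ribbon_rows n x \<rho>" and "skew_shape (ribbon_set n x \<rho>)"
  shows "ribbon n (ribbon_set n x \<rho>)"
proof -
  let ?S = "ribbon_set n x \<rho>" and ?b = "\<lambda>c. box (\<rho> c) c"
  let ?R = "\<lambda>x y. x \<in> ?S \<and> y \<in> ?S \<and> adjacent_boxes x y"
  have adj: "?R (?b c) (?b (c + 1)) \<and> ?R (?b (c + 1)) (?b c)" if "x - int n \<le> c" "c + 1 < x" for c
  proof -
    have "\<rho> (c + 1 - 1) = \<rho> (c + 1) \<or> \<rho> (c + 1 - 1) = Suc (\<rho> (c + 1))"
      using r that unfolding ribbon_rows_def by (auto dest!: bspec[of _ _ "c + 1"])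
    moreover have "0 \<le> int (\<rho> c) + c" "0 \<le> int (\<rho> (c + 1)) + (c + 1)"
      using r that by (auto simp: ribbon_rows_def)
    ultimately have "adjacent_boxes (?b c) (?b (c + 1))" "adjacent_boxes (?b (c + 1)) (?b c)"
      by (auto simp: adjacent_boxes_def box_def)
    then show ?thesis using that by (auto simp: ribbon_set_def)
  qed
  have path: "?R\<^sup>*\<^sup>* (?b c) (?b d) \<and> ?R\<^sup>*\<^sup>* (?b d) (?b c)" if "x - int n \<le> c" "c \<le> d" "d < x" for c d
    using that(2,3)
  proof (induction d rule: int_ge_induct)
    case (step i)
    then have "?R\<^sup>*\<^sup>* (?b c) (?b i)" "?R\<^sup>*\<^sup>* (?b i) (?b c)" by auto
    moreover have "?R (?b i) (?b (i + 1))" "?R (?b (i + 1)) (?b i)"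
      using adj[of i] step that(1) by auto
    ultimately show ?case
      by (blast intro: rtranclp.rtrancl_into_rtrancl converse_rtranclp_into_rtranclp)
  qed simp
  have "connected_boxes ?S"
    unfolding connected_boxes_def
  proof (intro ballI)
    fix a b assume "a \<in> ?S" "b \<in> ?S"
    then obtain c d where "a = ?b c" "c \<in> {x - int n..<x}" "b = ?b d" "d \<in> {x - int n..<x}"
      by (auto simp: ribbon_set_def)
    then show "?R\<^sup>*\<^sup>* a b" using path[of c d] path[of d c] by (cases "c \<le> d") auto
  qed
  moreover have "\<not> {(i, j), (i, Suc j), (Suc i, j), (Suc i, Suc j)} \<subseteq> ?S" for i j
  proof
    assume "{(i, j), (i, Suc j), (Suc i, j), (Suc i, Suc j)} \<subseteq> ?S"
    then have "(i, j) \<in> ?S" "(Suc i, Suc j) \<in> ?S" by auto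
    then have "fst (i, j) = \<rho> (content (i, j))" "fst (Suc i, Suc j) = \<rho> (content (Suc i, Suc j))"
      using mem_ribbon_set[OF r] by blast+
    then show False by (simp add: content_def)
  qed
  ultimately show ?thesis using assms by (simp add: ribbon_def card_ribbon_set)
qed

lemma top_right_box_ribbon_set:
  assumes r: "ribbon_rows n x \<rho>" and "n \<ge> 1"
  shows "top_right_box (ribbon_set n x \<rho>) b \<longleftrightarrow> b = box (\<rho> (x - 1)) (x - 1)"
proof
  assume "b = box (\<rho> (x - 1)) (x - 1)"
  moreover have "fst (box (\<rho> (x - 1)) (x - 1)) \<le> fst (box (\<rho> c) c) \<and>
      snd (box (\<rho> c) c) \<le> snd (box (\<rho> (x - 1)) (x - 1))" if "c \<in> {x - int n..<x}" for c
    using ribbon_rows_antimono[OF r, of c "x - 1"] that by (auto simp: box_def)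
  ultimately show "top_right_box (ribbon_set n x \<rho>) b"
    using assms(2) by (auto simp: top_right_box_def ribbon_set_def)
next
  assume b: "top_right_box (ribbon_set n x \<rho>) b"
  let ?t = "box (\<rho> (x - 1)) (x - 1)"
  have t: "?t \<in> ribbon_set n x \<rho>" using assms(2) by (auto simp: ribbon_set_def)
  have c: "content ?t = x - 1" using r assms(2) by (intro content_box) (auto simp: ribbon_rows_def)
  have "content ?t \<le> content b" using b t by (auto simp: top_right_box_def content_def)
  moreover have "content b < x" "fst b = \<rho> (content b)"
    using b mem_ribbon_set[OF r, of b] by (auto simp: top_right_box_def)
  moreover from calculation have cb: "content b = x - 1" using c by linarith
  ultimately have "fst b = \<rho> (x - 1)" by simp
  with cb show "b = ?t" by (metis box_content)
qed

text \<open>Each drop produces a value not seen before. The second conjunct, that the last value is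
  the least one so far, is what carries the induction.\<close>

lemma card_image_antitone_steps:
  fixes \<rho> :: "int \<Rightarrow> nat"
  assumes "a \<le> b" "\<And>c. a < c \<Longrightarrow> c \<le> b \<Longrightarrow> \<rho> (c - 1) = \<rho> c \<or> \<rho> (c - 1) = Suc (\<rho> c)"
  shows "card (\<rho> ` {a..b}) = Suc (card {c. a < c \<and> c \<le> b \<and> \<rho> (c - 1) \<noteq> \<rho> c}) \<and>
    (\<forall>c\<in>{a..b}. \<rho> b \<le> \<rho> c)"
  using assms
proof (induction b rule: int_ge_induct)
  case base
  have "{c. a < c \<and> c \<le> a \<and> \<rho> (c - 1) \<noteq> \<rho> c} = {}" by auto
  then show ?case by (simp only: card.empty) simp
next
  case (step b)
  then have IH: "card (\<rho> ` {a..b}) = Suc (card {c. a < c \<and> c \<le> b \<and> \<rho> (c - 1) \<noteq> \<rho> c})"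
    "\<forall>c\<in>{a..b}. \<rho> b \<le> \<rho> c" by auto
  have ins: "{a..b + 1} = insert (b + 1) {a..b}" using step(1) by auto
  then have img: "\<rho> ` {a..b + 1} = insert (\<rho> (b + 1)) (\<rho> ` {a..b})" by simp
  have st: "\<rho> b = \<rho> (b + 1) \<or> \<rho> b = Suc (\<rho> (b + 1))"
    using step(3)[of "b + 1"] step(1) by simp
  have fin: "finite {c. a < c \<and> c \<le> b \<and> \<rho> (c - 1) \<noteq> \<rho> c}"
    by (rule finite_subset[of _ "{a..b}"]) auto
  have low: "\<forall>c\<in>{a..b + 1}. \<rho> (b + 1) \<le> \<rho> c"
    unfolding ins using IH(2) st by fastforce
  show ?case
  proof (cases "\<rho> b = \<rho> (b + 1)")
    case True
    have "{c. a < c \<and> c \<le> b + 1 \<and> \<rho> (c - 1) \<noteq> \<rho> c} = {c. a < c \<and> c \<le> b \<and> \<rho> (c - 1) \<noteq> \<rho> c}"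
    proof (rule Collect_cong)
      fix c show "(a < c \<and> c \<le> b + 1 \<and> \<rho> (c - 1) \<noteq> \<rho> c) = (a < c \<and> c \<le> b \<and> \<rho> (c - 1) \<noteq> \<rho> c)"
        using True by (cases "c = b + 1") auto
    qed
    moreover have "\<rho> (b + 1) \<in> \<rho> ` {a..b}" using True step(1) by (metis atLeastAtMost_iff imageI order_refl)
    ultimately show ?thesis using IH(1) low by (simp add: img insert_absorb)
  next
    case False
    have "{c. a < c \<and> c \<le> b + 1 \<and> \<rho> (c - 1) \<noteq> \<rho> c} =
        insert (b + 1) {c. a < c \<and> c \<le> b \<and> \<rho> (c - 1) \<noteq> \<rho> c}"
    proof (rule set_eqI)
      fix c show "c \<in> {c. a < c \<and> c \<le> b + 1 \<and> \<rho> (c - 1) \<noteq> \<rho> c} \<longleftrightarrow>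
          c \<in> insert (b + 1) {c. a < c \<and> c \<le> b \<and> \<rho> (c - 1) \<noteq> \<rho> c}"
        using False step(1) by (cases "c = b + 1") auto
    qed
    moreover have "\<rho> (b + 1) \<notin> \<rho> ` {a..b}" using False st IH(2) by force
    ultimately show ?thesis using IH(1) low fin by (simp add: img)
  qed
qed

lemma ribbon_spin_ribbon_set:
  assumes r: "ribbon_rows n x \<rho>" and "n \<ge> 1"
  shows "ribbon_spin (ribbon_set n x \<rho>) = card {c \<in> {x - int n<..<x}. \<rho> (c - 1) \<noteq> \<rho> c}"
proof -
  have "fst ` ribbon_set n x \<rho> = \<rho> ` {x - int n..x - 1}"
    by (force simp: ribbon_set_def image_image)
  moreover have "{c. x - int n < c \<and> c \<le> x - 1 \<and> \<rho> (c - 1) \<noteq> \<rho> c} =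
      {c \<in> {x - int n<..<x}. \<rho> (c - 1) \<noteq> \<rho> c}" by auto
  moreover have "card (\<rho> ` {x - int n..x - 1}) =
      Suc (card {c. x - int n < c \<and> c \<le> x - 1 \<and> \<rho> (c - 1) \<noteq> \<rho> c})"
    by (rule card_image_antitone_steps[THEN conjunct1]) (use assms in \<open>simp_all add: ribbon_rows_def\<close>)
  ultimately show ?thesis by (simp add: ribbon_spin_def)
qed

section \<open>Ribbon strips and the motion of beads\<close>

text \<open>A continuity equation on the runners modulo \<open>n\<close>: \<open>x \<in> X\<close>
  records one bead step from \<open>x\<close> to \<open>x - n\<close> on the way from
  \<open>lam\<close> to \<open>\<mu>\<close>, so position \<open>y\<close> loses a bead if
  \<open>y \<in> X\<close> and gains one if \<open>y + n \<in> X\<close>. A bead may travel several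
  steps.\<close>

definition bead_flux :: "nat \<Rightarrow> int_partition \<Rightarrow> int_partition \<Rightarrow> int set \<Rightarrow> bool" where
  "bead_flux n lam \<mu> X \<longleftrightarrow> finite X \<and>
     (\<forall>y. of_bool (bead lam y) - of_bool (bead \<mu> y) = (of_bool (y \<in> X) - of_bool (y + int n \<in> X) :: int))"

text \<open>A ribbon with head \<open>x\<close> has one box on each diagonal from
  \<open>x - n\<close> to \<open>x - 1\<close>, so this is the number of ribbons that meet diagonal
  \<open>c\<close>.\<close>

definition strip_level :: "nat \<Rightarrow> int set \<Rightarrow> int \<Rightarrow> nat" where
  "strip_level n X c = card {x \<in> X. c < x \<and> x \<le> c + int n}"

lemma strip_level_step:
  assumes "finite X"
  shows "int (strip_level n X (c - 1)) = int (strip_level n X c) + of_bool (c \<in> X) - of_bool (c + int n \<in> X)"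
proof (cases "n = 0")
  case True
  have "{x \<in> X. c - 1 < x \<and> x \<le> c - 1 + int n} = {}" "{x \<in> X. c < x \<and> x \<le> c + int n} = {}"
    using True by auto
  then show ?thesis using True unfolding strip_level_def by (simp only: card.empty) simp
next
  case False
  let ?A = "{x \<in> X. c < x \<and> x \<le> c - 1 + int n}"
  have "{x \<in> X. c - 1 < x \<and> x \<le> c - 1 + int n} = ?A \<union> (if c \<in> X then {c} else {})"
    (is "?B = _")
  proof (rule set_eqI)
    show "x \<in> ?B \<longleftrightarrow> x \<in> ?A \<union> (if c \<in> X then {c} else {})" for x
      using False by (cases "x = c") auto
  qed
  moreover have "{x \<in> X. c < x \<and> x \<le> c + int n} = ?A \<union> (if c + int n \<in> X then {c + int n} else {})"
    (is "?B = _")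
  proof (rule set_eqI)
    show "x \<in> ?B \<longleftrightarrow> x \<in> ?A \<union> (if c + int n \<in> X then {c + int n} else {})" for x
      using False by (cases "x = c + int n") auto
  qed
  moreover have "finite ?A" using assms by simp
  ultimately show ?thesis unfolding strip_level_def by (simp add: card_insert_if)
qed

lemma strip_level_eq_0_above: "finite X \<Longrightarrow> (\<And>x. x \<in> X \<Longrightarrow> x \<le> c) \<Longrightarrow> strip_level n X c = 0"
  by (force simp: strip_level_def)

lemma strip_level_eq_0_below: "finite X \<Longrightarrow> (\<And>x. x \<in> X \<Longrightarrow> c + int n < x) \<Longrightarrow> strip_level n X c = 0"
  by (force simp: strip_level_def)

lemma finite_int_bounds:
  fixes X :: "int set"
  assumes "finite X" obtains a b where "\<And>x. x \<in> X \<Longrightarrow> a < x" "\<And>x. x \<in> X \<Longrightarrow> x < b"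
proof -
  have "bdd_below X" "bdd_above X" using assms by simp_all
  then obtain a b where "\<forall>x\<in>X. a \<le> x" "\<forall>x\<in>X. x \<le> b"
    by (auto simp: bdd_below_def bdd_above_def)
  then show ?thesis using that[of "a - 1" "b + 1"] by force
qed

text \<open>Summation of the continuity equation, starting from the far right where all counts are
  0.\<close>

lemma bead_flux_iff_beads_above:
  assumes "finite X"
  shows "bead_flux n lam \<mu> X \<longleftrightarrow> (\<forall>c. beads_above lam c = beads_above \<mu> c + strip_level n X c)"
proof
  assume *: "\<forall>c. beads_above lam c = beads_above \<mu> c + strip_level n X c"
  show "bead_flux n lam \<mu> X"
    unfolding bead_flux_def
  proof (intro conjI allI assms)
    fix y
    have "int (beads_above lam (y - 1)) - int (beads_above lam y) = of_bool (bead lam y)"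
      "int (beads_above \<mu> (y - 1)) - int (beads_above \<mu> y) = of_bool (bead \<mu> y)"
      by (simp_all add: beads_above_step)
    then show "of_bool (bead lam y) - of_bool (bead \<mu> y) = (of_bool (y \<in> X) - of_bool (y + int n \<in> X) :: int)"
      using *[rule_format, of y] *[rule_format, of "y - 1"] strip_level_step[OF assms, of n y] by linarith
  qed
next
  assume *: "bead_flux n lam \<mu> X"
  show "\<forall>c. beads_above lam c = beads_above \<mu> c + strip_level n X c"
  proof
    fix c
    obtain C where C: "\<And>c. c \<ge> C \<Longrightarrow> beads_above lam c = 0" using beads_above_eq_0[of lam] by metis
    obtain D where D: "\<And>c. c \<ge> D \<Longrightarrow> beads_above \<mu> c = 0" using beads_above_eq_0[of \<mu>] by metis
    obtain a b where b: "\<And>x. x \<in> X \<Longrightarrow> x < b" using finite_int_bounds[OF assms] by metis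
    have "c \<le> max (max c b) (max C D)" by simp
    then show "beads_above lam c = beads_above \<mu> c + strip_level n X c"
    proof (induction c rule: int_le_induct)
      case base
      have "strip_level n X (max (max c b) (max C D)) = 0"
        by (rule strip_level_eq_0_above) (use assms b in \<open>auto dest!: b\<close>)
      then show ?case using C D by simp
    next
      case (step i)
      have "of_bool (bead lam i) - of_bool (bead \<mu> i) = (of_bool (i \<in> X) - of_bool (i + int n \<in> X) :: int)"
        using * by (simp add: bead_flux_def)
      moreover have "int (beads_above lam (i - 1)) - int (beads_above lam i) = of_bool (bead lam i)"
        "int (beads_above \<mu> (i - 1)) - int (beads_above \<mu> i) = of_bool (bead \<mu> i)"
        by (simp_all add: beads_above_step)
      ultimately show ?case using step(2) strip_level_step[OF assms, of n i] by linarith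
    qed
  qed
qed

lemma not_mem_progression:
  fixes X :: "int set"
  assumes "finite X" "n \<ge> 1" shows "\<exists>k. y + int k * int n \<notin> X" "\<exists>k. y - int k * int n \<notin> X"
proof -
  have "inj (\<lambda>k. y + int k * int n)" "inj (\<lambda>k. y - int k * int n)"
    using assms(2) by (auto intro!: injI)
  then have "\<not> range (\<lambda>k. y + int k * int n) \<subseteq> X" "\<not> range (\<lambda>k. y - int k * int n) \<subseteq> X"
    using assms(1) by (metis finite_imageD finite_subset infinite_UNIV_nat)+
  then show "\<exists>k. y + int k * int n \<notin> X" "\<exists>k. y - int k * int n \<notin> X" by auto
qed

text \<open>The difference of two fluxes is \<open>n\<close>-periodic, while both sets are
  finite.\<close>

lemma bead_flux_unique:
  assumes "bead_flux n lam \<mu> X" "bead_flux n lam \<mu> Y" "n \<ge> 1"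
  shows "X = Y"
proof -
  have "X \<subseteq> Y" if "bead_flux n lam \<mu> X" "bead_flux n lam \<mu> Y" for X Y
  proof (rule subsetI, rule ccontr)
    fix y assume y: "y \<in> X" "y \<notin> Y"
    have "y + int k * int n \<in> X \<and> y + int k * int n \<notin> Y" for k
    proof (induction k)
      case (Suc k)
      let ?y = "y + int k * int n"
      have "of_bool (?y \<in> X) - of_bool (?y + int n \<in> X) =
          (of_bool (?y \<in> Y) - of_bool (?y + int n \<in> Y) :: int)"
        using that unfolding bead_flux_def by metis
      then have "?y + int n \<in> X \<and> ?y + int n \<notin> Y" using Suc by (auto simp: of_bool_def split: if_splits)
      then show ?case by (simp add: algebra_simps)
    qed (use y in simp)
    then show False using not_mem_progression(1)[of X n y] that assms(3) by (auto simp: bead_flux_def)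
  qed
  then show ?thesis using assms by blast
qed

text \<open>The top right box of a ribbon with head \<open>x\<close> has content
  \<open>x - 1\<close>. It can lie directly below \<open>\<mu>\<close> or in the first row only if
  \<open>\<mu>\<close> has no bead at \<open>x\<close>.\<close>

definition hflux :: "nat \<Rightarrow> int_partition \<Rightarrow> int_partition \<Rightarrow> int set \<Rightarrow> bool" where
  "hflux n lam \<mu> X \<longleftrightarrow> bead_flux n lam \<mu> X \<and> (\<forall>x\<in>X. \<not> bead \<mu> x)"

text \<open>Ribbons of a horizontal strip meeting a common diagonal are ordered on it by their heads.\<close>

definition strip_rows :: "int_partition \<Rightarrow> int set \<Rightarrow> int \<Rightarrow> int \<Rightarrow> nat" where
  "strip_rows \<mu> X x c = beads_above \<mu> c + card {y \<in> X. c < y \<and> y < x}"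

definition strip_ribbon :: "nat \<Rightarrow> int_partition \<Rightarrow> int set \<Rightarrow> int \<Rightarrow> (nat \<times> nat) set" where
  "strip_ribbon n \<mu> X x = ribbon_set n x (strip_rows \<mu> X x)"

lemma ribbon_set_cong:
  "(\<And>c. c \<in> {x - int n..<x} \<Longrightarrow> \<rho> c = \<rho>' c) \<Longrightarrow> ribbon_set n x \<rho> = ribbon_set n x \<rho>'"
  by (auto simp: ribbon_set_def)

lemma finite_diagram: "finite (diagram lam)"
proof -
  obtain m where m: "\<And>i. i \<ge> m \<Longrightarrow> part lam i = 0" using part_eventually_0[of lam] by metis
  have "diagram lam \<subseteq> {..<m} \<times> {..<part lam 0}"
  proof
    fix b assume "b \<in> diagram lam"
    then have "snd b < part lam (fst b)" by (auto simp: diagram_def)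
    moreover have "fst b < m" using calculation m[of "fst b"] by (metis less_nat_zero_code linorder_not_less)
    ultimately show "b \<in> {..<m} \<times> {..<part lam 0}"
      using part_antimono[of 0 "fst b" lam] by (cases b) simp
  qed
  then show ?thesis by (rule finite_subset) simp
qed

text \<open>The heads of the ribbons form the flux. Since the ribbons of a strip cannot cross, the
  heads determine every ribbon, and so the whole decomposition.\<close>

lemma hstrip_decomp_hflux:
  assumes D: "hstrip_decomp n (diagram lam) (diagram \<mu>) D" and n: "n \<ge> 1"
  obtains X where "hflux n lam \<mu> X" "D = strip_ribbon n \<mu> X ` X" "inj_on (strip_ribbon n \<mu> X) X"
    "\<And>x. x \<in> X \<Longrightarrow> ribbon_rows n x (strip_rows \<mu> X x)"
proof -
  have "\<forall>R\<in>D. \<exists>x \<rho>. R = ribbon_set n x \<rho> \<and> ribbon_rows n x \<rho>"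
    using D n ribbon_obtain_rows by (metis hstrip_decomp_def)
  then obtain hd \<rho> where R: "\<And>R. R \<in> D \<Longrightarrow> R = ribbon_set n (hd R) (\<rho> R)"
    and rr: "\<And>R. R \<in> D \<Longrightarrow> ribbon_rows n (hd R) (\<rho> R)" by metis
  have UnD: "\<Union>D = diagram lam - diagram \<mu>" and disj: "pairwise disjnt D"
    and sub: "diagram \<mu> \<subseteq> diagram lam" using D by (auto simp: hstrip_decomp_def)
  have mem: "b \<in> R \<longleftrightarrow> content b \<in> {hd R - int n..<hd R} \<and> fst b = \<rho> R (content b)" if "R \<in> D" for R b
    using R[OF that] mem_ribbon_set[OF rr[OF that]] by metis
  have boxin: "box (\<rho> R c) c \<in> R" "0 \<le> int (\<rho> R c) + c"
    "beads_above \<mu> c \<le> \<rho> R c" "\<rho> R c < beads_above lam c"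
    if "R \<in> D" "c \<in> {hd R - int n..<hd R}" for R c
  proof -
    show v: "0 \<le> int (\<rho> R c) + c" using rr[OF that(1)] that(2) by (auto simp: ribbon_rows_def)
    then show i: "box (\<rho> R c) c \<in> R" using that mem by simp
    then have "box (\<rho> R c) c \<in> diagram lam - diagram \<mu>" using UnD that(1) by blast
    then show "beads_above \<mu> c \<le> \<rho> R c" "\<rho> R c < beads_above lam c"
      using v by (auto simp: mem_diagram_content)
  qed
  have same: "R = R'" if "R \<in> D" "R' \<in> D" "c \<in> {hd R - int n..<hd R}" "c \<in> {hd R' - int n..<hd R'}"
    "\<rho> R c = \<rho> R' c" for R R' c
  proof -
    have "box (\<rho> R c) c \<in> R \<inter> R'"
      using boxin(1)[OF that(1,3)] boxin(1)[OF that(2,4)] that(5) by simp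
    then show ?thesis using that(1,2) disj unfolding pairwise_def disjnt_def by blast
  qed
  have head: "\<rho> R (hd R - 1) = beads_above \<mu> (hd R - 1)" "\<not> bead \<mu> (hd R)" if "R \<in> D" for R
  proof -
    have "\<exists>i j. top_right_box R (i, j) \<and> (i = 0 \<or> (i - 1, j) \<in> diagram \<mu>)"
      using D that unfolding hstrip_decomp_def by simp
    then obtain i j where tr: "top_right_box R (i, j)" and ij: "i = 0 \<or> (i - 1, j) \<in> diagram \<mu>"
      by (elim exE conjE)
    have "(i, j) = box (\<rho> R (hd R - 1)) (hd R - 1)"
      using tr top_right_box_ribbon_set[OF rr[OF that] n] R[OF that] by metis
    moreover have v: "0 \<le> int (\<rho> R (hd R - 1)) + (hd R - 1)"
      by (rule boxin(2)) (use that n in auto)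
    ultimately have i: "i = \<rho> R (hd R - 1)" and cij: "int j - int i = hd R - 1"
      by (auto simp: box_def)
    have "i \<le> beads_above \<mu> (hd R)"
    proof (cases "i = 0")
      case False
      then have "i - 1 < beads_above \<mu> (int j - int (i - 1))" using ij by (simp add: mem_diagram_iff)
      moreover have "int j - int (i - 1) = hd R" using False cij by simp
      ultimately show ?thesis by simp
    qed simp
    moreover have "beads_above \<mu> (hd R - 1) \<le> i" using i boxin(3)[OF that, of "hd R - 1"] n by simp
    ultimately show "\<rho> R (hd R - 1) = beads_above \<mu> (hd R - 1)" "\<not> bead \<mu> (hd R)"
      using i by (auto simp: beads_above_step)
  qed
  \<comment> \<open>Ribbons with equal heads share their top right box, which is the first box
    outside \<open>\<mu>\<close> on its diagonal.\<close>
  have hd_inj: "inj_on hd D"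
  proof (rule inj_onI)
    fix R R' assume *: "R \<in> D" "R' \<in> D" "hd R = hd R'"
    have "\<rho> R (hd R - 1) = \<rho> R' (hd R - 1)" using head(1)[of R] head(1)[of R'] * by simp
    then show "R = R'" by (intro same[of R R' "hd R - 1"]) (use * n in auto)
  qed
  \<comment> \<open>If the ribbon with the smaller head were the lower one on diagonal
    \<open>c\<close>, it would stay strictly lower up to its own head, since rows change by at most
    one per diagonal and never coincide. There it occupies the first row outside
    \<open>\<mu>\<close>, leaving no room above it.\<close>
  have ordered: "\<rho> R c < \<rho> R' c" if RR: "R \<in> D" "R' \<in> D" and c: "c \<in> {hd R - int n..<hd R}" "c \<in> {hd R' - int n..<hd R'}"
    and less: "hd R < hd R'" for R R' c
  proof (rule ccontr)
    assume "\<not> ?thesis"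
    moreover have "\<rho> R c \<noteq> \<rho> R' c" using same[OF RR c] less by auto
    ultimately have base: "\<rho> R' c < \<rho> R c" by simp
    have "\<rho> R' d < \<rho> R d" if "c \<le> d" "d < hd R" for d
      using that
    proof (induction d rule: int_ge_induct)
      case (step i)
      then have i: "i + 1 \<in> {hd R - int n<..<hd R}" "i + 1 \<in> {hd R' - int n<..<hd R'}"
        using c less by auto
      have "\<rho> R i = \<rho> R (i + 1) \<or> \<rho> R i = Suc (\<rho> R (i + 1))"
        using rr[OF RR(1)] i(1) unfolding ribbon_rows_def by (metis add_diff_cancel_right')
      moreover have "\<rho> R' i = \<rho> R' (i + 1) \<or> \<rho> R' i = Suc (\<rho> R' (i + 1))"
        using rr[OF RR(2)] i(2) unfolding ribbon_rows_def by (metis add_diff_cancel_right')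
      moreover have "\<rho> R (i + 1) \<noteq> \<rho> R' (i + 1)"
        using same[OF RR, of "i + 1"] i less by auto
      ultimately show ?case using step by linarith
    qed (use base in simp)
    then have "\<rho> R' (hd R - 1) < \<rho> R (hd R - 1)" using c by simp
    moreover have "beads_above \<mu> (hd R - 1) \<le> \<rho> R' (hd R - 1)"
      by (rule boxin(3)) (use RR c less in auto)
    ultimately show False using head(1)[OF RR(1)] by simp
  qed
  define X where "X = hd ` D"
  have "D \<subseteq> Pow (diagram lam)" using UnD by blast
  moreover have "finite (diagram lam)" by (rule finite_diagram)
  ultimately have finD: "finite D" by (meson finite_Pow_iff finite_subset)
  have bij: "card {R \<in> D. P (hd R)} = card {x \<in> X. P x}" for P
  proof -
    have "{x \<in> X. P x} = hd ` {R \<in> D. P (hd R)}" by (auto simp: X_def)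
    then show ?thesis using hd_inj by (simp add: card_image inj_on_def)
  qed
  have cover: "\<exists>R'\<in>D. c \<in> {hd R' - int n..<hd R'} \<and> \<rho> R' c = r"
    if "beads_above \<mu> c \<le> r" "r < beads_above lam c" for r c
  proof -
    have "0 \<le> int r + c" using that beads_above_ge[of c \<mu>] by linarith
    then have "box r c \<in> diagram lam - diagram \<mu>" using that by (simp add: mem_diagram_content)
    then obtain R' where "R' \<in> D" "box r c \<in> R'" using UnD by blast
    then show ?thesis using mem[of R' "box r c"] \<open>0 \<le> int r + c\<close> by auto
  qed
  have level: "\<rho> R c = strip_rows \<mu> X (hd R) c" if RD: "R \<in> D" and c: "c \<in> {hd R - int n..<hd R}" for R c
  proof -
    let ?E = "{R' \<in> D. c < hd R' \<and> hd R' < hd R}"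
    have E: "c \<in> {hd R' - int n..<hd R'}" if "R' \<in> ?E" for R' using that c by auto
    \<comment> \<open>On diagonal \<open>c\<close> the boxes between \<open>\<mu>\<close> and the
      ribbon \<open>R\<close> belong to the ribbons with smaller heads that meet this diagonal, one
      box each.\<close>
    have "{beads_above \<mu> c..<\<rho> R c} = (\<lambda>R'. \<rho> R' c) ` ?E"
    proof (intro subset_antisym subsetI)
      fix r assume r: "r \<in> {beads_above \<mu> c..<\<rho> R c}"
      then obtain R' where R': "R' \<in> D" "c \<in> {hd R' - int n..<hd R'}" "\<rho> R' c = r"
        using cover[of c r] boxin(4)[OF RD c] by auto
      have "hd R' < hd R"
      proof (rule ccontr)
        assume "\<not> hd R' < hd R"
        then have "hd R < hd R' \<or> R = R'" using hd_inj RD R' by (meson inj_onD linorder_neqE)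
        then show False using ordered[OF RD R'(1) c R'(2)] R'(3) r by auto
      qed
      then show "r \<in> (\<lambda>R'. \<rho> R' c) ` ?E" using R' by auto
    next
      fix r assume "r \<in> (\<lambda>R'. \<rho> R' c) ` ?E"
      then obtain R' where R': "R' \<in> ?E" "r = \<rho> R' c" by blast
      then show "r \<in> {beads_above \<mu> c..<\<rho> R c}"
        using boxin(3)[of R' c] E[OF R'(1)] ordered[of R' R c] RD c by auto
    qed
    then have "\<rho> R c - beads_above \<mu> c = card ((\<lambda>R'. \<rho> R' c) ` ?E)" by (metis card_atLeastLessThan)
    also have "\<dots> = card ?E"
      by (rule card_image, rule inj_onI) (use E same in blast)
    also have "\<dots> = card {y \<in> X. c < y \<and> y < hd R}" by (rule bij)
    finally show ?thesis using boxin(3)[OF RD c] by (simp add: strip_rows_def)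
  qed
  have "beads_above lam c = beads_above \<mu> c + strip_level n X c" for c
  proof -
    let ?E = "{R' \<in> D. c < hd R' \<and> hd R' \<le> c + int n}"
    have E: "c \<in> {hd R' - int n..<hd R'}" if "R' \<in> ?E" for R' using that by auto
    have "{beads_above \<mu> c..<beads_above lam c} = (\<lambda>R'. \<rho> R' c) ` ?E"
    proof (intro subset_antisym subsetI)
      fix r assume r: "r \<in> {beads_above \<mu> c..<beads_above lam c}"
      then show "r \<in> (\<lambda>R'. \<rho> R' c) ` ?E" using cover[of c r] by force
    next
      fix r assume "r \<in> (\<lambda>R'. \<rho> R' c) ` ?E"
      then obtain R' where R': "R' \<in> ?E" "r = \<rho> R' c" by blast
      then show "r \<in> {beads_above \<mu> c..<beads_above lam c}"
        using boxin(3,4)[of R' c] E[OF R'(1)] by auto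
    qed
    then have "beads_above lam c - beads_above \<mu> c = card ((\<lambda>R'. \<rho> R' c) ` ?E)" by (metis card_atLeastLessThan)
    also have "\<dots> = card ?E"
      by (rule card_image, rule inj_onI) (use E same in blast)
    also have "\<dots> = strip_level n X c" unfolding strip_level_def by (rule bij)
    finally have "beads_above lam c - beads_above \<mu> c = strip_level n X c" .
    moreover have "beads_above \<mu> c \<le> beads_above lam c"
    proof (rule ccontr)
      assume "\<not> ?thesis"
      then have "beads_above lam c < beads_above \<mu> c" by simp
      moreover have "0 \<le> int (beads_above lam c) + c" using beads_above_ge[of c lam] by simp
      ultimately have "box (beads_above lam c) c \<in> diagram \<mu> - diagram lam"
        by (simp add: mem_diagram_content)
      then show False using sub by blast
    qed
    ultimately show ?thesis by simp
  qed
  then have "bead_flux n lam \<mu> X"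
    using finD by (subst bead_flux_iff_beads_above) (auto simp: X_def)
  then have hf: "hflux n lam \<mu> X" using head(2) by (auto simp: hflux_def X_def)
  have eq: "R = strip_ribbon n \<mu> X (hd R)" if "R \<in> D" for R
    using R[OF that] ribbon_set_cong[OF level[OF that]] by (simp add: strip_ribbon_def)
  have "D = strip_ribbon n \<mu> X ` X" using eq by (force simp: X_def)
  moreover have "inj_on (strip_ribbon n \<mu> X) X"
  proof (rule inj_onI)
    fix x y assume "x \<in> X" "y \<in> X" "strip_ribbon n \<mu> X x = strip_ribbon n \<mu> X y"
    moreover obtain R S where "R \<in> D" "x = hd R" "S \<in> D" "y = hd S"
      using \<open>x \<in> X\<close> \<open>y \<in> X\<close> by (auto simp: X_def)
    ultimately have "R = S" using eq[of R] eq[of S] by simp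
    then show "x = y" using \<open>x = hd R\<close> \<open>y = hd S\<close> by simp
  qed
  moreover have "ribbon_rows n x (strip_rows \<mu> X x)" if "x \<in> X" for x
  proof -
    from that obtain R where RD: "R \<in> D" "x = hd R" by (auto simp: X_def)
    have l: "strip_rows \<mu> X x c = \<rho> R c" if "c \<in> {x - int n..<x}" for c
      using level[OF RD(1)] RD(2) that by simp
    have "strip_rows \<mu> X x (c - 1) = \<rho> R (c - 1)" if "c \<in> {x - int n<..<x}" for c
      using that by (intro l) auto
    then show ?thesis using rr[OF RD(1)] l RD(2) by (auto simp: ribbon_rows_def)
  qed
  ultimately show ?thesis using hf that by blast
qed

section \<open>From a flux back to a ribbon strip\<close>

lemma hflux_subset:
  assumes "bead_flux n lam \<mu> X"
  shows "diagram \<mu> \<subseteq> diagram lam"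
proof
  fix b assume "b \<in> diagram \<mu>"
  moreover have "beads_above \<mu> (content b) \<le> beads_above lam (content b)"
    using assms bead_flux_iff_beads_above[of X n lam \<mu>] by (auto simp: bead_flux_def)
  ultimately show "b \<in> diagram lam" by (simp add: mem_diagram_content)
qed

text \<open>Selection by rank; it picks the ribbon that contains a given box of a diagonal.\<close>

lemma ex_card_less_eq:
  fixes S :: "int set"
  assumes "finite S" "k < card S"
  shows "\<exists>x\<in>S. card {y \<in> S. y < x} = k"
proof -
  let ?f = "\<lambda>x. card {y \<in> S. y < x}"
  have less: "?f x < ?f y" if "x \<in> S" "x < y" for x y
    by (rule psubset_card_mono) (use assms(1) that in auto)
  have "inj_on ?f S"
  proof (rule inj_onI)
    fix x y assume "x \<in> S" "y \<in> S" "?f x = ?f y"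
    then show "x = y" using less[of x y] less[of y x] by (cases x y rule: linorder_cases) auto
  qed
  then have "card (?f ` S) = card {..<card S}" by (simp add: card_image)
  moreover have "?f ` S \<subseteq> {..<card S}"
  proof
    fix k assume "k \<in> ?f ` S"
    then obtain x where x: "x \<in> S" "k = ?f x" by blast
    have "?f x < card S" by (rule psubset_card_mono) (use assms(1) x in auto)
    then show "k \<in> {..<card S}" using x by simp
  qed
  ultimately have "?f ` S = {..<card S}" by (intro card_subset_eq) auto
  then have "k \<in> ?f ` S" using assms(2) by simp
  then show ?thesis by blast
qed

text \<open>The ribbons are added to \<open>\<mu>\<close> in the order of increasing heads. Every
  truncation of the flux to its small elements belongs to a partition, and consecutive truncations
  differ by one ribbon; this is why each ribbon is a skew shape.\<close>

lemma hflux_hstrip_decomp: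
  assumes h: "hflux n lam \<mu> X" and n: "n \<ge> 1"
  shows "hstrip_decomp n (diagram lam) (diagram \<mu>) (strip_ribbon n \<mu> X ` X)"
    and "\<And>x. x \<in> X \<Longrightarrow> ribbon n (strip_ribbon n \<mu> X x)"
proof -
  have flux: "bead_flux n lam \<mu> X" and nb: "\<And>x. x \<in> X \<Longrightarrow> \<not> bead \<mu> x" and fin: "finite X"
    using h by (auto simp: hflux_def bead_flux_def)
  have lev: "beads_above lam c = beads_above \<mu> c + strip_level n X c" for c
    using flux bead_flux_iff_beads_above[OF fin] by blast
  \<comment> \<open>A bead that arrives at \<open>c\<close> and does not move on stays
    there.\<close>
  have mid: "bead \<mu> c" if "c + int n \<in> X" "c \<notin> X" for c
  proof (rule ccontr)
    assume "\<not> bead \<mu> c"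
    moreover have "of_bool (bead lam c) - of_bool (bead \<mu> c) = (of_bool (c \<in> X) - of_bool (c + int n \<in> X) :: int)"
      using flux by (simp add: bead_flux_def)
    ultimately show False using that by (simp add: of_bool_def split: if_splits)
  qed
  have step: "strip_rows \<mu> X x (c - 1) = strip_rows \<mu> X x c + of_bool (bead \<mu> c \<or> c \<in> X)"
    if "c < x" for x c
  proof -
    have "{y \<in> X. c - 1 < y \<and> y < x} = {y \<in> X. c < y \<and> y < x} \<union> (if c \<in> X then {c} else {})"
      (is "?B = _")
    proof (rule set_eqI)
      show "y \<in> ?B \<longleftrightarrow> y \<in> {y \<in> X. c < y \<and> y < x} \<union> (if c \<in> X then {c} else {})" for y
        using that by (cases "y = c") auto
    qed
    then have "card {y \<in> X. c - 1 < y \<and> y < x} = card {y \<in> X. c < y \<and> y < x} + of_bool (c \<in> X)"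
      using fin by simp
    then show ?thesis using nb[of c] by (auto simp: strip_rows_def beads_above_step)
  qed
  have rows: "ribbon_rows n x (strip_rows \<mu> X x)" for x
    unfolding ribbon_rows_def
  proof (intro conjI ballI)
    show "0 \<le> int (strip_rows \<mu> X x c) + c" for c
      using beads_above_ge[of c \<mu>] by (simp add: strip_rows_def)
    show "strip_rows \<mu> X x (c - 1) = strip_rows \<mu> X x c \<or> strip_rows \<mu> X x (c - 1) = Suc (strip_rows \<mu> X x c)"
      if "c \<in> {x - int n<..<x}" for c using step[of c x] that by auto
  qed
  have trunc: "\<exists>\<alpha>. \<forall>c. beads_above \<alpha> c = beads_above \<mu> c + strip_level n {y \<in> X. P y} c"
    if P: "\<And>y y'. P y \<Longrightarrow> y' \<le> y \<Longrightarrow> P y'" for P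
  proof -
    let ?X = "{y \<in> X. P y}"
    let ?N = "\<lambda>c. beads_above \<mu> c + strip_level n ?X c"
    obtain C where C: "\<And>c. c \<ge> C \<Longrightarrow> beads_above \<mu> c = 0" using beads_above_eq_0[of \<mu>] by metis
    obtain D where D: "\<And>c. c \<le> D \<Longrightarrow> int (beads_above \<mu> c) = - c" using beads_above_eq_uminus[of \<mu>] by metis
    obtain a b where a: "\<And>x. x \<in> X \<Longrightarrow> a < x" and b: "\<And>x. x \<in> X \<Longrightarrow> x < b"
      using finite_int_bounds[OF fin] by metis
    \<comment> \<open>\<open>st\<close>, \<open>nn\<close> and \<open>le1\<close> confine the
      increments to 0 and 1. The property \<open>mid\<close> survives truncation because the
      elements that are kept are the small ones.\<close>
    have st: "int (?N (c - 1)) = int (?N c) + of_bool (bead \<mu> c) + of_bool (c \<in> ?X) - of_bool (c + int n \<in> ?X)" for c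
      using strip_level_step[of ?X n c] fin by (simp add: beads_above_step)
    have nn: "of_bool (c + int n \<in> ?X) \<le> (of_bool (bead \<mu> c) + of_bool (c \<in> ?X) :: int)" for c
      using mid[of c] P[of "c + int n" c] by auto
    have le1: "of_bool (bead \<mu> c) + of_bool (c \<in> ?X) \<le> (1 :: int)" for c
      using nb[of c] by auto
    have *: "?N c \<le> ?N (c - 1)" "?N (c - 1) \<le> ?N c + 1" for c
    proof -
      show "?N c \<le> ?N (c - 1)" using st[of c] nn[of c] by linarith
      have "0 \<le> (of_bool (c + int n \<in> ?X) :: int)" by simp
      then show "?N (c - 1) \<le> ?N c + 1" using st[of c] le1[of c] by linarith
    qed
    have top: "?N c = 0" if "c \<ge> max C b" for c
      using that C[of c] b strip_level_eq_0_above[of ?X c n] fin by force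
    have bot: "int (?N c) = - c" if "c \<le> min D (a - int n)" for c
      using that D[of c] a strip_level_eq_0_below[of ?X c n] fin by force
    show ?thesis using partition_of_beads_above[of ?N, OF * top bot] by metis
  qed
  \<comment> \<open>If the ribbon with head \<open>x\<close> meets diagonal \<open>c\<close>, so
    does every ribbon whose head lies between \<open>c\<close> and \<open>x\<close>.\<close>
  have cardX: "strip_level n {y \<in> X. y < x} c = card {y \<in> X. c < y \<and> y < x}" if "x \<le> c + int n" for x c
    unfolding strip_level_def by (rule arg_cong[of _ _ card]) (use that in auto)
  have skew: "skew_shape (strip_ribbon n \<mu> X x)" if x: "x \<in> X" for x
  proof -
    obtain \<alpha> where \<alpha>: "\<And>c. beads_above \<alpha> c = beads_above \<mu> c + strip_level n {y \<in> X. y \<le> x} c"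
      using trunc[of "\<lambda>y. y \<le> x"] by auto
    obtain \<beta> where \<beta>: "\<And>c. beads_above \<beta> c = beads_above \<mu> c + strip_level n {y \<in> X. y < x} c"
      using trunc[of "\<lambda>y. y < x"] by auto
    have \<alpha>\<beta>: "beads_above \<alpha> c = beads_above \<beta> c + of_bool (c < x \<and> x \<le> c + int n)" for c
    proof -
      have "{y \<in> {y \<in> X. y \<le> x}. c < y \<and> y \<le> c + int n} =
          {y \<in> {y \<in> X. y < x}. c < y \<and> y \<le> c + int n} \<union> (if c < x \<and> x \<le> c + int n then {x} else {})"
        using x by (auto split: if_splits)
      then show ?thesis using fin by (simp add: \<alpha> \<beta> strip_level_def)
    qed
    have "strip_ribbon n \<mu> X x = diagram \<alpha> - diagram \<beta>"
    proof (rule set_eqI)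
      fix b
      let ?c = "content b"
      have "b \<in> diagram \<alpha> - diagram \<beta> \<longleftrightarrow> ?c < x \<and> x \<le> ?c + int n \<and> fst b = beads_above \<beta> ?c"
        using \<alpha>\<beta>[of ?c] by (auto simp: mem_diagram_content)
      also have "\<dots> \<longleftrightarrow> ?c < x \<and> x \<le> ?c + int n \<and> fst b = strip_rows \<mu> X x ?c"
        using cardX by (auto simp: \<beta> strip_rows_def)
      also have "\<dots> \<longleftrightarrow> b \<in> strip_ribbon n \<mu> X x"
        unfolding strip_ribbon_def mem_ribbon_set[OF rows] by auto
      finally show "b \<in> strip_ribbon n \<mu> X x \<longleftrightarrow> b \<in> diagram \<alpha> - diagram \<beta>" ..
    qed
    moreover have "diagram \<beta> \<subseteq> diagram \<alpha>"
      using \<alpha>\<beta> by (auto simp: mem_diagram_content)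
    ultimately show ?thesis unfolding skew_shape_def by blast
  qed
  show rib: "ribbon n (strip_ribbon n \<mu> X x)" if "x \<in> X" for x
    using ribbon_setI[OF rows] skew[OF that] by (simp add: strip_ribbon_def)
  have mem: "b \<in> strip_ribbon n \<mu> X x \<longleftrightarrow>
      content b < x \<and> x \<le> content b + int n \<and> fst b = strip_rows \<mu> X x (content b)" for b x
    unfolding strip_ribbon_def mem_ribbon_set[OF rows] by auto
  have less: "strip_rows \<mu> X x c < strip_rows \<mu> X y c" if "x \<in> X" "c < x" "x < y" for x y c
    unfolding strip_rows_def by (intro add_strict_left_mono psubset_card_mono) (use that fin in auto)
  have disj: "pairwise disjnt (strip_ribbon n \<mu> X ` X)"
  proof (rule pairwise_imageI)
    fix x y assume xy: "x \<in> X" "y \<in> X" "x \<noteq> y"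
    show "disjnt (strip_ribbon n \<mu> X x) (strip_ribbon n \<mu> X y)"
    proof (rule ccontr)
      assume "\<not> ?thesis"
      then obtain b where b: "b \<in> strip_ribbon n \<mu> X x" "b \<in> strip_ribbon n \<mu> X y"
        by (auto simp: disjnt_iff)
      then show False using xy less[of x "content b" y] less[of y "content b" x]
        unfolding mem by (cases "x < y") auto
    qed
  qed
  have un: "\<Union> (strip_ribbon n \<mu> X ` X) = diagram lam - diagram \<mu>"
  proof (rule set_eqI)
    fix b
    let ?c = "content b"
    let ?S = "{y \<in> X. ?c < y \<and> y \<le> ?c + int n}"
    have S: "{y \<in> ?S. y < x} = {y \<in> X. ?c < y \<and> y < x}" if "x \<in> ?S" for x using that by auto
    have "b \<in> diagram lam - diagram \<mu> \<longleftrightarrow> beads_above \<mu> ?c \<le> fst b \<and> fst b < beads_above \<mu> ?c + card ?S"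
      by (auto simp: mem_diagram_content lev strip_level_def)
    also have "\<dots> \<longleftrightarrow> (\<exists>x\<in>?S. fst b = beads_above \<mu> ?c + card {y \<in> ?S. y < x})"
    proof
      assume "beads_above \<mu> ?c \<le> fst b \<and> fst b < beads_above \<mu> ?c + card ?S"
      then have "fst b - beads_above \<mu> ?c < card ?S" by linarith
      then obtain x where "x \<in> ?S" "card {y \<in> ?S. y < x} = fst b - beads_above \<mu> ?c"
        using ex_card_less_eq[of ?S "fst b - beads_above \<mu> ?c"] fin by auto
      then show "\<exists>x\<in>?S. fst b = beads_above \<mu> ?c + card {y \<in> ?S. y < x}"
        using \<open>beads_above \<mu> ?c \<le> fst b \<and> _\<close> by (intro bexI[of _ x]) linarith+
    next
      assume "\<exists>x\<in>?S. fst b = beads_above \<mu> ?c + card {y \<in> ?S. y < x}"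
      then obtain x where x: "x \<in> ?S" "fst b = beads_above \<mu> ?c + card {y \<in> ?S. y < x}" by blast
      have "card {y \<in> ?S. y < x} < card ?S"
        by (rule psubset_card_mono) (use fin x in auto)
      then show "beads_above \<mu> ?c \<le> fst b \<and> fst b < beads_above \<mu> ?c + card ?S"
        using x by linarith
    qed
    also have "\<dots> \<longleftrightarrow> (\<exists>x\<in>X. b \<in> strip_ribbon n \<mu> X x)"
      unfolding mem strip_rows_def using S by (metis (no_types, lifting) mem_Collect_eq)
    finally show "b \<in> \<Union> (strip_ribbon n \<mu> X ` X) \<longleftrightarrow> b \<in> diagram lam - diagram \<mu>" by blast
  qed
  have "\<exists>i j. top_right_box (strip_ribbon n \<mu> X x) (i, j) \<and> (i = 0 \<or> (i - 1, j) \<in> diagram \<mu>)"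
    if x: "x \<in> X" for x
  proof -
    let ?i = "strip_rows \<mu> X x (x - 1)"
    obtain i j where ij: "box ?i (x - 1) = (i, j)" by fastforce
    have "top_right_box (strip_ribbon n \<mu> X x) (i, j)"
      using top_right_box_ribbon_set[OF rows n] by (simp add: strip_ribbon_def ij[symmetric])
    moreover have "{y \<in> X. x - 1 < y \<and> y < x} = {}" by auto
    then have "?i = beads_above \<mu> (x - 1)" unfolding strip_rows_def by (simp only: card.empty)
    then have i: "i = beads_above \<mu> x" using ij nb[OF x] by (auto simp: box_def beads_above_step)
    have "0 \<le> int ?i + (x - 1)"
      using rows[of x] n by (auto simp: ribbon_rows_def)
    then have "int j - int i = x - 1" using ij by (auto simp: box_def)
    then have "i = 0 \<or> (i - 1, j) \<in> diagram \<mu>"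
    proof (cases "i = 0")
      case False
      then have "int j - int (i - 1) = x" using \<open>int j - int i = x - 1\<close> by simp
      then show ?thesis using False i by (simp add: mem_diagram_iff)
    qed simp
    ultimately show ?thesis by blast
  qed
  then show "hstrip_decomp n (diagram lam) (diagram \<mu>) (strip_ribbon n \<mu> X ` X)"
    unfolding hstrip_decomp_def using un disj rib hflux_subset[OF flux] by blast
qed

lemma horizontal_strip_iff:
  assumes "n \<ge> 1" shows "horizontal_strip n lam \<mu> \<longleftrightarrow> (\<exists>X. hflux n lam \<mu> X)"
  unfolding horizontal_strip_def
  using hstrip_decomp_hflux hflux_hstrip_decomp(1) assms by metis

lemma hstrip_decomp_unique:
  assumes "hflux n lam \<mu> X" "hstrip_decomp n (diagram lam) (diagram \<mu>) D" "n \<ge> 1"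
  shows "D = strip_ribbon n \<mu> X ` X"
proof -
  obtain Y where "hflux n lam \<mu> Y" "D = strip_ribbon n \<mu> Y ` Y"
    using hstrip_decomp_hflux[OF assms(2,3)] by metis
  then show ?thesis using bead_flux_unique assms by (metis hflux_def)
qed

lemma hflux_inj_on_rows:
  assumes "hflux n lam \<mu> X" "n \<ge> 1"
  shows "inj_on (strip_ribbon n \<mu> X) X" "x \<in> X \<Longrightarrow> ribbon_rows n x (strip_rows \<mu> X x)"
proof -
  obtain Y where Y: "hflux n lam \<mu> Y" "inj_on (strip_ribbon n \<mu> Y) Y"
    "\<And>x. x \<in> Y \<Longrightarrow> ribbon_rows n x (strip_rows \<mu> Y x)"
    using hstrip_decomp_hflux[OF hflux_hstrip_decomp(1)[OF assms] assms(2)] by metis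
  moreover have "X = Y" using bead_flux_unique assms Y(1) by (metis hflux_def)
  ultimately show "inj_on (strip_ribbon n \<mu> X) X" "x \<in> X \<Longrightarrow> ribbon_rows n x (strip_rows \<mu> X x)"
    by auto
qed

text \<open>A ribbon changes its row at \<open>c\<close> either along with the boundary of
  \<open>\<mu>\<close>, which happens at beads, or because another ribbon has its head there and
  ends above it.\<close>

lemma hflux_ribbon_spin:
  assumes "hflux n lam \<mu> X" "n \<ge> 1" "x \<in> X"
  shows "ribbon_spin (strip_ribbon n \<mu> X x) = card {h \<in> {x - int n<..<x}. bead \<mu> h \<or> h \<in> X}"
proof -
  have fin: "finite X" and nb: "\<And>x. x \<in> X \<Longrightarrow> \<not> bead \<mu> x"
    using assms by (auto simp: hflux_def bead_flux_def)
  have "strip_rows \<mu> X x (c - 1) \<noteq> strip_rows \<mu> X x c \<longleftrightarrow> bead \<mu> c \<or> c \<in> X" if "c < x" for c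
  proof -
    have "{y \<in> X. c - 1 < y \<and> y < x} = {y \<in> X. c < y \<and> y < x} \<union> (if c \<in> X then {c} else {})"
      (is "?B = _")
    proof (rule set_eqI)
      show "y \<in> ?B \<longleftrightarrow> y \<in> {y \<in> X. c < y \<and> y < x} \<union> (if c \<in> X then {c} else {})" for y
        using that by (cases "y = c") auto
    qed
    then have "card {y \<in> X. c - 1 < y \<and> y < x} = card {y \<in> X. c < y \<and> y < x} + of_bool (c \<in> X)"
      using fin by simp
    then show ?thesis using nb[of c] by (auto simp: strip_rows_def beads_above_step)
  qed
  then have "{c \<in> {x - int n<..<x}. strip_rows \<mu> X x (c - 1) \<noteq> strip_rows \<mu> X x c} =
      {h \<in> {x - int n<..<x}. bead \<mu> h \<or> h \<in> X}" by auto
  then show ?thesis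
    using ribbon_spin_ribbon_set[OF hflux_inj_on_rows(2)[OF assms] assms(2)] by (simp add: strip_ribbon_def)
qed

lemma hflux_spin:
  assumes "hflux n lam \<mu> X" "n \<ge> 1"
  shows "hstrip_spin n lam \<mu> = (\<Sum>x\<in>X. card {h \<in> {x - int n<..<x}. bead \<mu> h \<or> h \<in> X})"
proof -
  have "(THE D. hstrip_decomp n (diagram lam) (diagram \<mu>) D) = strip_ribbon n \<mu> X ` X"
    by (rule the_equality)
      (use hflux_hstrip_decomp(1)[OF assms] hstrip_decomp_unique[OF assms(1) _ assms(2)] in blast)+
  then have "hstrip_spin n lam \<mu> = (\<Sum>x\<in>X. ribbon_spin (strip_ribbon n \<mu> X x))"
    unfolding hstrip_spin_def by (simp add: sum.reindex[OF hflux_inj_on_rows(1)[OF assms]])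
  then show ?thesis using hflux_ribbon_spin[OF assms] by simp
qed

lemma card_hstrip_decomp:
  assumes "hstrip_decomp n L M D" "n \<ge> 1"
  shows "card (L - M) = n * card D"
proof -
  have D: "\<Union>D = L - M" "pairwise disjnt D" "\<And>R. R \<in> D \<Longrightarrow> card R = n"
    using assms by (auto simp: hstrip_decomp_def ribbon_def)
  have "card (\<Union>D) = (\<Sum>R\<in>D. card R)"
    by (rule card_Union_disjoint) (use D assms(2) in \<open>auto intro: card_ge_0_finite\<close>)
  also have "\<dots> = n * card D" using D(3) by simp
  finally show ?thesis using D(1) by simp
qed

lemma hflux_ribbon_count:
  assumes "hflux n lam \<mu> X" "n \<ge> 1"
  shows "ribbon_count n lam \<mu> = card X"
  using card_hstrip_decomp[OF hflux_hstrip_decomp(1)[OF assms] assms(2)] assms(2)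
  by (simp add: ribbon_count_def card_image[OF hflux_inj_on_rows(1)[OF assms]])

section \<open>Conjugation and vertical strips\<close>

lemma conjugate_exists:
  "\<exists>lam'. diagram lam' = prod.swap ` diagram lam \<and> (\<forall>x. bead lam' x \<longleftrightarrow> \<not> bead lam (1 - x))"
proof -
  \<comment> \<open>Transposition carries diagonal \<open>- c\<close> to diagonal \<open>c\<close>;
    subtracting \<open>c\<close> converts rows into columns.\<close>
  let ?N = "\<lambda>c. nat (int (beads_above lam (- c)) - c)"
  have ge: "0 \<le> int (beads_above lam (- c)) - c" for c using beads_above_ge[of "- c" lam] by simp
  have st: "int (?N (c - 1)) = int (?N c) + of_bool (\<not> bead lam (1 - c))" for c
    using ge[of c] ge[of "c - 1"] beads_above_step[of lam "1 - c"] by (simp add: of_bool_def)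
  obtain C where C: "\<And>c. c \<ge> C \<Longrightarrow> beads_above lam c = 0" using beads_above_eq_0[of lam] by metis
  obtain D where D: "\<And>c. c \<le> D \<Longrightarrow> int (beads_above lam c) = - c" using beads_above_eq_uminus[of lam] by metis
  have *: "?N c \<le> ?N (c - 1)" "?N (c - 1) \<le> ?N c + 1" for c
    using st[of c] by (auto simp: of_bool_def split: if_splits)
  have top: "?N c = 0" if "c \<ge> - D" for c using D[of "- c"] that by simp
  have bot: "int (?N c) = - c" if "c \<le> min (- C) 0" for c using C[of "- c"] that by simp
  obtain lam' where l: "\<And>c. beads_above lam' c = ?N c"
    using partition_of_beads_above[of ?N, OF * top bot] by metis
  have "bead lam' x \<longleftrightarrow> \<not> bead lam (1 - x)" for x
  proof -
    have "int (beads_above lam' (x - 1)) = int (beads_above lam' x) + of_bool (bead lam' x)"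
      by (simp add: beads_above_step)
    then show ?thesis using st[of x] unfolding l by (simp add: of_bool_def split: if_splits)
  qed
  moreover have "diagram lam' = prod.swap ` diagram lam"
  proof (rule set_eqI)
    fix b :: "nat \<times> nat"
    obtain i j where b: "b = (i, j)" by fastforce
    have "b \<in> diagram lam' \<longleftrightarrow> j < beads_above lam (int i - int j)"
      by (simp add: b mem_diagram_iff l) linarith
    also have "\<dots> \<longleftrightarrow> b \<in> prod.swap ` diagram lam" by (force simp: b mem_diagram_iff)
    finally show "b \<in> diagram lam' \<longleftrightarrow> b \<in> prod.swap ` diagram lam" .
  qed
  ultimately show ?thesis by blast
qed

text \<open>Conjugation exchanges beads and holes, so the condition of \<open>hflux\<close> at the
  start of a step turns into a bead of \<open>\<mu>\<close> at its end.\<close>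

definition vflux :: "nat \<Rightarrow> int_partition \<Rightarrow> int_partition \<Rightarrow> int set \<Rightarrow> bool" where
  "vflux n lam \<mu> A \<longleftrightarrow> bead_flux n lam \<mu> A \<and> (\<forall>a\<in>A. bead \<mu> (a - int n))"

text \<open>Under the reflection of positions by \<open>1 - y\<close> the step from \<open>a\<close>
  to \<open>a - n\<close> becomes, for the exchanged beads and holes, the step from
  \<open>1 - (a - n)\<close> to \<open>1 - a\<close>.\<close>

abbreviation reflect :: "nat \<Rightarrow> int \<Rightarrow> int" where
  "reflect n a \<equiv> 1 + int n - a"

lemma mem_reflect: "x \<in> reflect n ` A \<longleftrightarrow> reflect n x \<in> A"
proof
  assume "reflect n x \<in> A"
  then show "x \<in> reflect n ` A" by (rule rev_image_eqI) simp
qed auto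

lemma reflect_reflect: "reflect n ` reflect n ` A = A"
  by (rule set_eqI) (simp only: mem_reflect, simp)

lemma all_one_minus: "(\<forall>y :: int. P (1 - y)) \<longleftrightarrow> (\<forall>y. P y)"
proof (intro iffI allI)
  fix y assume "\<forall>y. P (1 - y)"
  then show "P y" by (elim allE[of _ "1 - y"]) simp
qed simp

lemma vflux_conjugate:
  assumes "\<forall>x. bead lam' x \<longleftrightarrow> \<not> bead lam (1 - x)" "\<forall>x. bead \<mu>' x \<longleftrightarrow> \<not> bead \<mu> (1 - x)"
  shows "hflux n lam' \<mu>' (reflect n ` A) \<longleftrightarrow> vflux n lam \<mu> A"
proof -
  have "bead_flux n lam' \<mu>' (reflect n ` A) \<longleftrightarrow> bead_flux n lam \<mu> A"
    unfolding bead_flux_def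
  proof (rule conj_cong)
    show "finite (reflect n ` A) \<longleftrightarrow> finite A"
      by (rule finite_image_iff) (auto intro: inj_onI)
    have "(\<forall>y. of_bool (bead lam' y) - of_bool (bead \<mu>' y)
        = (of_bool (y \<in> reflect n ` A) - of_bool (y + int n \<in> reflect n ` A) :: int)) \<longleftrightarrow>
      (\<forall>y. of_bool (bead lam' (1 - y)) - of_bool (bead \<mu>' (1 - y))
        = (of_bool (1 - y \<in> reflect n ` A) - of_bool (1 - y + int n \<in> reflect n ` A) :: int))"
      by (rule all_one_minus[symmetric])
    also have "\<dots> \<longleftrightarrow> (\<forall>y. of_bool (bead lam y) - of_bool (bead \<mu> y) = (of_bool (y \<in> A) - of_bool (y + int n \<in> A) :: int))"
    proof (intro all_cong1)
      fix y
      have "reflect n (1 - y) = y + int n" "reflect n (1 - y + int n) = y" by simp_all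
      then show "of_bool (bead lam' (1 - y)) - of_bool (bead \<mu>' (1 - y))
          = (of_bool (1 - y \<in> reflect n ` A) - of_bool (1 - y + int n \<in> reflect n ` A) :: int) \<longleftrightarrow>
        of_bool (bead lam y) - of_bool (bead \<mu> y) = (of_bool (y \<in> A) - of_bool (y + int n \<in> A) :: int)"
        unfolding mem_reflect using assms by (auto simp: of_bool_def add.commute[of "int n"])
    qed
    finally show "(\<forall>y. of_bool (bead lam' y) - of_bool (bead \<mu>' y)
        = (of_bool (y \<in> reflect n ` A) - of_bool (y + int n \<in> reflect n ` A) :: int)) \<longleftrightarrow>
      (\<forall>y. of_bool (bead lam y) - of_bool (bead \<mu> y) = (of_bool (y \<in> A) - of_bool (y + int n \<in> A) :: int))" .
  qed
  moreover have "(\<forall>x\<in>reflect n ` A. \<not> bead \<mu>' x) \<longleftrightarrow> (\<forall>a\<in>A. bead \<mu> (a - int n))"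
  proof -
    have "1 - reflect n a = a - int n" for a by simp
    then show ?thesis using assms(2) by simp
  qed
  ultimately show ?thesis by (simp add: hflux_def vflux_def)
qed

lemma image_swap_swap: "(`) prod.swap ` (`) prod.swap ` D = D"
  by (simp only: image_image swap_swap image_ident)

lemma vstrip_decomp_conjugate:
  assumes "diagram lam' = prod.swap ` diagram lam" "diagram \<mu>' = prod.swap ` diagram \<mu>"
  shows "vstrip_decomp n (diagram lam) (diagram \<mu>) D \<longleftrightarrow>
    hstrip_decomp n (diagram lam') (diagram \<mu>') ((`) prod.swap ` D)"
  by (simp add: vstrip_decomp_def assms)

lemma vertical_strip_iff:
  assumes "n \<ge> 1" shows "vertical_strip n lam \<mu> \<longleftrightarrow> (\<exists>A. vflux n lam \<mu> A)"
proof -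
  obtain lam' \<mu>' where d: "diagram lam' = prod.swap ` diagram lam" "diagram \<mu>' = prod.swap ` diagram \<mu>"
    and b: "\<forall>x. bead lam' x \<longleftrightarrow> \<not> bead lam (1 - x)" "\<forall>x. bead \<mu>' x \<longleftrightarrow> \<not> bead \<mu> (1 - x)"
    using conjugate_exists by metis
  have "vertical_strip n lam \<mu> \<longleftrightarrow> (\<exists>D. hstrip_decomp n (diagram lam') (diagram \<mu>') D)"
    unfolding vertical_strip_def vstrip_decomp_conjugate[OF d]
  proof
    assume "\<exists>D. hstrip_decomp n (diagram lam') (diagram \<mu>') D"
    then obtain D where "hstrip_decomp n (diagram lam') (diagram \<mu>') D" ..
    then show "\<exists>D. hstrip_decomp n (diagram lam') (diagram \<mu>') ((`) prod.swap ` D)"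
      by (intro exI[of _ "(`) prod.swap ` D"]) (simp only: image_swap_swap)
  qed blast
  also have "\<dots> \<longleftrightarrow> (\<exists>X. hflux n lam' \<mu>' X)"
    using horizontal_strip_iff[OF assms] by (simp add: horizontal_strip_def)
  also have "\<dots> \<longleftrightarrow> (\<exists>A. vflux n lam \<mu> A)"
  proof
    assume "\<exists>X. hflux n lam' \<mu>' X"
    then obtain X where "hflux n lam' \<mu>' (reflect n ` reflect n ` X)" by (auto simp only: reflect_reflect)
    then show "\<exists>A. vflux n lam \<mu> A" using vflux_conjugate[OF b] by blast
  qed (use vflux_conjugate[OF b] in blast)
  finally show ?thesis .
qed

text \<open>Transposition turns the horizontal steps of the ribbon, along which the row is constant,
  into vertical ones.\<close>

lemma ribbon_spin_swap_ribbon_set: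
  assumes r: "ribbon_rows n x \<rho>" and n: "n \<ge> 1"
  shows "ribbon_spin (prod.swap ` ribbon_set n x \<rho>) = card {c \<in> {x - int n<..<x}. \<rho> (c - 1) = \<rho> c}"
proof -
  \<comment> \<open>The column as a function of the negated content, that is, the row function of
    the transposed ribbon.\<close>
  define \<tau> where "\<tau> d = nat (int (\<rho> (- d)) + - d)" for d
  have "fst ` prod.swap ` ribbon_set n x \<rho> = (\<lambda>c. nat (int (\<rho> c) + c)) ` {x - int n..<x}"
    by (simp add: ribbon_set_def image_image box_def)
  also have "{x - int n..<x} = uminus ` {1 - x..int n - x}" by (simp add: image_uminus_atLeastAtMost) auto
  also have "(\<lambda>c. nat (int (\<rho> c) + c)) ` \<dots> = \<tau> ` {1 - x..int n - x}"
    by (simp only: image_image \<tau>_def[abs_def])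
  finally have img: "fst ` prod.swap ` ribbon_set n x \<rho> = \<tau> ` {1 - x..int n - x}" .
  have pos: "0 \<le> int (\<rho> c) + c" if "c \<in> {x - int n..<x}" for c
    using r that by (auto simp: ribbon_rows_def)
  have \<tau>: "int (\<tau> d) = int (\<rho> (- d)) - d" if "1 - x \<le> d" "d \<le> int n - x" for d
    using pos[of "- d"] that by (simp add: \<tau>_def)
  have st: "\<rho> (- d) = \<rho> (1 - d) \<or> \<rho> (- d) = Suc (\<rho> (1 - d))" if "1 - x < d" "d \<le> int n - x" for d
    using r that unfolding ribbon_rows_def by (auto dest!: bspec[of _ _ "1 - d"])
  have "card (\<tau> ` {1 - x..int n - x}) =
      Suc (card {d. 1 - x < d \<and> d \<le> int n - x \<and> \<tau> (d - 1) \<noteq> \<tau> d})"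
  proof (rule card_image_antitone_steps[THEN conjunct1])
    fix d assume d: "1 - x < d" "d \<le> int n - x"
    show "\<tau> (d - 1) = \<tau> d \<or> \<tau> (d - 1) = Suc (\<tau> d)"
      using st[OF d] \<tau>[of d] \<tau>[of "d - 1"] d by (simp add: algebra_simps) linarith
  qed (use n in simp)
  also have "{d. 1 - x < d \<and> d \<le> int n - x \<and> \<tau> (d - 1) \<noteq> \<tau> d} =
      (\<lambda>c. 1 - c) ` {c \<in> {x - int n<..<x}. \<rho> (c - 1) = \<rho> c}"
  proof (rule set_eqI)
    fix d
    have "\<tau> (d - 1) \<noteq> \<tau> d \<longleftrightarrow> \<rho> (- d) = \<rho> (1 - d)" if "1 - x < d" "d \<le> int n - x"
      using st[OF that] \<tau>[of d] \<tau>[of "d - 1"] that by (simp add: algebra_simps) linarith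
    then show "d \<in> {d. 1 - x < d \<and> d \<le> int n - x \<and> \<tau> (d - 1) \<noteq> \<tau> d} \<longleftrightarrow>
        d \<in> (\<lambda>c. 1 - c) ` {c \<in> {x - int n<..<x}. \<rho> (c - 1) = \<rho> c}"
      by (auto simp: image_iff intro!: exI[of _ "1 - d"])
  qed
  also have "card \<dots> = card {c \<in> {x - int n<..<x}. \<rho> (c - 1) = \<rho> c}"
    by (rule card_image) (auto intro: inj_onI)
  finally show ?thesis by (simp add: ribbon_spin_def img)
qed

text \<open>Among the \<open>n - 1\<close> positions strictly inside a step, conjugation exchanges
  those counted by \<open>hflux_ribbon_spin\<close> with the others. What is left are the beads of
  \<open>\<mu>\<close> that were not moved there by the strip itself.\<close>

lemma vflux_spin_count:
  assumes v: "vflux n lam \<mu> A" and n: "n \<ge> 1"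
  shows "vstrip_spin n lam \<mu> = (\<Sum>a\<in>A. card {b \<in> {a - int n<..<a}. bead \<mu> b \<and> b + int n \<notin> A})"
    and "ribbon_count n lam \<mu> = card A"
proof -
  obtain lam' \<mu>' where d: "diagram lam' = prod.swap ` diagram lam" "diagram \<mu>' = prod.swap ` diagram \<mu>"
    and b: "\<forall>x. bead lam' x \<longleftrightarrow> \<not> bead lam (1 - x)" "\<forall>x. bead \<mu>' x \<longleftrightarrow> \<not> bead \<mu> (1 - x)"
    using conjugate_exists by metis
  define X where "X = reflect n ` A"
  have h: "hflux n lam' \<mu>' X" using vflux_conjugate[OF b] v by (simp add: X_def)
  let ?R = "strip_ribbon n \<mu>' X"
  have inj: "inj_on ?R X" using hflux_inj_on_rows(1)[OF h n] .
  have uniq: "vstrip_decomp n (diagram lam) (diagram \<mu>) D \<longleftrightarrow> D = (`) prod.swap ` ?R ` X" for D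
    unfolding vstrip_decomp_conjugate[OF d]
  proof
    assume "hstrip_decomp n (diagram lam') (diagram \<mu>') ((`) prod.swap ` D)"
    then have "(`) prod.swap ` D = ?R ` X" by (rule hstrip_decomp_unique[OF h _ n])
    then show "D = (`) prod.swap ` ?R ` X" using image_swap_swap[of D] by simp
  next
    assume D: "D = (`) prod.swap ` ?R ` X"
    show "hstrip_decomp n (diagram lam') (diagram \<mu>') ((`) prod.swap ` D)"
      unfolding D image_swap_swap by (rule hflux_hstrip_decomp(1)[OF h n])
  qed
  have inj': "inj_on ((`) prod.swap) Y" for Y :: "(nat \<times> nat) set set"
    by (rule inj_on_inverseI[of _ "(`) prod.swap"]) (simp add: image_image)
  have "vstrip_spin n lam \<mu> = (\<Sum>x\<in>X. ribbon_spin (prod.swap ` ?R x))"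
    unfolding vstrip_spin_def uniq by (simp add: sum.reindex[OF inj'] sum.reindex[OF inj])
  also have "\<dots> = (\<Sum>x\<in>X. card {b \<in> {reflect n x - int n<..<reflect n x}. bead \<mu> b \<and> b + int n \<notin> A})"
  proof (rule sum.cong[OF refl])
    fix x assume x: "x \<in> X"
    let ?\<rho> = "strip_rows \<mu>' X x"
    note r = hflux_inj_on_rows(2)[OF h n x]
    have "ribbon_spin (prod.swap ` ?R x) = card {c \<in> {x - int n<..<x}. ?\<rho> (c - 1) = ?\<rho> c}"
      unfolding strip_ribbon_def using ribbon_spin_swap_ribbon_set[OF r n] .
    also have "\<dots> = card ({x - int n<..<x} - {c \<in> {x - int n<..<x}. ?\<rho> (c - 1) \<noteq> ?\<rho> c})"
      by (rule arg_cong[of _ _ card]) auto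
    also have "\<dots> = card {x - int n<..<x} - card {c \<in> {x - int n<..<x}. ?\<rho> (c - 1) \<noteq> ?\<rho> c}"
      by (rule card_Diff_subset) (auto intro: finite_subset[of _ "{x - int n<..<x}"])
    also have "card {c \<in> {x - int n<..<x}. ?\<rho> (c - 1) \<noteq> ?\<rho> c} = ribbon_spin (?R x)"
      unfolding strip_ribbon_def using ribbon_spin_ribbon_set[OF r n] by simp
    also have "\<dots> = card {h \<in> {x - int n<..<x}. bead \<mu>' h \<or> h \<in> X}" by (rule hflux_ribbon_spin[OF h n x])
    also have "card {x - int n<..<x} - \<dots> = card ({x - int n<..<x} - {h \<in> {x - int n<..<x}. bead \<mu>' h \<or> h \<in> X})"
      by (rule card_Diff_subset[symmetric]) (auto intro: finite_subset[of _ "{x - int n<..<x}"])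
    also have "{x - int n<..<x} - {h \<in> {x - int n<..<x}. bead \<mu>' h \<or> h \<in> X} =
        (\<lambda>b. 1 - b) ` {b \<in> {reflect n x - int n<..<reflect n x}. bead \<mu> b \<and> b + int n \<notin> A}"
    proof (rule set_eqI)
      fix h
      have "h \<in> X \<longleftrightarrow> 1 - h + int n \<in> A" by (simp add: X_def mem_reflect algebra_simps)
      then show "h \<in> {x - int n<..<x} - {h \<in> {x - int n<..<x}. bead \<mu>' h \<or> h \<in> X} \<longleftrightarrow>
          h \<in> (\<lambda>b. 1 - b) ` {b \<in> {reflect n x - int n<..<reflect n x}. bead \<mu> b \<and> b + int n \<notin> A}"
      proof -
        have "h \<in> (\<lambda>b. 1 - b) ` S \<longleftrightarrow> 1 - h \<in> S" for S :: "int set"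
          by (auto simp: image_iff) (metis diff_diff_eq2 add_diff_cancel_left')
        moreover have "1 - h \<in> {reflect n x - int n<..<reflect n x} \<longleftrightarrow> h \<in> {x - int n<..<x}" by auto
        ultimately show ?thesis using b(2) \<open>h \<in> X \<longleftrightarrow> _\<close> by simp blast
      qed
    qed
    also have "card \<dots> = card {b \<in> {reflect n x - int n<..<reflect n x}. bead \<mu> b \<and> b + int n \<notin> A}"
      by (rule card_image) (auto intro: inj_onI)
    finally show "ribbon_spin (prod.swap ` ?R x) =
      card {b \<in> {reflect n x - int n<..<reflect n x}. bead \<mu> b \<and> b + int n \<notin> A}" .
  qed
  also have "\<dots> = (\<Sum>a\<in>A. card {b \<in> {a - int n<..<a}. bead \<mu> b \<and> b + int n \<notin> A})"
    unfolding X_def by (subst sum.reindex) (auto intro: inj_onI)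
  finally show "vstrip_spin n lam \<mu> = (\<Sum>a\<in>A. card {b \<in> {a - int n<..<a}. bead \<mu> b \<and> b + int n \<notin> A})" .
  have "diagram lam' - diagram \<mu>' = prod.swap ` (diagram lam - diagram \<mu>)"
    unfolding d by (auto simp: image_iff)
  then have "card (diagram lam' - diagram \<mu>') = card (diagram lam - diagram \<mu>)"
    by (simp add: card_image)
  then have "ribbon_count n lam \<mu> = ribbon_count n lam' \<mu>'" by (simp add: ribbon_count_def)
  also have "\<dots> = card A"
    unfolding hflux_ribbon_count[OF h n] X_def by (rule card_image) (auto intro: inj_onI)
  finally show "ribbon_count n lam \<mu> = card A" .
qed

text \<open>Otherwise a bead would arrive at \<open>a\<close> and move on, leaving \<open>a\<close>
  empty in \<open>\<mu>\<close>; but in a vertical strip every step ends at a bead of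
  \<open>\<mu>\<close>.\<close>

lemma vflux_bead:
  assumes "vflux n lam \<mu> A" "a \<in> A" shows "bead lam a"
proof (rule ccontr)
  assume "\<not> bead lam a"
  moreover have "of_bool (bead lam a) - of_bool (bead \<mu> a) = (of_bool (a \<in> A) - of_bool (a + int n \<in> A) :: int)"
    using assms by (simp add: vflux_def bead_flux_def)
  ultimately have "a + int n \<in> A" "\<not> bead \<mu> a" using assms(2) by (auto simp: of_bool_def split: if_splits)
  then show False using assms(1) unfolding vflux_def by force
qed

section \<open>Moving beads between a horizontal and a vertical strip\<close>

lemma move_bead_obtain:
  assumes a: "bead \<nu> a" and b: "\<not> bead \<nu> b"
  obtains \<nu>' where "\<And>x. bead \<nu>' x \<longleftrightarrow> x = b \<or> bead \<nu> x \<and> x \<noteq> a"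
proof -
  have ab: "a \<noteq> b" using assms by auto
  define N where "N c = int (beads_above \<nu> c) + of_bool (c < b) - of_bool (c < a)" for c
  have st: "N (c - 1) = N c + of_bool (c = b \<or> bead \<nu> c \<and> c \<noteq> a)" for c
  proof -
    have "c - 1 < x \<longleftrightarrow> c < x \<or> c = x" for x by auto
    then show ?thesis using a b ab beads_above_step[of \<nu> c] by (auto simp: N_def of_bool_def)
  qed
  obtain C where C: "\<And>c. c \<ge> C \<Longrightarrow> beads_above \<nu> c = 0" using beads_above_eq_0[of \<nu>] by metis
  obtain D where D: "\<And>c. c \<le> D \<Longrightarrow> int (beads_above \<nu> c) = - c" using beads_above_eq_uminus[of \<nu>] by metis
  have top: "N c = 0" if "c \<ge> max C (max a b)" for c using that C[of c] by (simp add: N_def)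
  have bot: "N c = - c" if "c \<le> min D (min a b) - 1" for c using that D[of c] by (simp add: N_def)
  have anti: "N d \<le> N c" if "c \<le> d" for c d
    by (rule antitone_int[where N = N, OF _ that]) (simp add: st)
  have nn: "0 \<le> N c" for c
    using anti[of c "max c (max C (max a b))"] top[of "max c (max C (max a b))"] by simp
  have *: "nat (N c) \<le> nat (N (c - 1))" "nat (N (c - 1)) \<le> nat (N c) + 1" for c
    using st[of c] nn[of c] by (auto simp: of_bool_def)
  have bot': "int (nat (N c)) = - c" if "c \<le> min D (min a b) - 1" for c
    using bot[OF that] nn[of c] by simp
  have top': "nat (N c) = 0" if "c \<ge> max C (max a b)" for c using top[OF that] by simp
  obtain \<nu>' where n': "\<And>c. beads_above \<nu>' c = nat (N c)"
    using partition_of_beads_above[of "\<lambda>c. nat (N c)", OF * top' bot'] by metis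
  have "bead \<nu>' x \<longleftrightarrow> x = b \<or> bead \<nu> x \<and> x \<noteq> a" for x
    using st[of x] nn[of x] nn[of "x - 1"] by (auto simp: bead_iff n' of_bool_def split: if_splits)
  then show ?thesis by (rule that)
qed

text \<open>
  The spins of a horizontal strip followed by a vertical one depend on how the moved beads are
  distributed among the two strips only through the pairs counted in the last sum.
\<close>

lemma hflux_vflux_spin:
  assumes h: "hflux n lam \<nu> X" and v: "vflux n \<nu> \<mu> A" and n: "n \<ge> 1"
  defines "Z \<equiv> X \<union> A"
  shows "int (hstrip_spin n lam \<nu> + vstrip_spin n \<nu> \<mu>) =
    (\<Sum>x\<in>Z. \<Sum>h\<in>{x - int n<..<x}. of_bool (bead \<mu> h) + of_bool (h \<in> Z)) -
    2 * (\<Sum>x\<in>A. \<Sum>h\<in>{x - int n<..<x}. of_bool (h \<in> Z))"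
proof -
  let ?I = "\<lambda>x. {x - int n<..<x}"
  have fin: "finite X" "finite A" using h v by (auto simp: hflux_def vflux_def bead_flux_def)
  have disj: "X \<inter> A = {}" using vflux_bead[OF v] h by (auto simp: hflux_def)
  have fl: "of_bool (bead \<nu> y) = (of_bool (bead \<mu> y) + of_bool (y \<in> A) - of_bool (y + int n \<in> A) :: int)" for y
    using v unfolding vflux_def bead_flux_def by (metis add_diff_eq diff_add_cancel add.commute)
  have count: "int (card {h \<in> S. P h}) = (\<Sum>h\<in>S. of_bool (P h))" if "finite S" for S :: "int set" and P
  proof -
    have "(\<Sum>h\<in>S. of_bool (P h) :: int) = (\<Sum>h\<in>S. if P h then 1 else 0)" by (simp add: of_bool_def)
    also have "\<dots> = (\<Sum>h | h \<in> S \<and> P h. 1)" using that by (rule sum.inter_filter[symmetric])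
    finally show ?thesis by simp
  qed
  have "int (hstrip_spin n lam \<nu>) = (\<Sum>x\<in>X. \<Sum>h\<in>?I x. of_bool (bead \<nu> h \<or> h \<in> X))"
    unfolding hflux_spin[OF h n] of_nat_sum by (intro sum.cong refl count) simp
  also have "\<dots> = (\<Sum>x\<in>X. \<Sum>h\<in>?I x. of_bool (bead \<mu> h) + of_bool (h \<in> Z) - of_bool (h + int n \<in> A))"
  proof (intro sum.cong[OF refl])
    fix x y
    have "of_bool (bead \<nu> y \<or> y \<in> X) = (of_bool (bead \<nu> y) + of_bool (y \<in> X) :: int)"
      using h by (auto simp: hflux_def of_bool_def)
    moreover have "of_bool (y \<in> Z) = (of_bool (y \<in> X) + of_bool (y \<in> A) :: int)"
      using disj by (auto simp: Z_def of_bool_def)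
    ultimately show "of_bool (bead \<nu> y \<or> y \<in> X) =
        (of_bool (bead \<mu> y) + of_bool (y \<in> Z) - of_bool (y + int n \<in> A) :: int)"
      using fl[of y] by linarith
  qed
  finally have hs: "int (hstrip_spin n lam \<nu>) =
    (\<Sum>x\<in>X. \<Sum>h\<in>?I x. of_bool (bead \<mu> h) + of_bool (h \<in> Z) - of_bool (h + int n \<in> A))" .
  have "int (vstrip_spin n \<nu> \<mu>) = (\<Sum>x\<in>A. \<Sum>h\<in>?I x. of_bool (bead \<mu> h \<and> h + int n \<notin> A))"
    unfolding vflux_spin_count(1)[OF v n] of_nat_sum by (intro sum.cong refl count) simp
  also have "\<dots> = (\<Sum>x\<in>A. \<Sum>h\<in>?I x. of_bool (bead \<mu> h) - of_bool (h + int n \<in> A))"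
  proof (intro sum.cong[OF refl])
    fix x y
    have "bead \<mu> y" if "y + int n \<in> A" using v that unfolding vflux_def by (metis add_diff_cancel_right')
    then show "of_bool (bead \<mu> y \<and> y + int n \<notin> A) = (of_bool (bead \<mu> y) - of_bool (y + int n \<in> A) :: int)"
      by (auto simp: of_bool_def)
  qed
  finally have vs: "int (vstrip_spin n \<nu> \<mu>) = (\<Sum>x\<in>A. \<Sum>h\<in>?I x. of_bool (bead \<mu> h) - of_bool (h + int n \<in> A))" .
  have un: "(\<Sum>x\<in>Z. f x) = (\<Sum>x\<in>X. f x) + (\<Sum>x\<in>A. f x)" for f :: "int \<Rightarrow> int"
    unfolding Z_def by (rule sum.union_disjoint[OF fin disj])
  \<comment> \<open>Double counting of the pairs \<open>x \<in> Z\<close>, \<open>y \<in> A\<close>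
    with \<open>x < y < x + n\<close>: an arrival \<open>h = y - n\<close> inside the interval of
    \<open>x\<close> corresponds to the element \<open>x\<close> of \<open>Z\<close> inside the
    interval of \<open>y\<close>.\<close>
  have "(\<Sum>x\<in>Z. \<Sum>h\<in>?I x. of_bool (h + int n \<in> A)) = (\<Sum>x\<in>Z. \<Sum>y\<in>A. of_bool (x < y \<and> y < x + int n) :: int)"
  proof (rule sum.cong[OF refl])
    fix x
    have "(\<Sum>h\<in>?I x. of_bool (h + int n \<in> A) :: int) = int (card {h \<in> ?I x. h + int n \<in> A})"
      by (intro count[symmetric]) simp
    also have "card {h \<in> ?I x. h + int n \<in> A} = card ((\<lambda>h. h + int n) ` {h \<in> ?I x. h + int n \<in> A})"
      by (rule card_image[symmetric]) (auto intro: inj_onI)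
    also have "(\<lambda>h. h + int n) ` {h \<in> ?I x. h + int n \<in> A} = {y \<in> A. x < y \<and> y < x + int n}"
    proof (intro subset_antisym subsetI)
      fix y assume "y \<in> {y \<in> A. x < y \<and> y < x + int n}"
      then show "y \<in> (\<lambda>h. h + int n) ` {h \<in> ?I x. h + int n \<in> A}"
        by (intro image_eqI[of _ _ "y - int n"]) auto
    qed auto
    also have "int (card \<dots>) = (\<Sum>y\<in>A. of_bool (x < y \<and> y < x + int n))" using fin by (intro count)
    finally show "(\<Sum>h\<in>?I x. of_bool (h + int n \<in> A) :: int) = (\<Sum>y\<in>A. of_bool (x < y \<and> y < x + int n))" .
  qed
  also have "\<dots> = (\<Sum>y\<in>A. \<Sum>x\<in>Z. of_bool (x < y \<and> y < x + int n))" by (rule sum.swap)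
  also have "\<dots> = (\<Sum>y\<in>A. \<Sum>h\<in>?I y. of_bool (h \<in> Z))"
  proof (rule sum.cong[OF refl])
    fix y
    have "(\<Sum>x\<in>Z. of_bool (x < y \<and> y < x + int n) :: int) = int (card {x \<in> Z. x < y \<and> y < x + int n})"
      using fin by (intro count[symmetric]) (simp add: Z_def)
    also have "{x \<in> Z. x < y \<and> y < x + int n} = {h \<in> ?I y. h \<in> Z}" by auto
    also have "int (card \<dots>) = (\<Sum>h\<in>?I y. of_bool (h \<in> Z))" by (intro count) simp
    finally show "(\<Sum>x\<in>Z. of_bool (x < y \<and> y < x + int n) :: int) = (\<Sum>h\<in>?I y. of_bool (h \<in> Z))" .
  qed
  finally have sw: "(\<Sum>x\<in>Z. \<Sum>h\<in>?I x. of_bool (h + int n \<in> A)) = (\<Sum>y\<in>A. \<Sum>h\<in>?I y. of_bool (h \<in> Z) :: int)" .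
  show ?thesis
    unfolding of_nat_add hs vs sum.distrib sum_subtractf un
    using sw unfolding un by (simp add: sum.distrib sum_subtractf algebra_simps)
qed

lemma of_bool_Diff_insert:
  "x \<in> X \<Longrightarrow> of_bool (y \<in> X - {x}) = (of_bool (y \<in> X) - of_bool (y = x) :: int)"
  "x \<notin> X \<Longrightarrow> of_bool (y \<in> insert x X) = (of_bool (y \<in> X) + of_bool (y = x) :: int)"
  by (cases "y = x"; simp)+

text \<open>As \<open>x\<close> is the least element of the total flux, no step starts at
  \<open>x - n\<close>. The bead that \<open>\<nu>\<close> has there is therefore also a bead of
  \<open>\<mu>\<close>, which is the vertical condition for the transferred step.\<close>

lemma toggle_hv:
  assumes h: "hflux n lam \<nu> X" and v: "vflux n \<nu> \<mu> A" and n: "n \<ge> 1"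
    and x: "x \<in> X" "\<And>y. y \<in> X \<union> A \<Longrightarrow> x \<le> y" and \<nu>': "\<And>y. bead \<nu>' y \<longleftrightarrow> y = x \<or> bead \<nu> y \<and> y \<noteq> x - int n"
  shows "hflux n lam \<nu>' (X - {x})" "vflux n \<nu>' \<mu> (insert x A)" "bead \<nu> (x - int n)" "\<not> bead \<nu> x"
proof -
  have fin: "finite X" "finite A" using h v by (auto simp: hflux_def vflux_def bead_flux_def)
  have xm: "x - int n \<notin> X" "x - int n \<notin> A" using x(2)[of "x - int n"] n by auto
  have hf: "of_bool (bead lam y) - of_bool (bead \<nu> y) = (of_bool (y \<in> X) - of_bool (y + int n \<in> X) :: int)" for y
    using h by (simp add: hflux_def bead_flux_def)
  have vf: "of_bool (bead \<nu> y) - of_bool (bead \<mu> y) = (of_bool (y \<in> A) - of_bool (y + int n \<in> A) :: int)" for y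
    using v by (simp add: vflux_def bead_flux_def)
  show nx: "\<not> bead \<nu> x" using h x by (simp add: hflux_def)
  then have xA: "x \<notin> A" using vflux_bead[OF v] by blast
  show bx: "bead \<nu> (x - int n)" using hf[of "x - int n"] xm x by (simp add: of_bool_def split: if_splits)
  have bm: "bead \<mu> (x - int n)" using vf[of "x - int n"] xm xA bx by (simp add: of_bool_def split: if_splits)
  have b': "of_bool (bead \<nu>' y) = (of_bool (bead \<nu> y) + of_bool (y = x) - of_bool (y = x - int n) :: int)" for y
    using \<nu>'[of y] bx nx n by (auto simp: of_bool_def)
  have sh: "y + int n = x \<longleftrightarrow> y = x - int n" for y by auto
  have "of_bool (bead lam y) - of_bool (bead \<nu>' y) = (of_bool (y \<in> X - {x}) - of_bool (y + int n \<in> X - {x}) :: int)" for y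
    using hf[of y] b'[of y] unfolding of_bool_Diff_insert(1)[OF x(1)] sh by linarith
  moreover have "\<not> bead \<nu>' y" if "y \<in> X - {x}" for y using that h by (auto simp: hflux_def \<nu>')
  ultimately show "hflux n lam \<nu>' (X - {x})" using fin by (simp add: hflux_def bead_flux_def)
  have "of_bool (bead \<nu>' y) - of_bool (bead \<mu> y) = (of_bool (y \<in> insert x A) - of_bool (y + int n \<in> insert x A) :: int)" for y
    using vf[of y] b'[of y] unfolding of_bool_Diff_insert(2)[OF xA] sh by linarith
  then show "vflux n \<nu>' \<mu> (insert x A)" using fin v bm by (auto simp: vflux_def bead_flux_def)
qed

text \<open>The inverse of \<open>toggle_hv\<close>; again minimality of \<open>x\<close> excludes a
  step that starts at \<open>x - n\<close>.\<close>

lemma toggle_vh: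
  assumes h: "hflux n lam \<nu> X" and v: "vflux n \<nu> \<mu> A" and n: "n \<ge> 1"
    and x: "x \<in> A" "\<And>y. y \<in> X \<union> A \<Longrightarrow> x \<le> y" and \<nu>': "\<And>y. bead \<nu>' y \<longleftrightarrow> y = x - int n \<or> bead \<nu> y \<and> y \<noteq> x"
  shows "hflux n lam \<nu>' (insert x X)" "vflux n \<nu>' \<mu> (A - {x})" "bead \<nu> x" "\<not> bead \<nu> (x - int n)"
proof -
  have fin: "finite X" "finite A" using h v by (auto simp: hflux_def vflux_def bead_flux_def)
  have xm: "x - int n \<notin> X" "x - int n \<notin> A" using x(2)[of "x - int n"] n by auto
  have hf: "of_bool (bead lam y) - of_bool (bead \<nu> y) = (of_bool (y \<in> X) - of_bool (y + int n \<in> X) :: int)" for y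
    using h by (simp add: hflux_def bead_flux_def)
  have vf: "of_bool (bead \<nu> y) - of_bool (bead \<mu> y) = (of_bool (y \<in> A) - of_bool (y + int n \<in> A) :: int)" for y
    using v by (simp add: vflux_def bead_flux_def)
  show bx: "bead \<nu> x" using vflux_bead[OF v] x by simp
  then have xX: "x \<notin> X" using h by (auto simp: hflux_def)
  show nx: "\<not> bead \<nu> (x - int n)" using vf[of "x - int n"] xm x by (simp add: of_bool_def split: if_splits)
  have b': "of_bool (bead \<nu>' y) = (of_bool (bead \<nu> y) - of_bool (y = x) + of_bool (y = x - int n) :: int)" for y
    using \<nu>'[of y] bx nx n by (auto simp: of_bool_def)
  have sh: "y + int n = x \<longleftrightarrow> y = x - int n" for y by auto
  have "of_bool (bead lam y) - of_bool (bead \<nu>' y) = (of_bool (y \<in> insert x X) - of_bool (y + int n \<in> insert x X) :: int)" for y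
    using hf[of y] b'[of y] unfolding of_bool_Diff_insert(2)[OF xX] sh by linarith
  moreover have "\<not> bead \<nu>' y" if "y \<in> insert x X" for y using that h xm n by (auto simp: hflux_def \<nu>')
  ultimately show "hflux n lam \<nu>' (insert x X)" using fin by (simp add: hflux_def bead_flux_def)
  have "of_bool (bead \<nu>' y) - of_bool (bead \<mu> y) = (of_bool (y \<in> A - {x}) - of_bool (y + int n \<in> A - {x}) :: int)" for y
    using vf[of y] b'[of y] unfolding of_bool_Diff_insert(1)[OF x(1)] sh by linarith
  then show "vflux n \<nu>' \<mu> (A - {x})" using fin v by (auto simp: vflux_def bead_flux_def)
qed

definition hcoeff :: "nat \<Rightarrow> complex \<Rightarrow> complex \<Rightarrow> int_partition \<Rightarrow> int_partition \<Rightarrow> complex" where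
  "hcoeff n q z lam \<mu> = (if horizontal_strip n lam \<mu>
     then z ^ ribbon_count n lam \<mu> * q ^ hstrip_spin n lam \<mu> else 0)"

definition vcoeff :: "nat \<Rightarrow> complex \<Rightarrow> complex \<Rightarrow> int_partition \<Rightarrow> int_partition \<Rightarrow> complex" where
  "vcoeff n q z lam \<mu> = (if vertical_strip n lam \<mu>
     then z ^ ribbon_count n lam \<mu> * q ^ vstrip_spin n lam \<mu> else 0)"

lemma hcoeff_vcoeff:
  assumes "hflux n lam \<nu> X" "vflux n \<nu> \<mu> A" "n \<ge> 1"
  shows "hcoeff n q z lam \<nu> * vcoeff n q w \<nu> \<mu> =
    z ^ card X * w ^ card A * q ^ (hstrip_spin n lam \<nu> + vstrip_spin n \<nu> \<mu>)"
  using assms horizontal_strip_iff[OF assms(3)] vertical_strip_iff[OF assms(3)]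
    hflux_ribbon_count[OF assms(1,3)] vflux_spin_count(2)[OF assms(2,3)]
  by (auto simp: hcoeff_def vcoeff_def power_add)

lemma bead_flux_empty: "bead_flux n lam \<mu> {} \<longleftrightarrow> lam = \<mu>"
  by (auto simp: bead_flux_def of_bool_def split: if_splits intro!: eq_of_bead)

lemma bead_flux_Un:
  assumes "bead_flux n lam \<nu> X" "bead_flux n \<nu> \<mu> A" "X \<inter> A = {}"
  shows "bead_flux n lam \<mu> (X \<union> A)"
  unfolding bead_flux_def
proof (intro conjI allI)
  fix y
  have un: "of_bool (y \<in> X \<union> A) = (of_bool (y \<in> X) + of_bool (y \<in> A) :: int)" for y
    using assms(3) by (auto simp: of_bool_def)
  have "of_bool (bead lam y) - of_bool (bead \<nu> y) = (of_bool (y \<in> X) - of_bool (y + int n \<in> X) :: int)"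
    "of_bool (bead \<nu> y) - of_bool (bead \<mu> y) = (of_bool (y \<in> A) - of_bool (y + int n \<in> A) :: int)"
    using assms by (simp_all add: bead_flux_def)
  then show "of_bool (bead lam y) - of_bool (bead \<mu> y) =
      (of_bool (y \<in> X \<union> A) - of_bool (y + int n \<in> X \<union> A) :: int)" unfolding un by linarith
qed (use assms in \<open>auto simp: bead_flux_def\<close>)

lemma finite_subpartitions: "finite {\<nu>. diagram \<nu> \<subseteq> diagram lam}"
proof (rule finite_imageD)
  show "finite (diagram ` {\<nu>. diagram \<nu> \<subseteq> diagram lam})"
    by (rule finite_subset[of _ "Pow (diagram lam)"]) (auto simp: finite_diagram)
qed (simp add: inj_on_def diagram_inject)

lemma horizontal_strip_subset: "horizontal_strip n lam \<mu> \<Longrightarrow> diagram \<mu> \<subseteq> diagram lam"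
  by (auto simp: horizontal_strip_def hstrip_decomp_def)

lemma vertical_strip_subset: "vertical_strip n lam \<mu> \<Longrightarrow> diagram \<mu> \<subseteq> diagram lam"
  by (force simp: vertical_strip_def vstrip_decomp_def hstrip_decomp_def)

text \<open>
  The sign-reversing involution moves the least element of the total flux, which counts no pair in
  the previous formula, from one strip to the other.
\<close>

lemma hv_cancel:
  assumes n: "n \<ge> 1" and ne: "lam \<noteq> \<mu>"
  shows "(\<Sum>\<nu> | diagram \<nu> \<subseteq> diagram lam. hcoeff n q z lam \<nu> * vcoeff n q (- z) \<nu> \<mu>) = 0"
proof -
  define S where "S = {\<nu>. horizontal_strip n lam \<nu> \<and> vertical_strip n \<nu> \<mu>}"
  let ?f = "\<lambda>\<nu>. hcoeff n q z lam \<nu> * vcoeff n q (- z) \<nu> \<mu>"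
  have "(\<Sum>\<nu> | diagram \<nu> \<subseteq> diagram lam. ?f \<nu>) = (\<Sum>\<nu>\<in>S. ?f \<nu>)"
  proof (rule sum.mono_neutral_right)
    show "S \<subseteq> {\<nu>. diagram \<nu> \<subseteq> diagram lam}" unfolding S_def using horizontal_strip_subset by blast
    show "\<forall>\<nu>\<in>{\<nu>. diagram \<nu> \<subseteq> diagram lam} - S. ?f \<nu> = 0" by (auto simp: S_def hcoeff_def vcoeff_def)
  qed (rule finite_subpartitions)
  also have "\<dots> = 0"
  proof (cases "S = {}")
    case False
    have flux: "\<exists>X A. hflux n lam \<nu> X \<and> vflux n \<nu> \<mu> A \<and> X \<inter> A = {} \<and> bead_flux n lam \<mu> (X \<union> A)"
      if "\<nu> \<in> S" for \<nu>
    proof -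
      obtain X A where XA: "hflux n lam \<nu> X" "vflux n \<nu> \<mu> A"
        using \<open>\<nu> \<in> S\<close> horizontal_strip_iff[OF n] vertical_strip_iff[OF n] by (auto simp: S_def)
      moreover have "X \<inter> A = {}" using vflux_bead[OF XA(2)] XA(1) by (auto simp: hflux_def)
      moreover have "bead_flux n lam \<mu> (X \<union> A)"
        using XA calculation(3) by (intro bead_flux_Un) (auto simp: hflux_def vflux_def)
      ultimately show ?thesis by (intro exI[of _ X] exI[of _ A] conjI)
    qed
    then obtain Z where Z: "bead_flux n lam \<mu> Z" using False by blast
    then have finZ: "finite Z" by (simp add: bead_flux_def)
    have "Z \<noteq> {}" using Z ne bead_flux_empty by blast
    define x where "x = Min Z"
    have x: "x \<in> Z" "\<And>y. y \<in> Z \<Longrightarrow> x \<le> y" using finZ \<open>Z \<noteq> {}\<close> by (auto simp: x_def)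
    have XA: "\<exists>X A. hflux n lam \<nu> X \<and> vflux n \<nu> \<mu> A \<and> X \<inter> A = {} \<and> X \<union> A = Z" if "\<nu> \<in> S" for \<nu>
      using flux[OF that] bead_flux_unique[OF _ Z n] by blast
    \<comment> \<open>\<open>g\<close> flips the occupation of \<open>x\<close> and of
      \<open>x - n\<close>, whichever strip contains the step at \<open>x\<close>. This uniform
      description makes it evident that \<open>g\<close> is an involution.\<close>
    define g where "g \<nu> = (SOME \<nu>'. \<forall>y. bead \<nu>' y \<longleftrightarrow> (if y \<in> {x, x - int n} then \<not> bead \<nu> y else bead \<nu> y))" for \<nu>
    have main: "g \<nu> \<in> S \<and> g (g \<nu>) = \<nu> \<and> ?f (g \<nu>) = - ?f \<nu>" if \<nu>: "\<nu> \<in> S" for \<nu>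
    proof -
      obtain X A where h: "hflux n lam \<nu> X" and v: "vflux n \<nu> \<mu> A" and disj: "X \<inter> A = {}" and XAZ: "X \<union> A = Z"
        using XA[OF \<nu>] by blast
      have fin: "finite X" "finite A" using finZ XAZ by auto
      have min: "\<And>y. y \<in> X \<union> A \<Longrightarrow> x \<le> y" using x XAZ by simp
      have "\<exists>\<nu>' X' A'. (\<forall>y. bead \<nu>' y \<longleftrightarrow> (if y \<in> {x, x - int n} then \<not> bead \<nu> y else bead \<nu> y)) \<and>
          hflux n lam \<nu>' X' \<and> vflux n \<nu>' \<mu> A' \<and> X' \<union> A' = Z \<and>
          A' - {x} = A - {x} \<and> (z ^ card X' * (- z) ^ card A' = - (z ^ card X * (- z) ^ card A))"
      proof (cases "x \<in> X")
        case True
        obtain \<nu>' where \<nu>': "\<And>y. bead \<nu>' y \<longleftrightarrow> y = x \<or> bead \<nu> y \<and> y \<noteq> x - int n"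
        proof -
          have "bead \<nu> (x - int n)" "\<not> bead \<nu> x"
          proof -
            have xm: "x - int n \<notin> X" using x(2)[of "x - int n"] n XAZ by auto
            have "of_bool (bead lam (x - int n)) - of_bool (bead \<nu> (x - int n)) = (of_bool (x - int n \<in> X) - of_bool (x - int n + int n \<in> X) :: int)"
              using h unfolding hflux_def bead_flux_def by blast
            then show "bead \<nu> (x - int n)" using xm True by (simp add: of_bool_def split: if_splits)
            show "\<not> bead \<nu> x" using h True by (simp add: hflux_def)
          qed
          then show ?thesis using move_bead_obtain[of \<nu> "x - int n" x] that by metis
        qed
        note t = toggle_hv[OF h v n True min \<nu>']
        have xA: "x \<notin> A" using True disj by blast
        have "card X = Suc (card (X - {x}))" using True fin by (metis card.remove)
        then have "z ^ card (X - {x}) * (- z) ^ card (insert x A) = - (z ^ card X * (- z) ^ card A)"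
          using xA fin by simp
        moreover have "\<forall>y. bead \<nu>' y \<longleftrightarrow> (if y \<in> {x, x - int n} then \<not> bead \<nu> y else bead \<nu> y)"
          using \<nu>' t(3,4) n by auto
        moreover have "X - {x} \<union> insert x A = Z" "insert x A - {x} = A - {x}" using XAZ True by auto
        ultimately show ?thesis using t(1,2) by blast
      next
        case False
        then have xA: "x \<in> A" using x XAZ by blast
        obtain \<nu>' where \<nu>': "\<And>y. bead \<nu>' y \<longleftrightarrow> y = x - int n \<or> bead \<nu> y \<and> y \<noteq> x"
        proof -
          have "\<not> bead \<nu> (x - int n)" "bead \<nu> x"
          proof -
            have xm: "x - int n \<notin> A" using x(2)[of "x - int n"] n XAZ by auto
            have "of_bool (bead \<nu> (x - int n)) - of_bool (bead \<mu> (x - int n)) = (of_bool (x - int n \<in> A) - of_bool (x - int n + int n \<in> A) :: int)"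
              using v unfolding vflux_def bead_flux_def by blast
            then show "\<not> bead \<nu> (x - int n)" using xm xA by (simp add: of_bool_def split: if_splits)
            show "bead \<nu> x" using vflux_bead[OF v xA] .
          qed
          then show ?thesis using move_bead_obtain[of \<nu> x "x - int n"] that by metis
        qed
        note t = toggle_vh[OF h v n xA min \<nu>']
        have "card A = Suc (card (A - {x}))" using xA fin by (metis card.remove)
        then have "z ^ card (insert x X) * (- z) ^ card (A - {x}) = - (z ^ card X * (- z) ^ card A)"
          using False fin by simp
        moreover have "\<forall>y. bead \<nu>' y \<longleftrightarrow> (if y \<in> {x, x - int n} then \<not> bead \<nu> y else bead \<nu> y)"
          using \<nu>' t(3,4) n by auto
        moreover have "insert x X \<union> (A - {x}) = Z" "A - {x} - {x} = A - {x}" using XAZ xA by auto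
        ultimately show ?thesis using t(1,2) by blast
      qed
      then obtain \<nu>' X' A' where b': "\<forall>y. bead \<nu>' y \<longleftrightarrow> (if y \<in> {x, x - int n} then \<not> bead \<nu> y else bead \<nu> y)"
        and h': "hflux n lam \<nu>' X'" and v': "vflux n \<nu>' \<mu> A'" and Z': "X' \<union> A' = Z" and A': "A' - {x} = A - {x}"
        and sgn: "z ^ card X' * (- z) ^ card A' = - (z ^ card X * (- z) ^ card A)" by blast
      have gu: "g \<kappa> = \<nu>''" if "\<forall>y. bead \<nu>'' y \<longleftrightarrow> (if y \<in> {x, x - int n} then \<not> bead \<kappa> y else bead \<kappa> y)" for \<kappa> \<nu>''
      proof -
        have "\<forall>y. bead (g \<kappa>) y \<longleftrightarrow> (if y \<in> {x, x - int n} then \<not> bead \<kappa> y else bead \<kappa> y)"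
          unfolding g_def by (rule someI[of _ \<nu>'']) (rule that)
        then show ?thesis using that by (intro eq_of_bead) simp
      qed
      have g: "g \<nu> = \<nu>'" using gu[OF b'] .
      have gg: "g \<nu>' = \<nu>" by (rule gu) (use b' in simp)
      have S': "\<nu>' \<in> S" using h' v' horizontal_strip_iff[OF n] vertical_strip_iff[OF n] by (auto simp: S_def)
      \<comment> \<open>No element of \<open>Z\<close> lies below its minimum \<open>x\<close>, so
        the term of \<open>x\<close> in the subtracted sum of \<open>hflux_vflux_spin\<close> is 0
        whether or not \<open>x\<close> belongs to the vertical strip.\<close>
      have zero: "(\<Sum>h\<in>{x - int n<..<x}. of_bool (h \<in> Z)) = (0 :: int)"
        by (rule sum.neutral) (use x(2) in force)
      have drop: "(\<Sum>y\<in>B. \<Sum>h\<in>{y - int n<..<y}. of_bool (h \<in> Z)) = (\<Sum>y\<in>B - {x}. \<Sum>h\<in>{y - int n<..<y}. of_bool (h \<in> Z) :: int)"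
        if "finite B" for B
        by (rule sum.mono_neutral_right) (use that zero in auto)
      have "finite A'" using finZ Z' by auto
      have "(\<Sum>y\<in>A'. \<Sum>h\<in>{y - int n<..<y}. of_bool (h \<in> Z)) =
          (\<Sum>y\<in>A. \<Sum>h\<in>{y - int n<..<y}. of_bool (h \<in> Z) :: int)"
        unfolding drop[OF fin(2)] drop[OF \<open>finite A'\<close>] A' ..
      then have "int (hstrip_spin n lam \<nu>' + vstrip_spin n \<nu>' \<mu>) = int (hstrip_spin n lam \<nu> + vstrip_spin n \<nu> \<mu>)"
        unfolding hflux_vflux_spin[OF h v n] hflux_vflux_spin[OF h' v' n] Z' XAZ
        by (simp only:)
      then have spin: "hstrip_spin n lam \<nu>' + vstrip_spin n \<nu>' \<mu> = hstrip_spin n lam \<nu> + vstrip_spin n \<nu> \<mu>"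
        by linarith
      have "?f \<nu>' = - ?f \<nu>"
        unfolding hcoeff_vcoeff[OF h v n] hcoeff_vcoeff[OF h' v' n] spin sgn by simp
      then show ?thesis using g gg S' by simp
    qed
    have "(\<Sum>\<nu>\<in>S. ?f \<nu>) = (\<Sum>\<nu>\<in>S. - ?f \<nu>)"
      by (rule sum.reindex_bij_witness[of _ g g]) (use main in auto)
    then have "2 * (\<Sum>\<nu>\<in>S. ?f \<nu>) = 0" by (simp add: sum_negf)
    then show ?thesis by simp
  qed simp
  finally show ?thesis .
qed

section \<open>Cores\<close>

text \<open>A flux with arbitrary integer multiplicities: on every runner the two bead sets have the
  same renormalised number of beads. Unlike \<open>bead_flux\<close> this is an equivalence
  relation.\<close>

definition same_runners :: "nat \<Rightarrow> int_partition \<Rightarrow> int_partition \<Rightarrow> bool" where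
  "same_runners n lam \<mu> \<longleftrightarrow> (\<exists>f :: int \<Rightarrow> int. finite {y. f y \<noteq> 0} \<and>
     (\<forall>y. of_bool (bead lam y) - of_bool (bead \<mu> y) = f y - f (y + int n)))"

lemma same_runners_refl: "same_runners n lam lam"
  by (auto simp: same_runners_def intro!: exI[of _ "\<lambda>_. 0"])

lemma same_runners_sym: "same_runners n lam \<mu> \<Longrightarrow> same_runners n \<mu> lam"
  unfolding same_runners_def
proof (elim exE conjE)
  fix f :: "int \<Rightarrow> int"
  assume f: "finite {y. f y \<noteq> 0}" "\<forall>y. of_bool (bead lam y) - of_bool (bead \<mu> y) = f y - f (y + int n)"
  have "of_bool (bead \<mu> y) - of_bool (bead lam y) = - f y - - f (y + int n)" for y
    using f(2)[rule_format, of y] by linarith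
  then show "\<exists>f :: int \<Rightarrow> int. finite {y. f y \<noteq> 0} \<and>
      (\<forall>y. of_bool (bead \<mu> y) - of_bool (bead lam y) = f y - f (y + int n))"
    using f(1) by (intro exI[of _ "\<lambda>y. - f y"]) simp
qed

lemma same_runners_trans: "same_runners n lam \<mu> \<Longrightarrow> same_runners n \<mu> \<nu> \<Longrightarrow> same_runners n lam \<nu>"
  unfolding same_runners_def
proof (elim exE conjE)
  fix f g :: "int \<Rightarrow> int"
  assume f: "finite {y. f y \<noteq> 0}" "\<forall>y. of_bool (bead lam y) - of_bool (bead \<mu> y) = f y - f (y + int n)"
    and g: "finite {y. g y \<noteq> 0}" "\<forall>y. of_bool (bead \<mu> y) - of_bool (bead \<nu> y) = g y - g (y + int n)"
  have "of_bool (bead lam y) - of_bool (bead \<nu> y) = (f y + g y) - (f (y + int n) + g (y + int n))" for y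
    using f(2)[rule_format, of y] g(2)[rule_format, of y] by linarith
  moreover have "finite {y. f y + g y \<noteq> 0}"
    by (rule finite_subset[of _ "{y. f y \<noteq> 0} \<union> {y. g y \<noteq> 0}"]) (use f g in auto)
  ultimately show "\<exists>f :: int \<Rightarrow> int. finite {y. f y \<noteq> 0} \<and>
      (\<forall>y. of_bool (bead lam y) - of_bool (bead \<nu> y) = f y - f (y + int n))"
    by (intro exI[of _ "\<lambda>y. f y + g y"]) simp
qed

lemma bead_flux_same_runners: "bead_flux n lam \<mu> X \<Longrightarrow> same_runners n lam \<mu>"
  unfolding same_runners_def
  by (rule exI[of _ "\<lambda>y. of_bool (y \<in> X)"]) (auto simp: bead_flux_def)

definition is_core :: "nat \<Rightarrow> int_partition \<Rightarrow> bool" where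
  "is_core n \<kappa> \<longleftrightarrow> (\<forall>x. bead \<kappa> x \<longrightarrow> bead \<kappa> (x - int n))"

lemma is_core_iterate:
  assumes "is_core n \<kappa>" "bead \<kappa> x" shows "bead \<kappa> (x - int k * int n)"
proof (induction k)
  case (Suc k)
  then have "bead \<kappa> (x - int k * int n - int n)" using assms(1) by (simp add: is_core_def)
  then show ?case by (simp add: algebra_simps)
qed (use assms in simp)

text \<open>
  On each runner, the difference of the bead indicators of two cores has constant sign, so the
  finitely supported \<open>f\<close> of \<^const>\<open>same_runners\<close> is monotone there, hence zero.
\<close>

lemma core_le:
  assumes n: "n \<ge> 1" and core: "is_core n \<kappa>" "is_core n \<kappa>'" and same: "same_runners n \<kappa> \<kappa>'"
    and b: "bead \<kappa> y"
  shows "bead \<kappa>' y"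
proof (rule ccontr)
  assume nb: "\<not> bead \<kappa>' y"
  obtain f :: "int \<Rightarrow> int" where fin: "finite {y. f y \<noteq> 0}"
    and f: "\<And>y. of_bool (bead \<kappa> y) - of_bool (bead \<kappa>' y) = f y - f (y + int n)"
    using same by (auto simp: same_runners_def)
  have up: "f (y + int (Suc k) * int n) \<le> f (y + int n)" for k
  proof (induction k)
    case (Suc k)
    let ?x = "y + int (Suc k) * int n"
    have "\<not> bead \<kappa>' ?x" using is_core_iterate[OF core(2), of ?x "Suc k"] nb by auto
    then have "f (?x + int n) \<le> f ?x" using f[of ?x] by (simp add: of_bool_def split: if_splits)
    then show ?case using Suc by (simp add: algebra_simps)
  qed simp
  have down: "f y \<le> f (y - int k * int n)" for k
  proof (induction k)
    case (Suc k)
    let ?x = "y - int (Suc k) * int n"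
    have "bead \<kappa> ?x" by (rule is_core_iterate[OF core(1) b])
    then have "f (?x + int n) \<le> f ?x" using f[of ?x] by (simp add: of_bool_def split: if_splits)
    then show ?case using Suc by (simp add: algebra_simps)
  qed simp
  obtain k where "y + int n + int k * int n \<notin> {y. f y \<noteq> 0}" using not_mem_progression(1)[OF fin n] by blast
  then have "0 \<le> f (y + int n)" using up[of k] by (simp add: algebra_simps)
  moreover obtain k' where "y - int k' * int n \<notin> {y. f y \<noteq> 0}" using not_mem_progression(2)[OF fin n] by blast
  then have "f y \<le> 0" using down[of k'] by simp
  ultimately show False using f[of y] b nb by simp
qed

lemma core_unique:
  assumes "n \<ge> 1" "is_core n \<kappa>" "is_core n \<kappa>'" "same_runners n \<kappa> \<kappa>'"
  shows "\<kappa> = \<kappa>'"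
  using core_le[OF assms] core_le[OF assms(1,3,2) same_runners_sym[OF assms(4)]]
  by (intro eq_of_bead) blast

text \<open>A removable ribbon is a horizontal strip with a single ribbon.\<close>

lemma removes_ribbon_same_runners:
  assumes r: "removes_ribbon n lam \<kappa>" and n: "n \<ge> 1"
  shows "same_runners n lam \<kappa>"
proof -
  let ?R = "diagram lam - diagram \<kappa>"
  have R: "ribbon n ?R" and sub: "diagram \<kappa> \<subseteq> diagram lam" using r by (auto simp: removes_ribbon_def)
  obtain x \<rho> where x: "?R = ribbon_set n x \<rho>" "ribbon_rows n x \<rho>" using ribbon_obtain_rows[OF R n] .
  obtain i j where ij: "box (\<rho> (x - 1)) (x - 1) = (i, j)" by fastforce
  have tr: "top_right_box ?R (i, j)" using top_right_box_ribbon_set[OF x(2) n] x(1) ij by simp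
  \<comment> \<open>Otherwise the box above the top right box would itself belong to the
    ribbon.\<close>
  have "i = 0 \<or> (i - 1, j) \<in> diagram \<kappa>"
  proof (rule ccontr)
    assume *: "\<not> ?thesis"
    have "(i, j) \<in> diagram lam" using tr by (auto simp: top_right_box_def)
    then have "(i - 1, j) \<in> ?R" using * part_antimono[of "i - 1" i lam] by (auto simp: diagram_def)
    then have "i \<le> i - 1" using tr by (force simp: top_right_box_def)
    then show False using * by (cases i) auto
  qed
  then have "hstrip_decomp n (diagram lam) (diagram \<kappa>) {?R}"
    using R sub tr by (auto simp: hstrip_decomp_def)
  then obtain X where "hflux n lam \<kappa> X" using hstrip_decomp_hflux[OF _ n] by metis
  then show ?thesis by (auto simp: hflux_def intro: bead_flux_same_runners)
qed

lemma removes_ribbon_of_not_core: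
  assumes "\<not> is_core n lam" and n: "n \<ge> 1"
  shows "\<exists>\<kappa>. removes_ribbon n lam \<kappa>"
proof -
  obtain x where x: "bead lam x" "\<not> bead lam (x - int n)" using assms by (auto simp: is_core_def)
  obtain \<kappa> where \<kappa>: "\<And>y. bead \<kappa> y \<longleftrightarrow> y = x - int n \<or> bead lam y \<and> y \<noteq> x"
    using move_bead_obtain[OF x] by metis
  have "hflux n lam \<kappa> {x}"
    using \<kappa> x n by (auto simp: hflux_def bead_flux_def)
  from hflux_hstrip_decomp[OF this n] have "diagram \<kappa> \<subseteq> diagram lam" "ribbon n (diagram lam - diagram \<kappa>)"
    by (auto simp: hstrip_decomp_def)
  then show ?thesis by (auto simp: removes_ribbon_def)
qed

lemma removes_ribbon_rtranclp:
  assumes "(removes_ribbon n)\<^sup>*\<^sup>* lam \<kappa>" "n \<ge> 1"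
  shows "same_runners n lam \<kappa>" "diagram \<kappa> \<subseteq> diagram lam"
  using assms(1)
proof (induction rule: rtranclp_induct)
  case (step y z)
  {
    case 1 show ?case using step removes_ribbon_same_runners[OF step(2) assms(2)] same_runners_trans by blast
    case 2 show ?case using step by (auto simp: removes_ribbon_def)
  }
qed (auto intro: same_runners_refl)

lemma reaches_core:
  assumes "n \<ge> 1" shows "\<exists>\<kappa>. (removes_ribbon n)\<^sup>*\<^sup>* lam \<kappa> \<and> is_core n \<kappa>"
proof (induction "card (diagram lam)" arbitrary: lam rule: less_induct)
  case less
  show ?case
  proof (cases "is_core n lam")
    case False
    then obtain \<mu> where \<mu>: "removes_ribbon n lam \<mu>" using removes_ribbon_of_not_core[OF _ assms] by blast
    then have "diagram \<mu> \<subseteq> diagram lam" "card (diagram lam - diagram \<mu>) = n"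
      by (auto simp: removes_ribbon_def ribbon_def)
    then have "diagram \<mu> \<subset> diagram lam" using assms by auto
    then have "card (diagram \<mu>) < card (diagram lam)" by (intro psubset_card_mono finite_diagram)
    then obtain \<kappa> where "(removes_ribbon n)\<^sup>*\<^sup>* \<mu> \<kappa>" "is_core n \<kappa>" using less by blast
    then show ?thesis using \<mu> by (meson converse_rtranclp_into_rtranclp)
  qed blast
qed

text \<open>Every partition reachable from \<open>lam\<close> reaches some core with the same runner
  counts, and by \<open>core_unique\<close> this core is \<open>\<kappa>\<close>. Hence
  \<open>\<kappa>\<close> is contained in all of them.\<close>

lemma n_core_eqI:
  assumes n: "n \<ge> 1" and core: "is_core n \<kappa>" and same: "same_runners n lam \<kappa>"
  shows "n_core n lam = \<kappa>"
  unfolding n_core_def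
proof (rule the_equality)
  have reach: "(removes_ribbon n)\<^sup>*\<^sup>* \<nu> \<kappa>" if "same_runners n lam \<nu>" for \<nu>
  proof -
    obtain \<kappa>' where \<kappa>': "(removes_ribbon n)\<^sup>*\<^sup>* \<nu> \<kappa>'" "is_core n \<kappa>'" using reaches_core[OF n] by blast
    have "same_runners n \<kappa>' \<kappa>"
      using removes_ribbon_rtranclp(1)[OF \<kappa>'(1) n] that same same_runners_sym same_runners_trans by blast
    then show ?thesis using core_unique[OF n \<kappa>'(2) core] \<kappa>'(1) by simp
  qed
  have r: "(removes_ribbon n)\<^sup>*\<^sup>* lam \<kappa>" by (rule reach[OF same_runners_refl])
  have l: "\<forall>\<nu>. (removes_ribbon n)\<^sup>*\<^sup>* lam \<nu> \<longrightarrow> diagram \<kappa> \<subseteq> diagram \<nu>"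
    using reach removes_ribbon_rtranclp[OF _ n] by blast
  show "(removes_ribbon n)\<^sup>*\<^sup>* lam \<kappa> \<and> (\<forall>\<nu>. (removes_ribbon n)\<^sup>*\<^sup>* lam \<nu> \<longrightarrow> diagram \<kappa> \<subseteq> diagram \<nu>)"
    using r l by simp
  show "\<kappa>' = \<kappa>" if "(removes_ribbon n)\<^sup>*\<^sup>* lam \<kappa>' \<and> (\<forall>\<nu>. (removes_ribbon n)\<^sup>*\<^sup>* lam \<nu> \<longrightarrow> diagram \<kappa>' \<subseteq> diagram \<nu>)" for \<kappa>'
    using that r l diagram_inject[of \<kappa>' \<kappa>] by blast
qed

lemma n_core_eq_of_same_runners:
  assumes "n \<ge> 1" "same_runners n lam \<mu>"
  shows "n_core n lam = n_core n \<mu>"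
proof -
  obtain \<kappa> where \<kappa>: "(removes_ribbon n)\<^sup>*\<^sup>* \<mu> \<kappa>" "is_core n \<kappa>" using reaches_core[OF assms(1)] by blast
  have "same_runners n \<mu> \<kappa>" using removes_ribbon_rtranclp(1)[OF \<kappa>(1) assms(1)] .
  then show ?thesis
    using n_core_eqI[OF assms(1) \<kappa>(2)] same_runners_trans[OF assms(2)] by metis
qed

lemma super_ribbon_tableau_same_runners:
  assumes n: "n \<ge> 1" and T: "super_ribbon_tableau n r lam \<mu> T"
  shows "same_runners n lam \<mu>"
proof -
  have "same_runners n (T ! 0) (T ! (2 * i))" if "i \<le> r" for i
    using that
  proof (induction i)
    case (Suc i)
    then have "horizontal_strip n (T ! (2 * i)) (T ! (2 * i + 1))" "vertical_strip n (T ! (2 * i + 1)) (T ! (2 * i + 2))"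
      using T by (auto simp: super_ribbon_tableau_def)
    then have "same_runners n (T ! (2 * i)) (T ! (2 * i + 1))" "same_runners n (T ! (2 * i + 1)) (T ! (2 * i + 2))"
      using horizontal_strip_iff[OF n] vertical_strip_iff[OF n]
      by (auto simp: hflux_def vflux_def dest: bead_flux_same_runners)
    then show ?case using Suc same_runners_trans by (metis Suc_leD add_2_eq_Suc' mult_Suc_right add.commute)
  qed (simp add: same_runners_refl)
  then show ?thesis using T by (auto simp: super_ribbon_tableau_def)
qed

section \<open>Linear maps between free vector spaces\<close>

text \<open>\<open>scale_wedge\<close> over an arbitrary index type: pairs, triples, sequences and
  partitions all serve as bases.\<close>

definition scl :: "complex \<Rightarrow> ('a \<Rightarrow>\<^sub>0 complex) \<Rightarrow> ('a \<Rightarrow>\<^sub>0 complex)" where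
  "scl c x = Poly_Mapping.map ((*) c) x"

lemma lookup_scl [simp]: "Poly_Mapping.lookup (scl c x) i = c * Poly_Mapping.lookup x i"
  by (simp add: scl_def Poly_Mapping.map.rep_eq when_def)

interpretation scl: vector_space scl
  by unfold_locales (auto intro!: poly_mapping_eqI simp: lookup_add algebra_simps)

lemma scale_wedge_eq: "scale_wedge = scl"
  by (intro ext) (simp add: scale_wedge_def scl_def)

abbreviation basis :: "'a \<Rightarrow> ('a \<Rightarrow>\<^sub>0 complex)" where
  "basis i \<equiv> Poly_Mapping.single i 1"

lemma scl_single [simp]: "scl c (Poly_Mapping.single i d) = Poly_Mapping.single i (c * d)"
  by (rule poly_mapping_eqI) (simp add: lookup_single when_def)

lemma keys_scl: "Poly_Mapping.keys (scl c x) \<subseteq> Poly_Mapping.keys x"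
  by (auto simp: in_keys_iff)

lemma poly_mapping_basis_sum:
  assumes "finite S" "Poly_Mapping.keys x \<subseteq> S"
  shows "x = (\<Sum>i\<in>S. scl (Poly_Mapping.lookup x i) (basis i))"
proof (rule poly_mapping_eqI)
  fix k
  show "Poly_Mapping.lookup x k = Poly_Mapping.lookup (\<Sum>i\<in>S. scl (Poly_Mapping.lookup x i) (basis i)) k"
    using assms by (cases "k \<in> S") (auto simp: lookup_sum lookup_single when_def in_keys_iff sum.delta)
qed

definition lin :: "(('a \<Rightarrow>\<^sub>0 complex) \<Rightarrow> ('b \<Rightarrow>\<^sub>0 complex)) \<Rightarrow> bool" where
  "lin f \<longleftrightarrow> (\<forall>x y. f (x + y) = f x + f y) \<and> (\<forall>c x. f (scl c x) = scl c (f x))"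

lemma lin_add: "lin f \<Longrightarrow> f (x + y) = f x + f y"
  and lin_scl: "lin f \<Longrightarrow> f (scl c x) = scl c (f x)"
  by (simp_all add: lin_def)

lemma lin_0: "lin f \<Longrightarrow> f 0 = 0"
  using lin_scl[of f 0 0] by simp

lemma lin_uminus: "lin f \<Longrightarrow> f (- x) = - f x"
  using lin_scl[of f "- 1" x] by simp

lemma lin_diff: "lin f \<Longrightarrow> f (x - y) = f x - f y"
  using lin_add[of f x "- y"] by (simp add: lin_uminus)

lemma lin_sum: "lin f \<Longrightarrow> f (\<Sum>i\<in>S. g i) = (\<Sum>i\<in>S. f (g i))"
  by (induction S rule: infinite_finite_induct) (auto simp: lin_0 lin_add)

lemma lin_id: "lin (\<lambda>x. x)"
  by (simp add: lin_def)

lemma lin_zero: "lin (\<lambda>x. 0)"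
  by (simp add: lin_def)

lemma lin_comp: "lin f \<Longrightarrow> lin g \<Longrightarrow> lin (\<lambda>x. f (g x))"
  by (simp add: lin_def)

lemma lin_plus: "lin f \<Longrightarrow> lin g \<Longrightarrow> lin (\<lambda>x. f x + g x)"
  by (simp add: lin_def scl.scale_right_distrib)

lemma lin_minus: "lin f \<Longrightarrow> lin g \<Longrightarrow> lin (\<lambda>x. f x - g x)"
  by (simp add: lin_def scl.scale_right_diff_distrib)

lemma lin_neg: "lin f \<Longrightarrow> lin (\<lambda>x. - f x)"
  by (simp add: lin_def)

lemma lin_scale: "lin f \<Longrightarrow> lin (\<lambda>x. scl c (f x))"
  by (simp add: lin_def scl.scale_right_distrib mult.commute)

lemma lin_sum_op: "(\<And>i. i \<in> S \<Longrightarrow> lin (f i)) \<Longrightarrow> lin (\<lambda>x. \<Sum>i\<in>S. f i x)"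
  by (induction S rule: infinite_finite_induct) (auto simp: lin_zero intro!: lin_plus)

lemmas lin_intros = lin_id lin_zero lin_plus lin_minus lin_neg lin_scale lin_sum_op

lemma lin_expand:
  assumes "lin f"
  shows "f x = (\<Sum>i\<in>Poly_Mapping.keys x. scl (Poly_Mapping.lookup x i) (f (basis i)))"
proof -
  have "f x = f (\<Sum>i\<in>Poly_Mapping.keys x. scl (Poly_Mapping.lookup x i) (basis i))"
    by (rule arg_cong[of _ _ f]) (rule poly_mapping_basis_sum[OF finite_keys order_refl])
  also have "\<dots> = (\<Sum>i\<in>Poly_Mapping.keys x. scl (Poly_Mapping.lookup x i) (f (basis i)))"
    by (simp only: lin_sum[OF assms] lin_scl[OF assms])
  finally show ?thesis .
qed

lemma lin_eqI: "lin f \<Longrightarrow> lin g \<Longrightarrow> (\<And>i. f (basis i) = g (basis i)) \<Longrightarrow> f x = g x"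
proof -
  assume f: "lin f" and g: "lin g" and eq: "\<And>i. f (basis i) = g (basis i)"
  show "f x = g x" unfolding lin_expand[OF f, of x] lin_expand[OF g, of x] eq ..
qed

definition extend :: "('a \<Rightarrow> ('b \<Rightarrow>\<^sub>0 complex)) \<Rightarrow> ('a \<Rightarrow>\<^sub>0 complex) \<Rightarrow> ('b \<Rightarrow>\<^sub>0 complex)" where
  "extend f x = (\<Sum>i\<in>Poly_Mapping.keys x. scl (Poly_Mapping.lookup x i) (f i))"

lemma extend_superset:
  assumes "finite S" "Poly_Mapping.keys x \<subseteq> S"
  shows "extend f x = (\<Sum>i\<in>S. scl (Poly_Mapping.lookup x i) (f i))"
  unfolding extend_def by (rule sum.mono_neutral_left) (use assms in \<open>auto simp: in_keys_iff\<close>)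

lemma lin_extend: "lin (extend f)"
  unfolding lin_def
proof (intro conjI allI)
  fix x y :: "'a \<Rightarrow>\<^sub>0 complex" and c
  let ?S = "Poly_Mapping.keys x \<union> Poly_Mapping.keys y"
  show "extend f (x + y) = extend f x + extend f y"
    using extend_superset[of ?S x f] extend_superset[of ?S y f] extend_superset[of ?S "x + y" f]
      Poly_Mapping.keys_add[of x y]
    by (simp add: lookup_add scl.scale_left_distrib sum.distrib)
  show "extend f (scl c x) = scl c (extend f x)"
    using extend_superset[OF finite_keys keys_scl, of f c x]
    by (simp add: extend_def scl.scale_sum_right)
qed

lemma extend_basis [simp]: "extend f (basis i) = f i"
  by (simp add: extend_def)

text \<open>Exchange of finite sums; it yields the commutation of Hecke operators at disjoint
  places.\<close>

lemma extend_swap: "extend (\<lambda>i. extend (f i) y) x = extend (\<lambda>j. extend (\<lambda>i. f i j) x) y"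
  unfolding extend_def scl.scale_sum_right
  by (subst sum.swap) (simp add: mult.commute)

definition emb :: "('a \<Rightarrow> 'b) \<Rightarrow> ('a \<Rightarrow>\<^sub>0 complex) \<Rightarrow> ('b \<Rightarrow>\<^sub>0 complex)" where
  "emb g = extend (\<lambda>i. basis (g i))"

lemma lin_emb: "lin (emb g)"
  by (simp add: emb_def lin_extend)

lemma lin_emb_comp: "lin f \<Longrightarrow> lin (\<lambda>x. emb g (f x))"
  by (rule lin_comp[OF lin_emb])

lemma emb_basis [simp]: "emb g (basis i) = basis (g i)"
  by (simp add: emb_def)

lemma emb_single [simp]: "emb g (Poly_Mapping.single i c) = Poly_Mapping.single (g i) c"
  using lin_scl[OF lin_emb, of g c "basis i"] by simp

lemma emb_emb: "emb g (emb h x) = emb (\<lambda>i. g (h i)) x"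
proof -
  have "lin (\<lambda>x. emb g (emb h x))" by (rule lin_comp[OF lin_emb lin_emb])
  from lin_eqI[OF this lin_emb] show ?thesis by simp
qed

lemma emb_id: "emb (\<lambda>i. i) x = x"
  by (rule lin_eqI[OF lin_emb lin_id]) simp

lemma emb_eq_0:
  assumes "\<And>i. h (g i) = i" shows "emb g x = 0 \<longleftrightarrow> x = 0"
proof
  assume "emb g x = 0"
  then have "emb h (emb g x) = emb h 0" by simp
  then show "x = 0" by (simp add: emb_emb assms emb_id lin_0[OF lin_emb])
qed (simp add: lin_0[OF lin_emb])

lemmas emb_simps = lin_add[OF lin_emb] lin_diff[OF lin_emb] lin_scl[OF lin_emb] lin_sum[OF lin_emb]
  lin_0[OF lin_emb] lin_uminus[OF lin_emb]

section \<open>The Hecke operators\<close>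

lemma periodic_mod:
  fixes N :: int
  assumes "\<And>x. P (x + N) \<longleftrightarrow> P x"
  shows "P x \<longleftrightarrow> P (x mod N)"
proof -
  have nat: "P (y + int k * N) \<longleftrightarrow> P y" for y k
  proof (induction k)
    case (Suc k)
    have "y + int (Suc k) * N = (y + int k * N) + N" by (simp add: algebra_simps)
    then show ?case using assms Suc by metis
  qed simp
  have "P (y + z * N) \<longleftrightarrow> P y" for y z
  proof (cases "z \<ge> 0")
    case True
    then show ?thesis using nat[of y "nat z"] by simp
  next
    case False
    then show ?thesis using nat[of "y + z * N" "nat (- z)"] by (simp add: algebra_simps)
  qed
  from this[of "x mod N" "x div N"] show ?thesis by (simp add: mult.commute)
qed

section \<open>The Hecke operator on two tensor factors\<close>

locale fock =
  fixes n :: nat and q :: complex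
  assumes n: "n \<ge> 1" and q0: "q \<noteq> 0" and not_root: "\<And>m::nat. m \<ge> 1 \<Longrightarrow> q ^ m \<noteq> 1"
begin

abbreviation N :: int where "N \<equiv> int n"
abbreviation v :: complex where "v \<equiv> q\<^sup>2"

lemma N_pos: "N > 0" using n by simp

text \<open>\<open>1 + v \<noteq> 0\<close> comes from \<open>q ^ 4 \<noteq> 1\<close>. It keeps the
  eigenvalues \<open>v\<close> and \<open>- 1\<close> of a Hecke operator distinct, so that
  \<open>T + 1\<close> reaches the tensors with two equal factors.\<close>

lemma v_facts: "v \<noteq> 0" "v \<noteq> 1" "1 + v \<noteq> 0" "v + 1 \<noteq> 0"
proof -
  show "v \<noteq> 0" "v \<noteq> 1" using q0 not_root[of 2] by auto
  have "q ^ 4 \<noteq> 1" using not_root[of 4] by simp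
  then have "v * v \<noteq> 1" by (simp add: power2_eq_square numeral_eq_Suc mult.assoc)
  then show "1 + v \<noteq> 0" "v + 1 \<noteq> 0" by (metis add.commute add_eq_0_iff mult_minus_left mult_1 minus_minus)+
qed

text \<open>
  Identifying \<open>u\<^sub>l\<close>, \<open>l = a + n s\<close>, \<open>0 \<le> a < n\<close>, with the \<open>a\<close>-th unit vector times \<open>X ^ s\<close>, this is the
  Demazure-Lusztig operator on two tensor factors that restricts to the usual \<open>R\<close>-matrix when both
  exponents vanish.
\<close>

definition hecke_pair :: "int \<Rightarrow> int \<Rightarrow> (int \<times> int) \<Rightarrow>\<^sub>0 complex" where
  "hecke_pair l p = scl (if (p - l) mod N = 0 then v else q) (basis (p, l))
     + scl (v - 1) (\<Sum>k<nat ((l - p + N - 1) div N). basis (l - N * int k, p + N * int k))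
     - scl (v - 1) (\<Sum>k<nat ((p - l) div N).
         basis (p - N * int k - (p - l) mod N, l + N * int k + (p - l) mod N))"

text \<open>\<open>(l - p + N - 1) div N\<close> is the ceiling of \<open>(l - p) / N\<close>; for
  \<open>p < l\<close> it is the number of \<open>k\<close> with \<open>l - N k > p\<close>. For a
  gap below \<open>N\<close> at most the term \<open>k = 0\<close> of the first sum remains.\<close>

lemma hecke_pair_close:
  assumes "\<bar>l - p\<bar> < N"
  shows "hecke_pair l p = scl (if l = p then v else q) (basis (p, l)) + scl (if p < l then v - 1 else 0) (basis (l, p))"
proof -
  have K2: "nat ((p - l) div N) = 0"
    using assms N_pos by (cases "p \<ge> l") (auto simp: pos_imp_zdiv_neg_iff order_less_imp_le)
  have m: "(p - l) mod N = 0 \<longleftrightarrow> l = p"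
  proof
    assume "(p - l) mod N = 0"
    then have "N dvd p - l" by auto
    then show "l = p" using assms zdvd_imp_le[of N "p - l"] zdvd_imp_le[of N "l - p"] dvd_diff_commute[of N p l]
      by (cases p l rule: linorder_cases) auto
  qed simp
  show ?thesis
  proof (cases "p < l")
    case True
    have "(l - p + N - 1) div N = (l - p - 1) div N + 1"
      using div_add_self2[of N "l - p - 1"] N_pos by (simp add: algebra_simps)
    also have "(l - p - 1) div N = 0" using True assms by (intro div_pos_pos_trivial) auto
    finally show ?thesis using True K2 m by (simp add: hecke_pair_def)
  next
    case False
    have "(l - p + N - 1) div N = 0" using False assms by (intro div_pos_pos_trivial) auto
    then show ?thesis using False K2 m by (simp add: hecke_pair_def)
  qed
qed

lemma hecke_pair_shift_both: "hecke_pair (l + N) (p + N) = emb (\<lambda>(a, b). (a + N, b + N)) (hecke_pair l p)"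
  by (simp add: hecke_pair_def emb_simps algebra_simps)

text \<open>The Bernstein relation \<open>T X2 = X1 T - (v - 1) X1\<close>. Raising \<open>p\<close>
  by \<open>N\<close> either drops the term \<open>k = 0\<close> of the first sum or appends a last
  term to the second one.\<close>

lemma hecke_pair_shift_right:
  "hecke_pair l (p + N) = emb (\<lambda>(a, b). (a + N, b)) (hecke_pair l p) - scl (v - 1) (basis (l + N, p))"
proof -
  have i: "(p + N - l) mod N = (p - l) mod N"
    using mod_add_self2[of "p - l" N] by (simp add: algebra_simps)
  have d2: "(p + N - l) div N = (p - l) div N + 1"
    using div_add_self2[of N "p - l"] N_pos by (simp add: algebra_simps)
  have d1: "(l - p + N - 1) div N = (l - p - 1) div N + 1"
    using div_add_self2[of N "l - p - 1"] N_pos by (simp add: algebra_simps)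
  have d1': "(l - (p + N) + N - 1) div N = (l - p - 1) div N" by simp
  show ?thesis
  proof (cases "p < l")
    case True
    then have "(l - p - 1) div N \<ge> 0" using N_pos by (simp add: pos_imp_zdiv_nonneg_iff)
    then have K1: "nat ((l - p + N - 1) div N) = Suc (nat ((l - (p + N) + N - 1) div N))"
      unfolding d1 d1' by simp
    have "(p - l) div N < 0" using True N_pos by (simp add: pos_imp_zdiv_neg_iff)
    then have K2: "nat ((p - l) div N) = 0" "nat ((p + N - l) div N) = 0" unfolding d2 by simp_all
    show ?thesis
      unfolding hecke_pair_def K1 K2 i sum.lessThan_Suc_shift
      by (simp add: emb_simps algebra_simps scl.scale_right_distrib)
  next
    case False
    then have "(l - p - 1) div N < 0" using N_pos by (simp add: pos_imp_zdiv_neg_iff)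
    then have K1: "nat ((l - p + N - 1) div N) = 0" "nat ((l - (p + N) + N - 1) div N) = 0"
      unfolding d1 d1' by simp_all
    have "(p - l) div N \<ge> 0" using False N_pos by (simp add: pos_imp_zdiv_nonneg_iff)
    then have K2: "nat ((p + N - l) div N) = Suc (nat ((p - l) div N))" unfolding d2 by simp
    have "int (nat ((p - l) div N)) = (p - l) div N" using \<open>(p - l) div N \<ge> 0\<close> by simp
    then have last: "p + N - N * int (nat ((p - l) div N)) - (p - l) mod N = l + N"
      "l + N * int (nat ((p - l) div N)) + (p - l) mod N = p"
      using mult_div_mod_eq[of N "p - l"] by (simp_all only:)
    show ?thesis
      unfolding hecke_pair_def K1 K2 i sum.lessThan_Suc last
      by (simp add: emb_simps algebra_simps scl.scale_right_distrib)
  qed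
qed

definition hecke2 :: "((int \<times> int) \<Rightarrow>\<^sub>0 complex) \<Rightarrow> ((int \<times> int) \<Rightarrow>\<^sub>0 complex)" where
  "hecke2 = extend (\<lambda>(l, p). hecke_pair l p)"

lemma lin_hecke2: "lin hecke2" by (simp add: hecke2_def lin_extend)

lemma lin_hecke2_comp: "lin f \<Longrightarrow> lin (\<lambda>x. hecke2 (f x))"
  by (rule lin_comp[OF lin_hecke2])

lemmas hecke2_simps = lin_add[OF lin_hecke2] lin_diff[OF lin_hecke2] lin_scl[OF lin_hecke2] lin_sum[OF lin_hecke2]
  lin_0[OF lin_hecke2] lin_uminus[OF lin_hecke2]

lemma hecke2_basis [simp]: "hecke2 (basis (l, p)) = hecke_pair l p"
  by (simp add: hecke2_def)

lemma hecke2_single [simp]: "hecke2 (Poly_Mapping.single (l, p) c) = scl c (hecke_pair l p)"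
  using lin_scl[OF lin_hecke2, of c "basis (l, p)"] by simp

abbreviation "sh1 \<equiv> emb (\<lambda>(a, b). (a + N, b :: int))"
abbreviation "sh2 \<equiv> emb (\<lambda>(a :: int, b). (a, b + N))"
abbreviation "sh12 \<equiv> emb (\<lambda>(a, b). (a + N, b + N))"

lemma hecke2_sh2: "hecke2 (sh2 x) = sh1 (hecke2 x) - scl (v - 1) (sh1 x)"
  by (rule lin_eqI[where f = "\<lambda>x. hecke2 (sh2 x)" and g = "\<lambda>x. sh1 (hecke2 x) - scl (v - 1) (sh1 x)"]) (auto intro!: lin_intros lin_hecke2_comp lin_emb_comp simp: hecke_pair_shift_right)

lemma hecke2_sh12: "hecke2 (sh12 x) = sh12 (hecke2 x)"
  by (rule lin_eqI[where f = "\<lambda>x. hecke2 (sh12 x)" and g = "\<lambda>x. sh12 (hecke2 x)"]) (auto intro!: lin_intros lin_hecke2_comp lin_emb_comp simp: hecke_pair_shift_both)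

lemma sh12_eq: "sh12 x = sh1 (sh2 x)" "sh12 x = sh2 (sh1 x)"
  by (simp_all add: emb_emb case_prod_unfold)

lemma sh_inj: "sh1 x = 0 \<longleftrightarrow> x = 0" "sh2 x = 0 \<longleftrightarrow> x = 0" "sh12 x = 0 \<longleftrightarrow> x = 0"
proof -
  show "sh1 x = 0 \<longleftrightarrow> x = 0" by (rule emb_eq_0[of "\<lambda>(a, b). (a - N, b)"]) (simp add: case_prod_unfold)
  show "sh2 x = 0 \<longleftrightarrow> x = 0" by (rule emb_eq_0[of "\<lambda>(a, b). (a, b - N)"]) (simp add: case_prod_unfold)
  show "sh12 x = 0 \<longleftrightarrow> x = 0" by (rule emb_eq_0[of "\<lambda>(a, b). (a - N, b - N)"]) (simp add: case_prod_unfold)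
qed

text \<open>The second Bernstein relation follows from the first, because the simultaneous shift of
  both factors commutes with the operator.\<close>

lemma hecke2_sh1: "hecke2 (sh1 x) = sh2 (hecke2 x) + scl (v - 1) (sh1 x)"
proof -
  have "x = sh2 (emb (\<lambda>(a, b). (a, b - N)) x)" by (simp add: emb_emb case_prod_unfold emb_id)
  then obtain y where x: "x = sh2 y" ..
  have "hecke2 (sh1 x) = sh2 (sh1 (hecke2 y))"
    unfolding x sh12_eq(1)[symmetric] hecke2_sh12 by (rule sh12_eq(2))
  also have "sh1 (hecke2 y) = hecke2 x + scl (v - 1) (sh1 y)"
    unfolding x hecke2_sh2 by simp
  also have "sh2 \<dots> = sh2 (hecke2 x) + scl (v - 1) (sh2 (sh1 y))"
    by (simp only: emb_simps(1,3))
  also have "sh2 (sh1 y) = sh1 x"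
    unfolding x by (simp only: sh12_eq[symmetric])
  finally show ?thesis .
qed

text \<open>The defect \<open>Q\<close> of the relation commutes with \<open>sh2\<close> and
  \<open>sh12\<close>, so it vanishes everywhere once it vanishes on pairs of residues, where
  \<open>hecke_pair_close\<close> applies.\<close>

lemma hecke2_quadratic: "hecke2 (hecke2 x) = scl (v - 1) (hecke2 x) + scl v x"
proof -
  define Q where "Q x = hecke2 (hecke2 x) - scl (v - 1) (hecke2 x) - scl v x" for x
  have linQ: "lin Q" unfolding Q_def by (intro lin_intros lin_hecke2_comp)
  have Q2: "Q (sh2 x) = sh2 (Q x)" for x
    unfolding Q_def hecke2_sh2 hecke2_simps hecke2_sh1 emb_simps
    by (rule poly_mapping_eqI) (simp add: lookup_add lookup_minus ring_distribs)
  have Q12: "Q (sh12 x) = sh12 (Q x)" for x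
    unfolding Q_def hecke2_sh12 emb_simps ..
  have base: "Q (basis (l, p)) = 0" if "\<bar>l - p\<bar> < N" for l p
  proof -
    have "\<bar>p - l\<bar> < N" using that by simp
    then show ?thesis
      using that unfolding Q_def
      by (cases l p rule: linorder_cases; intro poly_mapping_eqI)
        (simp_all add: hecke_pair_close hecke2_simps emb_simps single_add[symmetric] lookup_add lookup_minus
          lookup_single ring_distribs power2_eq_square when_def)
  qed
  have s2: "Q (basis (l, p + N)) = 0 \<longleftrightarrow> Q (basis (l, p)) = 0" for l p
    using Q2[of "basis (l, p)"] sh_inj(2) by simp
  have s12: "Q (basis (l + N, p + N)) = 0 \<longleftrightarrow> Q (basis (l, p)) = 0" for l p
    using Q12[of "basis (l, p)"] sh_inj(3) by simp
  have "Q (basis (l, p)) = 0" for l p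
  proof -
    have "Q (basis (l, p)) = 0 \<longleftrightarrow> Q (basis (l, p mod N)) = 0"
      by (rule periodic_mod) (rule s2)
    also have "\<dots> \<longleftrightarrow> Q (basis (l mod N, p mod N)) = 0"
      by (rule periodic_mod) (metis s2 s12)
    finally have "Q (basis (l, p)) = 0 \<longleftrightarrow> Q (basis (l mod N, p mod N)) = 0" .
    moreover have "\<bar>l mod N - p mod N\<bar> < N"
      using pos_mod_bound[OF N_pos, of l] pos_mod_sign[OF N_pos, of l]
        pos_mod_bound[OF N_pos, of p] pos_mod_sign[OF N_pos, of p] by linarith
    ultimately show ?thesis using base by blast
  qed
  then have "Q (basis i) = 0" for i by (cases i) simp
  then have "Q x = 0" by (rule lin_eqI[OF linQ lin_zero])
  then show ?thesis unfolding Q_def by (simp add: algebra_simps)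
qed

section \<open>Three tensor factors and the braid relation\<close>

definition hecke12 :: "((int \<times> int \<times> int) \<Rightarrow>\<^sub>0 complex) \<Rightarrow> ((int \<times> int \<times> int) \<Rightarrow>\<^sub>0 complex)" where
  "hecke12 = extend (\<lambda>(a, b, c). emb (\<lambda>(a', b'). (a', b', c)) (hecke_pair a b))"

definition hecke23 :: "((int \<times> int \<times> int) \<Rightarrow>\<^sub>0 complex) \<Rightarrow> ((int \<times> int \<times> int) \<Rightarrow>\<^sub>0 complex)" where
  "hecke23 = extend (\<lambda>(a, b, c). emb (\<lambda>(b', c'). (a, b', c')) (hecke_pair b c))"

lemma lin_hecke12: "lin hecke12" and lin_hecke23: "lin hecke23"
  by (simp_all add: hecke12_def hecke23_def lin_extend)

lemma lin_hecke12_comp: "lin f \<Longrightarrow> lin (\<lambda>x. hecke12 (f x))"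
  by (rule lin_comp[OF lin_hecke12])

lemma lin_hecke23_comp: "lin f \<Longrightarrow> lin (\<lambda>x. hecke23 (f x))"
  by (rule lin_comp[OF lin_hecke23])

lemmas hecke12_simps = lin_add[OF lin_hecke12] lin_diff[OF lin_hecke12] lin_scl[OF lin_hecke12]
lemmas hecke23_simps = lin_add[OF lin_hecke23] lin_diff[OF lin_hecke23] lin_scl[OF lin_hecke23]

lemma hecke12_single [simp]:
  "hecke12 (Poly_Mapping.single (a, b, c) k) = scl k (emb (\<lambda>(a', b'). (a', b', c)) (hecke_pair a b))"
  using lin_scl[OF lin_hecke12, of k "basis (a, b, c)"] by (simp add: hecke12_def)

lemma hecke23_single [simp]:
  "hecke23 (Poly_Mapping.single (a, b, c) k) = scl k (emb (\<lambda>(b', c'). (a, b', c')) (hecke_pair b c))"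
  using lin_scl[OF lin_hecke23, of k "basis (a, b, c)"] by (simp add: hecke23_def)

text \<open>The Bernstein relation for the inverse shift of the first factor. It has the same shape
  as the one for the shift of the second factor, so the outer translations can be treated alike in
  the braid relation.\<close>

lemma hecke_pair_shift_left_back:
  "hecke_pair (l - N) p = emb (\<lambda>(a, b). (a, b - N)) (hecke_pair l p) - scl (v - 1) (basis (l, p - N))"
proof -
  have "hecke_pair l p = sh2 (hecke_pair (l - N) p) + scl (v - 1) (basis (l, p))"
    using hecke2_sh1[of "basis (l - N, p)"] by simp
  then have "sh2 (hecke_pair (l - N) p) = hecke_pair l p - scl (v - 1) (basis (l, p))" by simp
  then have "emb (\<lambda>(a, b). (a, b - N)) (sh2 (hecke_pair (l - N) p)) =
      emb (\<lambda>(a, b). (a, b - N)) (hecke_pair l p - scl (v - 1) (basis (l, p)))" by simp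
  then show ?thesis by (simp add: emb_emb case_prod_unfold emb_id emb_simps)
qed

abbreviation "tr1 \<equiv> emb (\<lambda>(a, b :: int, c :: int). (a + N, b, c))"
abbreviation "tr2 \<equiv> emb (\<lambda>(a :: int, b, c :: int). (a, b + N, c))"
abbreviation "tr3 \<equiv> emb (\<lambda>(a :: int, b :: int, c). (a, b, c + N))"
abbreviation "bk1 \<equiv> emb (\<lambda>(a, b :: int, c :: int). (a - N, b, c))"
abbreviation "bk2 \<equiv> emb (\<lambda>(a :: int, b, c :: int). (a, b - N, c))"
abbreviation "bk3 \<equiv> emb (\<lambda>(a :: int, b :: int, c). (a, b, c - N))"
abbreviation "tr123 \<equiv> emb (\<lambda>(a, b, c). (a + N, b + N, c + N))"

lemma lin_eqI3:
  fixes f g :: "((int \<times> int \<times> int) \<Rightarrow>\<^sub>0 complex) \<Rightarrow> ('b \<Rightarrow>\<^sub>0 complex)"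
  assumes "lin f" "lin g" "\<And>a b c. f (basis (a, b, c)) = g (basis (a, b, c))"
  shows "f x = g x"
  by (rule lin_eqI[OF assms(1,2)]) (use assms(3) in \<open>metis surj_pair\<close>)

lemma hecke12_tr2: "hecke12 (tr2 x) = tr1 (hecke12 x) - scl (v - 1) (tr1 x)"
  by (rule lin_eqI3[where f = "\<lambda>x. hecke12 (tr2 x)" and g = "\<lambda>x. tr1 (hecke12 x) - scl (v - 1) (tr1 x)"])
    (auto intro!: lin_intros lin_hecke12_comp lin_emb_comp simp: hecke_pair_shift_right emb_simps emb_emb case_prod_unfold)

lemma hecke23_tr3: "hecke23 (tr3 x) = tr2 (hecke23 x) - scl (v - 1) (tr2 x)"
  by (rule lin_eqI3[where f = "\<lambda>x. hecke23 (tr3 x)" and g = "\<lambda>x. tr2 (hecke23 x) - scl (v - 1) (tr2 x)"])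
    (auto intro!: lin_intros lin_hecke23_comp lin_emb_comp simp: hecke_pair_shift_right emb_simps emb_emb case_prod_unfold)

lemma hecke12_tr3: "hecke12 (tr3 x) = tr3 (hecke12 x)"
  by (rule lin_eqI3[where f = "\<lambda>x. hecke12 (tr3 x)" and g = "\<lambda>x. tr3 (hecke12 x)"])
    (auto intro!: lin_intros lin_hecke12_comp lin_emb_comp simp: emb_emb case_prod_unfold)

lemma hecke23_tr1: "hecke23 (tr1 x) = tr1 (hecke23 x)"
  by (rule lin_eqI3[where f = "\<lambda>x. hecke23 (tr1 x)" and g = "\<lambda>x. tr1 (hecke23 x)"])
    (auto intro!: lin_intros lin_hecke23_comp lin_emb_comp simp: emb_emb case_prod_unfold)

lemma hecke12_bk1: "hecke12 (bk1 x) = bk2 (hecke12 x) - scl (v - 1) (bk2 x)"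
  by (rule lin_eqI3[where f = "\<lambda>x. hecke12 (bk1 x)" and g = "\<lambda>x. bk2 (hecke12 x) - scl (v - 1) (bk2 x)"])
    (auto intro!: lin_intros lin_hecke12_comp lin_emb_comp simp: hecke_pair_shift_left_back emb_simps emb_emb case_prod_unfold)

lemma hecke23_bk2: "hecke23 (bk2 x) = bk3 (hecke23 x) - scl (v - 1) (bk3 x)"
  by (rule lin_eqI3[where f = "\<lambda>x. hecke23 (bk2 x)" and g = "\<lambda>x. bk3 (hecke23 x) - scl (v - 1) (bk3 x)"])
    (auto intro!: lin_intros lin_hecke23_comp lin_emb_comp simp: hecke_pair_shift_left_back emb_simps emb_emb case_prod_unfold)

lemma hecke12_bk3: "hecke12 (bk3 x) = bk3 (hecke12 x)"
  by (rule lin_eqI3[where f = "\<lambda>x. hecke12 (bk3 x)" and g = "\<lambda>x. bk3 (hecke12 x)"])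
    (auto intro!: lin_intros lin_hecke12_comp lin_emb_comp simp: emb_emb case_prod_unfold)

lemma hecke23_bk1: "hecke23 (bk1 x) = bk1 (hecke23 x)"
  by (rule lin_eqI3[where f = "\<lambda>x. hecke23 (bk1 x)" and g = "\<lambda>x. bk1 (hecke23 x)"])
    (auto intro!: lin_intros lin_hecke23_comp lin_emb_comp simp: emb_emb case_prod_unfold)

lemma hecke12_tr123: "hecke12 (tr123 x) = tr123 (hecke12 x)"
  by (rule lin_eqI3[where f = "\<lambda>x. hecke12 (tr123 x)" and g = "\<lambda>x. tr123 (hecke12 x)"])
    (auto intro!: lin_intros lin_hecke12_comp lin_emb_comp simp: hecke_pair_shift_both emb_emb case_prod_unfold)

lemma hecke23_tr123: "hecke23 (tr123 x) = tr123 (hecke23 x)"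
  by (rule lin_eqI3[where f = "\<lambda>x. hecke23 (tr123 x)" and g = "\<lambda>x. tr123 (hecke23 x)"])
    (auto intro!: lin_intros lin_hecke23_comp lin_emb_comp simp: hecke_pair_shift_both emb_emb case_prod_unfold)

lemma hecke12_emb: "hecke12 (emb (\<lambda>(a, b). (a, b, c)) y) = emb (\<lambda>(a, b). (a, b, c)) (hecke2 y)"
  by (rule lin_eqI[where f = "\<lambda>y. hecke12 (emb (\<lambda>(a, b). (a, b, c)) y)" and g = "\<lambda>y. emb (\<lambda>(a, b). (a, b, c)) (hecke2 y)"])
    (auto intro!: lin_intros lin_hecke12_comp lin_hecke2_comp lin_emb_comp)

lemma hecke23_emb: "hecke23 (emb (\<lambda>(b, c). (a, b, c)) y) = emb (\<lambda>(b, c). (a, b, c)) (hecke2 y)"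
  by (rule lin_eqI[where f = "\<lambda>y. hecke23 (emb (\<lambda>(b, c). (a, b, c)) y)" and g = "\<lambda>y. emb (\<lambda>(b, c). (a, b, c)) (hecke2 y)"])
    (auto intro!: lin_intros lin_hecke23_comp lin_hecke2_comp lin_emb_comp)

lemma hecke23_emb_Pair: "hecke23 (emb (Pair a) y) = emb (Pair a) (hecke2 y)"
  using hecke23_emb[of a y] by simp

lemma hecke12_quadratic: "hecke12 (hecke12 x) = scl (v - 1) (hecke12 x) + scl v x"
  by (rule lin_eqI3[where f = "\<lambda>x. hecke12 (hecke12 x)" and g = "\<lambda>x. scl (v - 1) (hecke12 x) + scl v x"])
    (use hecke2_quadratic[of "basis (_, _)"] in \<open>auto intro!: lin_intros lin_hecke12_comp simp: hecke12_emb emb_simps\<close>)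

lemma hecke23_quadratic: "hecke23 (hecke23 x) = scl (v - 1) (hecke23 x) + scl v x"
  by (rule lin_eqI3[where f = "\<lambda>x. hecke23 (hecke23 x)" and g = "\<lambda>x. scl (v - 1) (hecke23 x) + scl v x"])
    (use hecke2_quadratic[of "basis (_, _)"] in \<open>auto intro!: lin_intros lin_hecke23_comp simp: hecke23_emb_Pair emb_simps\<close>)

lemma when_of_bool: "(a when P) = a * of_bool P" for a :: complex
  by (simp add: when_def)

text \<open>
  The defect of the braid relation commutes with translations up to a permutation of the factors,
  so it suffices to check the relation on residues, where only the finite \<open>R\<close>-matrix enters.
\<close>

lemma hecke_braid: "hecke12 (hecke23 (hecke12 x)) = hecke23 (hecke12 (hecke23 x))"
proof -
  define \<Delta> where "\<Delta> x = hecke12 (hecke23 (hecke12 x)) - hecke23 (hecke12 (hecke23 x))" for x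
  have lin\<Delta>: "lin \<Delta>" unfolding \<Delta>_def by (intro lin_intros lin_hecke12_comp lin_hecke23_comp)
  \<comment> \<open>The Bernstein relations carry the shift of the third factor through both words
    to the first factor; the correction terms cancel by the quadratic relation.\<close>
  have t3: "\<Delta> (tr3 x) = tr1 (\<Delta> x)" for x
    unfolding \<Delta>_def hecke12_tr3 hecke23_tr3 hecke12_simps hecke23_simps hecke12_tr2 hecke23_tr1
      hecke12_quadratic hecke23_quadratic emb_simps
    by (rule poly_mapping_eqI) (simp add: lookup_add lookup_minus algebra_simps)
  have b1: "\<Delta> (bk1 x) = bk3 (\<Delta> x)" for x
    unfolding \<Delta>_def hecke12_bk1 hecke23_bk1 hecke12_simps hecke23_simps hecke12_bk3 hecke23_bk2
      hecke12_quadratic hecke23_quadratic emb_simps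
    by (rule poly_mapping_eqI) (simp add: lookup_add lookup_minus algebra_simps)
  have t123: "\<Delta> (tr123 x) = tr123 (\<Delta> x)" for x
    unfolding \<Delta>_def hecke12_tr123 hecke23_tr123 emb_simps ..
  let ?Z = "\<lambda>a b c. \<Delta> (basis (a, b, c)) = 0"
  have z3: "?Z a b (c + N) \<longleftrightarrow> ?Z a b c" for a b c
    using t3[of "basis (a, b, c)"] emb_eq_0[of "\<lambda>(a, b, c). (a - N, b, c)" "\<lambda>(a, b, c). (a + N, b, c)" "\<Delta> (basis (a, b, c))"]
    by (simp add: case_prod_unfold)
  have z1: "?Z (a + N) b c \<longleftrightarrow> ?Z a b c" for a b c
    using b1[of "basis (a + N, b, c)"] emb_eq_0[of "\<lambda>(a, b, c). (a, b, c + N)" "\<lambda>(a, b, c). (a, b, c - N)" "\<Delta> (basis (a + N, b, c))"]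
    by (simp add: case_prod_unfold)
  have z123: "?Z (a + N) (b + N) (c + N) \<longleftrightarrow> ?Z a b c" for a b c
    using t123[of "basis (a, b, c)"]
      emb_eq_0[of "\<lambda>(a, b, c). (a - N, b - N, c - N)" "\<lambda>(a, b, c). (a + N, b + N, c + N)" "\<Delta> (basis (a, b, c))"]
    by (simp add: case_prod_unfold)
  \<comment> \<open>Invariance in the middle factor follows from the outer factors and the
    simultaneous translation.\<close>
  have z2: "?Z a (b + N) c \<longleftrightarrow> ?Z a b c" for a b c
    using z1 z3 z123 by blast
  have base: "?Z a b c" if "a \<in> {0..<N}" "b \<in> {0..<N}" "c \<in> {0..<N}" for a b c
  proof -
    have close: "\<bar>a - b\<bar> < N" "\<bar>b - a\<bar> < N" "\<bar>a - c\<bar> < N" "\<bar>c - a\<bar> < N" "\<bar>b - c\<bar> < N" "\<bar>c - b\<bar> < N" "\<bar>b - b\<bar> < N"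
      "\<bar>a - a\<bar> < N" "\<bar>c - c\<bar> < N"
      using that by auto
    have A: "hecke12 (Poly_Mapping.single (x, y, z) k) =
        (if x = y then Poly_Mapping.single (x, y, z) (v * k) else if x < y then Poly_Mapping.single (y, x, z) (q * k)
         else Poly_Mapping.single (y, x, z) (q * k) + Poly_Mapping.single (x, y, z) ((v - 1) * k))"
      if "\<bar>x - y\<bar> < N" for x y z k
      using hecke_pair_close[OF that] by (simp add: emb_simps scl.scale_right_distrib mult.commute)
    have B: "hecke23 (Poly_Mapping.single (z, x, y) k) =
        (if x = y then Poly_Mapping.single (z, x, y) (v * k) else if x < y then Poly_Mapping.single (z, y, x) (q * k)
         else Poly_Mapping.single (z, y, x) (q * k) + Poly_Mapping.single (z, x, y) ((v - 1) * k))"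
      if "\<bar>x - y\<bar> < N" for x y z k
      using hecke_pair_close[OF that] by (simp add: emb_simps scl.scale_right_distrib mult.commute)
    note AB = A[OF close(1)] A[OF close(2)] A[OF close(3)] A[OF close(4)] A[OF close(5)] A[OF close(6)]
      B[OF close(1)] B[OF close(2)] B[OF close(3)] B[OF close(4)] B[OF close(5)] B[OF close(6)]
      A[OF close(7)] B[OF close(7)] A[OF close(8)] B[OF close(8)] A[OF close(9)] B[OF close(9)]
      lin_add[OF lin_hecke12] lin_add[OF lin_hecke23]
    note lookups = lookup_add lookup_minus lookup_single when_of_bool lookup_zero
    \<comment> \<open>The thirteen weak orders of three residues.\<close>
    consider "a = c" "b = c"
      | "a = b" "b < c"
      | "a = c" "c < b"
      | "b = c" "a < c"
      | "a < b" "b < c"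
      | "a < c" "c < b"
      | "b = c" "c < a"
      | "a = c" "b < c"
      | "b < a" "a < c"
      | "a = b" "c < b"
      | "c < a" "a < b"
      | "b < c" "c < a"
      | "c < b" "b < a"
      by (cases a b rule: linorder_cases; cases b c rule: linorder_cases; cases a c rule: linorder_cases; simp)
    then show ?thesis
    proof cases
      case 1
      have "hecke12 (Poly_Mapping.single (c, c, c) k) = Poly_Mapping.single (c, c, c) (v * k)"
        "hecke23 (Poly_Mapping.single (c, c, c) k) = Poly_Mapping.single (c, c, c) (v * k)" for k
        using A[OF close(9), of c k] B[OF close(9), of c k] by (simp_all only: refl if_True)
      then show ?thesis by (simp only: \<Delta>_def 1 diff_self)
    next
      case 2
      then have F: "(b < c) = True" "(b = c) = False" "(c < b) = False" "(c = b) = False" by auto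
      show ?thesis by (simp only: 2(1) F AB refl simp_thms if_True if_False \<Delta>_def, rule poly_mapping_eqI, simp only: lookups, algebra)
    next
      case 3
      then have F: "(c < b) = True" "(c = b) = False" "(b < c) = False" "(b = c) = False" by auto
      show ?thesis by (simp only: 3(1) F AB refl simp_thms if_True if_False \<Delta>_def, rule poly_mapping_eqI, simp only: lookups, algebra)
    next
      case 4
      then have F: "(a < c) = True" "(a = c) = False" "(c < a) = False" "(c = a) = False" by auto
      show ?thesis by (simp only: 4(1) F AB refl simp_thms if_True if_False \<Delta>_def, rule poly_mapping_eqI, simp only: lookups, algebra)
    next
      case 5
      then have F: "(a < b) = True" "(a = b) = False" "(a < c) = True" "(a = c) = False" "(b < a) = False" "(b = a) = False" "(b < c) = True" "(b = c) = False" "(c < a) = False" "(c = a) = False" "(c < b) = False" "(c = b) = False" by auto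
      show ?thesis by (simp only: F AB refl simp_thms if_True if_False \<Delta>_def, rule poly_mapping_eqI, simp only: lookups, algebra)
    next
      case 6
      then have F: "(a < c) = True" "(a = c) = False" "(a < b) = True" "(a = b) = False" "(c < a) = False" "(c = a) = False" "(c < b) = True" "(c = b) = False" "(b < a) = False" "(b = a) = False" "(b < c) = False" "(b = c) = False" by auto
      show ?thesis by (simp only: F AB refl simp_thms if_True if_False \<Delta>_def, rule poly_mapping_eqI, simp only: lookups, algebra)
    next
      case 7
      then have F: "(c < a) = True" "(c = a) = False" "(a < c) = False" "(a = c) = False" by auto
      show ?thesis by (simp only: 7(1) F AB refl simp_thms if_True if_False \<Delta>_def, rule poly_mapping_eqI, simp only: lookups, algebra)
    next
      case 8
      then have F: "(b < c) = True" "(b = c) = False" "(c < b) = False" "(c = b) = False" by auto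
      show ?thesis by (simp only: 8(1) F AB refl simp_thms if_True if_False \<Delta>_def, rule poly_mapping_eqI, simp only: lookups, algebra)
    next
      case 9
      then have F: "(b < a) = True" "(b = a) = False" "(b < c) = True" "(b = c) = False" "(a < b) = False" "(a = b) = False" "(a < c) = True" "(a = c) = False" "(c < b) = False" "(c = b) = False" "(c < a) = False" "(c = a) = False" by auto
      show ?thesis by (simp only: F AB refl simp_thms if_True if_False \<Delta>_def, rule poly_mapping_eqI, simp only: lookups, algebra)
    next
      case 10
      then have F: "(c < b) = True" "(c = b) = False" "(b < c) = False" "(b = c) = False" by auto
      show ?thesis by (simp only: 10(1) F AB refl simp_thms if_True if_False \<Delta>_def, rule poly_mapping_eqI, simp only: lookups, algebra)
    next
      case 11
      then have F: "(c < a) = True" "(c = a) = False" "(c < b) = True" "(c = b) = False" "(a < c) = False" "(a = c) = False" "(a < b) = True" "(a = b) = False" "(b < c) = False" "(b = c) = False" "(b < a) = False" "(b = a) = False" by auto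
      show ?thesis by (simp only: F AB refl simp_thms if_True if_False \<Delta>_def, rule poly_mapping_eqI, simp only: lookups, algebra)
    next
      case 12
      then have F: "(b < c) = True" "(b = c) = False" "(b < a) = True" "(b = a) = False" "(c < b) = False" "(c = b) = False" "(c < a) = True" "(c = a) = False" "(a < b) = False" "(a = b) = False" "(a < c) = False" "(a = c) = False" by auto
      show ?thesis by (simp only: F AB refl simp_thms if_True if_False \<Delta>_def, rule poly_mapping_eqI, simp only: lookups, algebra)
    next
      case 13
      then have F: "(c < b) = True" "(c = b) = False" "(c < a) = True" "(c = a) = False" "(b < c) = False" "(b = c) = False" "(b < a) = True" "(b = a) = False" "(a < c) = False" "(a = c) = False" "(a < b) = False" "(a = b) = False" by auto
      show ?thesis by (simp only: F AB refl simp_thms if_True if_False \<Delta>_def, rule poly_mapping_eqI, simp only: lookups, algebra)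
    qed
  qed
  have "?Z a b c" for a b c
  proof -
    have "?Z a b c \<longleftrightarrow> ?Z (a mod N) b c" by (rule periodic_mod) (rule z1)
    also have "\<dots> \<longleftrightarrow> ?Z (a mod N) (b mod N) c" by (rule periodic_mod) (rule z2)
    also have "\<dots> \<longleftrightarrow> ?Z (a mod N) (b mod N) (c mod N)" by (rule periodic_mod) (rule z3)
    finally show ?thesis using base[of "a mod N" "b mod N" "c mod N"]
      pos_mod_bound[OF N_pos] pos_mod_sign[OF N_pos] by (simp only: atLeastLessThan_iff simp_thms)
  qed
  then have "\<Delta> x = 0" by (rule lin_eqI3[OF lin\<Delta> lin_zero])
  then show ?thesis by (simp add: \<Delta>_def)
qed

end

section \<open>Hecke operators on semi-infinite sequences\<close>

lemma wedge_seq_eqI: "(\<And>k. entry x k = entry y k) \<Longrightarrow> x = y"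
  by (metis entry_inject ext)

lemma entry_set_entry: "entry (set_entry x j a) k = (if k = j then a else entry x k)"
  by (simp add: set_entry.rep_eq)

definition upd2 :: "wedge_seq \<Rightarrow> nat \<Rightarrow> int \<Rightarrow> int \<Rightarrow> wedge_seq" where
  "upd2 x j a b = set_entry (set_entry x j a) (Suc j) b"

lemma entry_upd2: "entry (upd2 x j a b) k = (if k = Suc j then b else if k = j then a else entry x k)"
  by (simp add: upd2_def entry_set_entry)

lemma upd2_upd2 [simp]: "upd2 (upd2 x j a b) j c d = upd2 x j c d"
  by (rule wedge_seq_eqI) (simp add: entry_upd2)

lemma upd2_same [simp]: "upd2 x j (entry x j) (entry x (Suc j)) = x"
  by (rule wedge_seq_eqI) (simp add: entry_upd2)

abbreviation place2 :: "wedge_seq \<Rightarrow> nat \<Rightarrow> ((int \<times> int) \<Rightarrow>\<^sub>0 complex) \<Rightarrow> wedge_vec" where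
  "place2 x j \<equiv> emb (\<lambda>(a, b). upd2 x j a b)"

definition swap_entries :: "wedge_seq \<Rightarrow> nat \<Rightarrow> wedge_seq" where
  "swap_entries x j = upd2 x j (entry x (Suc j)) (entry x j)"

lemma entry_swap_entries:
  "entry (swap_entries x j) k = (if k = j then entry x (Suc j) else if k = Suc j then entry x j else entry x k)"
  by (simp add: swap_entries_def entry_upd2)

context fock
begin

definition hecke :: "nat \<Rightarrow> wedge_vec \<Rightarrow> wedge_vec" where
  "hecke j = extend (\<lambda>x. place2 x j (hecke_pair (entry x j) (entry x (Suc j))))"

lemma lin_hecke: "lin (hecke j)"
  by (simp add: hecke_def lin_extend)

lemma lin_hecke_comp: "lin f \<Longrightarrow> lin (\<lambda>x. hecke j (f x))"
  by (rule lin_comp[OF lin_hecke])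

lemma hecke_basis: "hecke j (basis x) = place2 x j (hecke_pair (entry x j) (entry x (Suc j)))"
  by (simp add: hecke_def)

text \<open>\<open>place2\<close> intertwines the operator on two factors with
  \<open>hecke j\<close>, and so transports identities from pairs to sequences.\<close>

lemma hecke_place2: "hecke j (place2 x j y) = place2 x j (hecke2 y)"
proof (rule lin_eqI[where f = "\<lambda>y. hecke j (place2 x j y)" and g = "\<lambda>y. place2 x j (hecke2 y)"])
  show "lin (\<lambda>y. hecke j (place2 x j y))" "lin (\<lambda>y. place2 x j (hecke2 y))"
    by (intro lin_hecke_comp lin_hecke2_comp lin_emb_comp lin_id)+
  fix i :: "int \<times> int"
  obtain a b where "i = (a, b)" by fastforce
  then show "hecke j (place2 x j (basis i)) = place2 x j (hecke2 (basis i))"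
    by (simp add: hecke_basis entry_upd2)
qed

lemma basis_place2: "basis x = place2 x j (basis (entry x j, entry x (Suc j)))"
  by simp

lemma hecke_wedge_quadratic: "hecke j (hecke j x) = scl (v - 1) (hecke j x) + scl v x"
proof (rule lin_eqI[where f = "\<lambda>x. hecke j (hecke j x)" and g = "\<lambda>x. scl (v - 1) (hecke j x) + scl v x"])
  show "lin (\<lambda>x. hecke j (hecke j x))" "lin (\<lambda>x. scl (v - 1) (hecke j x) + scl v x)"
    by (intro lin_intros lin_hecke_comp)+
  fix i
  show "hecke j (hecke j (basis i)) = scl (v - 1) (hecke j (basis i)) + scl v (basis i)"
    unfolding basis_place2[of i j] hecke_place2 hecke2_quadratic by (simp only: emb_simps)
qed

abbreviation place3 :: "wedge_seq \<Rightarrow> nat \<Rightarrow> ((int \<times> int \<times> int) \<Rightarrow>\<^sub>0 complex) \<Rightarrow> wedge_vec" where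
  "place3 x j \<equiv> emb (\<lambda>(a, b, c). set_entry (upd2 x j a b) (Suc (Suc j)) c)"

lemma hecke_place3:
  "hecke j (place3 x j y) = place3 x j (hecke12 y)"
  "hecke (Suc j) (place3 x j y) = place3 x j (hecke23 y)"
proof -
  have 1: "upd2 (set_entry (upd2 x j a b) (Suc (Suc j)) c) j a' b' = set_entry (upd2 x j a' b') (Suc (Suc j)) c"
    "upd2 (set_entry (upd2 x j a b) (Suc (Suc j)) c) (Suc j) b' c' = set_entry (upd2 x j a b') (Suc (Suc j)) c'"
    for a b c a' b' c'
    by (rule wedge_seq_eqI; simp add: entry_upd2 entry_set_entry)+
  show "hecke j (place3 x j y) = place3 x j (hecke12 y)"
  proof (rule lin_eqI3[where f = "\<lambda>y. hecke j (place3 x j y)" and g = "\<lambda>y. place3 x j (hecke12 y)"])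
    show "lin (\<lambda>y. hecke j (place3 x j y))" "lin (\<lambda>y. place3 x j (hecke12 y))"
      by (intro lin_hecke_comp lin_hecke12_comp lin_emb_comp lin_id)+
    show "hecke j (place3 x j (basis (a, b, c))) = place3 x j (hecke12 (basis (a, b, c)))" for a b c
      by (simp add: hecke_basis entry_upd2 entry_set_entry emb_emb case_prod_unfold 1)
  qed
  show "hecke (Suc j) (place3 x j y) = place3 x j (hecke23 y)"
  proof (rule lin_eqI3[where f = "\<lambda>y. hecke (Suc j) (place3 x j y)" and g = "\<lambda>y. place3 x j (hecke23 y)"])
    show "lin (\<lambda>y. hecke (Suc j) (place3 x j y))" "lin (\<lambda>y. place3 x j (hecke23 y))"
      by (intro lin_hecke_comp lin_hecke23_comp lin_emb_comp lin_id)+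
    show "hecke (Suc j) (place3 x j (basis (a, b, c))) = place3 x j (hecke23 (basis (a, b, c)))" for a b c
      by (simp add: hecke_basis entry_upd2 entry_set_entry emb_emb case_prod_unfold 1)
  qed
qed

lemma hecke_wedge_braid: "hecke j (hecke (Suc j) (hecke j x)) = hecke (Suc j) (hecke j (hecke (Suc j) x))"
proof (rule lin_eqI[where f = "\<lambda>x. hecke j (hecke (Suc j) (hecke j x))" and g = "\<lambda>x. hecke (Suc j) (hecke j (hecke (Suc j) x))"])
  show "lin (\<lambda>x. hecke j (hecke (Suc j) (hecke j x)))" "lin (\<lambda>x. hecke (Suc j) (hecke j (hecke (Suc j) x)))"
    by (intro lin_id lin_hecke_comp)+
  fix i
  have i: "basis i = place3 i j (basis (entry i j, entry i (Suc j), entry i (Suc (Suc j))))"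
  proof -
    have "set_entry i (Suc (Suc j)) (entry i (Suc (Suc j))) = i"
      by (rule wedge_seq_eqI) (simp add: entry_set_entry)
    then show ?thesis by simp
  qed
  show "hecke j (hecke (Suc j) (hecke j (basis i))) = hecke (Suc j) (hecke j (hecke (Suc j) (basis i)))"
    unfolding i hecke_place3 hecke_braid ..
qed

lemma hecke_commute:
  assumes "Suc j < k"
  shows "hecke j (hecke k x) = hecke k (hecke j x)"
proof (rule lin_eqI[where f = "\<lambda>x. hecke j (hecke k x)" and g = "\<lambda>x. hecke k (hecke j x)"])
  show "lin (\<lambda>x. hecke j (hecke k x))" "lin (\<lambda>x. hecke k (hecke j x))"
    by (intro lin_id lin_hecke_comp)+
  fix i
  \<comment> \<open>Both orders of composition are brought into the form of a double
    \<open>extend\<close> over the two pairs, to which \<open>extend_swap\<close> applies.\<close>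
  have e: "hecke j' (place2 i k' y) = extend (\<lambda>(a, b). extend (\<lambda>(a', b'). basis (upd2 (upd2 i k' a b) j' a' b'))
      (hecke_pair (entry i j') (entry i (Suc j')))) y"
    if "Suc j' < k' \<or> Suc k' < j'" for j' k' y
  proof (rule lin_eqI[OF _ lin_extend, where f = "\<lambda>y. hecke j' (place2 i k' y)"])
    show "lin (\<lambda>y. hecke j' (place2 i k' y))" by (intro lin_hecke_comp lin_emb_comp lin_id)
    fix p :: "int \<times> int"
    obtain a b where "p = (a, b)" by fastforce
    then show "hecke j' (place2 i k' (basis p)) = extend (\<lambda>(a, b). extend (\<lambda>(a', b'). basis (upd2 (upd2 i k' a b) j' a' b'))
      (hecke_pair (entry i j') (entry i (Suc j')))) (basis p)"
      using that by (auto simp: hecke_basis entry_upd2 emb_def case_prod_unfold)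
  qed
  have u: "upd2 (upd2 i k a b) j a' b' = upd2 (upd2 i j a' b') k a b" for a b a' b'
    using assms by (intro wedge_seq_eqI) (simp add: entry_upd2)
  show "hecke j (hecke k (basis i)) = hecke k (hecke j (basis i))"
    unfolding hecke_basis[of k] hecke_basis[of j] e[OF disjI1[OF assms]] e[OF disjI2[OF assms]]
    unfolding case_prod_unfold u by (rule extend_swap)
qed

section \<open>The antisymmetrizer\<close>

abbreviation hy :: complex where "hy \<equiv> - 1 / v"

text \<open>\<open>T_(M-1) ... T_(M-k)\<close>, with \<open>T_(M-k)\<close> acting first: the
  operator of the cycle that carries the factor at place \<open>M - k\<close> to place
  \<open>M\<close>. These cycles are the coset representatives in \<open>asym\<close>.\<close>

fun rot :: "nat \<Rightarrow> nat \<Rightarrow> wedge_vec \<Rightarrow> wedge_vec" where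
  "rot M 0 x = x"
| "rot M (Suc k) x = rot M k (hecke (M - Suc k) x)"

text \<open>
  Splitting the symmetric group into minimal coset representatives, this is the sum of
  \<open>(- 1 / v) ^ length w\<close> times the Hecke operator of \<open>w\<close> over the permutations \<open>w\<close> of the first \<open>M\<close> factors.
\<close>

fun asym :: "nat \<Rightarrow> wedge_vec \<Rightarrow> wedge_vec" where
  "asym 0 x = x"
| "asym (Suc M) x = asym M (\<Sum>k\<le>M. scl (hy ^ k) (rot M k x))"

lemma lin_rot: "lin (rot M k)"
proof (induction k)
  case 0 show ?case using lin_id by (simp add: lin_def)
next
  case (Suc k)
  have "rot M (Suc k) = (\<lambda>x. rot M k (hecke (M - Suc k) x))" by (simp add: fun_eq_iff)
  then show ?case using lin_comp[OF Suc lin_hecke] by simp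
qed

lemma lin_asym: "lin (asym M)"
proof (induction M)
  case 0 show ?case using lin_id by (simp add: lin_def)
next
  case (Suc M)
  have "asym (Suc M) = (\<lambda>x. asym M (\<Sum>k\<le>M. scl (hy ^ k) (rot M k x)))" by (simp add: fun_eq_iff)
  moreover have "lin (\<lambda>x. \<Sum>k\<le>M. scl (hy ^ k) (rot M k x))"
    by (intro lin_sum_op lin_scale) (rule lin_rot)
  ultimately show ?case using lin_comp[OF Suc] by simp
qed

lemma rot_left: "Suc j < M - k \<Longrightarrow> rot M k (hecke j x) = hecke j (rot M k x)"
proof (induction k arbitrary: x)
  case (Suc k)
  have "hecke (M - Suc k) (hecke j x) = hecke j (hecke (M - Suc k) x)"
    using Suc.prems by (intro hecke_commute[symmetric]) simp
  then show ?case using Suc by simp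
qed simp

text \<open>A generator inside the range of the cycle passes through it with its index lowered by
  one; this takes a single braid relation, where it meets its neighbour.\<close>

lemma rot_right: "M - k < j \<Longrightarrow> j < M \<Longrightarrow> k \<le> M \<Longrightarrow> rot M k (hecke j x) = hecke (j - 1) (rot M k x)"
proof (induction k arbitrary: x)
  case (Suc k)
  let ?i = "M - Suc k"
  have si: "Suc ?i = M - k" using Suc.prems by simp
  show ?case
  proof (cases "M - k < j")
    case True
    then have "hecke ?i (hecke j x) = hecke j (hecke ?i x)" using si by (intro hecke_commute) simp
    then show ?thesis using Suc True by simp
  next
    case False
    then have j: "M - k = j" using Suc.prems by simp
    then obtain k' where k: "k = Suc k'" using Suc.prems by (cases k) auto
    have ji: "Suc ?i = j" using j si by simp
    have "rot M (Suc k) (hecke j x) = rot M k' (hecke (Suc ?i) (hecke ?i (hecke (Suc ?i) x)))"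
      using j k ji by simp
    also have "\<dots> = rot M k' (hecke ?i (hecke (Suc ?i) (hecke ?i x)))"
      by (simp only: hecke_wedge_braid)
    also have "\<dots> = hecke ?i (rot M k' (hecke (Suc ?i) (hecke ?i x)))"
      by (rule rot_left) (use Suc.prems k j in simp)
    also have "rot M k' (hecke (Suc ?i) (hecke ?i x)) = rot M (Suc k) x" using k j ji by simp
    finally show ?thesis using ji by (metis diff_Suc_1)
  qed
qed simp

text \<open>All cycles except two pass the generator on to the antisymmetrizer of the first
  \<open>M\<close> factors, where the induction hypothesis applies. The cycles \<open>m\<close> and
  \<open>m + 1\<close> differ by the generator itself, and for them the sign comes from the
  quadratic relation and \<open>hy * v = - 1\<close>.\<close>

lemma asym_hecke: "Suc j < M \<Longrightarrow> asym M (hecke j x) = - asym M x"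
proof (induction M arbitrary: j x)
  case (Suc M)
  then have j: "j < M" by simp
  let ?a = "\<lambda>k x. asym M (scl (hy ^ k) (rot M k x))"
  have expand: "asym (Suc M) x = (\<Sum>k\<le>M. ?a k x)" for x
    by (simp add: lin_sum[OF lin_asym])
  define m where "m = M - Suc j"
  have m: "Suc m \<le> M" "M - m = Suc j" "M - Suc m = j" using j by (auto simp: m_def)
  have S: "{..M} = {..M} - {m, Suc m} \<union> {m, Suc m}" using m by auto
  have split: "(\<Sum>k\<le>M. f k) = (\<Sum>k\<in>{..M} - {m, Suc m}. f k) + (f m + f (Suc m))" for f :: "nat \<Rightarrow> wedge_vec"
    by (subst S, subst sum.union_disjoint) auto
  have other: "?a k (hecke j x) = - ?a k x" if k: "k \<in> {..M} - {m, Suc m}" for k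
  proof (cases "k < m")
    case True
    then have "rot M k (hecke j x) = hecke j (rot M k x)" using m by (intro rot_left) simp
    moreover have "Suc j < M" using True m by simp
    ultimately show ?thesis using Suc.IH by (simp add: lin_scl[OF lin_asym] scl.scale_minus_right)
  next
    case False
    then have r: "rot M k (hecke j x) = hecke (j - 1) (rot M k x)" using m k j by (intro rot_right) auto
    have "Suc (j - 1) < M" "j \<ge> 1" using False m k by auto
    then show ?thesis using r Suc.IH by (simp add: lin_scl[OF lin_asym] scl.scale_minus_right)
  qed
  have hy: "hy * v = - 1" using v_facts by simp
  have "rot M (Suc m) (hecke j x) = rot M m (hecke j (hecke j x))" using m by simp
  also have "\<dots> = scl (v - 1) (rot M (Suc m) x) + scl v (rot M m x)"
    using m by (simp add: hecke_wedge_quadratic lin_add[OF lin_rot] lin_scl[OF lin_rot])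
  finally have r: "rot M (Suc m) (hecke j x) = scl (v - 1) (rot M (Suc m) x) + scl v (rot M m x)" .
  have "scl (z ^ Suc m) (scl (v - 1) f + scl v g) = scl (z ^ m * (z * v - z)) f + scl (z ^ m * (z * v)) g"
    for z and f g :: wedge_vec
    by (rule poly_mapping_eqI) (simp add: lookup_add algebra_simps)
  then have "scl (hy ^ Suc m) (rot M (Suc m) (hecke j x)) =
      scl (hy ^ m * (hy * v - hy)) (rot M (Suc m) x) + scl (hy ^ m * (hy * v)) (rot M m x)"
    unfolding r .
  then have E1: "scl (hy ^ Suc m) (rot M (Suc m) (hecke j x)) =
      scl (hy ^ m * (- 1 - hy)) (rot M (Suc m) x) + scl (hy ^ m * (- 1)) (rot M m x)"
    unfolding hy .
  have E2: "scl (hy ^ m) (rot M m (hecke j x)) = scl (hy ^ m) (rot M (Suc m) x)" using m by simp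
  have "scl (hy ^ m) (rot M m (hecke j x)) + scl (hy ^ Suc m) (rot M (Suc m) (hecke j x)) =
      - (scl (hy ^ m) (rot M m x) + scl (hy ^ Suc m) (rot M (Suc m) x))"
    unfolding E1 E2 by (rule poly_mapping_eqI) (simp add: lookup_add algebra_simps del: rot.simps)
  then have "asym M (scl (hy ^ m) (rot M m (hecke j x)) + scl (hy ^ Suc m) (rot M (Suc m) (hecke j x))) =
      asym M (- (scl (hy ^ m) (rot M m x) + scl (hy ^ Suc m) (rot M (Suc m) x)))" by (rule arg_cong)
  then have two: "?a m (hecke j x) + ?a (Suc m) (hecke j x) = - (?a m x + ?a (Suc m) x)"
    by (simp only: lin_uminus[OF lin_asym] lin_add[OF lin_asym])
  show ?case
    unfolding expand split two using other by (simp add: sum_negf)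
qed simp

end

section \<open>Triangularity of the antisymmetrizer\<close>

definition supported :: "'a set \<Rightarrow> ('a \<Rightarrow>\<^sub>0 complex) \<Rightarrow> bool" where
  "supported A x \<longleftrightarrow> Poly_Mapping.keys x \<subseteq> A"

lemma supported_lookup: "supported A x \<longleftrightarrow> (\<forall>i. i \<notin> A \<longrightarrow> Poly_Mapping.lookup x i = 0)"
  by (auto simp: supported_def in_keys_iff)

lemma supported_0: "supported A 0"
  and supported_add: "supported A x \<Longrightarrow> supported A z \<Longrightarrow> supported A (x + z)"
  and supported_diff: "supported A x \<Longrightarrow> supported A z \<Longrightarrow> supported A (x - z)"
  and supported_scl: "supported A x \<Longrightarrow> supported A (scl c x)"
  by (simp_all add: supported_lookup lookup_add lookup_minus)

lemma supported_single: "i \<in> A \<Longrightarrow> supported A (Poly_Mapping.single i c)"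
  by (auto simp: supported_lookup lookup_single when_def)

lemma supported_sum: "(\<And>i. i \<in> S \<Longrightarrow> supported A (f i)) \<Longrightarrow> supported A (sum f S)"
  by (induction S rule: infinite_finite_induct) (auto simp: supported_0 supported_add)

lemma supported_extend: "supported A x \<Longrightarrow> (\<And>i. i \<in> A \<Longrightarrow> supported B (f i)) \<Longrightarrow> supported B (extend f x)"
  unfolding extend_def by (intro supported_sum supported_scl) (auto simp: supported_def)

lemma supported_emb: "supported A x \<Longrightarrow> (\<And>i. i \<in> A \<Longrightarrow> g i \<in> B) \<Longrightarrow> supported B (emb g x)"
  unfolding emb_def by (erule supported_extend) (simp add: supported_single)

lemma supported_mono: "supported A x \<Longrightarrow> A \<subseteq> B \<Longrightarrow> supported B x"
  by (auto simp: supported_def)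

text \<open>A Hecke operator keeps the sum of the two entries and brings them closer together in all
  terms except the pair itself and its swap; these other terms have a smaller sum of
  squares.\<close>

definition energy :: "nat \<Rightarrow> wedge_seq \<Rightarrow> int" where
  "energy M x = (\<Sum>j<M. (entry x j)\<^sup>2)"

text \<open>Inversions relative to the decreasing order, which is the order of the kets.\<close>

definition inversions :: "nat \<Rightarrow> wedge_seq \<Rightarrow> nat" where
  "inversions M x = card {(i, j). i < j \<and> j < M \<and> entry x i < entry x j}"

lemma finite_pairs_less: "finite {(i, j). i < j \<and> j < M \<and> P i j}" for M :: nat
  by (rule finite_subset[of _ "{..<M} \<times> {..<M}"]) auto

lemma energy_upd2:
  assumes "Suc j < M"
  shows "energy M (upd2 x j a b) = energy M x - (entry x j)\<^sup>2 - (entry x (Suc j))\<^sup>2 + a\<^sup>2 + b\<^sup>2"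
proof -
  have S: "{..<M} = insert j (insert (Suc j) ({..<M} - {j, Suc j}))" using assms by auto
  have e: "energy M z = (entry z j)\<^sup>2 + ((entry z (Suc j))\<^sup>2 + (\<Sum>i\<in>{..<M} - {j, Suc j}. (entry z i)\<^sup>2))" for z
    unfolding energy_def by (subst S, subst sum.insert, simp, simp, subst sum.insert) simp_all
  have "(\<Sum>i\<in>{..<M} - {j, Suc j}. (entry (upd2 x j a b) i)\<^sup>2) = (\<Sum>i\<in>{..<M} - {j, Suc j}. (entry x i)\<^sup>2)"
    by (rule sum.cong) (auto simp: entry_upd2)
  then show ?thesis unfolding e by (simp add: entry_upd2)
qed

lemma energy_swap_entries: "Suc j < M \<Longrightarrow> energy M (swap_entries x j) = energy M x"
  by (simp add: swap_entries_def energy_upd2)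

lemma inversions_swap_entries: 
  assumes True: "Suc j < M"
  shows "inversions M (swap_entries x j) \<le> Suc (inversions M x)"
proof -
  define \<tau> where "\<tau> k = (if k = j then Suc j else if k = Suc j then j else k)" for k
  let ?I = "\<lambda>x. {(i, k). i < k \<and> k < M \<and> entry x i < entry x k}"
    have "?I (swap_entries x j) \<subseteq> insert (j, Suc j) ((\<lambda>(a, b). (\<tau> a, \<tau> b)) ` ?I x)"
    proof
      fix p assume p: "p \<in> ?I (swap_entries x j)"
      obtain a b where ab: "p = (a, b)" by fastforce
      show "p \<in> insert (j, Suc j) ((\<lambda>(a, b). (\<tau> a, \<tau> b)) ` ?I x)"
      proof (cases "p = (j, Suc j)")
        case False
        then have "(\<tau> a, \<tau> b) \<in> ?I x"
          using p True by (auto simp: ab \<tau>_def entry_swap_entries split: if_splits)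
        moreover have "p = (\<tau> (\<tau> a), \<tau> (\<tau> b))" by (simp add: ab \<tau>_def)
        ultimately show ?thesis by (intro insertI2 image_eqI[of _ _ "(\<tau> a, \<tau> b)"]) auto
      qed simp
    qed
    then have "card (?I (swap_entries x j)) \<le> card (insert (j, Suc j) ((\<lambda>(a, b). (\<tau> a, \<tau> b)) ` ?I x))"
      by (rule card_mono[rotated]) (simp add: finite_pairs_less)
    also have "\<dots> \<le> Suc (card ((\<lambda>(a, b). (\<tau> a, \<tau> b)) ` ?I x))" by (rule card_insert_le_m1) simp_all
    also have "card ((\<lambda>(a, b). (\<tau> a, \<tau> b)) ` ?I x) \<le> card (?I x)"
      by (rule card_image_le) (rule finite_pairs_less)
    finally show ?thesis by (simp add: inversions_def)
qed

context fock
begin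

text \<open>Moving an amount \<open>s\<close> with \<open>0 < s < l - p\<close> from the larger to
  the smaller entry lowers the sum of squares by \<open>2 s (l - p - s)\<close>. For
  \<open>p < l\<close> only the first sum is present and it stops short of the swapped pair, so that
  pair keeps its nonzero coefficient.\<close>

lemma hecke_pair_supported:
  "supported ({(l, p), (p, l)} \<union> {(a, b). a\<^sup>2 + b\<^sup>2 < l\<^sup>2 + p\<^sup>2}) (hecke_pair l p)"
  and hecke_pair_leading: "p < l \<Longrightarrow> \<exists>c r. c \<noteq> 0 \<and> hecke_pair l p = Poly_Mapping.single (p, l) c + r \<and>
    supported ({(l, p)} \<union> {(a, b). a\<^sup>2 + b\<^sup>2 < l\<^sup>2 + p\<^sup>2}) r"
proof -
  let ?L = "{(a, b). a\<^sup>2 + b\<^sup>2 < l\<^sup>2 + p\<^sup>2}"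
  have sq: "(l - s)\<^sup>2 + (p + s)\<^sup>2 = l\<^sup>2 + p\<^sup>2 - 2 * (s * (l - p - s))"
    "(p - s)\<^sup>2 + (l + s)\<^sup>2 = l\<^sup>2 + p\<^sup>2 - 2 * (s * (p - l - s))" for s
    by (simp_all add: power2_eq_square algebra_simps)
  have K1: "(l - N * int k, p + N * int k) \<in> {(l, p)} \<union> ?L" if "k < nat ((l - p + N - 1) div N)" for k
  proof (cases "k = 0")
    case False
    have "int k < (l - p + N - 1) div N" using that by simp
    then have "int k + 1 \<le> (l - p + N - 1) div N" by simp
    then have "N * (int k + 1) \<le> N * ((l - p + N - 1) div N)" using N_pos by (intro mult_left_mono) auto
    also have "\<dots> \<le> l - p + N - 1" using N_pos by (metis mult_div_mod_eq pos_mod_sign le_add_same_cancel1)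
    finally have "N * int k < l - p" by (simp add: algebra_simps)
    moreover have "0 < N * int k" using False N_pos by simp
    ultimately have "0 < N * int k * (l - p - N * int k)" by (intro mult_pos_pos[of "N * int k"]) auto
    then show ?thesis using sq(1)[of "N * int k"] by simp
  qed simp
  have K2: "(p - N * int k - (p - l) mod N, l + N * int k + (p - l) mod N) \<in> {(p, l)} \<union> ?L \<and> l < p"
    if "k < nat ((p - l) div N)" for k
  proof -
    let ?s = "N * int k + (p - l) mod N"
    have "int k < (p - l) div N" using that by simp
    then have "int k + 1 \<le> (p - l) div N" by simp
    then have "N * (int k + 1) \<le> N * ((p - l) div N)" using N_pos by (intro mult_left_mono) auto
    then have "N * int k + N + (p - l) mod N \<le> p - l"
      using mult_div_mod_eq[of N "p - l"] distrib_left[of N "int k" 1] by linarith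
    then have s: "?s < p - l" using N_pos by simp
    have s0: "0 \<le> ?s" using N_pos by simp
    then have lp: "l < p" using s by simp
    show ?thesis
    proof (cases "?s = 0")
      case False
      then have "0 < ?s * (p - l - ?s)" using s s0 by (intro mult_pos_pos[of ?s]) auto
      then show ?thesis using sq(2)[of ?s] lp by (simp add: algebra_simps)
    next
      case True
      then have "p - N * int k - (p - l) mod N = p" "l + N * int k + (p - l) mod N = l" by linarith+
      then show ?thesis using lp by simp
    qed
  qed
  let ?r1 = "scl (v - 1) (\<Sum>k<nat ((l - p + N - 1) div N). basis (l - N * int k, p + N * int k))"
  let ?r2 = "scl (v - 1) (\<Sum>k<nat ((p - l) div N).
         basis (p - N * int k - (p - l) mod N, l + N * int k + (p - l) mod N))"
  have r1: "supported ({(l, p)} \<union> ?L) ?r1"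
    by (intro supported_scl supported_sum supported_single) (use K1 in blast)
  have r2: "supported ({(p, l)} \<union> ?L) ?r2"
    by (intro supported_scl supported_sum supported_single) (use K2 in blast)
  have h: "hecke_pair l p = Poly_Mapping.single (p, l) (if (p - l) mod N = 0 then v else q) + ?r1 - ?r2"
    by (simp add: hecke_pair_def)
  show "supported ({(l, p), (p, l)} \<union> ?L) (hecke_pair l p)"
    unfolding h by (intro supported_add supported_diff supported_single supported_mono[OF r1] supported_mono[OF r2]) auto
  assume "p < l"
  then have "{..<nat ((p - l) div N)} = {}" using K2 by fastforce
  then have "?r2 = 0" by (simp only: sum.empty) simp
  then have "hecke_pair l p = Poly_Mapping.single (p, l) (if (p - l) mod N = 0 then v else q) + ?r1" using h by simp
  then show "\<exists>c r. c \<noteq> 0 \<and> hecke_pair l p = Poly_Mapping.single (p, l) c + r \<and> supported ({(l, p)} \<union> ?L) r"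
    using r1 q0 by (intro exI[of _ "if (p - l) mod N = 0 then v else q"] exI[of _ ?r1]) simp
qed

text \<open>Initial segments of the lexicographic order by energy and inversions; one Hecke operator
  raises the bound on inversions by one.\<close>

definition low :: "nat \<Rightarrow> int \<Rightarrow> nat \<Rightarrow> wedge_seq set" where
  "low M E m = {x. energy M x < E \<or> energy M x = E \<and> inversions M x < m}"

lemma low_mono: "m \<le> m' \<Longrightarrow> low M E m \<subseteq> low M E m'"
  by (auto simp: low_def)

lemma hecke_low:
  assumes "supported (low M E m) x" "Suc j < M"
  shows "supported (low M E (Suc m)) (hecke j x)"
  unfolding hecke_def
proof (rule supported_extend[OF assms(1)])
  fix x assume x: "x \<in> low M E m"
  show "supported (low M E (Suc m)) (place2 x j (hecke_pair (entry x j) (entry x (Suc j))))"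
  proof (rule supported_emb[OF hecke_pair_supported])
    fix i assume i: "i \<in> {(entry x j, entry x (Suc j)), (entry x (Suc j), entry x j)} \<union>
      {(a, b). a\<^sup>2 + b\<^sup>2 < (entry x j)\<^sup>2 + (entry x (Suc j))\<^sup>2}"
    then consider "i = (entry x j, entry x (Suc j))" | "i = (entry x (Suc j), entry x j)"
      | a b where "i = (a, b)" "a\<^sup>2 + b\<^sup>2 < (entry x j)\<^sup>2 + (entry x (Suc j))\<^sup>2" by auto
    then show "(case i of (a, b) \<Rightarrow> upd2 x j a b) \<in> low M E (Suc m)"
    proof cases
      case 1
      then show ?thesis using x by (auto simp: low_def)
    next
      case 2
      then show ?thesis
        using x energy_swap_entries[OF assms(2), of x] inversions_swap_entries[OF assms(2), of x]
        by (auto simp: low_def swap_entries_def)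
    next
      case 3
      then show ?thesis using x energy_upd2[OF assms(2), of x a b] by (auto simp: low_def)
    qed
  qed
qed

lemma hecke_leading:
  assumes "Suc j < M" "entry x (Suc j) < entry x j"
  shows "\<exists>c r. c \<noteq> 0 \<and> hecke j (basis x) = Poly_Mapping.single (swap_entries x j) c + r \<and>
    supported (low M (energy M x) (Suc (inversions M x))) r"
proof -
  obtain c r where c: "c \<noteq> 0" "hecke_pair (entry x j) (entry x (Suc j)) = Poly_Mapping.single (entry x (Suc j), entry x j) c + r"
    and r: "supported ({(entry x j, entry x (Suc j))} \<union> {(a, b). a\<^sup>2 + b\<^sup>2 < (entry x j)\<^sup>2 + (entry x (Suc j))\<^sup>2}) r"
    using hecke_pair_leading[OF assms(2)] by metis
  have "hecke j (basis x) = Poly_Mapping.single (swap_entries x j) c + place2 x j r"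
    unfolding hecke_basis c(2) by (simp add: emb_simps swap_entries_def)
  moreover have "supported (low M (energy M x) (Suc (inversions M x))) (place2 x j r)"
    by (rule supported_emb[OF r]) (use energy_upd2[OF assms(1), of x] in \<open>auto simp: low_def\<close>)
  ultimately show ?thesis using c(1) by blast
qed

lemma rot_low: "supported (low M E m) x \<Longrightarrow> k \<le> K \<Longrightarrow> K < M \<Longrightarrow> supported (low M E (m + k)) (rot K k x)"
proof (induction k arbitrary: x m)
  case (Suc k)
  have "supported (low M E (Suc m)) (hecke (K - Suc k) x)" by (rule hecke_low) (use Suc.prems in auto)
  from Suc.IH[OF this] show ?case using Suc.prems by simp
qed simp

text \<open>\<open>K (K - 1) / 2\<close>: the length of the longest permutation, and the number of
  inversions of an increasing sequence.\<close>

fun asym_length :: "nat \<Rightarrow> nat" where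
  "asym_length 0 = 0"
| "asym_length (Suc K) = K + asym_length K"

lemma asym_low: "supported (low M E m) x \<Longrightarrow> K \<le> M \<Longrightarrow> supported (low M E (m + asym_length K)) (asym K x)"
proof (induction K arbitrary: x m)
  case (Suc K)
  have "supported (low M E (m + K)) (\<Sum>k\<le>K. scl (hy ^ k) (rot K k x))"
  proof (intro supported_sum supported_scl)
    fix k assume "k \<in> {..K}"
    then have "supported (low M E (m + k)) (rot K k x)" using Suc.prems by (intro rot_low) auto
    then show "supported (low M E (m + K)) (rot K k x)"
      by (rule supported_mono) (use \<open>k \<in> {..K}\<close> in \<open>simp add: low_mono\<close>)
  qed
  from Suc.IH[OF this] show ?case using Suc.prems by (simp add: add.assoc)
qed simp

text \<open>The factor at place \<open>K - k\<close> exceeds all factors that it passes, so every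
  Hecke operator of the cycle contributes its leading swap.\<close>

lemma rot_leading:
  assumes "k \<le> K" "K < M" "\<And>j. K - k < j \<Longrightarrow> j \<le> K \<Longrightarrow> entry x j < entry x (K - k)"
  shows "\<exists>c r z. c \<noteq> 0 \<and> rot K k (basis x) = Poly_Mapping.single z c + r \<and>
    supported (low M (energy M x) (inversions M x + k)) r \<and> energy M z = energy M x \<and>
    inversions M z \<le> inversions M x + k \<and>
    (\<forall>j. entry z j = (if j < K - k \<or> K < j then entry x j else if j = K then entry x (K - k) else entry x (Suc j)))"
  using assms
proof (induction k arbitrary: x)
  case 0
  have "\<forall>j. entry x j = (if j < K - 0 \<or> K < j then entry x j else if j = K then entry x (K - 0) else entry x (Suc j))"
    by auto
  then show ?case by (intro exI[of _ 1] exI[of _ 0] exI[of _ x]) (auto simp: supported_0)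
next
  case (Suc k)
  let ?i = "K - Suc k"
  let ?x = "swap_entries x ?i"
  have si: "Suc ?i = K - k" using Suc.prems by simp
  have iM: "Suc ?i < M" using Suc.prems by simp
  have "entry x (Suc ?i) < entry x ?i" using Suc.prems(3)[of "Suc ?i"] Suc.prems(1) by simp
  then obtain c r where c: "c \<noteq> 0" "hecke ?i (basis x) = Poly_Mapping.single ?x c + r"
    and r: "supported (low M (energy M x) (Suc (inversions M x))) r"
    using hecke_leading[of ?i M x] iM by blast
  have "entry ?x j < entry ?x (K - k)" if "K - k < j" "j \<le> K" for j
    using Suc.prems(3)[of j] that si by (auto simp: entry_swap_entries)
  then obtain c' r' z where z: "c' \<noteq> 0" "rot K k (basis ?x) = Poly_Mapping.single z c' + r'"
    "supported (low M (energy M ?x) (inversions M ?x + k)) r'" "energy M z = energy M ?x"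
    "inversions M z \<le> inversions M ?x + k"
    "\<forall>j. entry z j = (if j < K - k \<or> K < j then entry ?x j else if j = K then entry ?x (K - k) else entry ?x (Suc j))"
    using Suc.IH[of ?x] Suc.prems by auto
  have e: "energy M ?x = energy M x" using Suc.prems by (intro energy_swap_entries) simp
  have isw: "inversions M ?x \<le> Suc (inversions M x)" using Suc.prems by (intro inversions_swap_entries) simp
  have "rot K (Suc k) (basis x) = scl c (rot K k (basis ?x)) + rot K k r"
    using c(2) lin_scl[OF lin_rot, of K k c "basis ?x"] by (simp add: lin_add[OF lin_rot])
  also have "\<dots> = Poly_Mapping.single z (c * c') + (scl c r' + rot K k r)"
    using z(2) by (simp add: scl.scale_right_distrib add.assoc)
  finally have 1: "rot K (Suc k) (basis x) = Poly_Mapping.single z (c * c') + (scl c r' + rot K k r)" .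
  have 2: "supported (low M (energy M x) (inversions M x + Suc k)) (scl c r' + rot K k r)"
  proof (intro supported_add supported_scl)
    show "supported (low M (energy M x) (inversions M x + Suc k)) r'"
      by (rule supported_mono[OF z(3)]) (use e isw in \<open>simp add: low_mono\<close>)
    show "supported (low M (energy M x) (inversions M x + Suc k)) (rot K k r)"
      using rot_low[OF r, of k K] Suc.prems by simp
  qed
  have 3: "inversions M z \<le> inversions M x + Suc k" using z(5) isw by simp
  have 4: "\<forall>j. entry z j = (if j < K - Suc k \<or> K < j then entry x j else if j = K then entry x (K - Suc k) else entry x (Suc j))"
  proof
    fix j
    show "entry z j = (if j < K - Suc k \<or> K < j then entry x j else if j = K then entry x (K - Suc k) else entry x (Suc j))"
      using z(6) si Suc.prems(1) by (cases "j = ?i") (auto simp: entry_swap_entries)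
  qed
  show ?case using 1 2 3 4 z(1,4) c(1) e by (intro exI[of _ "c * c'"] exI[of _ "scl c r' + rot K k r"] exI[of _ z]) simp
qed

text \<open>The longest permutation contributes the reversed sequence. Every other product of Hecke
  operators has fewer factors and creates fewer inversions at the same energy.\<close>

lemma asym_leading:
  assumes "K \<le> M" "\<And>i j. i < j \<Longrightarrow> j < K \<Longrightarrow> entry x j < entry x i"
  shows "\<exists>c r z. c \<noteq> 0 \<and> asym K (basis x) = Poly_Mapping.single z c + r \<and>
    supported (low M (energy M x) (inversions M x + asym_length K)) r \<and> energy M z = energy M x \<and>
    (\<forall>j. entry z j = (if j < K then entry x (K - 1 - j) else entry x j))"
  using assms
proof (induction K arbitrary: x)
  case 0
  then show ?case by (intro exI[of _ 1] exI[of _ 0] exI[of _ x]) (auto simp: supported_0)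
next
  case (Suc K)
  obtain c r w where w: "c \<noteq> 0" "rot K K (basis x) = Poly_Mapping.single w c + r"
    "supported (low M (energy M x) (inversions M x + K)) r" "energy M w = energy M x"
    "inversions M w \<le> inversions M x + K"
    "\<forall>j. entry w j = (if j < K - K \<or> K < j then entry x j else if j = K then entry x (K - K) else entry x (Suc j))"
    using rot_leading[of K K M x] Suc.prems by auto
  have "entry w j < entry w i" if "i < j" "j < K" for i j
    using w(6) that Suc.prems(2)[of "Suc i" "Suc j"] by auto
  then obtain c' r' z where z: "c' \<noteq> 0" "asym K (basis w) = Poly_Mapping.single z c' + r'"
    "supported (low M (energy M w) (inversions M w + asym_length K)) r'" "energy M z = energy M w"
    "\<forall>j. entry z j = (if j < K then entry w (K - 1 - j) else entry w j)"
    using Suc.IH[of w] Suc.prems(1) by auto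
  define s where "s = (\<Sum>k<K. scl (hy ^ k) (rot K k (basis x)))"
  have "supported (low M (energy M x) (inversions M x + K)) s"
    unfolding s_def
  proof (intro supported_sum supported_scl)
    fix k assume k: "k \<in> {..<K}"
    have "x \<in> low M (energy M x) (Suc (inversions M x))" by (simp add: low_def)
    then have "supported (low M (energy M x) (Suc (inversions M x) + k)) (rot K k (basis x))"
      using k Suc.prems(1) by (intro rot_low supported_single) auto
    then show "supported (low M (energy M x) (inversions M x + K)) (rot K k (basis x))"
      by (rule supported_mono) (rule low_mono, use k in simp)
  qed
  then have "supported (low M (energy M x) (inversions M x + K)) (scl (hy ^ K) r + s)"
    using w(3) by (intro supported_add supported_scl)
  then have t: "supported (low M (energy M x) (inversions M x + K + asym_length K)) (asym K (scl (hy ^ K) r + s))"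
    using Suc.prems(1) by (intro asym_low) auto
  have "asym (Suc K) (basis x) = asym K (s + scl (hy ^ K) (rot K K (basis x)))"
    by (simp add: s_def lessThan_Suc_atMost[symmetric] del: lessThan_Suc_atMost)
  also have "s + scl (hy ^ K) (rot K K (basis x)) = scl (hy ^ K * c) (basis w) + (scl (hy ^ K) r + s)"
    unfolding w(2) by (simp add: scl.scale_right_distrib)
  also have "asym K \<dots> = scl (hy ^ K * c) (asym K (basis w)) + asym K (scl (hy ^ K) r + s)"
    by (simp only: lin_add[OF lin_asym] lin_scl[OF lin_asym])
  also have "\<dots> = Poly_Mapping.single z (hy ^ K * c * c') + (scl (hy ^ K * c) r' + asym K (scl (hy ^ K) r + s))"
    unfolding z(2) by (simp add: scl.scale_right_distrib)
  finally have 1: "asym (Suc K) (basis x) = Poly_Mapping.single z (hy ^ K * c * c') + (scl (hy ^ K * c) r' + asym K (scl (hy ^ K) r + s))" .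
  have 2: "supported (low M (energy M x) (inversions M x + asym_length (Suc K))) (scl (hy ^ K * c) r' + asym K (scl (hy ^ K) r + s))"
  proof (intro supported_add supported_scl)
    show "supported (low M (energy M x) (inversions M x + asym_length (Suc K))) r'"
      by (rule supported_mono[OF z(3)]) (use w(4,5) in \<open>simp add: low_mono\<close>)
  qed (use t in \<open>simp add: add.assoc\<close>)
  have 3: "\<forall>j. entry z j = (if j < Suc K then entry x (Suc K - 1 - j) else entry x j)"
    using z(5) w(6) by (auto simp: less_Suc_eq Suc_diff_Suc)
  have "hy ^ K * c * c' \<noteq> 0" using w(1) z(1) v_facts by simp
  then show ?case using 1 2 3 z(4) w(4)
    by (intro exI[of _ "hy ^ K * c * c'"] exI[of _ "scl (hy ^ K * c) r' + asym K (scl (hy ^ K) r + s)"] exI[of _ z]) simp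
qed

lemma inversions_increasing:
  assumes "\<And>i j. i < j \<Longrightarrow> j < M \<Longrightarrow> entry z i < entry z j"
  shows "inversions M z = asym_length M"
  using assms
proof (induction M)
  case 0
  then show ?case by (simp add: inversions_def)
next
  case (Suc M)
  have "{(i, j). i < j \<and> j < Suc M \<and> entry z i < entry z j} =
      {(i, j). i < j \<and> j < M \<and> entry z i < entry z j} \<union> (\<lambda>i. (i, M)) ` {..<M}"
    using Suc.prems by (auto simp: less_Suc_eq)
  moreover have "card ({(i, j). i < j \<and> j < M \<and> entry z i < entry z j} \<union> (\<lambda>i. (i, M)) ` {..<M}) =
      card {(i, j). i < j \<and> j < M \<and> entry z i < entry z j} + card ((\<lambda>i. (i, M)) ` {..<M})"
    by (rule card_Un_disjoint) (auto simp: finite_pairs_less)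
  moreover have "card ((\<lambda>i. (i, M)) ` {..<M}) = M" by (simp add: card_image inj_on_def)
  moreover have "inversions M z = asym_length M" using Suc by simp
  ultimately show ?case by (simp add: inversions_def)
qed

text \<open>Among the terms with nonzero coefficient one of maximal energy is chosen. Its reversal
  has the largest possible number of inversions, so it lies in no remainder, and it is the reversal
  of no other sequence of the family.\<close>

lemma asym_independent:
  assumes S: "finite S" and dec: "\<And>x i j. x \<in> S \<Longrightarrow> i < j \<Longrightarrow> j < M \<Longrightarrow> entry x j < entry x i"
    and zero: "asym M (\<Sum>x\<in>S. scl (c x) (basis x)) = 0" and x: "x \<in> S"
  shows "c x = 0"
proof (rule ccontr)
  assume "c x \<noteq> 0"
  define S' where "S' = {x \<in> S. c x \<noteq> 0}"
  have S': "finite S'" "x \<in> S'" using S x \<open>c x \<noteq> 0\<close> by (auto simp: S'_def)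
  have "Max (energy M ` S') \<in> energy M ` S'" using S' by (intro Max_in) auto
  then obtain x0 where x0: "x0 \<in> S'" "Max (energy M ` S') = energy M x0" by blast
  have x0max: "energy M x \<le> energy M x0" if "x \<in> S'" for x
    unfolding x0(2)[symmetric] using S'(1) that by (intro Max_ge) auto
  define P where "P x a r z \<longleftrightarrow> a \<noteq> 0 \<and> asym M (basis x) = Poly_Mapping.single z a + r \<and>
    supported (low M (energy M x) (inversions M x + asym_length M)) r \<and> energy M z = energy M x \<and>
    (\<forall>j. entry z j = (if j < M then entry x (M - 1 - j) else entry x j))" for x a r z
  have "\<forall>x\<in>S. \<exists>a r z. P x a r z"
    unfolding P_def using asym_leading[of M M] dec by blast
  then obtain a r z where "\<forall>x\<in>S. P x (a x) (r x) (z x)" by metis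
  then have L: "\<And>x. x \<in> S \<Longrightarrow> a x \<noteq> 0" "\<And>x. x \<in> S \<Longrightarrow> asym M (basis x) = Poly_Mapping.single (z x) (a x) + r x"
    "\<And>x. x \<in> S \<Longrightarrow> supported (low M (energy M x) (inversions M x + asym_length M)) (r x)"
    "\<And>x. x \<in> S \<Longrightarrow> energy M (z x) = energy M x"
    "\<And>x j. x \<in> S \<Longrightarrow> entry (z x) j = (if j < M then entry x (M - 1 - j) else entry x j)"
    unfolding P_def by blast+
  have sub: "x \<in> S" if "x \<in> S'" for x using that by (simp add: S'_def)
  have inv0: "inversions M x = 0" if "x \<in> S" for x
  proof -
    have "{(i, j). i < j \<and> j < M \<and> entry x i < entry x j} = {}"
      using dec[OF that] by (auto simp: not_less[symmetric] dest: order.strict_implies_order order.asym)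
    then show ?thesis unfolding inversions_def by (simp only: card.empty)
  qed
  have top: "inversions M (z x0) = asym_length M"
    by (rule inversions_increasing) (use L(5)[OF sub[OF x0(1)]] dec[OF sub[OF x0(1)]] in auto)
  have inj: "w = x0" if "w \<in> S" "z w = z x0" for w
  proof (rule wedge_seq_eqI)
    fix k
    show "entry w k = entry x0 k"
      using L(5)[OF that(1), of "M - 1 - k"] L(5)[OF sub[OF x0(1)], of "M - 1 - k"]
        L(5)[OF that(1), of k] L(5)[OF sub[OF x0(1)], of k] that(2) by (cases "k < M") auto
  qed
  have trm: "Poly_Mapping.lookup (asym M (basis w)) (z x0) = (if w = x0 then a x0 else 0)" if "w \<in> S'" for w
  proof -
    have "z x0 \<notin> low M (energy M w) (inversions M w + asym_length M)"
      using x0max[OF that] top inv0[OF sub[OF that]] L(4)[OF sub[OF x0(1)]] by (auto simp: low_def)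
    then have "Poly_Mapping.lookup (r w) (z x0) = 0"
      using L(3)[OF sub[OF that]] by (auto simp: supported_lookup)
    then show ?thesis using L(2)[OF sub[OF that]] inj[OF sub[OF that]]
      by (auto simp: lookup_add lookup_single when_def)
  qed
  have "(\<Sum>x\<in>S. scl (c x) (basis x)) = (\<Sum>x\<in>S'. scl (c x) (basis x))"
    by (rule sum.mono_neutral_right) (use S in \<open>auto simp: S'_def\<close>)
  then have "(\<Sum>x\<in>S'. scl (c x) (asym M (basis x))) = 0"
    using zero by (simp only: lin_sum[OF lin_asym] lin_scl[OF lin_asym])
  then have "(\<Sum>w\<in>S'. c w * Poly_Mapping.lookup (asym M (basis w)) (z x0)) = 0"
    by (drule_tac arg_cong[of _ _ "\<lambda>f. Poly_Mapping.lookup f (z x0)"]) (simp add: lookup_sum)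
  moreover have "(\<Sum>w\<in>S'. c w * Poly_Mapping.lookup (asym M (basis w)) (z x0)) = (\<Sum>w\<in>S'. if w = x0 then c x0 * a x0 else 0)"
    by (rule sum.cong[OF refl]) (simp add: trm)
  ultimately have "c x0 * a x0 = 0" using S'(1) x0(1) by simp
  then show False using x0(1) L(1)[OF sub[OF x0(1)]] by (auto simp: S'_def)
qed

section \<open>The relations as the image of the Hecke operators\<close>

text \<open>The relator on two tensor factors, with \<open>g = - q\<close> inserted because it
  concerns incongruent indices.\<close>

definition straight_pair :: "int \<Rightarrow> int \<Rightarrow> (int \<times> int) \<Rightarrow>\<^sub>0 complex" where
  "straight_pair l p = (let d = (p - l) mod N in basis (l, p) -
     (scl (- q) (basis (p, l)) + scl (v - 1)
       ((\<Sum>t | l + int t * N + d < p - int t * N - d. scl (v ^ t) (basis (p - int t * N - d, l + int t * N + d))) +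
        (\<Sum>t | l + (int t + 1) * N < p - (int t + 1) * N.
           scl (v ^ t * - q) (basis (p - (int t + 1) * N, l + (int t + 1) * N))))))"

definition cong_pair :: "int \<Rightarrow> int \<Rightarrow> (int \<times> int) \<Rightarrow>\<^sub>0 complex" where
  "cong_pair l p = basis (l, p) + basis (p, l)"

definition relator_pairs :: "((int \<times> int) \<Rightarrow>\<^sub>0 complex) set" where
  "relator_pairs = {cong_pair l p | l p. (p - l) mod N = 0} \<union>
     {straight_pair l p | l p. l < p \<and> (p - l) mod N \<noteq> 0}"

definition sym_pair :: "int \<Rightarrow> int \<Rightarrow> (int \<times> int) \<Rightarrow>\<^sub>0 complex" where
  "sym_pair l p = hecke_pair l p + basis (l, p)"

lemma hecke_pair_increasing:
  assumes "l \<le> p"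
  shows "hecke_pair l p = scl (if (p - l) mod N = 0 then v else q) (basis (p, l))
     - scl (v - 1) (\<Sum>k<nat ((p - l) div N). basis (p - N * int k - (p - l) mod N, l + N * int k + (p - l) mod N))"
proof -
  have "(l - p + N - 1) div N \<le> 0"
  proof (rule ccontr)
    assume "\<not> ?thesis"
    then have "N * 1 \<le> N * ((l - p + N - 1) div N)" using N_pos by (intro mult_left_mono) auto
    also have "\<dots> \<le> l - p + N - 1" using N_pos mult_div_mod_eq[of N "l - p + N - 1"] pos_mod_sign[OF N_pos, of "l - p + N - 1"] by linarith
    finally show False using assms by simp
  qed
  then have "nat ((l - p + N - 1) div N) = 0" by simp
  then show ?thesis unfolding hecke_pair_def by (simp only: lessThan_0 sum.empty scl.scale_zero_right add_0_right)
qed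

lemma finite_straight_range: "finite {t. a + int t * N < b}"
proof (rule finite_subset)
  show "{t. a + int t * N < b} \<subseteq> {..nat (b - a)}"
  proof
    fix t assume "t \<in> {t. a + int t * N < b}"
    moreover have "int t * 1 \<le> int t * N" using n by (intro mult_left_mono) auto
    ultimately show "t \<in> {..nat (b - a)}" by simp
  qed
qed simp

lemma mod_shift2: "(p - N - (l + N)) mod N = (p - l) mod N"
proof -
  have "p - N - (l + N) = (p - l) + (- 2) * N" by simp
  then show ?thesis by (metis mod_mult_self1)
qed

text \<open>The factor \<open>v\<close> aligns the weights \<open>v ^ t\<close> of the inner relator
  with those of the outer one, so that in both sums only the term \<open>t = 0\<close> survives. The
  right-hand side is the same as in \<open>sym_pair_rec\<close>.\<close>

lemma straight_pair_rec:
  assumes lp: "2 * N < p - l"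
  shows "straight_pair l p - scl v (straight_pair (l + N) (p - N)) =
    basis (l, p) + scl q (basis (p, l)) - scl (v - 1) (basis (p - (p - l) mod N, l + (p - l) mod N))
    - scl q (basis (p - N, l + N)) - scl v (basis (l + N, p - N))"
proof -
  define d where "d = (p - l) mod N"
  have d: "0 \<le> d" "d < N" using N_pos by (auto simp: d_def)
  have shift: "(\<Sum>t | P t. f t) = f 0 + (\<Sum>t | P (Suc t). f (Suc t))"
    if "P 0" "finite {t. P t}" for P and f :: "nat \<Rightarrow> (int \<times> int) \<Rightarrow>\<^sub>0 complex"
  proof -
    have S: "{t. P t} = insert 0 (Suc ` {t. P (Suc t)})"
    proof (rule set_eqI)
      fix t show "t \<in> {t. P t} \<longleftrightarrow> t \<in> insert 0 (Suc ` {t. P (Suc t)})"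
        using that(1) by (cases t) auto
    qed
    have "finite (Suc ` {t. P (Suc t)})" using that(2) unfolding S by simp
    then show ?thesis by (subst S) (simp add: sum.reindex)
  qed
  have fin1: "finite {t. l + int t * N + d < p - int t * N - d}"
    by (rule finite_subset[OF _ finite_straight_range[of l p]]) (use d N_pos in \<open>auto intro: order.strict_trans1[rotated]\<close>)
  have fin2: "finite {t. l + (int t + 1) * N < p - (int t + 1) * N}"
  proof (rule finite_subset[OF _ finite_straight_range[of l p]], rule subsetI)
    fix t assume t: "t \<in> {t. l + (int t + 1) * N < p - (int t + 1) * N}"
    have "0 \<le> int t * N" "(int t + 1) * N = int t * N + N" using N_pos by (simp_all add: distrib_right)
    then have "l + int t * N < p" using t N_pos unfolding mem_Collect_eq by linarith
    then show "t \<in> {t. l + int t * N < p}" by simp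
  qed
  have 1: "(\<Sum>t | l + int t * N + d < p - int t * N - d. scl (v ^ t) (basis (p - int t * N - d, l + int t * N + d)))
      = basis (p - d, l + d) + scl v (\<Sum>t | l + N + int t * N + d < p - N - int t * N - d.
          scl (v ^ t) (basis (p - N - int t * N - d, l + N + int t * N + d)))"
    by (subst shift) (use fin1 lp d in \<open>simp_all add: scl.scale_sum_right algebra_simps del: scl_single\<close>)
  have 2: "(\<Sum>t | l + (int t + 1) * N < p - (int t + 1) * N. scl (v ^ t * - q) (basis (p - (int t + 1) * N, l + (int t + 1) * N)))
      = scl (- q) (basis (p - N, l + N)) + scl v (\<Sum>t | l + N + (int t + 1) * N < p - N - (int t + 1) * N.
          scl (v ^ t * - q) (basis (p - N - (int t + 1) * N, l + N + (int t + 1) * N)))"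
    by (subst shift) (use fin2 lp in \<open>simp_all add: scl.scale_sum_right algebra_simps del: scl_single\<close>)
  show ?thesis
    unfolding straight_pair_def Let_def mod_shift2 d_def[symmetric] 1 2
    by (rule poly_mapping_eqI) (simp add: lookup_add lookup_minus algebra_simps del: scl_single)
qed

text \<open>The constant weights cancel without any factor: only the first and the last term of the
  longer sum survive.\<close>

lemma sym_pair_rec:
  assumes lp: "2 * N < p - l" and nc: "(p - l) mod N \<noteq> 0"
  shows "sym_pair l p - sym_pair (l + N) (p - N) =
    basis (l, p) + scl q (basis (p, l)) - scl (v - 1) (basis (p - (p - l) mod N, l + (p - l) mod N))
    - scl q (basis (p - N, l + N)) - scl v (basis (l + N, p - N))"
proof -
  define d where "d = (p - l) mod N"
  define K where "K = nat ((p - N - (l + N)) div N)"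
  have "p - N - (l + N) = (p - l) + (- 2) * N" by simp
  then have dv: "(p - N - (l + N)) div N = (p - l) div N - 2"
    using N_pos div_mult_self1[of N "p - l" "- 2"] by (metis add.commute uminus_add_conv_diff less_irrefl)
  have "0 \<le> (p - N - (l + N)) div N" using lp N_pos by (simp add: pos_imp_zdiv_nonneg_iff)
  then have K: "nat ((p - l) div N) = Suc (Suc K)" "int K + 2 = (p - l) div N"
    unfolding K_def dv by simp_all
  have "N * (int K + 2) + d = p - l" unfolding K(2) d_def by simp
  then have last: "p - N * int (Suc K) - d = l + N" "l + N * int (Suc K) + d = p - N"
    by (simp_all add: algebra_simps)
  have s: "(\<Sum>k<Suc (Suc K). basis (p - N * int k - d, l + N * int k + d)) =
      basis (p - d, l + d) + (\<Sum>k<K. basis (p - N - N * int k - d, l + N + N * int k + d)) + basis (l + N, p - N)"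
  proof -
    have "basis (p - N * int (Suc k) - d, l + N * int (Suc k) + d) =
        basis (p - N - N * int k - d, l + N + N * int k + d)" for k
      by (simp add: algebra_simps)
    moreover have "(\<Sum>k<Suc (Suc K). f k) = f 0 + (\<Sum>k<K. f (Suc k)) + f (Suc K)"
      for f :: "nat \<Rightarrow> (int \<times> int) \<Rightarrow>\<^sub>0 complex"
      by (simp only: sum.lessThan_Suc[of _ "Suc K"] sum.lessThan_Suc_shift[of _ K])
    ultimately show ?thesis by (simp only: last) simp
  qed
  have 1: "hecke_pair l p = scl q (basis (p, l)) - scl (v - 1) (\<Sum>k<Suc (Suc K). basis (p - N * int k - d, l + N * int k + d))"
    using hecke_pair_increasing[of l p] lp N_pos nc unfolding K(1) d_def by simp
  have 2: "hecke_pair (l + N) (p - N) = scl q (basis (p - N, l + N)) -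
      scl (v - 1) (\<Sum>k<K. basis (p - N - N * int k - d, l + N + N * int k + d))"
    using hecke_pair_increasing[of "l + N" "p - N"] lp nc unfolding mod_shift2 d_def K_def by simp
  show ?thesis
    unfolding sym_pair_def 1 2 s d_def[symmetric]
    by (rule poly_mapping_eqI) (simp add: lookup_add lookup_minus algebra_simps del: scl_single)
qed

text \<open>The base of the comparison: the sums have at most the term with weight
  \<open>v ^ 0\<close>.\<close>

lemma straight_pair_eq_sym_pair:
  assumes "l < p" "p - l < 2 * N" and nc: "(p - l) mod N \<noteq> 0"
  shows "straight_pair l p = sym_pair l p"
proof -
  define d where "d = (p - l) mod N"
  have d: "0 < d" "d < N"
    using nc pos_mod_sign[OF N_pos, of "p - l"] pos_mod_bound[OF N_pos, of "p - l"] unfolding d_def by linarith+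
  have e2: "{t. l + (int t + 1) * N < p - (int t + 1) * N} = {}"
  proof -
    have "N * 1 \<le> (int t + 1) * N" for t using N_pos by (simp add: algebra_simps)
    then have "\<not> l + (int t + 1) * N < p - (int t + 1) * N" for t using assms(2) by (smt (verit))
    then show ?thesis by simp
  qed
  show ?thesis
  proof (cases "p - l < N")
    case True
    then have dd: "d = p - l" unfolding d_def using assms(1) by (intro mod_pos_pos_trivial) auto
    have e1: "{t. l + int t * N + d < p - int t * N - d} = {}"
    proof -
      have "0 \<le> int t * N" for t using N_pos by simp
      then have "\<not> l + int t * N + d < p - int t * N - d" for t using dd assms(1) by (smt (verit))
      then show ?thesis by simp
    qed
    have "(p - l) div N = 0" using True assms(1) by (intro div_pos_pos_trivial) auto
    then have "hecke_pair l p = scl q (basis (p, l))"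
      using hecke_pair_increasing[of l p] assms(1) nc by simp
    then show ?thesis unfolding straight_pair_def Let_def d_def[symmetric] e1 e2 sym_pair_def
      by (simp add: single_uminus)
  next
    case False
    have "(p - l) div N = 1"
    proof -
      have "(p - l) div N = (p - l - N) div N + 1" using div_add_self2[of N "p - l - N"] N_pos by simp
      also have "(p - l - N) div N = 0" using False assms(2) by (intro div_pos_pos_trivial) auto
      finally show ?thesis by simp
    qed
    then have pl: "p - l = N + d" using mult_div_mod_eq[of N "p - l"] by (simp add: d_def)
    have e1: "{t. l + int t * N + d < p - int t * N - d} = {0}"
    proof (intro subset_antisym subsetI)
      fix t assume t: "t \<in> {t. l + int t * N + d < p - int t * N - d}"
      show "t \<in> {0}"
      proof (rule ccontr)
        assume "t \<notin> {0}"
        then have "1 * N \<le> int t * N" using N_pos by (intro mult_right_mono) auto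
        then show False using t pl d unfolding mem_Collect_eq by linarith
      qed
    qed (use pl d in auto)
    have hp: "hecke_pair l p = scl q (basis (p, l)) - scl (v - 1) (basis (p - d, l + d))"
      using hecke_pair_increasing[of l p] assms(1) nc \<open>(p - l) div N = 1\<close> by (simp add: d_def[symmetric])
    show ?thesis unfolding straight_pair_def Let_def d_def[symmetric] e1 e2 sym_pair_def hp
      by (intro poly_mapping_eqI) (simp add: lookup_add lookup_minus algebra_simps del: scl_single)
  qed
qed

lemma reflect_sum:
  fixes f :: "nat \<Rightarrow> (int \<times> int) \<Rightarrow>\<^sub>0 complex"
  assumes "\<And>k. k \<in> {1..<K} \<Longrightarrow> g k = f k + f (K - k)"
  shows "(\<Sum>k\<in>{1..<K}. f k) = scl (1 / 2) (\<Sum>k\<in>{1..<K}. g k)"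
proof -
  have "(\<Sum>k\<in>{1..<K}. f (K - k)) = (\<Sum>k\<in>{1..<K}. f k)"
    by (rule sum.reindex_bij_witness[of _ "\<lambda>k. K - k" "\<lambda>k. K - k"]) auto
  then have "(\<Sum>k\<in>{1..<K}. g k) = (\<Sum>k\<in>{1..<K}. f k) + (\<Sum>k\<in>{1..<K}. f k)"
    using assms by (simp add: sum.distrib)
  then show ?thesis by (intro poly_mapping_eqI) (simp add: lookup_add)
qed

lemma sum_lessThan_split0:
  fixes f :: "nat \<Rightarrow> (int \<times> int) \<Rightarrow>\<^sub>0 complex"
  shows "K > 0 \<Longrightarrow> (\<Sum>k<K. f k) = f 0 + (\<Sum>k\<in>{1..<K}. f k)"
  by (subst atLeast0LessThan[symmetric]) (simp add: sum.atLeast_Suc_lessThan)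

text \<open>The term \<open>k = 0\<close> turns the coefficient \<open>v\<close> of the swapped pair
  into 1. The rest of the sum is invariant under \<open>k \<mapsto> K - k\<close>, which swaps the
  two entries; this explains the factor 1 / 2.\<close>

lemma cong_pair_increasing:
  assumes lp: "l < p" and c: "(p - l) mod N = 0"
  defines "K \<equiv> nat ((p - l) div N)"
  shows "sym_pair l p = cong_pair l p - scl ((v - 1) / 2) (\<Sum>k\<in>{1..<K}. cong_pair (p - N * int k) (l + N * int k))"
proof -
  have NK: "N * int K = p - l" using c lp N_pos mult_div_mod_eq[of N "p - l"] by (simp add: K_def pos_imp_zdiv_nonneg_iff)
  then have K0: "K > 0" using lp by (cases K) auto
  have r: "(\<Sum>k\<in>{1..<K}. basis (p - N * int k, l + N * int k)) =
      scl (1 / 2) (\<Sum>k\<in>{1..<K}. cong_pair (p - N * int k) (l + N * int k))"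
  proof (rule reflect_sum)
    fix k assume k: "k \<in> {1..<K}"
    then have "p - N * int (K - k) = l + N * int k" "l + N * int (K - k) = p - N * int k"
      using NK by (simp_all add: of_nat_diff right_diff_distrib)
    then show "cong_pair (p - N * int k) (l + N * int k) =
        basis (p - N * int k, l + N * int k) + basis (p - N * int (K - k), l + N * int (K - k))"
      unfolding cong_pair_def by (simp only:)
  qed
  have h: "hecke_pair l p = scl v (basis (p, l)) - scl (v - 1) (\<Sum>k<K. basis (p - N * int k, l + N * int k))"
    using hecke_pair_increasing[of l p] lp c by (simp add: K_def)
  define S where "S = (\<Sum>k\<in>{1..<K}. cong_pair (p - N * int k) (l + N * int k))"
  show ?thesis
    unfolding sym_pair_def h sum_lessThan_split0[OF K0] r S_def[symmetric] cong_pair_def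
    by (rule poly_mapping_eqI) (simp add: lookup_add lookup_minus field_simps del: scl_single)
qed

lemma cong_pair_decreasing:
  assumes lp: "p < l" and c: "(p - l) mod N = 0"
  defines "K \<equiv> nat ((l - p) div N)"
  shows "sym_pair l p = scl v (cong_pair l p) + scl ((v - 1) / 2) (\<Sum>k\<in>{1..<K}. cong_pair (l - N * int k) (p + N * int k))"
proof -
  have "N dvd p - l" using c by auto
  then have "N dvd l - p" by (simp add: dvd_diff_commute)
  then have NK: "N * int K = l - p" using lp N_pos by (simp add: K_def pos_imp_zdiv_nonneg_iff)
  then have K0: "K > 0" using lp by (cases K) auto
  have r: "(\<Sum>k\<in>{1..<K}. basis (l - N * int k, p + N * int k)) =
      scl (1 / 2) (\<Sum>k\<in>{1..<K}. cong_pair (l - N * int k) (p + N * int k))"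
  proof (rule reflect_sum)
    fix k assume k: "k \<in> {1..<K}"
    then have "l - N * int (K - k) = p + N * int k" "p + N * int (K - k) = l - N * int k"
      using NK by (simp_all add: of_nat_diff right_diff_distrib)
    then show "cong_pair (l - N * int k) (p + N * int k) =
        basis (l - N * int k, p + N * int k) + basis (l - N * int (K - k), p + N * int (K - k))"
      unfolding cong_pair_def by (simp only:)
  qed
  have "(l - p + N - 1) div N = (N - 1 + N * int K) div N" unfolding NK by (simp add: algebra_simps)
  also have "\<dots> = int K + (N - 1) div N" using N_pos by (intro div_mult_self2) simp
  also have "(N - 1) div N = 0" using N_pos by (intro div_pos_pos_trivial) auto
  finally have K1: "nat ((l - p + N - 1) div N) = K" by simp
  have "(p - l) div N < 0" using lp N_pos by (simp add: pos_imp_zdiv_neg_iff)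
  then have K2: "nat ((p - l) div N) = 0" by simp
  have h: "hecke_pair l p = scl v (basis (p, l)) + scl (v - 1) (\<Sum>k<K. basis (l - N * int k, p + N * int k))"
    using c unfolding hecke_pair_def K1 K2 by simp
  define S where "S = (\<Sum>k\<in>{1..<K}. cong_pair (l - N * int k) (p + N * int k))"
  show ?thesis
    unfolding sym_pair_def h sum_lessThan_split0[OF K0] r S_def[symmetric] cong_pair_def
    by (rule poly_mapping_eqI) (simp add: lookup_add lookup_minus field_simps del: scl_single)
qed

lemma cong_pair_equal: "sym_pair l l = scl ((1 + v) / 2) (cong_pair l l)"
proof -
  have "hecke_pair l l = scl v (basis (l, l))" using hecke_pair_close[of l l] N_pos by simp
  then show ?thesis
    by (intro poly_mapping_eqI) (simp add: sym_pair_def lookup_add cong_pair_def algebra_simps del: scl_single)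
qed

lemma cong_pair_commute: "cong_pair l p = cong_pair p l"
  by (simp add: cong_pair_def add.commute)

abbreviation "sym_pairs \<equiv> range (\<lambda>(l, p). sym_pair l p)"

lemma sym_pair_in: "sym_pair l p \<in> scl.span sym_pairs"
  by (rule scl.span_base) auto

text \<open>\<open>cong_pair_increasing\<close> is triangular with respect to the gap, hence
  invertible; the pair of equal entries requires a division by \<open>1 + v\<close>.\<close>

lemma cong_pair_in_span: "(p - l) mod N = 0 \<Longrightarrow> l \<le> p \<Longrightarrow> cong_pair l p \<in> scl.span sym_pairs"
proof (induction "nat (p - l)" arbitrary: l p rule: less_induct)
  case less
  show ?case
  proof (cases "l = p")
    case True
    have "cong_pair l l = scl (2 / (1 + v)) (sym_pair l l)"
    proof -
      have "2 / w * (w / 2) = 1" if "w \<noteq> 0" for w :: complex using that by simp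
      from this[OF v_facts(3)] have "2 / (1 + v) * ((1 + v) / 2) = 1" .
      then show ?thesis unfolding cong_pair_equal scl.scale_scale by (simp only: scl.scale_one)
    qed
    then show ?thesis using True scl.span_scale[OF sym_pair_in] by metis
  next
    case False
    then have lp: "l < p" using less.prems by simp
    let ?K = "nat ((p - l) div N)"
    have NK: "N * int ?K = p - l" using less.prems lp N_pos mult_div_mod_eq[of N "p - l"]
      by (simp add: pos_imp_zdiv_nonneg_iff)
    have "cong_pair (p - N * int k) (l + N * int k) \<in> scl.span sym_pairs" if k: "k \<in> {1..<?K}" for k
    proof -
      have "N * 1 \<le> N * int k" "N * (int k + 1) \<le> N * int ?K" using k N_pos by (auto intro!: mult_left_mono)
      then have b: "0 < N * int k" "N * int k < p - l" using N_pos NK by (auto simp: algebra_simps)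
      have h1: "nat ((l + N * int k) - (p - N * int k)) < nat (p - l)" "nat ((p - N * int k) - (l + N * int k)) < nat (p - l)"
        using b lp by linarith+
      have m1: "((p - N * int k) - (l + N * int k)) mod N = 0" "((l + N * int k) - (p - N * int k)) mod N = 0"
      proof -
        have "N dvd p - l" using less.prems by auto
        then have "N dvd (p - l) - 2 * (N * int k)" "N dvd 2 * (N * int k) - (p - l)" by (auto intro: dvd_diff)
        moreover have "(p - l) - 2 * (N * int k) = (p - N * int k) - (l + N * int k)"
          "2 * (N * int k) - (p - l) = (l + N * int k) - (p - N * int k)" by simp_all
        ultimately show "((p - N * int k) - (l + N * int k)) mod N = 0" "((l + N * int k) - (p - N * int k)) mod N = 0"
          by (simp_all only: mod_eq_0_iff_dvd)
      qed
      show ?thesis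
      proof (cases "p - N * int k \<le> l + N * int k")
        case True
        show ?thesis by (rule less.hyps[OF h1(1) m1(2) True])
      next
        case False
        then have "l + N * int k \<le> p - N * int k" by linarith
        then show ?thesis by (subst cong_pair_commute) (rule less.hyps[OF h1(2) m1(1)])
      qed
    qed
    then have "sym_pair l p + scl ((v - 1) / 2) (\<Sum>k\<in>{1..<?K}. cong_pair (p - N * int k) (l + N * int k)) \<in> scl.span sym_pairs"
      by (intro scl.span_add scl.span_scale scl.span_sum sym_pair_in) auto
    then show ?thesis unfolding cong_pair_increasing[OF lp less.prems(1)] by simp
  qed
qed

text \<open>Equating \<open>straight_pair_rec\<close> and \<open>sym_pair_rec\<close> expresses a
  relator by two elements of \<open>sym_pairs\<close> and a relator with a smaller gap.\<close>

lemma straight_pair_in_span: "(p - l) mod N \<noteq> 0 \<Longrightarrow> l < p \<Longrightarrow> straight_pair l p \<in> scl.span sym_pairs"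
proof (induction "nat (p - l)" arbitrary: l p rule: less_induct)
  case less
  show ?case
  proof (cases "p - l < 2 * N")
    case True
    then show ?thesis using straight_pair_eq_sym_pair[OF less.prems(2) True less.prems(1)] sym_pair_in by simp
  next
    case False
    have "p - l \<noteq> 2 * N" using less.prems(1) by auto
    then have lp: "2 * N < p - l" using False by simp
    have m: "(p - N - (l + N)) mod N \<noteq> 0" using less.prems by (simp only: mod_shift2) simp
    have h1: "nat (p - N - (l + N)) < nat (p - l)" and h2: "l + N < p - N" using lp N_pos by simp_all
    have "straight_pair (l + N) (p - N) \<in> scl.span sym_pairs" by (rule less.hyps[OF h1 m h2])
    then have "scl v (straight_pair (l + N) (p - N)) + (sym_pair l p - sym_pair (l + N) (p - N)) \<in> scl.span sym_pairs"
      by (intro scl.span_add scl.span_scale scl.span_diff sym_pair_in)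
    moreover have "straight_pair l p = scl v (straight_pair (l + N) (p - N)) + (sym_pair l p - sym_pair (l + N) (p - N))"
      unfolding sym_pair_rec[OF lp less.prems(1)] straight_pair_rec[OF lp, symmetric] by simp
    ultimately show ?thesis by simp
  qed
qed

lemma cong_pair_rel: "(p - l) mod N = 0 \<Longrightarrow> cong_pair l p \<in> scl.span relator_pairs"
  unfolding relator_pairs_def
  by (rule scl.span_base, rule UnI1, rule CollectI, rule exI[of _ l], rule exI[of _ p]) simp

lemma sym_pair_increasing_in_span: "(p - l) mod N \<noteq> 0 \<Longrightarrow> l < p \<Longrightarrow> sym_pair l p \<in> scl.span relator_pairs"
proof (induction "nat (p - l)" arbitrary: l p rule: less_induct)
  case less
  have s: "straight_pair l p \<in> scl.span relator_pairs" if "(p - l) mod N \<noteq> 0" "l < p" for l p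
    unfolding relator_pairs_def by (rule scl.span_base) (use that in blast)
  show ?case
  proof (cases "p - l < 2 * N")
    case True
    then show ?thesis using straight_pair_eq_sym_pair[OF less.prems(2) True less.prems(1)] s less.prems by metis
  next
    case False
    have "p - l \<noteq> 2 * N" using less.prems(1) by auto
    then have lp: "2 * N < p - l" using False by simp
    have m: "(p - N - (l + N)) mod N \<noteq> 0" using less.prems by (simp only: mod_shift2) simp
    have h1: "nat (p - N - (l + N)) < nat (p - l)" and h2: "l + N < p - N" using lp N_pos by simp_all
    have "sym_pair (l + N) (p - N) \<in> scl.span relator_pairs" by (rule less.hyps[OF h1 m h2])
    moreover have "straight_pair (l + N) (p - N) \<in> scl.span relator_pairs"
      by (rule s[OF m h2])
    ultimately have "sym_pair (l + N) (p - N) + (straight_pair l p - scl v (straight_pair (l + N) (p - N))) \<in> scl.span relator_pairs"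
      using s[OF less.prems] by (intro scl.span_add scl.span_scale scl.span_diff)
    moreover have "sym_pair l p = sym_pair (l + N) (p - N) + (straight_pair l p - scl v (straight_pair (l + N) (p - N)))"
      unfolding straight_pair_rec[OF lp] sym_pair_rec[OF lp less.prems(1), symmetric] by simp
    ultimately show ?thesis by simp
  qed
qed

text \<open>
  For \<open>l > p\<close> the quadratic relation expresses \<open>(T + 1) (u\<^sub>l \<otimes> u\<^sub>p)\<close> through pairs that are either
  in increasing order or closer together.
\<close>

lemma sym_pair_decreasing:
  assumes lp: "p < l" and nc: "(l - p) mod N \<noteq> 0"
  shows "scl q (sym_pair l p) = scl v (sym_pair p l) +
    scl (v - 1) (\<Sum>k<nat ((l - p) div N). sym_pair (l - N * int k - (l - p) mod N) (p + N * int k + (l - p) mod N))"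
proof -
  let ?S = "\<Sum>k<nat ((l - p) div N). basis (l - N * int k - (l - p) mod N, p + N * int k + (l - p) mod N)"
  have h: "hecke_pair p l = scl q (basis (l, p)) - scl (v - 1) ?S"
    using hecke_pair_increasing[of p l] lp nc by simp
  \<comment> \<open>\<open>(T + 1) T = v (T + 1)\<close> is a form of the quadratic
    relation.\<close>
  have "hecke2 (hecke_pair p l) + hecke_pair p l = scl v (sym_pair p l)"
    using hecke2_quadratic[of "basis (p, l)"]
    by (intro poly_mapping_eqI) (simp add: sym_pair_def lookup_add algebra_simps)
  moreover have "hecke2 (scl q (basis (l, p)) - scl (v - 1) ?S) + (scl q (basis (l, p)) - scl (v - 1) ?S) =
      scl q (sym_pair l p) - scl (v - 1) (\<Sum>k<nat ((l - p) div N). sym_pair (l - N * int k - (l - p) mod N) (p + N * int k + (l - p) mod N))"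
    unfolding hecke2_simps hecke2_basis sym_pair_def sum.distrib
    by (rule poly_mapping_eqI) (simp add: lookup_add lookup_minus algebra_simps del: scl_single)
  ultimately show ?thesis unfolding h by (simp add: algebra_simps)
qed

text \<open>Congruent pairs have explicit formulas and increasing ones the recursion. For decreasing
  incongruent pairs \<open>sym_pair_decreasing\<close> is divided by \<open>q\<close>; the pairs
  inside its sum have a smaller gap.\<close>

lemma sym_pair_in_span: "sym_pair l p \<in> scl.span relator_pairs"
proof (induction "nat \<bar>l - p\<bar>" arbitrary: l p rule: less_induct)
  case less
  show ?case
  proof (cases "(p - l) mod N = 0")
    case True
    have dv: "N dvd p - l" using True by auto
    have c: "cong_pair (p - N * int k) (l + N * int k) \<in> scl.span relator_pairs"
      "cong_pair (l - N * int k) (p + N * int k) \<in> scl.span relator_pairs" for k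
    proof -
      have "N dvd 2 * (N * int k) - (p - l)" "N dvd 2 * (N * int k) + (p - l)" using dv by (auto intro: dvd_diff dvd_add)
      moreover have "2 * (N * int k) - (p - l) = (l + N * int k) - (p - N * int k)"
        "2 * (N * int k) + (p - l) = (p + N * int k) - (l - N * int k)" by simp_all
      ultimately show "cong_pair (p - N * int k) (l + N * int k) \<in> scl.span relator_pairs"
        "cong_pair (l - N * int k) (p + N * int k) \<in> scl.span relator_pairs"
        by (intro cong_pair_rel; simp only: mod_eq_0_iff_dvd)+
    qed
    show ?thesis
    proof (cases l p rule: linorder_cases)
      case less
      then show ?thesis unfolding cong_pair_increasing[OF less True]
        by (intro scl.span_diff scl.span_scale scl.span_sum c cong_pair_rel True)
    next
      case equal
      then show ?thesis unfolding equal cong_pair_equal by (intro scl.span_scale cong_pair_rel) simp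
    next
      case greater
      then show ?thesis unfolding cong_pair_decreasing[OF greater True]
        by (intro scl.span_add scl.span_scale scl.span_sum c cong_pair_rel True)
    qed
  next
    case False
    have nc: "(l - p) mod N \<noteq> 0"
    proof
      assume "(l - p) mod N = 0"
      then have "N dvd l - p" by auto
      then have "N dvd p - l" by (simp add: dvd_diff_commute)
      then show False using False by simp
    qed
    show ?thesis
    proof (cases "l < p")
      case True
      then show ?thesis using sym_pair_increasing_in_span False by simp
    next
      case F: False
      then have lp: "p < l" using False by (cases "l = p") auto
      have inner: "sym_pair (l - N * int k - (l - p) mod N) (p + N * int k + (l - p) mod N) \<in> scl.span relator_pairs"
        if "k < nat ((l - p) div N)" for k
      proof (rule less.hyps)
        let ?s = "N * int k + (l - p) mod N"
        have "int k < (l - p) div N" using that by simp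
        then have "N * (int k + 1) \<le> N * ((l - p) div N)" using N_pos by (intro mult_left_mono) auto
        then have "?s < l - p" using mult_div_mod_eq[of N "l - p"] distrib_left[of N "int k" 1] N_pos by linarith
        moreover have "0 < (l - p) mod N" using nc pos_mod_sign[OF N_pos, of "l - p"] by linarith
        moreover have "0 \<le> N * int k" using N_pos by simp
        ultimately show "nat \<bar>l - N * int k - (l - p) mod N - (p + N * int k + (l - p) mod N)\<bar> < nat \<bar>l - p\<bar>"
          by linarith
      qed
      have "scl q (sym_pair l p) \<in> scl.span relator_pairs"
        unfolding sym_pair_decreasing[OF lp nc]
        by (intro scl.span_add scl.span_scale scl.span_sum inner sym_pair_increasing_in_span) (use lp nc in auto)
      then have "scl (1 / q) (scl q (sym_pair l p)) \<in> scl.span relator_pairs" by (rule scl.span_scale)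
      then show ?thesis using q0 by simp
    qed
  qed
qed

lemma span_relator_pairs: "scl.span relator_pairs = scl.span sym_pairs"
proof (rule scl.span_unique[symmetric])
  show "sym_pairs \<subseteq> scl.span relator_pairs" using sym_pair_in_span by auto
  show "scl.subspace (scl.span relator_pairs)" by simp
  show "scl.span relator_pairs \<subseteq> T" if "sym_pairs \<subseteq> T" "scl.subspace T" for T
  proof (rule scl.span_minimal[OF _ that(2)])
    have "scl.span sym_pairs \<subseteq> T" using that by (intro scl.span_minimal)
    moreover have "cong_pair l p \<in> scl.span sym_pairs" if "(p - l) mod N = 0" for l p
    proof (cases "l \<le> p")
      case False
      have "N dvd p - l" using that by auto
      then have "(l - p) mod N = 0" by (simp add: dvd_diff_commute)
      then show ?thesis using cong_pair_in_span[of l p] False by (simp add: cong_pair_commute[of l p])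
    next
      case True
      show ?thesis by (rule cong_pair_in_span[OF that True])
    qed
    ultimately show "relator_pairs \<subseteq> T" using straight_pair_in_span by (auto simp: relator_pairs_def)
  qed
qed

end

section \<open>Straightening\<close>

text \<open>The deviation from the vacuum sequence. Straightening preserves it, and on kets it is
  the size of the partition; it provides the grading of the Fock space.\<close>

definition wedge_degree :: "wedge_seq \<Rightarrow> int" where
  "wedge_degree x = (\<Sum>j | entry x j \<noteq> - int j. entry x j + int j)"

lemma wedge_tail_obtain:
  fixes x :: wedge_seq obtains M where "\<And>j. j \<ge> M \<Longrightarrow> entry x j = - int j"
  using entry[of x] by (auto simp: eventually_sequentially)

lemma wedge_degree_eq:
  assumes "\<And>j. j \<ge> M \<Longrightarrow> entry x j = - int j"
  shows "wedge_degree x = (\<Sum>j<M. entry x j + int j)"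
  unfolding wedge_degree_def
  by (rule sum.mono_neutral_left) (use assms in \<open>auto simp: not_le[symmetric]\<close>)

definition partition_size :: "int_partition \<Rightarrow> nat" where
  "partition_size lam = (\<Sum>j | part lam j \<noteq> 0. part lam j)"

lemma entry_partition_seq: "entry (partition_seq lam) j = int (part lam j) - int j"
  by (simp add: partition_seq.rep_eq)

lemma wedge_degree_partition_seq: "wedge_degree (partition_seq lam) = int (partition_size lam)"
  by (simp add: wedge_degree_def partition_size_def entry_partition_seq)

lemma partition_seq_decreasing: "i < j \<Longrightarrow> entry (partition_seq lam) j < entry (partition_seq lam) i"
  using part_antimono[of i j lam] by (simp add: entry_partition_seq)

lemma partition_seq_inject: "partition_seq lam = partition_seq \<mu> \<Longrightarrow> lam = \<mu>"
proof -
  assume eq: "partition_seq lam = partition_seq \<mu>"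
  have "part lam j = part \<mu> j" for j
    using arg_cong[OF eq, of "\<lambda>x. entry x j"] by (simp add: entry_partition_seq)
  then show ?thesis by (simp add: part_inject[symmetric] fun_eq_iff)
qed

lemma decreasing_eq_partition_seq:
  assumes "\<And>j. entry x (Suc j) < entry x j"
  shows "\<exists>lam. x = partition_seq lam"
proof -
  obtain M where M: "\<And>j. j \<ge> M \<Longrightarrow> entry x j = - int j" using wedge_tail_obtain[of x] by metis
  let ?g = "\<lambda>j. entry x j + int j"
  have step: "?g (Suc j) \<le> ?g j" for j using assms[of j] by simp
  have anti: "?g j \<le> ?g i" if "i \<le> j" for i j by (rule lift_Suc_antimono_le[of ?g, OF step that])
  have nn: "0 \<le> ?g j" for j using anti[of j "max j M"] M[of "max j M"] by simp
  let ?f = "\<lambda>j. nat (?g j)"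
  have "antimono ?f" by (rule antimonoI) (use anti in \<open>simp add: nat_mono\<close>)
  moreover have "finite {j. ?f j \<noteq> 0}"
    by (rule finite_subset[of _ "{..<M}"]) (use M in \<open>auto simp: not_le[symmetric]\<close>)
  ultimately have "part (Abs_int_partition ?f) = ?f" by (intro Abs_int_partition_inverse CollectI conjI)
  then have "x = partition_seq (Abs_int_partition ?f)"
    by (intro wedge_seq_eqI) (simp add: entry_partition_seq nn)
  then show ?thesis ..
qed

lemma wedge_eq_basis: "wedge = basis"
  by (simp add: fun_eq_iff wedge_def)

context fock
begin

section \<open>The subspace of relations\<close>

abbreviation null :: "wedge_vec set" where "null \<equiv> fock_null n q"

lemma null_eq_span: "null = scl.span (fock_relators n q)"
  by (simp add: fock_null_def scale_wedge_eq)

lemma subspace_null: "scl.subspace null"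
  by (simp add: null_eq_span)

lemmas null_0 = scl.subspace_0[OF subspace_null]
  and null_add = scl.subspace_add[OF subspace_null]
  and null_diff = scl.subspace_diff[OF subspace_null]
  and null_neg = scl.subspace_neg[OF subspace_null]
  and null_scale = scl.subspace_scale[OF subspace_null]
  and null_sum = scl.subspace_sum[OF subspace_null]

lemma cong_iff_mod: "[l = p] (mod N) \<longleftrightarrow> (p - l) mod N = 0"
  by (metis cong_iff_dvd_diff cong_sym_eq mod_eq_0_iff_dvd)

lemma congruent_relator_place2:
  "congruent_relator x j = place2 x j (cong_pair (entry x j) (entry x (Suc j)))"
  by (simp add: congruent_relator_def Let_def wedge_with_pair_def wedge_eq_basis cong_pair_def emb_simps upd2_def)

lemma straightening_relator_place2:
  assumes "(entry x (Suc j) - entry x j) mod N \<noteq> 0"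
  shows "straightening_relator n q x j = place2 x j (straight_pair (entry x j) (entry x (Suc j)))"
proof -
  have "\<not> [entry x j - entry x (Suc j) = 0] (mod N)"
  proof
    assume "[entry x j - entry x (Suc j) = 0] (mod N)"
    then have "N dvd entry x j - entry x (Suc j)" by (simp add: cong_iff_dvd_diff)
    then show False using assms by (simp add: dvd_diff_commute)
  qed
  then have g: "twist_g n q (entry x j - entry x (Suc j)) = - q" by (simp add: twist_g_def)
  have w: "wedge_with_pair x j a b = place2 x j (basis (a, b))" for a b
    by (simp add: wedge_with_pair_def wedge_eq_basis upd2_def)
  show ?thesis
    unfolding straightening_relator_def Let_def g w scale_wedge_eq straight_pair_def emb_simps ..
qed

lemma cong_pair_relator: "(p - l) mod N = 0 \<Longrightarrow> cong_pair l p \<in> relator_pairs"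
  unfolding relator_pairs_def by (rule UnI1, rule CollectI, rule exI[of _ l], rule exI[of _ p]) simp

lemma straight_pair_relator: "l < p \<Longrightarrow> (p - l) mod N \<noteq> 0 \<Longrightarrow> straight_pair l p \<in> relator_pairs"
  unfolding relator_pairs_def by (rule UnI2, rule CollectI, rule exI[of _ l], rule exI[of _ p]) simp

lemma place2_relators:
  assumes "r \<in> relator_pairs" shows "place2 x j r \<in> fock_relators n q"
proof -
  from assms consider l p where "r = cong_pair l p" "(p - l) mod N = 0"
    | l p where "r = straight_pair l p" "l < p" "(p - l) mod N \<noteq> 0"
    unfolding relator_pairs_def by (simp only: Un_iff mem_Collect_eq) metis
  then show ?thesis
  proof cases
    case 1
    let ?x = "upd2 x j l p"
    have "congruent_relator ?x j = place2 x j r"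
      using 1 congruent_relator_place2[of ?x j] by (simp add: entry_upd2)
    moreover have "[entry ?x j = entry ?x (Suc j)] (mod int n)" using 1 by (simp add: cong_iff_mod entry_upd2)
    ultimately show ?thesis unfolding fock_relators_def
      by - (rule UnI1, rule CollectI, rule exI[of _ ?x], rule exI[of _ j], simp only: simp_thms)
  next
    case 2
    let ?x = "upd2 x j l p"
    have "straightening_relator n q ?x j = place2 x j r"
      using 2 straightening_relator_place2[of ?x j] by (simp add: entry_upd2)
    moreover have "\<not> [entry ?x j = entry ?x (Suc j)] (mod int n)" using 2 by (simp add: cong_iff_mod entry_upd2)
    moreover have "entry ?x j < entry ?x (Suc j)" using 2 by (simp add: entry_upd2)
    ultimately show ?thesis unfolding fock_relators_def
      by - (rule UnI2, rule CollectI, rule exI[of _ ?x], rule exI[of _ j], simp only: simp_thms)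
  qed
qed

lemma fock_relators_place2:
  assumes "z \<in> fock_relators n q" shows "\<exists>x j r. r \<in> relator_pairs \<and> z = place2 x j r"
proof -
  from assms consider x j where "z = congruent_relator x j" "[entry x j = entry x (Suc j)] (mod int n)"
    | x j where "z = straightening_relator n q x j" "entry x j < entry x (Suc j)" "\<not> [entry x j = entry x (Suc j)] (mod int n)"
    unfolding fock_relators_def by blast
  then show ?thesis
  proof cases
    case 1
    then have "cong_pair (entry x j) (entry x (Suc j)) \<in> relator_pairs"
      unfolding cong_iff_mod by (intro cong_pair_relator)
    then show ?thesis using 1 congruent_relator_place2 by blast
  next
    case 2
    then have "straight_pair (entry x j) (entry x (Suc j)) \<in> relator_pairs"
      unfolding cong_iff_mod by (intro straight_pair_relator)
    then show ?thesis using 2 straightening_relator_place2 unfolding cong_iff_mod by blast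
  qed
qed

lemma place2_null:
  assumes "r \<in> scl.span relator_pairs" shows "place2 x j r \<in> null"
  using assms
proof (induction rule: scl.span_induct_alt)
  case base
  show ?case by (simp add: emb_simps null_0)
next
  case (step c r s)
  have "place2 x j r \<in> null" unfolding null_eq_span by (rule scl.span_base[OF place2_relators[OF step(1)]])
  then show ?case using step by (simp add: emb_simps null_add null_scale)
qed

lemma hecke_null: "hecke j z + z \<in> null"
proof -
  have l: "lin (\<lambda>z. hecke j z + z)" by (intro lin_plus lin_hecke lin_id)
  have b: "hecke j (basis x) + basis x \<in> null" for x
  proof -
    have "hecke j (basis x) + basis x = place2 x j (sym_pair (entry x j) (entry x (Suc j)))"
      by (simp add: hecke_basis sym_pair_def emb_simps)
    then show ?thesis using place2_null[OF sym_pair_in_span] by simp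
  qed
  show ?thesis
    unfolding lin_expand[OF l, of z] by (intro null_sum null_scale b)
qed

text \<open>Through \<open>span_relator_pairs\<close> it suffices to test vectors
  \<open>(T_j + 1) x\<close>, for which Hecke algebra identities are at hand. Both the
  antisymmetrizer and \<open>J_op\<close> are shown to respect the relations in this way.\<close>

lemma null_subset:
  assumes S: "scl.subspace S" and h: "\<And>j x. hecke j (basis x) + basis x \<in> S"
  shows "null \<subseteq> S"
  unfolding null_eq_span
proof (rule scl.span_minimal[OF _ S], rule subsetI)
  fix z assume "z \<in> fock_relators n q"
  then obtain x j r where r: "r \<in> relator_pairs" "z = place2 x j r" using fock_relators_place2 by metis
  have "r \<in> scl.span sym_pairs" using scl.span_base[OF r(1)] by (simp add: span_relator_pairs)
  then have "place2 x j r \<in> S"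
  proof (induction rule: scl.span_induct_alt)
    case base
    show ?case by (simp add: emb_simps scl.subspace_0[OF S])
  next
    case (step c r s)
    then obtain l p where "r = sym_pair l p" by auto
    then have "place2 x j r = hecke j (basis (upd2 x j l p)) + basis (upd2 x j l p)"
      by (simp add: hecke_basis sym_pair_def emb_simps entry_upd2)
    then have "place2 x j r \<in> S" using h by simp
    then show ?case using step by (simp add: emb_simps scl.subspace_add[OF S] scl.subspace_scale[OF S])
  qed
  then show "z \<in> S" using r by simp
qed

text \<open>The bound depends on the vector: a relation at the places \<open>j\<close> and
  \<open>j + 1\<close> is annihilated once both are among the first \<open>M\<close>.\<close>

lemma asym_null: "z \<in> null \<Longrightarrow> \<exists>M0. \<forall>M\<ge>M0. asym M z = 0"
proof -
  let ?S = "{z. \<exists>M0. \<forall>M\<ge>M0. asym M z = 0}"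
  have "null \<subseteq> ?S"
  proof (rule null_subset)
    show "scl.subspace ?S"
      unfolding scl.subspace_def
    proof (intro conjI ballI allI)
      fix x z c assume "x \<in> ?S" "z \<in> ?S"
      then obtain a b where "\<forall>M\<ge>a. asym M x = 0" "\<forall>M\<ge>b. asym M z = 0" by blast
      then have "\<forall>M\<ge>max a b. asym M (x + z) = 0" by (simp add: lin_add[OF lin_asym])
      then show "x + z \<in> ?S" by blast
    next
      fix x c assume "x \<in> ?S"
      then show "scl c x \<in> ?S" by (auto simp: lin_scl[OF lin_asym])
    qed (simp add: lin_0[OF lin_asym])
    fix j x
    have "asym M (hecke j (basis x) + basis x) = 0" if "M \<ge> Suc (Suc j)" for M
      using that by (simp add: lin_add[OF lin_asym] asym_hecke)
    then show "hecke j (basis x) + basis x \<in> ?S" by blast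
  qed
  then show "z \<in> null \<Longrightarrow> ?thesis" by blast
qed

text \<open>Progress is measured by the second entry, which drops below \<open>p\<close>; the sum is
  kept and no entry leaves the range from \<open>l\<close> to \<open>p\<close>.\<close>

lemma pair_straighten:
  assumes "l \<le> p"
  shows "\<exists>r. basis (l, p) - r \<in> scl.span relator_pairs \<and> supported {(a, b). a + b = l + p \<and> l \<le> b \<and> b < p} r"
proof (cases "(p - l) mod N = 0")
  case True
  note c = cong_pair_rel[OF True]
  show ?thesis
  proof (cases "l = p")
    case eq: True
    have "scl (1 / 2) (cong_pair l p) \<in> scl.span relator_pairs" by (rule scl.span_scale[OF c])
    moreover have "scl (1 / 2) (cong_pair l p) = basis (l, p) - 0"
      by (rule poly_mapping_eqI) (simp add: eq cong_pair_def lookup_add del: scl_single)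
    ultimately show ?thesis by (intro exI[of _ 0] conjI supported_0) (simp only:)
  next
    case False
    have "basis (l, p) - (- basis (p, l)) \<in> scl.span relator_pairs" using c by (simp add: cong_pair_def)
    moreover have "supported {(a, b). a + b = l + p \<and> l \<le> b \<and> b < p} (- basis (p, l))"
      using False assms by (auto simp: supported_lookup lookup_single when_def)
    ultimately show ?thesis by blast
  qed
next
  case False
  then have lp: "l < p" using assms by (cases "l = p") auto
  define r where "r = basis (l, p) - straight_pair l p"
  have "straight_pair l p \<in> scl.span relator_pairs"
    unfolding relator_pairs_def by (rule scl.span_base) (use False lp in blast)
  then have "basis (l, p) - r \<in> scl.span relator_pairs" by (simp add: r_def)
  moreover have "supported {(a, b). a + b = l + p \<and> l \<le> b \<and> b < p} r"
  proof -
    define d where "d = (p - l) mod N"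
    have d: "0 \<le> d" using N_pos by (simp add: d_def)
    define X where "X = scl (- q) (basis (p, l)) + scl (v - 1)
       ((\<Sum>t | l + int t * N + d < p - int t * N - d. scl (v ^ t) (basis (p - int t * N - d, l + int t * N + d))) +
        (\<Sum>t | l + (int t + 1) * N < p - (int t + 1) * N.
           scl (v ^ t * - q) (basis (p - (int t + 1) * N, l + (int t + 1) * N))))"
    have "straight_pair l p = basis (l, p) - X" unfolding straight_pair_def Let_def d_def X_def ..
    then have r: "r = X" by (simp add: r_def)
    have nn: "0 \<le> int t * N" "0 < (int t + 1) * N" for t using N_pos by (simp_all add: distrib_right add_nonneg_pos)
    have 1: "(p - int t * N - d, l + int t * N + d) \<in> {(a, b). a + b = l + p \<and> l \<le> b \<and> b < p}"
      if "l + int t * N + d < p - int t * N - d" for t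
      unfolding mem_Collect_eq prod.case using that nn[of t] d by linarith
    have 2: "(p - (int t + 1) * N, l + (int t + 1) * N) \<in> {(a, b). a + b = l + p \<and> l \<le> b \<and> b < p}"
      if "l + (int t + 1) * N < p - (int t + 1) * N" for t
      unfolding mem_Collect_eq prod.case using that nn[of t] by linarith
    show ?thesis
      unfolding r X_def using 1 2 lp
      by (intro supported_add supported_scl supported_sum supported_single) auto
  qed
  ultimately show ?thesis by blast
qed

text \<open>Straightening at \<open>j\<close> moves an amount from place \<open>j + 1\<close> to
  place \<open>j\<close> and so lowers the sum of \<open>j (x_j - lo)\<close>. The bounds on the
  entries are preserved, and they keep this sum nonnegative. Recording them is what makes
  \<open>window_null\<close> possible.\<close>

lemma window_straighten:
  assumes "\<And>j. s \<le> j \<Longrightarrow> j < e \<Longrightarrow> lo \<le> entry x j \<and> entry x j \<le> hi"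
  shows "basis x \<in> scl.span (null \<union> basis ` {z. (\<forall>j. j < s \<or> e \<le> j \<longrightarrow> entry z j = entry x j) \<and>
     (\<forall>j. s \<le> j \<longrightarrow> Suc j < e \<longrightarrow> entry z (Suc j) < entry z j) \<and>
     (\<forall>j. s \<le> j \<longrightarrow> j < e \<longrightarrow> lo \<le> entry z j \<and> entry z j \<le> hi) \<and>
     (\<Sum>j\<in>{s..<e}. entry z j) = (\<Sum>j\<in>{s..<e}. entry x j)})"
  using assms
proof (induction "nat (\<Sum>j\<in>{s..<e}. int j * (entry x j - lo))" arbitrary: x rule: less_induct)
  case less
  let ?G = "\<lambda>x. {z. (\<forall>j. j < s \<or> e \<le> j \<longrightarrow> entry z j = entry x j) \<and>
     (\<forall>j. s \<le> j \<longrightarrow> Suc j < e \<longrightarrow> entry z (Suc j) < entry z j) \<and>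
     (\<forall>j. s \<le> j \<longrightarrow> j < e \<longrightarrow> lo \<le> entry z j \<and> entry z j \<le> hi) \<and>
     (\<Sum>j\<in>{s..<e}. entry z j) = (\<Sum>j\<in>{s..<e}. entry x j)}"
  show ?case
  proof (cases "\<forall>j. s \<le> j \<longrightarrow> Suc j < e \<longrightarrow> entry x (Suc j) < entry x j")
    case True
    then have "x \<in> ?G x" using less.prems by simp
    then show ?thesis by (intro scl.span_base) blast
  next
    case False
    then obtain j where j: "s \<le> j" "Suc j < e" "entry x j \<le> entry x (Suc j)" by (auto simp: not_less)
    let ?l = "entry x j" and ?p = "entry x (Suc j)"
    obtain r where r: "basis (?l, ?p) - r \<in> scl.span relator_pairs"
      "supported {(a, b). a + b = ?l + ?p \<and> ?l \<le> b \<and> b < ?p} r"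
      using pair_straighten[OF j(3)] by blast
    have S: "{s..<e} = insert j (insert (Suc j) ({s..<e} - {j, Suc j}))" using j by auto
    have split: "(\<Sum>i\<in>{s..<e}. f i) = f j + (f (Suc j) + (\<Sum>i\<in>{s..<e} - {j, Suc j}. f i))" for f :: "nat \<Rightarrow> int"
      by (subst S, subst sum.insert, simp, simp, subst sum.insert) simp_all
    have step: "basis (upd2 x j a b) \<in> scl.span (null \<union> basis ` ?G x)"
      if ab: "a + b = ?l + ?p" "?l \<le> b" "b < ?p" for a b
    proof -
      let ?z = "upd2 x j a b"
      have rest: "(\<Sum>i\<in>{s..<e} - {j, Suc j}. g i (entry ?z i)) = (\<Sum>i\<in>{s..<e} - {j, Suc j}. g i (entry x i))"
        for g :: "nat \<Rightarrow> int \<Rightarrow> int" by (rule sum.cong) (auto simp: entry_upd2)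
      have sum: "(\<Sum>i\<in>{s..<e}. entry ?z i) = (\<Sum>i\<in>{s..<e}. entry x i)"
        unfolding split using rest[of "\<lambda>i a. a"] ab by (simp add: entry_upd2)
      have lp: "lo \<le> ?l" "?p \<le> hi" using less.prems[of j] less.prems[of "Suc j"] j by auto
      have range: "lo \<le> entry ?z i \<and> entry ?z i \<le> hi" if "s \<le> i" "i < e" for i
        using less.prems[OF that] lp ab by (auto simp: entry_upd2)
      have "int j * (a - lo) + int (Suc j) * (b - lo) = int j * ((a + b) - 2 * lo) + (b - lo)"
        by (simp add: algebra_simps)
      also have "\<dots> < int j * ((?l + ?p) - 2 * lo) + (?p - lo)" using ab by simp
      also have "\<dots> = int j * (?l - lo) + int (Suc j) * (?p - lo)" by (simp add: algebra_simps)
      finally have "(\<Sum>i\<in>{s..<e}. int i * (entry ?z i - lo)) < (\<Sum>i\<in>{s..<e}. int i * (entry x i - lo))"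
        unfolding split using rest[of "\<lambda>i a. int i * (a - lo)"] by (simp add: entry_upd2)
      moreover have "0 \<le> (\<Sum>i\<in>{s..<e}. int i * (entry ?z i - lo))"
        by (rule sum_nonneg) (use range in auto)
      ultimately have "nat (\<Sum>i\<in>{s..<e}. int i * (entry ?z i - lo)) < nat (\<Sum>i\<in>{s..<e}. int i * (entry x i - lo))"
        by simp
      from less.hyps[OF this range] have "basis ?z \<in> scl.span (null \<union> basis ` ?G ?z)" by blast
      moreover have "?G ?z = ?G x"
        unfolding sum using j by (auto simp: entry_upd2)
      ultimately show ?thesis by simp
    qed
    have "basis x = place2 x j (basis (?l, ?p) - r) + place2 x j r" by (simp add: emb_simps)
    moreover have "place2 x j (basis (?l, ?p) - r) \<in> scl.span (null \<union> basis ` ?G x)"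
      by (intro scl.span_base UnI1 place2_null r(1))
    moreover have "place2 x j r \<in> scl.span (null \<union> basis ` ?G x)"
      unfolding emb_def extend_def
      by (intro scl.span_sum scl.span_scale) (use r(2) step in \<open>auto simp: supported_def\<close>)
    ultimately show ?thesis by (simp add: scl.span_add)
  qed
qed

text \<open>Pigeonhole: \<open>e - s\<close> strictly decreasing entries do not fit between
  \<open>lo\<close> and \<open>hi\<close>.\<close>

lemma window_null:
  assumes "\<And>j. s \<le> j \<Longrightarrow> j < e \<Longrightarrow> lo \<le> entry x j \<and> entry x j \<le> hi" and se: "s < e" and big: "hi - lo + 1 < int e - int s"
  shows "basis x \<in> null"
proof -
  let ?G = "{z. (\<forall>j. j < s \<or> e \<le> j \<longrightarrow> entry z j = entry x j) \<and>
     (\<forall>j. s \<le> j \<longrightarrow> Suc j < e \<longrightarrow> entry z (Suc j) < entry z j) \<and>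
     (\<forall>j. s \<le> j \<longrightarrow> j < e \<longrightarrow> lo \<le> entry z j \<and> entry z j \<le> hi) \<and>
     (\<Sum>j\<in>{s..<e}. entry z j) = (\<Sum>j\<in>{s..<e}. entry x j)}"
  have False if "z \<in> ?G" for z
  proof -
    have dec: "entry z (s + k) \<le> entry z s - int k" if "s + k < e" for k
      using that
    proof (induction k)
      case (Suc k)
      then have "entry z (Suc (s + k)) < entry z (s + k)" using \<open>z \<in> ?G\<close> by auto
      then show ?case using Suc by simp
    qed simp
    have "entry z (s + (e - 1 - s)) \<le> entry z s - int (e - 1 - s)" by (rule dec) (use se in simp)
    moreover have "lo \<le> entry z (e - 1)" "entry z s \<le> hi" using \<open>z \<in> ?G\<close> se by auto
    ultimately show False using big se by (simp add: of_nat_diff)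
  qed
  then have "?G = {}" by blast
  with window_straighten[OF assms(1), of s e] show ?thesis
    by (simp only: image_empty Un_empty_right) (metis scl.span_eq_iff subspace_null)
qed

end

section \<open>Coordinates on the Fock space\<close>

definition lift_ket :: "(int_partition \<Rightarrow>\<^sub>0 complex) \<Rightarrow> wedge_vec" where
  "lift_ket = emb partition_seq"

lemma lin_lift_ket: "lin lift_ket"
  by (simp add: lift_ket_def lin_emb)

lemma lift_ket_basis: "lift_ket (basis lam) = basis (partition_seq lam)"
  by (simp add: lift_ket_def)

lemma lift_ket_sum:
  "lift_ket c = (\<Sum>lam\<in>Poly_Mapping.keys c. Poly_Mapping.lookup c lam *\<^sub>W ket lam)"
  by (simp add: lift_ket_def emb_def extend_def scale_wedge_eq ket_def wedge_eq_basis)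

definition homogeneous :: "int \<Rightarrow> (int_partition \<Rightarrow>\<^sub>0 complex) \<Rightarrow> bool" where
  "homogeneous d f \<longleftrightarrow> supported {lam. int (partition_size lam) = d} f"

definition shift_entry :: "nat \<Rightarrow> nat \<Rightarrow> nat \<Rightarrow> wedge_seq \<Rightarrow> wedge_seq" where
  "shift_entry n k m x = set_entry x m (entry x m - int n * int k)"

lemma entry_shift_entry: "entry (shift_entry n k m x) j = (if j = m then entry x m - int n * int k else entry x j)"
  by (simp add: shift_entry_def entry_set_entry)

lemma shift_entry_commute: "shift_entry n k m (shift_entry n l m' x) = shift_entry n l m' (shift_entry n k m x)"
  by (rule wedge_seq_eqI) (simp add: entry_shift_entry)

definition tail_from :: "nat \<Rightarrow> wedge_seq \<Rightarrow> bool" where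
  "tail_from M x \<longleftrightarrow> (\<forall>j\<ge>M. entry x j = - int j)"

lemma tail_from_ex: "\<exists>M. tail_from M x"
  using wedge_tail_obtain[of x] unfolding tail_from_def by metis

lemma tail_from_mono: "tail_from M x \<Longrightarrow> M \<le> M' \<Longrightarrow> tail_from M' x"
  by (simp add: tail_from_def)

lemma tail_from_shift_entry: "tail_from M x \<Longrightarrow> m < M \<Longrightarrow> tail_from M (shift_entry n k m x)"
  by (simp add: tail_from_def entry_shift_entry)

lemma wedge_degree_shift_entry: "wedge_degree (shift_entry n k m x) = wedge_degree x - int n * int k"
proof -
  obtain M where M: "tail_from M x" using tail_from_ex by blast
  let ?M = "max M (Suc m)"
  have t: "tail_from ?M x" "tail_from ?M (shift_entry n k m x)"
    using M tail_from_mono[OF M, of ?M] by (auto intro: tail_from_shift_entry)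
  have S: "{..<?M} = insert m ({..<?M} - {m})" by auto
  have "(\<Sum>j\<in>{..<?M} - {m}. entry (shift_entry n k m x) j + int j) = (\<Sum>j\<in>{..<?M} - {m}. entry x j + int j)"
    by (rule sum.cong) (auto simp: entry_shift_entry)
  moreover have "(\<Sum>j<?M. f j) = f m + (\<Sum>j\<in>{..<?M} - {m}. f j)" for f :: "nat \<Rightarrow> int"
    by (subst S, subst sum.insert) simp_all
  ultimately show ?thesis
    using wedge_degree_eq[of ?M x] wedge_degree_eq[of ?M "shift_entry n k m x"] t
    by (simp add: tail_from_def entry_shift_entry)
qed

context fock
begin

lemma basis_ket_span:
  "basis x \<in> scl.span (null \<union> {basis (partition_seq lam) | lam. int (partition_size lam) = wedge_degree x})"
proof -
  obtain M where M: "tail_from M x" using tail_from_ex by blast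
  define B where "B = Max ((\<lambda>j. \<bar>entry x j\<bar>) ` {..<Suc M})"
  have B: "\<bar>entry x j\<bar> \<le> B" if "j < M" for j
    unfolding B_def by (rule Max_ge) (use that in auto)
  have B0: "0 \<le> B" unfolding B_def
    by (rule order_trans[of _ "\<bar>entry x M\<bar>"]) (auto intro: Max_ge)
  \<comment> \<open>The window reaches into the vacuum tail until \<open>- (e - 1)\<close> bounds
    all its entries from below. After straightening it still lies above the first untouched entry
    \<open>- e\<close>, so the whole sequence is decreasing.\<close>
  define e where "e = M + nat B + 1"
  have xe: "- int (e - 1) \<le> entry x j \<and> entry x j \<le> B" if "j < e" for j
  proof (cases "j < M")
    case True
    then show ?thesis using B[OF True] by (auto simp: e_def)
  next
    case False
    then show ?thesis using M that B0 by (auto simp: tail_from_def e_def)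
  qed
  let ?G = "{z. (\<forall>j. j < 0 \<or> e \<le> j \<longrightarrow> entry z j = entry x j) \<and>
     (\<forall>j. 0 \<le> j \<longrightarrow> Suc j < e \<longrightarrow> entry z (Suc j) < entry z j) \<and>
     (\<forall>j. 0 \<le> j \<longrightarrow> j < e \<longrightarrow> - int (e - 1) \<le> entry z j \<and> entry z j \<le> B) \<and>
     (\<Sum>j\<in>{0..<e}. entry z j) = (\<Sum>j\<in>{0..<e}. entry x j)}"
  have "basis x \<in> scl.span (null \<union> basis ` ?G)"
    by (rule window_straighten[of 0 e "- int (e - 1)" x B, OF xe])
  moreover
  have "basis ` ?G \<subseteq> {basis (partition_seq lam) | lam. int (partition_size lam) = wedge_degree x}"
  proof
    fix f assume "f \<in> basis ` ?G"
    then obtain z where fz: "f = basis z" and zG: "z \<in> ?G" by (rule imageE)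
    then have z: "\<And>j. e \<le> j \<Longrightarrow> entry z j = entry x j" "\<And>j. Suc j < e \<Longrightarrow> entry z (Suc j) < entry z j"
      "\<And>j. j < e \<Longrightarrow> - int (e - 1) \<le> entry z j" "(\<Sum>j\<in>{0..<e}. entry z j) = (\<Sum>j\<in>{0..<e}. entry x j)"
      by simp_all
    have xtail: "entry x j = - int j" if "e \<le> j" for j using M that by (auto simp: tail_from_def e_def)
    have ztail: "entry z j = - int j" if "e \<le> j" for j using z(1)[OF that] xtail[OF that] by simp
    have "entry z (Suc j) < entry z j" for j
    proof -
      consider "Suc j < e" | "Suc j = e" | "e \<le> j" by linarith
      then show ?thesis
      proof cases
        case 1
        then show ?thesis by (rule z(2))
      next
        case 2
        then have "- int (e - 1) \<le> entry z j" by (intro z(3)) simp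
        then show ?thesis using 2 ztail[of "Suc j"] by simp
      next
        case 3
        then show ?thesis using ztail[of j] ztail[of "Suc j"] by simp
      qed
    qed
    then obtain lam where lam: "z = partition_seq lam" using decreasing_eq_partition_seq by blast
    have "wedge_degree z = wedge_degree x"
      using wedge_degree_eq[of e z, OF ztail] wedge_degree_eq[of e x, OF xtail] z(4)
      by (simp add: sum.distrib atLeast0LessThan)
    then have "int (partition_size lam) = wedge_degree x" by (simp add: lam wedge_degree_partition_seq)
    then show "f \<in> {basis (partition_seq lam) | lam. int (partition_size lam) = wedge_degree x}"
      unfolding fz lam by blast
  qed
  then have "scl.span (null \<union> basis ` ?G) \<subseteq>
      scl.span (null \<union> {basis (partition_seq lam) | lam. int (partition_size lam) = wedge_degree x})"
    by (intro scl.span_mono Un_mono order_refl)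
  ultimately show ?thesis by (rule rev_subsetD)
qed

text \<open>Linear independence of the kets: a large antisymmetrizer kills the given relation but is
  injective on combinations of decreasing sequences.\<close>

lemma lift_ket_null: "lift_ket c \<in> null \<Longrightarrow> c = 0"
proof -
  assume "lift_ket c \<in> null"
  then obtain M where M: "asym M (lift_ket c) = 0" using asym_null by blast
  let ?S = "partition_seq ` Poly_Mapping.keys c"
  let ?c = "\<lambda>x. Poly_Mapping.lookup c (inv partition_seq x)"
  have inj: "inj partition_seq" by (rule injI) (rule partition_seq_inject)
  have l: "lift_ket c = (\<Sum>x\<in>?S. scl (?c x) (basis x))"
    unfolding lift_ket_def emb_def extend_def
    by (subst sum.reindex) (use inj in \<open>auto intro: inj_on_subset simp: inv_f_f\<close>)
  have "?c x = 0" if "x \<in> ?S" for x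
  proof (rule asym_independent[of ?S M ?c, OF _ _ _ that])
    show "asym M (\<Sum>x\<in>?S. scl (?c x) (basis x)) = 0" using M l by simp
    show "entry x j < entry x i" if "x \<in> ?S" "i < j" "j < M" for x i j
      using that partition_seq_decreasing by auto
  qed simp
  then have "Poly_Mapping.lookup c lam = 0" if "lam \<in> Poly_Mapping.keys c" for lam
    using that by (metis inv_f_f[OF inj] imageI)
  then have "Poly_Mapping.lookup c lam = 0" for lam
    by (cases "lam \<in> Poly_Mapping.keys c") (auto simp: in_keys_iff)
  then show "c = 0" by (intro poly_mapping_eqI) simp
qed

abbreviation coords :: "wedge_vec \<Rightarrow> (int_partition \<Rightarrow>\<^sub>0 complex)" where "coords \<equiv> fock_coords n q"

lemma coords_ex: "\<exists>c. z - lift_ket c \<in> null"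
proof -
  let ?S = "{z. \<exists>c. z - lift_ket c \<in> null}"
  have sub: "scl.subspace ?S"
    unfolding scl.subspace_def
  proof (intro conjI ballI allI)
    have "0 - lift_ket 0 \<in> null" by (simp add: lin_0[OF lin_lift_ket] null_0)
    then show "0 \<in> ?S" by blast
  next
    fix x z assume "x \<in> ?S" "z \<in> ?S"
    then obtain a b where "x - lift_ket a \<in> null" "z - lift_ket b \<in> null" by blast
    then have "(x - lift_ket a) + (z - lift_ket b) \<in> null" by (rule null_add)
    moreover have "(x - lift_ket a) + (z - lift_ket b) = x + z - lift_ket (a + b)"
      by (simp add: lin_add[OF lin_lift_ket])
    ultimately show "x + z \<in> ?S" by (intro CollectI exI[of _ "a + b"]) simp
  next
    fix x c assume "x \<in> ?S"
    then obtain a where "x - lift_ket a \<in> null" by blast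
    then have "scl c (x - lift_ket a) \<in> null" by (rule null_scale)
    then have "scl c x - lift_ket (scl c a) \<in> null"
      by (simp add: lin_scl[OF lin_lift_ket] scl.scale_right_diff_distrib)
    then show "scl c x \<in> ?S" by blast
  qed
  have k: "null \<union> range (\<lambda>lam. basis (partition_seq lam)) \<subseteq> ?S"
  proof (intro Un_least subsetI)
    fix z assume "z \<in> null"
    then show "z \<in> ?S" by (intro CollectI exI[of _ 0]) (simp add: lin_0[OF lin_lift_ket])
  next
    fix z :: wedge_vec assume "z \<in> range (\<lambda>lam. basis (partition_seq lam))"
    then obtain lam where "z = lift_ket (basis lam)" by (auto simp: lift_ket_basis)
    then show "z \<in> ?S" by (intro CollectI exI[of _ "basis lam"]) (simp add: null_0)
  qed
  have b: "basis x \<in> ?S" for x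
  proof -
    have "scl.span (null \<union> {basis (partition_seq lam) | lam. int (partition_size lam) = wedge_degree x}) \<subseteq> ?S"
      by (rule scl.span_minimal[OF _ sub]) (use k in blast)
    then show ?thesis using basis_ket_span by blast
  qed
  have "(\<Sum>i\<in>Poly_Mapping.keys z. scl (Poly_Mapping.lookup z i) (basis i)) \<in> ?S"
    by (rule scl.subspace_sum[OF sub], rule scl.subspace_scale[OF sub], rule b)
  then have "z \<in> ?S" by (simp only: lin_expand[OF lin_id, of z, symmetric])
  then show ?thesis by blast
qed

lemma coords_unique: "z - lift_ket c \<in> null \<Longrightarrow> coords z = c"
  unfolding fock_coords_def lift_ket_sum[symmetric]
proof (rule the_equality)
  fix c' assume c: "z - lift_ket c \<in> null" and "z - lift_ket c' \<in> null"
  then have "(z - lift_ket c) - (z - lift_ket c') \<in> null" by (rule null_diff)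
  then have "lift_ket (c' - c) \<in> null" by (simp add: lin_diff[OF lin_lift_ket])
  from lift_ket_null[OF this] show "c' = c" by simp
qed

lemma coords_lift: "z - lift_ket (coords z) \<in> null"
  using coords_ex[of z] coords_unique by metis

lemma lin_coords: "lin coords"
  unfolding lin_def
proof (intro conjI allI)
  fix x z c
  have "(x - lift_ket (coords x)) + (z - lift_ket (coords z)) \<in> null" by (intro null_add coords_lift)
  then show "coords (x + z) = coords x + coords z"
    by (intro coords_unique) (simp add: lin_add[OF lin_lift_ket] algebra_simps)
  have "scl c (x - lift_ket (coords x)) \<in> null" by (intro null_scale coords_lift)
  then show "coords (scl c x) = scl c (coords x)"
    by (intro coords_unique) (simp add: lin_scl[OF lin_lift_ket] scl.scale_right_diff_distrib)
qed

lemma coords_lift_ket: "coords (lift_ket c) = c"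
  by (rule coords_unique) (simp add: null_0)

lemma coords_eq_0_iff: "coords z = 0 \<longleftrightarrow> z \<in> null"
  using coords_lift[of z] coords_unique[of z 0] by (auto simp: lin_0[OF lin_lift_ket])

lemma coords_cong: "x - z \<in> null \<Longrightarrow> coords x = coords z"
  using coords_eq_0_iff[of "x - z"] by (simp add: lin_diff[OF lin_coords])

abbreviation wcoords :: "wedge_seq \<Rightarrow> (int_partition \<Rightarrow>\<^sub>0 complex)" where
  "wcoords x \<equiv> coords (basis x)"

lemma wcoords_partition_seq: "wcoords (partition_seq lam) = basis lam"
  using coords_lift_ket[of "basis lam"] by (simp add: lift_ket_basis)

lemma homogeneous_wcoords: "homogeneous (wedge_degree x) (wcoords x)"
proof -
  let ?S = "{z. homogeneous (wedge_degree x) (coords z)}"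
  have "scl.span (null \<union> {basis (partition_seq lam) | lam. int (partition_size lam) = wedge_degree x}) \<subseteq> ?S"
  proof (rule scl.span_minimal)
    show "scl.subspace ?S"
      unfolding scl.subspace_def homogeneous_def
      by (simp add: lin_0[OF lin_coords] lin_add[OF lin_coords] lin_scl[OF lin_coords] supported_0 supported_add supported_scl)
    show "null \<union> {basis (partition_seq lam) | lam. int (partition_size lam) = wedge_degree x} \<subseteq> ?S"
      using coords_eq_0_iff[THEN iffD2] by (auto simp: homogeneous_def supported_0 wcoords_partition_seq intro: supported_single)
  qed
  then show ?thesis using basis_ket_span by blast
qed

lemma wcoords_negative_degree: "wedge_degree x < 0 \<Longrightarrow> wcoords x = 0"
  using homogeneous_wcoords[of x]
  by (intro poly_mapping_eqI) (auto simp: homogeneous_def supported_lookup)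

section \<open>The operators of the Heisenberg algebra on the Fock space\<close>

abbreviation "bx k l \<equiv> emb (\<lambda>(a, b). (a - N * int k, b - N * int l))"

lemma hecke2_bx10: "hecke2 (bx 1 0 x) = bx 0 1 (hecke2 x) - scl (v - 1) (bx 0 1 x)"
proof -
  have "hecke2 x = sh2 (hecke2 (bx 1 0 x)) + scl (v - 1) x"
    using hecke2_sh1[of "bx 1 0 x"] by (simp add: emb_emb case_prod_unfold emb_id)
  then have "bx 0 1 (hecke2 x) = bx 0 1 (sh2 (hecke2 (bx 1 0 x)) + scl (v - 1) x)" by simp
  then show ?thesis by (simp add: emb_simps emb_emb case_prod_unfold emb_id)
qed

lemma hecke2_bx01: "hecke2 (bx 0 1 x) = bx 1 0 (hecke2 x) + scl (v - 1) (bx 0 1 x)"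
proof -
  have "hecke2 x = sh1 (hecke2 (bx 0 1 x)) - scl (v - 1) (sh1 (bx 0 1 x))"
    using hecke2_sh2[of "bx 0 1 x"] by (simp add: emb_emb case_prod_unfold emb_id)
  then have "bx 1 0 (hecke2 x) = bx 1 0 (sh1 (hecke2 (bx 0 1 x)) - scl (v - 1) (sh1 (bx 0 1 x)))" by simp
  then show ?thesis by (simp add: emb_simps emb_emb case_prod_unfold emb_id)
qed

text \<open>With \<open>X\<close> and \<open>Y\<close> the two backward shifts, the power sums
  satisfy \<open>p_k = p_1 p_(k-1) - X Y p_(k-2)\<close>, and \<open>p_1\<close> and
  \<open>X Y\<close> commute with the operator by the Bernstein relations.\<close>

lemma hecke2_power_sum: "hecke2 (bx k 0 x + bx 0 k x) = bx k 0 (hecke2 x) + bx 0 k (hecke2 x)"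
proof (induction k arbitrary: x rule: less_induct)
  case (less k)
  have e1: "hecke2 (bx 1 0 x + bx 0 1 x) = bx 1 0 (hecke2 x) + bx 0 1 (hecke2 x)" for x
    by (simp only: hecke2_simps hecke2_bx10 hecke2_bx01) simp
  have comp: "bx a b (bx c d x) = bx (a + c) (b + d) x" for a b c d x
    by (simp add: emb_emb case_prod_unfold algebra_simps)
  have e2: "hecke2 (bx 1 1 x) = bx 1 1 (hecke2 x)" for x
  proof -
    have "hecke2 (bx 1 0 (bx 0 1 x)) = bx 0 1 (bx 1 0 (hecke2 x))"
      by (simp only: hecke2_bx10 hecke2_bx01 emb_simps) simp
    then show ?thesis unfolding comp by simp
  qed
  consider "k = 0" | "k = 1" | m where "k = Suc (Suc m)" by (metis One_nat_def not0_implies_Suc)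
  then show ?case
  proof cases
    case 1
    then show ?thesis by (simp add: emb_id case_prod_unfold hecke2_simps)
  next
    case 2
    then show ?thesis using e1 by simp
  next
    case 3
    let ?p = "\<lambda>k x. bx k 0 x + bx 0 k x"
    have rec: "?p k x = ?p 1 (?p (Suc m) x) - bx 1 1 (?p m x)" for x
      unfolding 3 emb_simps comp by simp
    have "hecke2 (?p k x) = hecke2 (?p 1 (?p (Suc m) x)) - hecke2 (bx 1 1 (?p m x))"
      unfolding rec hecke2_simps(2) ..
    also have "\<dots> = ?p 1 (hecke2 (?p (Suc m) x)) - bx 1 1 (hecke2 (?p m x))"
      by (simp only: e1 e2)
    also have "\<dots> = ?p 1 (?p (Suc m) (hecke2 x)) - bx 1 1 (?p m (hecke2 x))"
      using less[of "Suc m" x] less[of m x] 3 by simp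
    also have "\<dots> = ?p k (hecke2 x)" by (rule rec[symmetric])
    finally show ?thesis .
  qed
qed

definition shift_sum :: "nat \<Rightarrow> nat \<Rightarrow> wedge_vec \<Rightarrow> wedge_vec" where
  "shift_sum M k z = (\<Sum>m<M. emb (shift_entry n k m) z)"

lemma lin_shift_sum: "lin (shift_sum M k)"
  unfolding shift_sum_def by (intro lin_sum_op lin_emb)

text \<open>The shifts of the places \<open>j\<close> and \<open>j + 1\<close> add up to a symmetric
  function in two variables; the other shifts act on different places.\<close>

lemma hecke_shift_sum:
  assumes "Suc j < M"
  shows "hecke j (shift_sum M k z) = shift_sum M k (hecke j z)"
proof (rule lin_eqI[where f = "\<lambda>z. hecke j (shift_sum M k z)" and g = "\<lambda>z. shift_sum M k (hecke j z)"])
  show "lin (\<lambda>z. hecke j (shift_sum M k z))" "lin (\<lambda>z. shift_sum M k (hecke j z))"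
    by (rule lin_comp; intro lin_hecke lin_shift_sum)+
  fix x
  let ?h = "hecke_pair (entry x j) (entry x (Suc j))"
  have S: "{..<M} = insert j (insert (Suc j) ({..<M} - {j, Suc j}))" using assms by auto
  have split: "(\<Sum>m<M. f m) = f j + (f (Suc j) + (\<Sum>m\<in>{..<M} - {j, Suc j}. f m))" for f :: "nat \<Rightarrow> wedge_vec"
    by (subst S, subst sum.insert, simp, simp, subst sum.insert) simp_all
  have here: "shift_entry n k j (upd2 x j a b) = upd2 x j (a - N * int k) (b - N * int 0)"
    "shift_entry n k (Suc j) (upd2 x j a b) = upd2 x j (a - N * int 0) (b - N * int k)" for a b
    by (rule wedge_seq_eqI; simp add: entry_shift_entry entry_upd2)+
  have two: "emb (shift_entry n k j) (place2 x j f) + emb (shift_entry n k (Suc j)) (place2 x j f) =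
      place2 x j (bx k 0 f + bx 0 k f)" for f
    by (simp add: emb_simps emb_emb case_prod_unfold here)
  have other: "hecke j (emb (shift_entry n k m) (basis x)) = emb (shift_entry n k m) (place2 x j ?h)"
    if "m \<in> {..<M} - {j, Suc j}" for m
  proof -
    have "upd2 (shift_entry n k m x) j a b = shift_entry n k m (upd2 x j a b)" for a b
      by (rule wedge_seq_eqI) (use that in \<open>simp add: entry_shift_entry entry_upd2\<close>)
    then show ?thesis using that by (simp add: hecke_basis entry_shift_entry emb_emb case_prod_unfold)
  qed
  have "hecke j (shift_sum M k (basis x)) = hecke j (place2 x j (bx k 0 (basis (entry x j, entry x (Suc j))) + bx 0 k (basis (entry x j, entry x (Suc j)))))
      + (\<Sum>m\<in>{..<M} - {j, Suc j}. hecke j (emb (shift_entry n k m) (basis x)))"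
    unfolding shift_sum_def split two[symmetric] basis_place2[of x j, symmetric]
    by (simp only: lin_add[OF lin_hecke] lin_sum[OF lin_hecke] add.assoc)
  also have "\<dots> = place2 x j (bx k 0 ?h + bx 0 k ?h) + (\<Sum>m\<in>{..<M} - {j, Suc j}. emb (shift_entry n k m) (place2 x j ?h))"
    unfolding hecke_place2 hecke2_power_sum hecke2_basis by (simp only: sum.cong[OF refl other])
  also have "\<dots> = shift_sum M k (hecke j (basis x))"
    unfolding shift_sum_def hecke_basis split two[symmetric] by (simp only: add.assoc)
  finally show "hecke j (shift_sum M k (basis x)) = shift_sum M k (hecke j (basis x))" .
qed

text \<open>A tail entry lowered by \<open>n k\<close> leaves \<open>n k + 1\<close> consecutive
  places whose entries take only \<open>n k\<close> values, so \<open>window_null\<close>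
  applies.\<close>

lemma shift_far_null:
  assumes "tail_from M x" "M \<le> m" "k \<ge> 1"
  shows "basis (shift_entry n k m x) \<in> null"
proof (rule window_null[of m "m + n * k + 1" "- int m - N * int k" _ "- int m - 1"])
  fix j assume "m \<le> j" "j < m + n * k + 1"
  then have "int m \<le> int j" "int j < int m + N * int k + 1" by (simp_all flip: of_nat_mult)
  moreover have "1 * 1 \<le> N * int k" using n assms(3) by (intro mult_mono) auto
  moreover have "entry x m = - int m" "entry x j = - int j" using assms \<open>m \<le> j\<close> by (auto simp: tail_from_def)
  ultimately show "- int m - N * int k \<le> entry (shift_entry n k m x) j \<and> entry (shift_entry n k m x) j \<le> - int m - 1"
    by (auto simp: entry_shift_entry)
qed (simp_all flip: of_nat_mult)

text \<open>\<open>fock_sum\<close> selects the summands that are nonzero in the quotient; any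
  finite index set containing all of these gives the same vector of the quotient.\<close>

lemma fock_sum_cong_finite:
  assumes "finite B" "B \<subseteq> A" "\<And>a. a \<in> A - B \<Longrightarrow> f a \<in> null"
  shows "fock_sum n q f A - (\<Sum>a\<in>B. f a) \<in> null"
proof -
  let ?C = "{a. a \<in> A \<and> f a \<notin> null}"
  have C: "?C \<subseteq> B" using assms(3) by blast
  have "(\<Sum>a\<in>B. f a) = (\<Sum>a\<in>?C. f a) + (\<Sum>a\<in>B - ?C. f a)"
    using sum.subset_diff[OF C assms(1), of f] by (simp add: add.commute)
  moreover have "(\<Sum>a\<in>B - ?C. f a) \<in> null" by (rule null_sum) (use assms(2) in auto)
  ultimately show ?thesis using null_neg by (simp add: fock_sum_def)
qed

lemma J_op_extend: "J_op n q (int k) = extend (\<lambda>x. fock_sum n q (\<lambda>m. basis (shift_entry n k m x)) UNIV)"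
  by (simp add: fun_eq_iff J_op_def extend_def scale_wedge_eq wedge_eq_basis shift_entry_def)

lemma lin_J_op: "lin (J_op n q (int k))"
  unfolding J_op_extend by (rule lin_extend)

lemma J_op_basis:
  assumes "tail_from M x" "k \<ge> 1"
  shows "J_op n q (int k) (basis x) - shift_sum M k (basis x) \<in> null"
  unfolding J_op_extend shift_sum_def extend_basis emb_basis
  by (rule fock_sum_cong_finite) (use shift_far_null[OF assms(1) _ assms(2)] in auto)

lemma J_op_supported:
  assumes "supported {x. tail_from M x} z" "k \<ge> 1"
  shows "J_op n q (int k) z - shift_sum M k z \<in> null"
proof -
  have l: "lin (\<lambda>z. J_op n q (int k) z - shift_sum M k z)" by (intro lin_minus lin_J_op lin_shift_sum)
  show ?thesis
    unfolding lin_expand[OF l, of z]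
    by (intro null_sum null_scale J_op_basis assms(2)) (use assms(1) in \<open>auto simp: supported_def\<close>)
qed

text \<open>On \<open>(T_j + 1) x\<close> one bound \<open>M\<close>, beyond the tail of
  \<open>x\<close> and beyond \<open>j + 1\<close>, replaces \<open>J_op\<close> by a finite
  \<open>shift_sum\<close> that commutes with \<open>T_j\<close>.\<close>

lemma J_op_null:
  assumes "z \<in> null" and k: "k \<ge> 1" shows "J_op n q (int k) z \<in> null"
proof -
  have "null \<subseteq> {z. J_op n q (int k) z \<in> null}"
  proof (rule null_subset)
    show "scl.subspace {z. J_op n q (int k) z \<in> null}"
      unfolding scl.subspace_def
      by (simp add: lin_0[OF lin_J_op] lin_add[OF lin_J_op] lin_scl[OF lin_J_op] null_0 null_add null_scale)
    fix j x
    let ?z = "hecke j (basis x) + basis x"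
    obtain M0 where M0: "tail_from M0 x" using tail_from_ex by blast
    let ?M = "max M0 (Suc (Suc j))"
    have t: "tail_from ?M x" by (rule tail_from_mono[OF M0]) simp
    have "supported {x. tail_from ?M x} (hecke j (basis x))"
      unfolding hecke_basis emb_def extend_def
      by (intro supported_sum supported_scl) (use t in \<open>auto simp: tail_from_def entry_upd2 intro!: supported_single\<close>)
    then have "supported {x. tail_from ?M x} ?z" using t by (intro supported_add supported_single) auto
    then have "J_op n q (int k) ?z - shift_sum ?M k ?z \<in> null" using k by (rule J_op_supported)
    moreover have "shift_sum ?M k ?z = hecke j (shift_sum ?M k (basis x)) + shift_sum ?M k (basis x)"
      by (simp add: lin_add[OF lin_shift_sum] hecke_shift_sum)
    then have "shift_sum ?M k ?z \<in> null" by (simp add: hecke_null)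
    ultimately have "(J_op n q (int k) ?z - shift_sum ?M k ?z) + shift_sum ?M k ?z \<in> null" by (rule null_add)
    then show "?z \<in> {z. J_op n q (int k) z \<in> null}" by simp
  qed
  then show ?thesis using assms by blast
qed

definition Jh :: "nat \<Rightarrow> (int_partition \<Rightarrow>\<^sub>0 complex) \<Rightarrow> (int_partition \<Rightarrow>\<^sub>0 complex)" where
  "Jh k f = coords (J_op n q (int k) (lift_ket f))"

lemma lin_Jh: "lin (Jh k)"
proof -
  have "lin (\<lambda>f. J_op n q (int k) (lift_ket f))" by (rule lin_comp[OF lin_J_op lin_lift_ket])
  from lin_comp[OF lin_coords this] show ?thesis unfolding Jh_def .
qed

lemma coords_J_op: "k \<ge> 1 \<Longrightarrow> coords (J_op n q (int k) z) = Jh k (coords z)"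
  unfolding Jh_def using J_op_null[OF coords_lift, of k z]
  by (intro coords_cong) (simp add: lin_diff[OF lin_J_op])

lemma Jh_wcoords:
  assumes "tail_from M x" "k \<ge> 1"
  shows "Jh k (wcoords x) = (\<Sum>m<M. wcoords (shift_entry n k m x))"
  using coords_cong[OF J_op_basis[OF assms]] assms(2)
  by (simp add: coords_J_op shift_sum_def lin_sum[OF lin_coords])

lemma homogeneous_Jh:
  assumes "homogeneous d f" "k \<ge> 1"
  shows "homogeneous (d - N * int k) (Jh k f)"
proof -
  have "homogeneous (d - N * int k) (Jh k (basis lam))" if "int (partition_size lam) = d" for lam
  proof -
    obtain M where M: "tail_from M (partition_seq lam)" using tail_from_ex by blast
    have "homogeneous (d - N * int k) (wcoords (shift_entry n k m (partition_seq lam)))" for m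
      using homogeneous_wcoords[of "shift_entry n k m (partition_seq lam)"]
      by (simp add: wedge_degree_shift_entry wedge_degree_partition_seq that)
    then show ?thesis
      using Jh_wcoords[OF M assms(2)] by (simp add: wcoords_partition_seq homogeneous_def supported_sum)
  qed
  then show ?thesis
    unfolding lin_expand[OF lin_Jh, of k f] homogeneous_def
    by (intro supported_sum supported_scl) (use assms(1) in \<open>auto simp: homogeneous_def supported_def\<close>)
qed

lemma Jh_commute:
  assumes "k \<ge> 1" "l \<ge> 1" shows "Jh k (Jh l f) = Jh l (Jh k f)"
proof (rule lin_eqI[OF lin_comp[OF lin_Jh lin_Jh] lin_comp[OF lin_Jh lin_Jh], of k l l k])
  fix lam
  obtain M where M: "tail_from M (partition_seq lam)" using tail_from_ex by blast
  have e: "Jh k (Jh l (wcoords (partition_seq lam))) =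
      (\<Sum>m<M. \<Sum>m'<M. wcoords (shift_entry n k m' (shift_entry n l m (partition_seq lam))))"
    if "k \<ge> 1" "l \<ge> 1" for k l
    unfolding Jh_wcoords[OF M that(2)] lin_sum[OF lin_Jh]
    by (rule sum.cong[OF refl], rule Jh_wcoords) (use M that in \<open>auto intro: tail_from_shift_entry\<close>)
  have "Jh k (Jh l (wcoords (partition_seq lam))) = Jh l (Jh k (wcoords (partition_seq lam)))"
    unfolding e[OF assms] e[OF assms(2,1)] by (subst sum.swap) (simp only: shift_entry_commute[of n k])
  then show "Jh k (Jh l (basis lam)) = Jh l (Jh k (basis lam))" by (simp add: wcoords_partition_seq)
qed

end

section \<open>Vertical strips from lowering disjoint factors\<close>

definition lower :: "nat \<Rightarrow> nat set \<Rightarrow> wedge_seq \<Rightarrow> wedge_seq" where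
  "lower n S x = Abs_wedge_seq (\<lambda>j. entry x j - (if j \<in> S then int n else 0))"

lemma entry_lower:
  assumes "finite S"
  shows "entry (lower n S x) j = entry x j - (if j \<in> S then int n else 0)"
proof -
  obtain M where M: "\<And>j. j \<ge> M \<Longrightarrow> entry x j = - int j" using wedge_tail_obtain[of x] by metis
  obtain M' where M': "\<And>j. j \<in> S \<Longrightarrow> j < M'" using assms finite_nat_set_iff_bounded by metis
  have "\<forall>\<^sub>F j in sequentially. entry x j - (if j \<in> S then int n else 0) = - int j"
    unfolding eventually_sequentially
    by (rule exI[of _ "max M M'"]) (use M M' in \<open>auto simp: not_le[symmetric]\<close>)
  then show ?thesis by (simp add: lower_def Abs_wedge_seq_inverse)
qed

lemma lower_insert: "finite S \<Longrightarrow> m \<notin> S \<Longrightarrow> lower n (insert m S) x = shift_entry n 1 m (lower n S x)"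
  by (rule wedge_seq_eqI) (simp add: entry_lower entry_shift_entry)

lemma lower_empty [simp]: "lower n {} x = x"
  by (rule wedge_seq_eqI) (simp add: entry_lower)

lemma wedge_degree_lower: "finite S \<Longrightarrow> wedge_degree (lower n S x) = wedge_degree x - int n * int (card S)"
proof (induction S rule: finite_induct)
  case (insert m S)
  then show ?case by (simp add: lower_insert wedge_degree_shift_entry algebra_simps)
qed simp

lemma tail_from_lower: "tail_from M x \<Longrightarrow> S \<subseteq> {..<M} \<Longrightarrow> tail_from M (lower n S x)"
  using finite_subset[of S "{..<M}"] by (auto simp: tail_from_def entry_lower)

text \<open>The first \<open>M\<close> entries lie strictly above the tail, so all inversions are
  among them and sorting does not reach the tail.\<close>

definition bounded_tail :: "nat \<Rightarrow> wedge_seq \<Rightarrow> bool" where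
  "bounded_tail M x \<longleftrightarrow> tail_from M x \<and> (\<forall>j<M. - int M < entry x j)"

lemma bounded_tail_ex: "\<exists>M. bounded_tail M x"
proof -
  obtain M where M: "tail_from M x" using tail_from_ex by blast
  define B where "B = Max ((\<lambda>j. nat \<bar>entry x j\<bar>) ` {..<Suc M})"
  have B: "nat \<bar>entry x j\<bar> \<le> B" if "j < M" for j
    unfolding B_def by (rule Max_ge) (use that in auto)
  have "- int (M + B + 1) < entry x j" if "j < M + B + 1" for j
  proof (cases "j < M")
    case True
    then show ?thesis using B[OF True] by linarith
  next
    case False
    then show ?thesis using M that by (simp add: tail_from_def)
  qed
  then show ?thesis using tail_from_mono[OF M, of "M + B + 1"] by (auto simp: bounded_tail_def)
qed

lemma inversions_swap_entries_eq:
  assumes j: "Suc j < M" and less: "entry x j < entry x (Suc j)"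
  shows "inversions M x = Suc (inversions M (swap_entries x j))"
proof -
  define \<tau> where "\<tau> k = (if k = j then Suc j else if k = Suc j then j else k)" for k
  let ?f = "\<lambda>(a, b). (\<tau> a, \<tau> b)"
  let ?I = "\<lambda>x. {(i, k). i < k \<and> k < M \<and> entry x i < entry x k}"
  have \<tau>\<tau>: "\<tau> (\<tau> a) = a" for a by (simp add: \<tau>_def)
  have "?I x = insert (j, Suc j) (?f ` ?I (swap_entries x j))"
  proof (intro subset_antisym subsetI)
    fix p assume p: "p \<in> ?I x"
    obtain a b where ab: "p = (a, b)" by fastforce
    show "p \<in> insert (j, Suc j) (?f ` ?I (swap_entries x j))"
    proof (cases "p = (j, Suc j)")
      case False
      then have "(\<tau> a, \<tau> b) \<in> ?I (swap_entries x j)"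
        using p j by (auto simp: ab \<tau>_def entry_swap_entries split: if_splits)
      then show ?thesis by (intro insertI2 image_eqI[of _ _ "(\<tau> a, \<tau> b)"]) (auto simp: ab \<tau>\<tau>)
    qed simp
  next
    fix p assume p: "p \<in> insert (j, Suc j) (?f ` ?I (swap_entries x j))"
    then consider "p = (j, Suc j)" | a b where "p = (\<tau> a, \<tau> b)" "(a, b) \<in> ?I (swap_entries x j)" by auto
    then show "p \<in> ?I x"
    proof cases
      case 1
      then show ?thesis using j less by simp
    next
      case 2
      have "\<not> (a = j \<and> b = Suc j)" using 2(2) less by (auto simp: entry_swap_entries)
      then show ?thesis using 2 j by (auto simp: \<tau>_def entry_swap_entries split: if_splits)
    qed
  qed
  moreover have "(j, Suc j) \<notin> ?f ` ?I (swap_entries x j)"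
  proof
    assume "(j, Suc j) \<in> ?f ` ?I (swap_entries x j)"
    then obtain a b where "\<tau> a = j" "\<tau> b = Suc j" "a < b" by auto
    then show False by (auto simp: \<tau>_def split: if_splits)
  qed
  moreover have "inj_on ?f (?I (swap_entries x j))"
    by (rule inj_on_inverseI[of _ ?f]) (auto simp: \<tau>\<tau>)
  ultimately show ?thesis
    unfolding inversions_def by (simp add: finite_pairs_less card_image)
qed

context fock
begin

text \<open>
  If all inversions have gap less than \<open>n\<close>, then straightening only swaps adjacent factors and each
  swap contributes \<open>- q\<close>.
\<close>

lemma wcoords_small_gaps:
  assumes "bounded_tail M x" "\<And>i j. i < j \<Longrightarrow> entry x j - entry x i < N"
  shows "(\<not> inj (entry x) \<longrightarrow> wcoords x = 0) \<and> (inj (entry x) \<longrightarrow>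
    (\<exists>\<mu>. (\<forall>y. bead \<mu> y \<longleftrightarrow> y \<in> range (entry x)) \<and> wcoords x = scl ((- q) ^ inversions M x) (basis \<mu>)))"
  using assms
proof (induction "inversions M x" arbitrary: x rule: less_induct)
  case less
  have tail: "entry x j = - int j" if "j \<ge> M" for j using less.prems(1) that by (simp add: bounded_tail_def tail_from_def)
  have low: "- int M < entry x j" if "j < M" for j using less.prems(1) that by (simp add: bounded_tail_def)
  show ?case
  proof (cases "\<exists>j. Suc j < M \<and> entry x j \<le> entry x (Suc j)")
    case True
    then obtain j where j: "Suc j < M" "entry x j \<le> entry x (Suc j)" by blast
    have h: "coords (hecke j (basis x) + basis x) = 0" using hecke_null coords_eq_0_iff by blast
    show ?thesis
    proof (cases "entry x j = entry x (Suc j)")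
      case True
      \<comment> \<open>On equal neighbours \<open>T\<close> acts as \<open>v\<close>; since
        \<open>T + 1\<close> vanishes in the quotient and \<open>v + 1 \<noteq> 0\<close>, the wedge
        is 0.\<close>
      then have "hecke j (basis x) = scl v (basis x)"
        using hecke_pair_close[of "entry x j" "entry x (Suc j)"] N_pos upd2_same[of x j]
        by (simp add: hecke_basis)
      then have "scl (v + 1) (wcoords x) = 0"
        using h lin_scl[OF lin_coords, of v "basis x"] lin_add[OF lin_coords, of "scl v (basis x)" "basis x"]
        by (simp add: scl.scale_left_distrib)
      then have "wcoords x = 0" using v_facts by simp
      moreover have "\<not> inj (entry x)" using True by (metis injD n_not_Suc_n)
      ultimately show ?thesis by simp
    next
      case False
      then have lt: "entry x j < entry x (Suc j)" using j by simp
      let ?x = "swap_entries x j"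
      \<comment> \<open>For an increasing pair with gap below \<open>n\<close> only the swapped term
        remains.\<close>
      have "hecke j (basis x) = scl q (basis ?x)"
        using hecke_pair_close[of "entry x j" "entry x (Suc j)"] less.prems(2)[of j "Suc j"] lt
        by (simp add: hecke_basis swap_entries_def)
      then have w: "wcoords x = scl (- q) (wcoords ?x)"
        using h lin_scl[OF lin_coords, of q "basis ?x"] lin_add[OF lin_coords, of "scl q (basis ?x)" "basis x"]
        by (simp add: add_eq_0_iff)
      have inv: "inversions M x = Suc (inversions M ?x)" by (rule inversions_swap_entries_eq[OF j(1) lt])
      have bt: "bounded_tail M ?x"
        using less.prems(1) j(1) by (auto simp: bounded_tail_def tail_from_def entry_swap_entries)
      have gap: "entry ?x k - entry ?x i < N" if "i < k" for i k
      proof (cases "i = j \<and> k = Suc j")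
        case True
        then show ?thesis using lt N_pos by (simp add: entry_swap_entries)
      next
        case F: False
        let ?t = "\<lambda>k. if k = j then Suc j else if k = Suc j then j else k"
        have "?t i < ?t k" using that F by auto
        moreover have "entry ?x k = entry x (?t k)" for k by (simp add: entry_swap_entries)
        ultimately show ?thesis using less.prems(2) by simp
      qed
      have ex: "entry ?x = entry x \<circ> (\<lambda>k. if k = j then Suc j else if k = Suc j then j else k)"
        by (auto simp: entry_swap_entries)
      have bij: "bij (\<lambda>k. if k = j then Suc j else if k = Suc j then j else k)"
        by (rule o_bij[of "\<lambda>k. if k = j then Suc j else if k = Suc j then j else k"]) auto
      have inj: "inj (entry ?x) \<longleftrightarrow> inj (entry x)" and range: "range (entry ?x) = range (entry x)"
      proof -
        show "range (entry ?x) = range (entry x)" unfolding ex image_comp[symmetric] bij_is_surj[OF bij] ..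
        show "inj (entry ?x) \<longleftrightarrow> inj (entry x)"
        proof
          assume "inj (entry x)"
          then show "inj (entry ?x)" unfolding ex using bij_is_inj[OF bij] by (rule inj_compose)
        next
          assume "inj (entry ?x)"
          then have "inj (entry ?x \<circ> (\<lambda>k. if k = j then Suc j else if k = Suc j then j else k))"
            using bij_is_inj[OF bij] by (rule inj_compose)
          moreover have "entry ?x \<circ> (\<lambda>k. if k = j then Suc j else if k = Suc j then j else k) = entry x"
            by (auto simp: entry_swap_entries)
          ultimately show "inj (entry x)" by simp
        qed
      qed
      have IH: "(\<not> inj (entry ?x) \<longrightarrow> wcoords ?x = 0) \<and> (inj (entry ?x) \<longrightarrow>
          (\<exists>\<mu>. (\<forall>y. bead \<mu> y \<longleftrightarrow> y \<in> range (entry ?x)) \<and> wcoords ?x = scl ((- q) ^ inversions M ?x) (basis \<mu>)))"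
        by (rule less.hyps[OF _ bt gap]) (simp add: inv)
      show ?thesis
      proof (intro conjI impI)
        assume "\<not> inj (entry x)"
        then show "wcoords x = 0" using IH inj w by simp
      next
        assume "inj (entry x)"
        then obtain \<mu> where "\<forall>y. bead \<mu> y \<longleftrightarrow> y \<in> range (entry ?x)" "wcoords ?x = scl ((- q) ^ inversions M ?x) (basis \<mu>)"
          using IH inj by blast
        then show "\<exists>\<mu>. (\<forall>y. bead \<mu> y \<longleftrightarrow> y \<in> range (entry x)) \<and> wcoords x = scl ((- q) ^ inversions M x) (basis \<mu>)"
          using w range inv by (intro exI[of _ \<mu>]) simp
      qed
    qed
  next
    case False
    have dec: "entry x (Suc j) < entry x j" for j
    proof -
      consider "Suc j < M" | "Suc j = M" | "M \<le> j" by linarith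
      then show ?thesis
      proof cases
        case 1
        then show ?thesis using False by (simp add: not_le)
      next
        case 2
        then show ?thesis using low[of j] tail[of "Suc j"] by simp
      next
        case 3
        then show ?thesis using tail[of j] tail[of "Suc j"] by simp
      qed
    qed
    then obtain lam where lam: "x = partition_seq lam" using decreasing_eq_partition_seq by blast
    have "inj (entry x)"
      unfolding lam using partition_seq_decreasing[of _ _ lam]
      by (intro injI) (metis less_irrefl linorder_neqE_nat)
    moreover have "\<forall>y. bead lam y \<longleftrightarrow> y \<in> range (entry x)"
      by (auto simp: lam bead_def entry_partition_seq)
    moreover have "{(i, j). i < j \<and> j < M \<and> entry x i < entry x j} = {}"
      using partition_seq_decreasing[of _ _ lam] by (auto simp: lam dest: order.asym)
    then have "inversions M x = 0" unfolding inversions_def by (simp only: card.empty)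
    ultimately show ?thesis using wcoords_partition_seq[of lam] by (auto simp: lam intro!: exI[of _ lam])
  qed
qed

definition Vop :: "complex \<Rightarrow> (int_partition \<Rightarrow>\<^sub>0 complex) \<Rightarrow> (int_partition \<Rightarrow>\<^sub>0 complex)" where
  "Vop z = extend (\<lambda>lam. \<Sum>\<mu> | diagram \<mu> \<subseteq> diagram lam. scl (vcoeff n (- q) z lam \<mu>) (basis \<mu>))"

text \<open>The inverted pairs consist of a lowered factor and a later, not lowered one whose entry
  is less than \<open>n\<close> below. These are the resting beads that a moving bead jumps over,
  which is what the spin of the vertical strip counts.\<close>

lemma lower_partition_seq:
  assumes M: "tail_from M (partition_seq lam)" and S: "S \<subseteq> {..<M}" and inj: "inj (entry (lower n S (partition_seq lam)))"
  shows "\<exists>\<mu>. vflux n lam \<mu> (entry (partition_seq lam) ` S) \<and>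
    wcoords (lower n S (partition_seq lam)) = scl ((- q) ^ vstrip_spin n lam \<mu>) (basis \<mu>)"
proof -
  let ?x = "partition_seq lam"
  let ?z = "lower n S ?x"
  define A where "A = entry ?x ` S"
  have fin: "finite S" using S by (rule finite_subset) simp
  have xinj: "entry ?x i = entry ?x j \<longleftrightarrow> i = j" for i j
    using partition_seq_decreasing[of i j lam] partition_seq_decreasing[of j i lam] by (cases i j rule: linorder_cases) auto
  have xless: "entry ?x i < entry ?x j \<longleftrightarrow> j < i" for i j
    using partition_seq_decreasing[of i j lam] partition_seq_decreasing[of j i lam] by (cases i j rule: linorder_cases) auto
  have memA: "entry ?x j \<in> A \<longleftrightarrow> j \<in> S" for j by (auto simp: A_def xinj)
  have beadx: "bead lam y \<longleftrightarrow> (\<exists>j. entry ?x j = y)" for y by (auto simp: bead_def entry_partition_seq)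
  obtain K where K: "bounded_tail K ?z" using bounded_tail_ex by blast
  have gap: "entry ?z j - entry ?z i < N" if "i < j" for i j
    using partition_seq_decreasing[OF that, of lam] N_pos by (simp add: entry_lower[OF fin])
  obtain \<mu> where \<mu>: "\<forall>y. bead \<mu> y \<longleftrightarrow> y \<in> range (entry ?z)" "wcoords ?z = scl ((- q) ^ inversions K ?z) (basis \<mu>)"
    using wcoords_small_gaps[OF K gap] inj by blast
  have b: "bead \<mu> y \<longleftrightarrow> (bead lam y \<and> y \<notin> A) \<or> y + N \<in> A" for y
  proof
    assume "bead \<mu> y"
    then obtain j where j: "y = entry ?z j" using \<mu>(1) by auto
    show "(bead lam y \<and> y \<notin> A) \<or> y + N \<in> A"
      using j memA[of j] beadx[of y] by (cases "j \<in> S") (auto simp: entry_lower[OF fin])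
  next
    assume "(bead lam y \<and> y \<notin> A) \<or> y + N \<in> A"
    then show "bead \<mu> y"
    proof
      assume "bead lam y \<and> y \<notin> A"
      then obtain j where "entry ?x j = y" "j \<notin> S" using beadx memA by auto
      then have "entry ?z j = y" by (simp add: entry_lower[OF fin])
      then show ?thesis using \<mu>(1) by blast
    next
      assume "y + N \<in> A"
      then obtain j where "j \<in> S" "entry ?x j = y + N" by (auto simp: A_def)
      then have "entry ?z j = y" by (simp add: entry_lower[OF fin])
      then show ?thesis using \<mu>(1) by blast
    qed
  qed
  \<comment> \<open>A bead arriving at a resting bead would produce two equal entries.\<close>
  have disj: "y \<in> A \<or> \<not> bead lam y" if yN: "y + N \<in> A" for y
  proof (rule ccontr)
    assume "\<not> ?thesis"
    then obtain j where j: "entry ?x j = y" "j \<notin> S" using beadx memA by auto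
    obtain k where "k \<in> S" "y + N = entry ?x k"
      using yN unfolding A_def by (elim imageE)
    with j have "entry ?z j = entry ?z k" "j \<noteq> k" by (auto simp: entry_lower[OF fin])
    then show False using inj by (auto dest: injD)
  qed
  have A: "bead lam y" if "y \<in> A" for y using that beadx by (auto simp: A_def)
  have "bead_flux n lam \<mu> A"
    unfolding bead_flux_def using b disj A fin by (auto simp: A_def of_bool_def)
  then have v: "vflux n lam \<mu> A" unfolding vflux_def using b by auto
  have "inversions K ?z = card {(i, j). i < j \<and> i \<in> S \<and> j \<notin> S \<and> entry ?x i - N < entry ?x j}"
    unfolding inversions_def
  proof (rule arg_cong[of _ _ card], rule set_eqI)
    fix p :: "nat \<times> nat"
    obtain i j where p: "p = (i, j)" by fastforce
    have iff: "entry ?z i < entry ?z j \<longleftrightarrow> i \<in> S \<and> j \<notin> S \<and> entry ?x i - N < entry ?x j" if "i < j"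
      using partition_seq_decreasing[OF that, of lam] N_pos by (auto simp: entry_lower[OF fin])
    have "j < K" if "i < j" "entry ?z i < entry ?z j"
    proof (rule ccontr)
      assume "\<not> j < K"
      then have j: "entry ?z j = - int j" using K by (simp add: bounded_tail_def tail_from_def)
      have "\<not> i < K" using K that(2) j \<open>\<not> j < K\<close> by (auto simp: bounded_tail_def)
      then have "entry ?z i = - int i" using K by (simp add: bounded_tail_def tail_from_def)
      then show False using that j by simp
    qed
    then show "p \<in> {(i, j). i < j \<and> j < K \<and> entry ?z i < entry ?z j} \<longleftrightarrow>
        p \<in> {(i, j). i < j \<and> i \<in> S \<and> j \<notin> S \<and> entry ?x i - N < entry ?x j}"
      using iff by (auto simp: p)
  qed
  also have "\<dots> = card ((\<lambda>(i, j). (entry ?x i, entry ?x j)) ` {(i, j). i < j \<and> i \<in> S \<and> j \<notin> S \<and> entry ?x i - N < entry ?x j})"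
    by (rule card_image[symmetric]) (auto simp: inj_on_def xinj)
  also have "(\<lambda>(i, j). (entry ?x i, entry ?x j)) ` {(i, j). i < j \<and> i \<in> S \<and> j \<notin> S \<and> entry ?x i - N < entry ?x j} =
      (SIGMA a:A. {b \<in> {a - N<..<a}. bead lam b \<and> b \<notin> A})" (is "?L = ?R")
  proof (intro subset_antisym subsetI)
    fix p assume "p \<in> ?L"
    then show "p \<in> ?R" using memA beadx by (auto simp: A_def xless)
  next
    fix p assume "p \<in> ?R"
    then obtain a b where p: "p = (a, b)" "a \<in> A" "a - N < b" "b < a" "bead lam b" "b \<notin> A" by auto
    then obtain i j where "i \<in> S" "entry ?x i = a" "entry ?x j = b" using beadx by (auto simp: A_def)
    then show "p \<in> ?L" using p memA by (intro image_eqI[of _ _ "(i, j)"]) (auto simp flip: xless)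
  qed
  also have "card \<dots> = (\<Sum>a\<in>A. card {b \<in> {a - N<..<a}. bead lam b \<and> b \<notin> A})"
    by (rule card_SigmaI) (use fin in \<open>auto simp: A_def intro: finite_subset[of _ "{_<..<_}"]\<close>)
  also have "\<dots> = (\<Sum>a\<in>A. card {h \<in> {a - N<..<a}. bead \<mu> h \<and> h + N \<notin> A})"
  proof (rule sum.cong[OF refl], rule arg_cong[of _ _ card])
    show "{h \<in> {a - N<..<a}. bead lam h \<and> h \<notin> A} = {h \<in> {a - N<..<a}. bead \<mu> h \<and> h + N \<notin> A}" for a
      using b disj by blast
  qed
  also have "\<dots> = vstrip_spin n lam \<mu>" using vflux_spin_count(1)[OF v n] by simp
  finally have "inversions K ?z = vstrip_spin n lam \<mu>" .
  then show ?thesis using v \<mu>(2) by (auto simp: A_def)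
qed

lemma vflux_lower:
  assumes M: "tail_from M (partition_seq lam)" and v: "vflux n lam \<mu> A"
  shows "\<exists>S\<subseteq>{..<M}. A = entry (partition_seq lam) ` S \<and> inj (entry (lower n S (partition_seq lam)))"
proof -
  let ?x = "partition_seq lam"
  define S where "S = {j. entry ?x j \<in> A}"
  have flux: "of_bool (bead lam y) - of_bool (bead \<mu> y) = (of_bool (y \<in> A) - of_bool (y + N \<in> A) :: int)" for y
    using v by (simp add: vflux_def bead_flux_def)
  have finA: "finite A" using v by (simp add: vflux_def bead_flux_def)
  have bk: "bead \<mu> (a - N)" if "a \<in> A" for a using v that by (simp add: vflux_def)
  have beadx: "bead lam y \<longleftrightarrow> (\<exists>j. entry ?x j = y)" for y by (auto simp: bead_def entry_partition_seq)
  have xinj: "entry ?x i = entry ?x j \<longleftrightarrow> i = j" for i j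
    using partition_seq_decreasing[of i j lam] partition_seq_decreasing[of j i lam] by (cases i j rule: linorder_cases) auto
  have S: "S \<subseteq> {..<M}"
  proof (rule subsetI, rule ccontr)
    fix j assume j: "j \<in> S" "j \<notin> {..<M}"
    have t: "entry ?x k = - int k" if "k \<ge> M" for k using M that by (simp add: tail_from_def)
    \<comment> \<open>In the vacuum tail all positions carry beads, and \<open>\<mu>\<close> has a
      bead at the end of every step; hence a bead that moves there forces the next one on its runner
      to move as well, ad infinitum.\<close>
    have "- int j - int k * N \<in> A" for k
    proof (induction k)
      case 0
      then show ?case using j t[of j] by (simp add: S_def)
    next
      case (Suc k)
      let ?a = "- int j - int k * N"
      have "entry ?x (j + Suc k * n) = ?a - N" using t[of "j + Suc k * n"] j by (simp add: algebra_simps)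
      then have "bead lam (?a - N)" using beadx by blast
      then have "?a - N \<in> A" using flux[of "?a - N"] bk[OF Suc] Suc by (simp add: of_bool_def split: if_splits)
      then show ?case by (simp add: algebra_simps)
    qed
    then show False using not_mem_progression(2)[OF finA n, of "- int j"] by blast
  qed
  have finS: "finite S" using S by (rule finite_subset) simp
  have "A = entry ?x ` S" using vflux_bead[OF v] beadx by (force simp: S_def)
  moreover have "inj (entry (lower n S ?x))"
  proof -
    have F: False if "j \<in> S" "k \<notin> S" "entry ?x j - N = entry ?x k" for j k
    proof -
      have a: "entry ?x j \<in> A" "entry ?x j - N \<notin> A" using that by (auto simp: S_def)
      have "bead lam (entry ?x j - N)" using that(3) beadx by auto
      then show False using flux[of "entry ?x j - N"] a by (simp add: of_bool_def split: if_splits)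
    qed
    show ?thesis
    proof (rule injI)
      fix j k assume "entry (lower n S ?x) j = entry (lower n S ?x) k"
      then show "j = k" using F[of j k] F[of k j] xinj[of j k]
        by (auto simp: entry_lower[OF finS] split: if_splits)
    qed
  qed
  ultimately show ?thesis using S by blast
qed

text \<open>The right-hand side is the generating function of the elementary symmetric functions in
  the shifts. Sets \<open>S\<close> that produce a collision contribute 0, and the other ones
  correspond bijectively to vertical strips.\<close>

lemma Vop_basis:
  assumes M: "tail_from M (partition_seq lam)"
  shows "Vop z (basis lam) = (\<Sum>S\<in>Pow {..<M}. scl (z ^ card S) (wcoords (lower n S (partition_seq lam))))"
proof -
  let ?x = "partition_seq lam"
  let ?I = "{S. S \<subseteq> {..<M} \<and> inj (entry (lower n S ?x))}"
  have xinj: "entry ?x i = entry ?x j \<longleftrightarrow> i = j" for i j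
    using partition_seq_decreasing[of i j lam] partition_seq_decreasing[of j i lam] by (cases i j rule: linorder_cases) auto
  have zero: "wcoords (lower n S ?x) = 0" if S: "S \<subseteq> {..<M}" and ni: "\<not> inj (entry (lower n S ?x))" for S
  proof -
    have fin: "finite S" using S by (rule finite_subset) simp
    obtain K where K: "bounded_tail K (lower n S ?x)" using bounded_tail_ex by blast
    have gap: "entry (lower n S ?x) j - entry (lower n S ?x) i < N" if "i < j" for i j
      using partition_seq_decreasing[OF that, of lam] N_pos by (simp add: entry_lower[OF fin])
    show ?thesis using wcoords_small_gaps[OF K gap] ni by blast
  qed
  define P where "P S \<mu> \<longleftrightarrow> vflux n lam \<mu> (entry ?x ` S) \<and>
      wcoords (lower n S ?x) = scl ((- q) ^ vstrip_spin n lam \<mu>) (basis \<mu>)" for S \<mu>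
  have "\<forall>S\<in>?I. \<exists>\<mu>. P S \<mu>"
    using lower_partition_seq[OF M] unfolding P_def by blast
  then obtain m where "\<forall>S\<in>?I. P S (m S)" by (rule bchoice[THEN exE])
  then have m: "\<And>S. S \<in> ?I \<Longrightarrow> vflux n lam (m S) (entry ?x ` S)"
    "\<And>S. S \<in> ?I \<Longrightarrow> wcoords (lower n S ?x) = scl ((- q) ^ vstrip_spin n lam (m S)) (basis (m S))"
    unfolding P_def by blast+
  have inj: "inj_on m ?I"
  proof (rule inj_onI)
    fix S T assume ST: "S \<in> ?I" "T \<in> ?I" "m S = m T"
    then have "entry ?x ` S = entry ?x ` T"
      using bead_flux_unique[OF _ _ n] m(1)[OF ST(1)] m(1)[OF ST(2)] by (metis vflux_def)
    moreover have "inj (entry ?x)" using xinj by (auto simp: inj_def)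
    ultimately show "S = T" by (simp add: inj_image_eq_iff)
  qed
  have img: "m ` ?I = {\<mu>. vertical_strip n lam \<mu>}"
  proof (intro subset_antisym subsetI)
    fix \<mu> assume "\<mu> \<in> m ` ?I"
    then show "\<mu> \<in> {\<mu>. vertical_strip n lam \<mu>}" using m(1) vertical_strip_iff[OF n] by blast
  next
    fix \<mu> assume "\<mu> \<in> {\<mu>. vertical_strip n lam \<mu>}"
    then obtain A where A: "vflux n lam \<mu> A" using vertical_strip_iff[OF n] by blast
    obtain S where S: "S \<in> ?I" "A = entry ?x ` S" using vflux_lower[OF M A] by blast
    have "bead \<mu> y = bead (m S) y" for y
    proof -
      have "of_bool (bead lam y) - of_bool (bead \<mu> y) = (of_bool (y \<in> A) - of_bool (y + N \<in> A) :: int)"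
        "of_bool (bead lam y) - of_bool (bead (m S) y) = (of_bool (y \<in> A) - of_bool (y + N \<in> A) :: int)"
        using A m(1)[OF S(1)] S(2) by (simp_all add: vflux_def bead_flux_def)
      then have "of_bool (bead \<mu> y) = (of_bool (bead (m S) y) :: int)" by linarith
      then show ?thesis by (cases "bead \<mu> y"; cases "bead (m S) y") auto
    qed
    then have "\<mu> = m S" by (rule eq_of_bead)
    then show "\<mu> \<in> m ` ?I" using S(1) by blast
  qed
  have "(\<Sum>S\<in>Pow {..<M}. scl (z ^ card S) (wcoords (lower n S ?x))) = (\<Sum>S\<in>?I. scl (z ^ card S) (wcoords (lower n S ?x)))"
    by (rule sum.mono_neutral_right) (use zero in auto)
  also have "\<dots> = (\<Sum>S\<in>?I. scl (vcoeff n (- q) z lam (m S)) (basis (m S)))"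
  proof (rule sum.cong[OF refl])
    fix S assume S: "S \<in> ?I"
    have "card (entry ?x ` S) = card S" by (rule card_image) (auto simp: inj_on_def xinj)
    then have "ribbon_count n lam (m S) = card S" using vflux_spin_count(2)[OF m(1)[OF S] n] by simp
    moreover have "vertical_strip n lam (m S)" using m(1)[OF S] vertical_strip_iff[OF n] by blast
    ultimately show "scl (z ^ card S) (wcoords (lower n S ?x)) = scl (vcoeff n (- q) z lam (m S)) (basis (m S))"
      using m(2)[OF S] by (simp add: vcoeff_def)
  qed
  also have "\<dots> = (\<Sum>\<mu>\<in>m ` ?I. scl (vcoeff n (- q) z lam \<mu>) (basis \<mu>))"
    by (simp add: sum.reindex[OF inj])
  also have "\<dots> = (\<Sum>\<mu> | diagram \<mu> \<subseteq> diagram lam. scl (vcoeff n (- q) z lam \<mu>) (basis \<mu>))"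
    unfolding img
  proof (rule sum.mono_neutral_left[OF finite_subpartitions])
    show "{\<mu>. vertical_strip n lam \<mu>} \<subseteq> {\<mu>. diagram \<mu> \<subseteq> diagram lam}" using vertical_strip_subset by blast
  qed (simp add: vcoeff_def)
  also have "\<dots> = Vop z (basis lam)" by (simp add: Vop_def)
  finally show ?thesis ..
qed

end

section \<open>Half vertex operators\<close>

abbreviation below :: "nat \<Rightarrow> int_partition set" where
  "below s \<equiv> {lam. partition_size lam < s}"

definition size_op :: "(int_partition \<Rightarrow>\<^sub>0 complex) \<Rightarrow> (int_partition \<Rightarrow>\<^sub>0 complex)" where
  "size_op = extend (\<lambda>lam. scl (of_nat (partition_size lam)) (basis lam))"

lemma lin_size_op: "lin size_op"
  by (simp add: size_op_def lin_extend)

lemma size_op_basis: "size_op (basis lam) = scl (of_nat (partition_size lam)) (basis lam)"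
  unfolding size_op_def by (rule extend_basis)

lemma lookup_size_op: "Poly_Mapping.lookup (size_op f) \<mu> = of_nat (partition_size \<mu>) * Poly_Mapping.lookup f \<mu>"
proof -
  have "Poly_Mapping.lookup (size_op f) \<mu> =
      (\<Sum>lam\<in>Poly_Mapping.keys f. if lam = \<mu> then of_nat (partition_size \<mu>) * Poly_Mapping.lookup f \<mu> else 0)"
    unfolding size_op_def extend_def lookup_sum
    by (rule sum.cong[OF refl]) (simp add: lookup_single when_def)
  then show ?thesis by (simp add: in_keys_iff)
qed

lemma size_op_homogeneous: "homogeneous d f \<Longrightarrow> size_op f = scl (of_int d) f"
proof (rule poly_mapping_eqI)
  fix \<mu> assume f: "homogeneous d f"
  show "Poly_Mapping.lookup (size_op f) \<mu> = Poly_Mapping.lookup (scl (of_int d) f) \<mu>"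
  proof (cases "d = int (partition_size \<mu>)")
    case False
    then show ?thesis using f by (simp add: lookup_size_op homogeneous_def supported_lookup)
  qed (simp add: lookup_size_op)
qed

lemma homogeneous_below: "homogeneous d f \<Longrightarrow> d < int s \<Longrightarrow> supported (below s) f"
  unfolding homogeneous_def by (erule supported_mono) auto

lemma supported_empty: "supported {} f \<Longrightarrow> f = 0"
  by (simp add: supported_def)

lemma bounded_ex: "\<exists>s. supported (below s) f"
proof -
  have "finite (partition_size ` Poly_Mapping.keys f)" by simp
  then obtain s where "\<forall>k\<in>partition_size ` Poly_Mapping.keys f. k < s" using finite_nat_set_iff_bounded by blast
  then show ?thesis by (auto simp: supported_def)
qed

lemma max_key:
  assumes "f \<noteq> 0"
  obtains \<mu> where "Poly_Mapping.lookup f \<mu> \<noteq> 0" "supported (below (Suc (partition_size \<mu>))) f"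
proof -
  have "Poly_Mapping.keys f \<noteq> {}" using assms by simp
  then have "Max (partition_size ` Poly_Mapping.keys f) \<in> partition_size ` Poly_Mapping.keys f" by (intro Max_in) auto
  then obtain \<mu> where \<mu>: "\<mu> \<in> Poly_Mapping.keys f" "Max (partition_size ` Poly_Mapping.keys f) = partition_size \<mu>" by blast
  have "partition_size lam \<le> partition_size \<mu>" if "lam \<in> Poly_Mapping.keys f" for lam
    unfolding \<mu>(2)[symmetric] using that by (intro Max_ge) auto
  then have "supported (below (Suc (partition_size \<mu>))) f" by (auto simp: supported_def less_Suc_eq_le)
  then show ?thesis using that \<mu>(1) by (simp add: in_keys_iff)
qed

lemma sum_Pow_split:
  fixes f :: "nat set \<Rightarrow> 'a :: comm_monoid_add"
  assumes "m \<in> A" "finite A"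
  shows "(\<Sum>S\<in>Pow A. f S) = (\<Sum>T\<in>Pow (A - {m}). f T + f (insert m T))"
proof -
  have "Pow A = Pow (A - {m}) \<union> insert m ` Pow (A - {m})"
    using assms(1) Pow_insert[of m "A - {m}"] by (simp add: insert_absorb)
  moreover have "inj_on (insert m) (Pow (A - {m}))" by (auto simp: inj_on_def)
  moreover have "Pow (A - {m}) \<inter> insert m ` Pow (A - {m}) = {}" by auto
  ultimately show ?thesis
    using assms(2) by (simp add: sum.union_disjoint sum.reindex sum.distrib)
qed

lemma sum_telescope_from_1:
  fixes f :: "nat \<Rightarrow> 'a :: ab_group_add"
  shows "(\<Sum>k\<in>{1..m}. f k - f (Suc k)) = f 1 - f (Suc m)"
  by (induction m) auto

context fock
begin

lemma Jh_vanish: "supported (below s) f \<Longrightarrow> s \<le> k \<Longrightarrow> k \<ge> 1 \<Longrightarrow> Jh k f = 0"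
proof -
  assume f: "supported (below s) f" and k: "s \<le> k" "k \<ge> 1"
  have "Jh k (basis lam) = 0" if "partition_size lam < s" for lam
  proof -
    have "homogeneous (int (partition_size lam)) (basis lam)"
      by (auto simp: homogeneous_def intro: supported_single)
    then have "homogeneous (int (partition_size lam) - N * int k) (Jh k (basis lam))" using k(2) by (rule homogeneous_Jh)
    moreover have "1 * int k \<le> N * int k" using n by (intro mult_right_mono) auto
    then have "int (partition_size lam) - N * int k < int 0" using that k by linarith
    ultimately have "supported (below 0) (Jh k (basis lam))" by (rule homogeneous_below)
    then show ?thesis by (simp add: supported_empty)
  qed
  then show "Jh k f = 0"
    unfolding lin_expand[OF lin_Jh, of k f] using f by (intro sum.neutral ballI) (auto simp: supported_def)
qed

lemma Jh_below: "supported (below s) f \<Longrightarrow> k \<ge> 1 \<Longrightarrow> supported (below (s - 1)) (Jh k f)"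
proof -
  assume f: "supported (below s) f" and k: "k \<ge> 1"
  have "supported (below (s - 1)) (Jh k (basis lam))" if "partition_size lam < s" for lam
  proof (rule homogeneous_below)
    show "homogeneous (int (partition_size lam) - N * int k) (Jh k (basis lam))"
      using k by (intro homogeneous_Jh) (auto simp: homogeneous_def intro: supported_single)
    have "1 * 1 \<le> N * int k" using n k by (intro mult_mono) auto
    then show "int (partition_size lam) - N * int k < int (s - 1)" using that by linarith
  qed
  then show "supported (below (s - 1)) (Jh k f)"
    unfolding lin_expand[OF lin_Jh, of k f] using f by (intro supported_sum supported_scl) (auto simp: supported_def)
qed

text \<open>The infinite sum of \<open>a k J_k\<close>: on a ket the terms with \<open>k\<close>
  above its size vanish, because \<open>J_k\<close> lowers the size by \<open>n k\<close>.\<close>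

definition Jser :: "(nat \<Rightarrow> complex) \<Rightarrow> (int_partition \<Rightarrow>\<^sub>0 complex) \<Rightarrow> (int_partition \<Rightarrow>\<^sub>0 complex)" where
  "Jser a = extend (\<lambda>lam. \<Sum>k\<in>{1..partition_size lam}. scl (a k) (Jh k (basis lam)))"

lemma lin_Jser: "lin (Jser a)"
  by (simp add: Jser_def lin_extend)

lemma Jser_eq:
  assumes "supported (below (Suc s)) f"
  shows "Jser a f = (\<Sum>k\<in>{1..s}. scl (a k) (Jh k f))"
proof -
  have l: "lin (\<lambda>f. \<Sum>k\<in>{1..s}. scl (a k) (Jh k f))" by (intro lin_sum_op lin_scale lin_Jh)
  have b: "Jser a (basis lam) = (\<Sum>k\<in>{1..s}. scl (a k) (Jh k (basis lam)))" if "partition_size lam \<le> s" for lam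
  proof -
    have "Jser a (basis lam) = (\<Sum>k\<in>{1..partition_size lam}. scl (a k) (Jh k (basis lam)))" by (simp add: Jser_def)
    also have "\<dots> = (\<Sum>k\<in>{1..s}. scl (a k) (Jh k (basis lam)))"
    proof (rule sum.mono_neutral_left)
      show "\<forall>k\<in>{1..s} - {1..partition_size lam}. scl (a k) (Jh k (basis lam)) = 0"
        by (auto intro!: Jh_vanish[of "Suc (partition_size lam)"] supported_single)
    qed (use that in auto)
    finally show ?thesis .
  qed
  show ?thesis
    unfolding lin_expand[OF lin_Jser, of a f] lin_expand[OF l, of f]
    by (rule sum.cong[OF refl]) (use assms b in \<open>auto simp: supported_def less_Suc_eq_le\<close>)
qed

lemma Jser_below: "supported (below s) f \<Longrightarrow> supported (below (s - 1)) (Jser a f)"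
proof -
  assume f: "supported (below s) f"
  then have f': "supported (below (Suc s)) f" by (rule supported_mono) auto
  show ?thesis unfolding Jser_eq[OF f'] by (intro supported_sum supported_scl Jh_below f) auto
qed

lemma Jser_add: "Jser (\<lambda>k. a k + b k) f = Jser a f + Jser b f"
proof -
  obtain s where "supported (below s) f" using bounded_ex by blast
  then have f: "supported (below (Suc s)) f" by (rule supported_mono) auto
  show ?thesis unfolding Jser_eq[OF f] by (simp add: scl.scale_left_distrib sum.distrib)
qed

lemma Jser_scale: "Jser (\<lambda>k. c * a k) f = scl c (Jser a f)"
proof -
  obtain s where "supported (below s) f" using bounded_ex by blast
  then have f: "supported (below (Suc s)) f" by (rule supported_mono) auto
  show ?thesis unfolding Jser_eq[OF f] by (simp add: scl.scale_sum_right)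
qed

lemma Jser_uminus: "Jser (\<lambda>k. - a k) f = - Jser a f"
  using Jser_scale[of "- 1" a f] by simp

lemma Jser_commute: "Jser a (Jser b f) = Jser b (Jser a f)"
proof -
  obtain s where "supported (below s) f" using bounded_ex by blast
  then have f: "supported (below (Suc s)) f" by (rule supported_mono) auto
  have g: "supported (below (Suc s)) (Jser c f)" for c using Jser_below[OF f] by (rule supported_mono) auto
  have e: "Jser a (Jser b f) = (\<Sum>k\<in>{1..s}. \<Sum>l\<in>{1..s}. scl (a k * b l) (Jh k (Jh l f)))" for a b
    unfolding Jser_eq[OF g] unfolding Jser_eq[OF f] lin_sum[OF lin_Jh] lin_scl[OF lin_Jh] scl.scale_sum_right by simp
  show ?thesis
    unfolding e[of b a] by (subst sum.swap) (auto simp: e[of a b] Jh_commute mult.commute intro!: sum.cong)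
qed

lemma Jser_Jh_commute: "k \<ge> 1 \<Longrightarrow> Jser a (Jh k f) = Jh k (Jser a f)"
proof -
  assume k: "k \<ge> 1"
  obtain s where "supported (below s) f" using bounded_ex by blast
  then have f: "supported (below (Suc s)) f" by (rule supported_mono) auto
  have g: "supported (below (Suc s)) (Jh k f)" using Jh_below[OF f k] by (rule supported_mono) auto
  show ?thesis
    unfolding Jser_eq[OF g] Jser_eq[OF f] lin_sum[OF lin_Jh] lin_scl[OF lin_Jh]
    by (intro sum.cong refl arg_cong2[of _ _ _ _ scl] Jh_commute) (use k in auto)
qed

lemma size_op_Jh:
  assumes k: "k \<ge> 1" shows "size_op (Jh k f) = Jh k (size_op f) - scl (of_nat (n * k)) (Jh k f)"
proof (rule lin_eqI[where f = "\<lambda>f. size_op (Jh k f)" and g = "\<lambda>f. Jh k (size_op f) - scl (of_nat (n * k)) (Jh k f)"])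
  show "lin (\<lambda>f. size_op (Jh k f))" by (rule lin_comp[OF lin_size_op lin_Jh])
  show "lin (\<lambda>f. Jh k (size_op f) - scl (of_nat (n * k)) (Jh k f))"
    by (intro lin_minus lin_scale lin_Jh lin_comp[OF lin_Jh lin_size_op])
  fix lam
  have "homogeneous (int (partition_size lam) - N * int k) (Jh k (basis lam))"
    using k by (intro homogeneous_Jh) (auto simp: homogeneous_def intro: supported_single)
  from size_op_homogeneous[OF this]
  show "size_op (Jh k (basis lam)) = Jh k (size_op (basis lam)) - scl (of_nat (n * k)) (Jh k (basis lam))"
    unfolding size_op_basis lin_scl[OF lin_Jh] by (simp add: scl.scale_left_diff_distrib)
qed

lemma size_op_Jser: "size_op (Jser a f) = Jser a (size_op f) - scl (of_nat n) (Jser (\<lambda>k. of_nat k * a k) f)"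
proof -
  obtain s where "supported (below s) f" using bounded_ex by blast
  then have f: "supported (below (Suc s)) f" by (rule supported_mono) auto
  have g: "supported (below (Suc s)) (size_op f)"
    using f by (auto simp: supported_lookup lookup_size_op)
  have "size_op (Jser a f) = (\<Sum>k\<in>{1..s}. scl (a k) (Jh k (size_op f)) - scl (of_nat n) (scl (of_nat k * a k) (Jh k f)))"
    unfolding Jser_eq[OF f] lin_sum[OF lin_size_op] lin_scl[OF lin_size_op]
    by (rule sum.cong[OF refl]) (simp add: size_op_Jh scl.scale_right_diff_distrib mult_ac)
  then show ?thesis
    unfolding Jser_eq[OF f] Jser_eq[OF g] by (simp only: sum_subtractf scl.scale_sum_right)
qed

text \<open>\<open>Jser\<close> lowers the size, so a nonzero coefficient at a partition of maximal
  size forces that size to be \<open>d\<close>, where the coefficient is assumed to be 0.\<close>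

lemma size_op_uniq:
  assumes eq: "size_op f = scl d f + scl c (Jser a f)"
    and top: "\<And>\<mu>. of_nat (partition_size \<mu>) = d \<Longrightarrow> Poly_Mapping.lookup f \<mu> = 0"
  shows "f = 0"
proof (rule ccontr)
  assume "f \<noteq> 0"
  then obtain \<mu> where \<mu>: "Poly_Mapping.lookup f \<mu> \<noteq> 0" "supported (below (Suc (partition_size \<mu>))) f" by (rule max_key)
  have "supported (below (partition_size \<mu>)) (Jser a f)" using Jser_below[OF \<mu>(2)] by simp
  then have "Poly_Mapping.lookup (Jser a f) \<mu> = 0" by (simp add: supported_lookup)
  then have "of_nat (partition_size \<mu>) * Poly_Mapping.lookup f \<mu> = d * Poly_Mapping.lookup f \<mu>"
    using arg_cong[OF eq, of "\<lambda>f. Poly_Mapping.lookup f \<mu>"] by (simp add: lookup_size_op lookup_add)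
  then show False using \<mu>(1) top by auto
qed

lemma lin_Vop: "lin (Vop z)"
  by (simp add: Vop_def lin_extend)

lemma Vop_leading: "\<exists>r. Vop z (basis lam) = basis lam + r \<and> supported (below (partition_size lam)) r"
proof -
  let ?x = "partition_seq lam"
  obtain M where M: "tail_from M ?x" using tail_from_ex by blast
  let ?f = "\<lambda>S. scl (z ^ card S) (wcoords (lower n S ?x))"
  let ?r = "\<Sum>S\<in>Pow {..<M} - {{}}. ?f S"
  have "Vop z (basis lam) = ?f {} + ?r"
    unfolding Vop_basis[OF M] by (rule sum.remove) auto
  then have "Vop z (basis lam) = basis lam + ?r" by (simp add: wcoords_partition_seq)
  moreover have "supported (below (partition_size lam)) ?r"
  proof (intro supported_sum supported_scl)
    fix S assume S: "S \<in> Pow {..<M} - {{}}"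
    then have fin: "finite S" by (auto intro: finite_subset)
    have "card S \<ge> 1" using S fin by (simp add: card_gt_0_iff Suc_le_eq)
    then have "1 * 1 \<le> N * int (card S)" using n by (intro mult_mono) auto
    then show "supported (below (partition_size lam)) (wcoords (lower n S ?x))"
      using homogeneous_wcoords[of "lower n S ?x"]
      by (intro homogeneous_below) (auto simp: wedge_degree_lower[OF fin] wedge_degree_partition_seq)
  qed
  ultimately show ?thesis by blast
qed

lemma Vop_top: "supported (below (Suc s)) f \<Longrightarrow> supported (below s) (Vop z f - f)"
proof -
  assume f: "supported (below (Suc s)) f"
  have l: "lin (\<lambda>f. Vop z f - f)" by (intro lin_minus lin_Vop lin_id)
  have "supported (below s) (Vop z (basis lam) - basis lam)" if "partition_size lam \<le> s" for lam
  proof -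
    obtain r where r: "Vop z (basis lam) = basis lam + r" "supported (below (partition_size lam)) r"
      using Vop_leading by blast
    have "supported (below s) r" by (rule supported_mono[OF r(2)]) (use that in auto)
    then show ?thesis by (simp add: r(1))
  qed
  then show ?thesis
    unfolding lin_expand[OF l, of f] using f
    by (intro supported_sum supported_scl) (auto simp: supported_def less_Suc_eq_le)
qed

text \<open>By unitriangularity the coefficient at a partition of maximal size survives
  \<open>Vop\<close>.\<close>

lemma Vop_reflects_below:
  assumes "supported (below s) (Vop z f)" shows "supported (below s) f"
proof (cases "f = 0")
  case False
  then obtain \<mu> where \<mu>: "Poly_Mapping.lookup f \<mu> \<noteq> 0" "supported (below (Suc (partition_size \<mu>))) f" by (rule max_key)
  have "Poly_Mapping.lookup (Vop z f - f) \<mu> = 0"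
    using Vop_top[OF \<mu>(2), of z] by (simp add: supported_lookup)
  then have "Poly_Mapping.lookup (Vop z f) \<mu> \<noteq> 0" using \<mu>(1) by (simp add: lookup_minus)
  then have "partition_size \<mu> < s" using assms by (auto simp: supported_lookup)
  then show ?thesis by (intro supported_mono[OF \<mu>(2)]) auto
qed (simp add: supported_0)

lemma Vop_inj: "Vop z f = Vop z g \<Longrightarrow> f = g"
proof -
  assume "Vop z f = Vop z g"
  then have "Vop z (f - g) = 0" by (simp only: lin_diff[OF lin_Vop] diff_self)
  then have "supported (below 0) (f - g)" using Vop_reflects_below[of 0 z "f - g"] by (simp only: supported_0)
  then show "f = g" using supported_empty[of "f - g"] by simp
qed

text \<open>
  The terms in which a factor is lowered twice cancel between a subset \<open>S\<close> not containing the
  position and \<open>insert m S\<close>; this is Newton's identity for the generating function of the \<open>e\<^sub>k\<close>.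
\<close>

lemma Jser_Vop_basis:
  assumes M: "tail_from M (partition_seq lam)"
  shows "Jser (\<lambda>k. w ^ k) (Vop (- w) (basis lam)) =
    - (\<Sum>S\<in>Pow {..<M}. scl (of_nat (card S) * (- w) ^ card S) (wcoords (lower n S (partition_seq lam))))"
proof -
  let ?x = "partition_seq lam"
  let ?K = "partition_size lam"
  let ?u = "\<lambda>T k m. wcoords (shift_entry n k m (lower n T ?x))"
  let ?F = "\<lambda>S. scl ((- w) ^ card S) (wcoords (lower n S ?x))"
  have finS: "finite S" if "S \<in> Pow {..<M}" for S using that by (auto intro: finite_subset)
  have supp: "supported (below (Suc ?K)) (Vop (- w) (basis lam))"
  proof -
    obtain r where r: "Vop (- w) (basis lam) = basis lam + r" "supported (below ?K) r" using Vop_leading by blast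
    show ?thesis unfolding r(1)
      by (intro supported_add supported_single supported_mono[OF r(2)]) auto
  qed
  have "Jser (\<lambda>k. w ^ k) (Vop (- w) (basis lam)) =
      (\<Sum>k\<in>{1..?K}. \<Sum>S\<in>Pow {..<M}. \<Sum>m<M. scl (w ^ k * (- w) ^ card S) (?u S k m))"
  proof -
    have "Jh k (wcoords (lower n S ?x)) = (\<Sum>m<M. ?u S k m)" if "k \<in> {1..?K}" "S \<in> Pow {..<M}" for k S
      by (rule Jh_wcoords) (use tail_from_lower[OF M] that in auto)
    then show ?thesis
      unfolding Jser_eq[OF supp] unfolding Vop_basis[OF M] lin_sum[OF lin_Jh] lin_scl[OF lin_Jh] scl.scale_sum_right
      by (intro sum.cong refl) (simp add: scl.scale_sum_right)
  qed
  also have "\<dots> = (\<Sum>m<M. \<Sum>S\<in>Pow {..<M}. \<Sum>k\<in>{1..?K}. scl (w ^ k * (- w) ^ card S) (?u S k m))"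
    by (subst sum.swap[of _ "Pow {..<M}"], subst sum.swap[of _ "{..<M}"], subst sum.swap[of _ "{..<M}"])
      (rule refl)
  also have "\<dots> = (\<Sum>m<M. \<Sum>T\<in>Pow ({..<M} - {m}). - ?F (insert m T))"
  proof (rule sum.cong[OF refl])
    fix m assume m: "m \<in> {..<M}"
    have "(\<Sum>S\<in>Pow {..<M}. \<Sum>k\<in>{1..?K}. scl (w ^ k * (- w) ^ card S) (?u S k m)) =
        (\<Sum>T\<in>Pow ({..<M} - {m}). (\<Sum>k\<in>{1..?K}. scl (w ^ k * (- w) ^ card T) (?u T k m)) +
          (\<Sum>k\<in>{1..?K}. scl (w ^ k * (- w) ^ card (insert m T)) (?u (insert m T) k m)))"
      by (rule sum_Pow_split[OF m]) simp
    also have "\<dots> = (\<Sum>T\<in>Pow ({..<M} - {m}). - ?F (insert m T))"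
    proof (rule sum.cong[OF refl])
      fix T assume T: "T \<in> Pow ({..<M} - {m})"
      then have fin: "finite T" and mT: "m \<notin> T" by (auto intro: finite_subset)
      let ?g = "\<lambda>k. scl (w ^ k * (- w) ^ card T) (?u T k m)"
      \<comment> \<open>A place in the set is already lowered once, so shifting it by
        \<open>k\<close> amounts to a shift by \<open>k + 1\<close> with the place removed from the
        set. Together with the sign of \<open>- w\<close> this makes the sum over \<open>k\<close>
        telescope.\<close>
      have u: "?u (insert m T) k m = ?u T (Suc k) m" for k
      proof -
        have "shift_entry n k m (lower n (insert m T) ?x) = shift_entry n (Suc k) m (lower n T ?x)"
          using fin mT by (intro wedge_seq_eqI) (simp add: entry_shift_entry entry_lower algebra_simps)
        then show ?thesis by simp
      qed
      have "(\<Sum>k\<in>{1..?K}. ?g k) + (\<Sum>k\<in>{1..?K}. scl (w ^ k * (- w) ^ card (insert m T)) (?u (insert m T) k m)) =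
          (\<Sum>k\<in>{1..?K}. ?g k - ?g (Suc k))"
        unfolding u using fin mT by (simp add: sum_subtractf sum_negf mult_ac)
      also have "\<dots> = ?g 1 - ?g (Suc ?K)" by (rule sum_telescope_from_1)
      \<comment> \<open>The upper end of the telescope has negative degree; this is why a sum up to
        the size \<open>?K\<close> suffices.\<close>
      also have "?u T (Suc ?K) m = 0"
      proof (rule wcoords_negative_degree)
        have neg: "a - b - c < 0" if "a < c" "0 \<le> b" for a b c :: int using that by linarith
        have "int ?K < 1 * int (Suc ?K)" by simp
        also have "\<dots> \<le> N * int (Suc ?K)" using n by (intro mult_right_mono) auto
        finally show "wedge_degree (shift_entry n (Suc ?K) m (lower n T ?x)) < 0"
          unfolding wedge_degree_shift_entry wedge_degree_lower[OF fin] wedge_degree_partition_seq by (rule neg) simp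
      qed
      also have "?g 1 - scl (w ^ Suc ?K * (- w) ^ card T) 0 = - ?F (insert m T)"
        using fin mT by (simp add: lower_insert)
      finally show "(\<Sum>k\<in>{1..?K}. ?g k) + (\<Sum>k\<in>{1..?K}. scl (w ^ k * (- w) ^ card (insert m T)) (?u (insert m T) k m)) =
          - ?F (insert m T)" .
    qed
    finally show "(\<Sum>S\<in>Pow {..<M}. \<Sum>k\<in>{1..?K}. scl (w ^ k * (- w) ^ card S) (?u S k m)) =
        (\<Sum>T\<in>Pow ({..<M} - {m}). - ?F (insert m T))" .
  qed
  also have "\<dots> = (\<Sum>m<M. \<Sum>S\<in>Pow {..<M}. if m \<in> S then - ?F S else 0)"
  proof (rule sum.cong[OF refl])
    fix m assume m: "m \<in> {..<M}"
    have "(\<Sum>S\<in>Pow {..<M}. if m \<in> S then - ?F S else 0) =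
        (\<Sum>T\<in>Pow ({..<M} - {m}). (if m \<in> T then - ?F T else 0) + (if m \<in> insert m T then - ?F (insert m T) else 0))"
      by (rule sum_Pow_split[OF m]) simp
    also have "\<dots> = (\<Sum>T\<in>Pow ({..<M} - {m}). - ?F (insert m T))"
      by (rule sum.cong[OF refl]) auto
    finally show "(\<Sum>T\<in>Pow ({..<M} - {m}). - ?F (insert m T)) = (\<Sum>S\<in>Pow {..<M}. if m \<in> S then - ?F S else 0)" ..
  qed
  \<comment> \<open>Every \<open>S\<close> is now counted once for each of its elements, which
    produces the factor \<open>card S\<close>.\<close>
  also have "\<dots> = (\<Sum>S\<in>Pow {..<M}. \<Sum>m<M. if m \<in> S then - ?F S else 0)" by (rule sum.swap)
  also have "\<dots> = (\<Sum>S\<in>Pow {..<M}. - scl (of_nat (card S) * (- w) ^ card S) (wcoords (lower n S ?x)))"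
  proof (rule sum.cong[OF refl])
    fix S assume S: "S \<in> Pow {..<M}"
    have "(\<Sum>m<M. if m \<in> S then - ?F S else 0) = (\<Sum>m\<in>S. - ?F S)"
      using S by (subst sum.inter_restrict[symmetric]) (auto simp: Int_absorb1)
    also have "\<dots> = - scl (of_nat (card S) * (- w) ^ card S) (wcoords (lower n S ?x))"
      by (rule poly_mapping_eqI) (simp add: lookup_sum lookup_minus del: sum_constant, simp)
    finally show "(\<Sum>m<M. if m \<in> S then - ?F S else 0) =
        - scl (of_nat (card S) * (- w) ^ card S) (wcoords (lower n S ?x))" .
  qed
  finally show ?thesis by (simp add: sum_negf)
qed

text \<open>Lowering the factors in \<open>S\<close> reduces the degree by \<open>n card S\<close>,
  so the commutator with \<open>size_op\<close> acts on the series like a derivative in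
  \<open>w\<close>; \<open>Jser_Vop_basis\<close> rewrites this derivative as a product.\<close>

lemma size_op_Vop: "size_op (Vop (- w) f) = Vop (- w) (size_op f) + scl (of_nat n) (Jser (\<lambda>k. w ^ k) (Vop (- w) f))"
proof (rule lin_eqI[where f = "\<lambda>f. size_op (Vop (- w) f)" and
      g = "\<lambda>f. Vop (- w) (size_op f) + scl (of_nat n) (Jser (\<lambda>k. w ^ k) (Vop (- w) f))"])
  show "lin (\<lambda>f. size_op (Vop (- w) f))" by (rule lin_comp[OF lin_size_op lin_Vop])
  show "lin (\<lambda>f. Vop (- w) (size_op f) + scl (of_nat n) (Jser (\<lambda>k. w ^ k) (Vop (- w) f)))"
    by (intro lin_plus lin_scale lin_comp[OF lin_Vop lin_size_op] lin_comp[OF lin_Jser lin_Vop])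
  fix lam
  let ?x = "partition_seq lam"
  obtain M where M: "tail_from M ?x" using tail_from_ex by blast
  let ?W = "\<lambda>S. wcoords (lower n S ?x)"
  have "size_op (Vop (- w) (basis lam)) = (\<Sum>S\<in>Pow {..<M}. scl ((- w) ^ card S) (size_op (?W S)))"
    unfolding Vop_basis[OF M] lin_sum[OF lin_size_op] lin_scl[OF lin_size_op] ..
  also have "\<dots> = (\<Sum>S\<in>Pow {..<M}. scl (of_nat (partition_size lam)) (scl ((- w) ^ card S) (?W S)) +
      scl (of_nat n) (- scl (of_nat (card S) * (- w) ^ card S) (?W S)))"
  proof (rule sum.cong[OF refl])
    fix S assume "S \<in> Pow {..<M}"
    then have "finite S" by (auto intro: finite_subset)
    then have e: "size_op (?W S) = scl (of_int (int (partition_size lam) - N * int (card S))) (?W S)"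
      using size_op_homogeneous[OF homogeneous_wcoords[of "lower n S ?x"]]
      by (simp add: wedge_degree_lower wedge_degree_partition_seq)
    show "scl ((- w) ^ card S) (size_op (?W S)) =
      scl (of_nat (partition_size lam)) (scl ((- w) ^ card S) (?W S)) +
      scl (of_nat n) (- scl (of_nat (card S) * (- w) ^ card S) (?W S))" unfolding e
      by (intro poly_mapping_eqI) (simp add: lookup_add lookup_minus algebra_simps)
  qed
  also have "\<dots> = scl (of_nat (partition_size lam)) (Vop (- w) (basis lam)) +
      scl (of_nat n) (Jser (\<lambda>k. w ^ k) (Vop (- w) (basis lam)))"
    unfolding Jser_Vop_basis[OF M] unfolding Vop_basis[OF M] sum.distrib scl.scale_sum_right[symmetric] sum_negf ..
  finally show "size_op (Vop (- w) (basis lam)) =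
      Vop (- w) (size_op (basis lam)) + scl (of_nat n) (Jser (\<lambda>k. w ^ k) (Vop (- w) (basis lam)))"
    unfolding size_op_basis lin_scl[OF lin_Vop] .
qed

text \<open>\<open>Vop_basis\<close> describes \<open>Vop\<close> on kets only, whereas
  \<open>Jh\<close> yields straightened vectors. Both sides are therefore compared as solutions of
  one equation for \<open>size_op\<close>. In size \<open>s - n j\<close>, where that equation
  leaves the solution free, both agree with \<open>Jh j\<close> of the ket.\<close>

lemma Vop_Jh_commute:
  assumes j: "j \<ge> 1" shows "Vop (- w) (Jh j f) = Jh j (Vop (- w) f)"
proof (rule lin_eqI[where f = "\<lambda>f. Vop (- w) (Jh j f)" and g = "\<lambda>f. Jh j (Vop (- w) f)"])
  show "lin (\<lambda>f. Vop (- w) (Jh j f))" "lin (\<lambda>f. Jh j (Vop (- w) f))"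
    by (rule lin_comp; intro lin_Vop lin_Jh)+
  fix lam
  let ?s = "partition_size lam"
  let ?e = "basis lam :: int_partition \<Rightarrow>\<^sub>0 complex"
  let ?P = "Jser (\<lambda>k. w ^ k)"
  define g where "g = Vop (- w) (Jh j ?e) - Jh j (Vop (- w) ?e)"
  let ?d = "of_nat ?s - of_nat (n * j) :: complex"
  have 1: "size_op (Vop (- w) (Jh j ?e)) = scl ?d (Vop (- w) (Jh j ?e)) + scl (of_nat n) (?P (Vop (- w) (Jh j ?e)))"
    unfolding size_op_Vop size_op_Jh[OF j] size_op_basis lin_diff[OF lin_Vop] lin_scl[OF lin_Vop] lin_scl[OF lin_Jh]
    by (simp add: scl.scale_left_diff_distrib)
  have 2: "size_op (Jh j (Vop (- w) ?e)) = scl ?d (Jh j (Vop (- w) ?e)) + scl (of_nat n) (?P (Jh j (Vop (- w) ?e)))"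
    unfolding size_op_Jh[OF j] size_op_Vop size_op_basis lin_add[OF lin_Jh] lin_scl[OF lin_Vop] lin_scl[OF lin_Jh]
      Jser_Jh_commute[OF j]
    by (simp add: scl.scale_left_diff_distrib)
  have eq: "size_op g = scl ?d g + scl (of_nat n) (?P g)"
    unfolding g_def lin_diff[OF lin_size_op] 1 2 lin_diff[OF lin_Jser]
    by (simp add: scl.scale_right_diff_distrib)
  have hJ: "homogeneous (int ?s - N * int j) (Jh j ?e)"
    using j by (intro homogeneous_Jh) (auto simp: homogeneous_def intro: supported_single)
  have "g = 0"
  proof (rule size_op_uniq[OF eq])
    fix \<mu> assume "of_nat (partition_size \<mu>) = ?d"
    then have "(of_nat (partition_size \<mu> + n * j) :: complex) = of_nat ?s" by simp
    then have \<mu>: "partition_size \<mu> + n * j = ?s" by (simp only: of_nat_eq_iff)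
    have "supported (below (Suc (partition_size \<mu>))) (Jh j ?e)"
      by (rule homogeneous_below[OF hJ]) (use \<mu> in \<open>simp flip: of_nat_mult of_nat_add\<close>)
    then have a: "Poly_Mapping.lookup (Vop (- w) (Jh j ?e) - Jh j ?e) \<mu> = 0"
      using Vop_top[of "partition_size \<mu>" "Jh j ?e" "- w"] by (simp add: supported_lookup)
    obtain r where r: "Vop (- w) ?e = ?e + r" "supported (below ?s) r" using Vop_leading by blast
    have "Poly_Mapping.lookup (Jh j r) \<mu> = 0"
    proof -
      have "Poly_Mapping.lookup (Jh j (basis \<nu>)) \<mu> = 0" if "partition_size \<nu> < ?s" for \<nu>
      proof -
        have "homogeneous (int (partition_size \<nu>) - N * int j) (Jh j (basis \<nu>))"
          using j by (intro homogeneous_Jh) (auto simp: homogeneous_def intro: supported_single)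
        moreover have "int (partition_size \<nu>) - N * int j \<noteq> int (partition_size \<mu>)"
          using that \<mu> by (simp flip: of_nat_mult of_nat_add)
        ultimately show ?thesis by (auto simp: homogeneous_def supported_lookup)
      qed
      then show ?thesis
        unfolding lin_expand[OF lin_Jh, of j r] using r(2)
        by (auto simp: lookup_sum supported_def intro!: sum.neutral)
    qed
    then show "Poly_Mapping.lookup g \<mu> = 0"
      using a unfolding g_def r(1) lin_add[OF lin_Jh] by (simp add: lookup_minus lookup_add)
  qed
  then show "Vop (- w) (Jh j ?e) = Jh j (Vop (- w) ?e)" by (simp add: g_def)
qed

lemma Vop_Jser_commute: "Vop (- w) (Jser a f) = Jser a (Vop (- w) f)"
proof -
  obtain s where "supported (below s) f" using bounded_ex by blast
  then have f: "supported (below (Suc s)) f" by (rule supported_mono) auto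
  have "supported (below (Suc s)) ((Vop (- w) f - f) + f)"
    by (rule supported_add[OF supported_mono[OF Vop_top[OF f]] f]) auto
  then have g: "supported (below (Suc s)) (Vop (- w) f)" by simp
  show ?thesis
    unfolding Jser_eq[OF f] Jser_eq[OF g] lin_sum[OF lin_Vop] lin_scl[OF lin_Vop]
    by (intro sum.cong refl arg_cong2[of _ _ _ _ scl] Vop_Jh_commute) simp
qed

section \<open>Horizontal strips as the inverse of vertical strips\<close>

definition Hop :: "complex \<Rightarrow> (int_partition \<Rightarrow>\<^sub>0 complex) \<Rightarrow> (int_partition \<Rightarrow>\<^sub>0 complex)" where
  "Hop z = extend (\<lambda>lam. \<Sum>\<mu> | diagram \<mu> \<subseteq> diagram lam. scl (hcoeff n (- q) z lam \<mu>) (basis \<mu>))"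

lemma lin_Hop: "lin (Hop z)"
  by (simp add: Hop_def lin_extend)

lemma coeff_refl: "hcoeff n c z lam lam = 1" "vcoeff n c z lam lam = 1"
proof -
  have h: "hflux n lam lam {}" "vflux n lam lam {}" by (auto simp: hflux_def vflux_def bead_flux_empty)
  show "hcoeff n c z lam lam = 1" "vcoeff n c z lam lam = 1"
    using h hflux_spin[OF h(1) n] hflux_ribbon_count[OF h(1) n] vflux_spin_count[OF h(2) n]
      horizontal_strip_iff[OF n] vertical_strip_iff[OF n]
    by (auto simp: hcoeff_def vcoeff_def)
qed

lemma vcoeff_not_subset: "\<not> diagram \<mu> \<subseteq> diagram lam \<Longrightarrow> vcoeff n c z lam \<mu> = 0"
  and hcoeff_not_subset: "\<not> diagram \<mu> \<subseteq> diagram lam \<Longrightarrow> hcoeff n c z lam \<mu> = 0"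
  using vertical_strip_subset[of n lam \<mu>] horizontal_strip_subset[of n lam \<mu>] unfolding vcoeff_def hcoeff_def by (metis (full_types))+

lemma lookup_Vop_basis: "Poly_Mapping.lookup (Vop z (basis lam)) \<mu> = vcoeff n (- q) z lam \<mu>"
proof -
  have "Poly_Mapping.lookup (Vop z (basis lam)) \<mu> =
      (\<Sum>\<nu> | diagram \<nu> \<subseteq> diagram lam. if \<nu> = \<mu> then vcoeff n (- q) z lam \<mu> else 0)"
    unfolding Vop_def extend_basis lookup_sum by (rule sum.cong[OF refl]) (simp add: lookup_single when_def)
  then show ?thesis using vcoeff_not_subset finite_subpartitions by (simp add: sum.delta)
qed

lemma lookup_Hop_basis: "Poly_Mapping.lookup (Hop z (basis lam)) \<mu> = hcoeff n (- q) z lam \<mu>"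
proof -
  have "Poly_Mapping.lookup (Hop z (basis lam)) \<mu> =
      (\<Sum>\<nu> | diagram \<nu> \<subseteq> diagram lam. if \<nu> = \<mu> then hcoeff n (- q) z lam \<mu> else 0)"
    unfolding Hop_def extend_basis lookup_sum by (rule sum.cong[OF refl]) (simp add: lookup_single when_def)
  then show ?thesis using hcoeff_not_subset finite_subpartitions by (simp add: sum.delta)
qed

text \<open>Off the diagonal this is \<open>hv_cancel\<close>; on the diagonal containment leaves
  only \<open>\<nu> = lam\<close>.\<close>

lemma Vop_Hop: "Vop (- z) (Hop z f) = f"
proof (rule lin_eqI[where f = "\<lambda>f. Vop (- z) (Hop z f)" and g = "\<lambda>f. f"])
  show "lin (\<lambda>f. Vop (- z) (Hop z f))" by (rule lin_comp[OF lin_Vop lin_Hop])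
  fix lam
  show "Vop (- z) (Hop z (basis lam)) = basis lam"
  proof (rule poly_mapping_eqI)
    fix \<mu>
    have "Poly_Mapping.lookup (Vop (- z) (Hop z (basis lam))) \<mu> =
        (\<Sum>\<nu> | diagram \<nu> \<subseteq> diagram lam. hcoeff n (- q) z lam \<nu> * vcoeff n (- q) (- z) \<nu> \<mu>)"
      unfolding Hop_def extend_basis lin_sum[OF lin_Vop] lin_scl[OF lin_Vop] lookup_sum lookup_scl lookup_Vop_basis ..
    also have "\<dots> = (if lam = \<mu> then 1 else 0)"
    proof (cases "lam = \<mu>")
      case True
      have "hcoeff n (- q) z lam \<nu> * vcoeff n (- q) (- z) \<nu> \<mu> = (if \<nu> = lam then 1 else 0)" for \<nu>
        using vcoeff_not_subset[of lam \<nu>] hcoeff_not_subset[of \<nu> lam] diagram_inject[of lam \<nu>]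
        unfolding True[symmetric] by (cases "lam = \<nu>") (simp add: coeff_refl, metis mult_eq_0_iff subset_antisym)
      then show ?thesis using True finite_subpartitions by (simp add: sum.delta)
    qed (simp add: hv_cancel[OF n])
    finally show "Poly_Mapping.lookup (Vop (- z) (Hop z (basis lam))) \<mu> = Poly_Mapping.lookup (basis lam) \<mu>"
      by (simp add: lookup_single when_def)
  qed
qed (rule lin_id)

text \<open>\<open>Hop\<close> is accessible only as a right inverse of the injective
  \<open>Vop\<close>, through which its properties are derived.\<close>

lemma Hop_Jser_commute: "Hop z (Jser a f) = Jser a (Hop z f)"
  by (rule Vop_inj[of "- z"]) (simp add: Vop_Hop Vop_Jser_commute)

lemma size_op_Hop: "size_op (Hop z f) = Hop z (size_op f) - scl (of_nat n) (Jser (\<lambda>k. z ^ k) (Hop z f))"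
proof (rule Vop_inj[of "- z"])
  have "size_op f = Vop (- z) (size_op (Hop z f)) + scl (of_nat n) (Jser (\<lambda>k. z ^ k) f)"
    using size_op_Vop[of z "Hop z f"] by (simp add: Vop_Hop)
  then show "Vop (- z) (size_op (Hop z f)) =
      Vop (- z) (Hop z (size_op f) - scl (of_nat n) (Jser (\<lambda>k. z ^ k) (Hop z f)))"
    by (simp add: lin_diff[OF lin_Vop] lin_scl[OF lin_Vop] Vop_Hop Vop_Jser_commute)
qed

lemma Hop_top: "supported (below (Suc s)) f \<Longrightarrow> supported (below s) (Hop z f - f)"
proof -
  assume f: "supported (below (Suc s)) f"
  have "Vop (- z) (Hop z f - f) = - (Vop (- z) f - f)" by (simp only: lin_diff[OF lin_Vop] Vop_Hop minus_diff_eq)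
  moreover have "supported (below s) (- (Vop (- z) f - f))"
    using Vop_top[OF f, of "- z"] by (simp add: supported_lookup lookup_minus)
  ultimately have "supported (below s) (Vop (- z) (Hop z f - f))" by simp
  then show ?thesis by (rule Vop_reflects_below)
qed

section \<open>Exponentials of the bosonic operators\<close>

lemma Jser_cong: "(\<And>k. k \<ge> 1 \<Longrightarrow> a k = b k) \<Longrightarrow> Jser a f = Jser b f"
proof -
  assume ab: "\<And>k. k \<ge> 1 \<Longrightarrow> a k = b k"
  obtain s where "supported (below s) f" using bounded_ex by blast
  then have f: "supported (below (Suc s)) f" by (rule supported_mono) auto
  show ?thesis unfolding Jser_eq[OF f] by (rule sum.cong[OF refl]) (simp add: ab)
qed

lemma coords_L_plus:
  "coords (L_plus n q r z x) = Jser (\<lambda>k. 1 / of_nat k * (\<Sum>i<r. z i ^ k)) (coords x)"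
proof -
  let ?a = "\<lambda>k. 1 / of_nat k * (\<Sum>i<r. z i ^ k)"
  obtain s where "supported (below s) (coords x)" using bounded_ex by blast
  then have f: "supported (below (Suc s)) (coords x)" by (rule supported_mono) auto
  have "L_plus n q r z x - (\<Sum>k\<in>{1..s}. scl (?a k) (J_op n q (int k) x)) \<in> null"
    unfolding L_plus_def scale_wedge_eq
  proof (rule fock_sum_cong_finite)
    fix k assume k: "k \<in> {1..} - {1..s}"
    then have k1: "k \<ge> 1" and "Suc s \<le> k" by auto
    then have "coords (scl (?a k) (J_op n q (int k) x)) = 0"
      unfolding lin_scl[OF lin_coords] coords_J_op[OF k1] by (simp add: Jh_vanish[OF f])
    then show "scl (?a k) (J_op n q (int k) x) \<in> null" by (simp only: coords_eq_0_iff)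
  qed auto
  then have "coords (L_plus n q r z x) = coords (\<Sum>k\<in>{1..s}. scl (?a k) (J_op n q (int k) x))" by (rule coords_cong)
  also have "\<dots> = Jser ?a (coords x)"
    unfolding Jser_eq[OF f] lin_sum[OF lin_coords] lin_scl[OF lin_coords]
    by (rule sum.cong[OF refl]) (simp add: coords_J_op)
  finally show ?thesis .
qed

text \<open>A truncated exponential. \<open>Jser\<close> lowers the size by at least 1, so
  \<open>K\<close> terms are exact on vectors supported in sizes below \<open>K\<close>.\<close>

definition Jexp :: "(nat \<Rightarrow> complex) \<Rightarrow> nat \<Rightarrow> (int_partition \<Rightarrow>\<^sub>0 complex) \<Rightarrow> (int_partition \<Rightarrow>\<^sub>0 complex)" where
  "Jexp a K f = (\<Sum>m<K. scl (1 / fact m) ((Jser a ^^ m) f))"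

lemma lin_Jser_power: "lin (Jser a ^^ m)"
proof (induction m)
  case 0
  show ?case by (simp add: id_def lin_id)
next
  case (Suc m)
  show ?case unfolding funpow.simps comp_def by (rule lin_comp[OF lin_Jser Suc])
qed

lemma lin_Jexp: "lin (Jexp a K)"
  unfolding Jexp_def by (intro lin_sum_op lin_scale lin_Jser_power)

lemma Jser_power_below: "supported (below s) f \<Longrightarrow> supported (below (s - m)) ((Jser a ^^ m) f)"
proof (induction m)
  case (Suc m)
  then have "supported (below (s - m - 1)) (Jser a ((Jser a ^^ m) f))" by (intro Jser_below)
  then show ?case by simp
qed simp

lemma Jser_power_vanish: "supported (below s) f \<Longrightarrow> s \<le> m \<Longrightarrow> (Jser a ^^ m) f = 0"
  using Jser_power_below[of s f m a] by (simp add: supported_empty)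

lemma coords_exp_op:
  assumes A: "\<And>x. coords (A x) = Jser a (coords x)" and x: "supported (below K) (coords x)"
  shows "coords (exp_op n q A x) = Jexp a K (coords x)"
proof -
  have pow: "coords ((A ^^ m) x) = (Jser a ^^ m) (coords x)" for m
    by (induction m) (simp_all add: A)
  have "exp_op n q A x - (\<Sum>m<K. scl (1 / fact m) ((A ^^ m) x)) \<in> null"
    unfolding exp_op_def scale_wedge_eq
  proof (rule fock_sum_cong_finite)
    fix m assume "m \<in> UNIV - {..<K}"
    then have "coords (scl (1 / fact m) ((A ^^ m) x)) = 0"
      unfolding lin_scl[OF lin_coords] pow by (simp add: Jser_power_vanish[OF x])
    then show "scl (1 / fact m) ((A ^^ m) x) \<in> null" by (simp only: coords_eq_0_iff)
  qed auto
  then have "coords (exp_op n q A x) = coords (\<Sum>m<K. scl (1 / fact m) ((A ^^ m) x))" by (rule coords_cong)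
  then show ?thesis
    unfolding Jexp_def lin_sum[OF lin_coords] lin_scl[OF lin_coords] pow .
qed

lemma Jser_power_commute: "(Jser a ^^ m) (Jser b f) = Jser b ((Jser a ^^ m) f)"
  by (induction m) (simp_all add: Jser_commute)

lemma Jexp_Jser_commute: "Jexp a K (Jser b f) = Jser b (Jexp a K f)"
  unfolding Jexp_def lin_sum[OF lin_Jser] lin_scl[OF lin_Jser] Jser_power_commute ..

text \<open>The commutator of \<open>size_op\<close> with \<open>Jser a\<close> commutes with
  \<open>Jser a\<close>, so the Leibniz rule collects \<open>m + 1\<close> equal terms.\<close>

lemma size_op_Jser_power:
  "size_op ((Jser a ^^ Suc m) f) = (Jser a ^^ Suc m) (size_op f) -
    scl (of_nat n * of_nat (Suc m)) (Jser (\<lambda>k. of_nat k * a k) ((Jser a ^^ m) f))"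
proof (induction m)
  case (Suc m)
  let ?b = "\<lambda>k. of_nat k * a k"
  have "size_op ((Jser a ^^ Suc (Suc m)) f) =
      Jser a (size_op ((Jser a ^^ Suc m) f)) - scl (of_nat n) (Jser ?b ((Jser a ^^ Suc m) f))"
    unfolding funpow.simps(2)[of "Suc m"] comp_apply by (rule size_op_Jser)
  also have "Jser a (size_op ((Jser a ^^ Suc m) f)) = (Jser a ^^ Suc (Suc m)) (size_op f) -
      scl (of_nat n * of_nat (Suc m)) (Jser ?b ((Jser a ^^ Suc m) f))"
    unfolding Suc.IH lin_diff[OF lin_Jser] lin_scl[OF lin_Jser] Jser_commute[of a ?b] by simp
  finally have "size_op ((Jser a ^^ Suc (Suc m)) f) = (Jser a ^^ Suc (Suc m)) (size_op f) -
      (scl (of_nat n * of_nat (Suc m)) (Jser ?b ((Jser a ^^ Suc m) f)) + scl (of_nat n) (Jser ?b ((Jser a ^^ Suc m) f)))"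
    by (simp only: diff_diff_eq)
  also have "scl (of_nat n * of_nat (Suc m)) (Jser ?b ((Jser a ^^ Suc m) f)) + scl (of_nat n) (Jser ?b ((Jser a ^^ Suc m) f)) =
      scl (of_nat n * of_nat (Suc (Suc m))) (Jser ?b ((Jser a ^^ Suc m) f))"
    unfolding scl.scale_left_distrib[symmetric] of_nat_Suc[of "Suc m"] by (simp add: algebra_simps)
  finally show ?case .
qed (simp add: size_op_Jser)

text \<open>Differentiating the truncated series loses its last term, \<open>m = K\<close>; its
  contribution vanishes on vectors of size at most \<open>K\<close>.\<close>

lemma size_op_Jexp:
  assumes f: "supported (below (Suc K)) f"
  shows "size_op (Jexp a (Suc K) f) =
    Jexp a (Suc K) (size_op f) - scl (of_nat n) (Jser (\<lambda>k. of_nat k * a k) (Jexp a (Suc K) f))"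
proof -
  let ?b = "\<lambda>k. of_nat k * a k"
  have shift: "Jexp a (Suc K) g = g + (\<Sum>m<K. scl (1 / fact (Suc m)) ((Jser a ^^ Suc m) g))" for g
    unfolding Jexp_def sum.lessThan_Suc_shift by simp
  have step: "scl (1 / fact (Suc m)) (scl (of_nat n * of_nat (Suc m)) g) = scl (of_nat n) (scl (1 / fact m) g)"
    for m and g :: "int_partition \<Rightarrow>\<^sub>0 complex"
    by (simp add: field_simps del: of_nat_Suc)
  have top: "Jser ?b ((Jser a ^^ K) f) = 0"
  proof -
    have "supported (below (Suc K - K - 1)) (Jser ?b ((Jser a ^^ K) f))"
      by (intro Jser_below Jser_power_below f)
    then show ?thesis by (simp add: supported_empty)
  qed
  have "size_op (Jexp a (Suc K) f) =
      size_op f + (\<Sum>m<K. scl (1 / fact (Suc m)) ((Jser a ^^ Suc m) (size_op f)) -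
        scl (of_nat n) (scl (1 / fact m) (Jser ?b ((Jser a ^^ m) f))))"
    unfolding shift lin_add[OF lin_size_op] lin_sum[OF lin_size_op] lin_scl[OF lin_size_op] size_op_Jser_power
      scl.scale_right_diff_distrib step ..
  also have "\<dots> = Jexp a (Suc K) (size_op f) -
      scl (of_nat n) (\<Sum>m<K. scl (1 / fact m) (Jser ?b ((Jser a ^^ m) f)))"
    unfolding shift sum_subtractf scl.scale_sum_right by simp
  also have "(\<Sum>m<K. scl (1 / fact m) (Jser ?b ((Jser a ^^ m) f))) = Jser ?b (Jexp a (Suc K) f)"
    unfolding Jexp_def lin_sum[OF lin_Jser] lin_scl[OF lin_Jser] sum.lessThan_Suc lin_add[OF lin_Jser] top by simp
  finally show ?thesis .
qed

lemma Jexp_top: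
  assumes f: "supported (below (Suc s)) f" shows "supported (below s) (Jexp a (Suc K) f - f)"
proof -
  have "Jexp a (Suc K) f - f = (\<Sum>m<K. scl (1 / fact (Suc m)) ((Jser a ^^ Suc m) f))"
    unfolding Jexp_def sum.lessThan_Suc_shift by simp
  moreover have "supported (below s) ((Jser a ^^ Suc m) f)" for m
    by (rule supported_mono[OF Jser_power_below[OF f]]) auto
  ultimately show ?thesis by (simp only: supported_sum supported_scl)
qed

text \<open>Index 0 acts first, and \<open>Hop\<close> before \<open>Vop\<close>; this is the order
  of a tableau read from the outer shape inwards.\<close>

primrec strip_op ::
    "(nat \<Rightarrow> complex) \<Rightarrow> (nat \<Rightarrow> complex) \<Rightarrow> nat \<Rightarrow> (int_partition \<Rightarrow>\<^sub>0 complex) \<Rightarrow> (int_partition \<Rightarrow>\<^sub>0 complex)" where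
  "strip_op z w 0 f = f"
| "strip_op z w (Suc i) f = Vop (- w i) (Hop (z i) (strip_op z w i f))"

text \<open>All factors commute with \<open>Jser\<close>, so their logarithmic derivatives add
  up.\<close>

lemma size_op_strip_op:
  "size_op (strip_op z w i f) = strip_op z w i (size_op f) +
    scl (of_nat n) (Jser (\<lambda>k. (\<Sum>j<i. w j ^ k) - (\<Sum>j<i. z j ^ k)) (strip_op z w i f))"
proof (induction i)
  case 0
  have "Jser (\<lambda>k. 0) f = 0" using Jser_scale[of 0 "\<lambda>_. 0" f] by simp
  then show ?case by simp
next
  case (Suc i)
  let ?c = "\<lambda>k. (\<Sum>j<i. w j ^ k) - (\<Sum>j<i. z j ^ k)"
  let ?X = "strip_op z w (Suc i) f"
  have c: "Jser (\<lambda>k. (\<Sum>j<Suc i. w j ^ k) - (\<Sum>j<Suc i. z j ^ k)) ?X =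
      Jser ?c ?X + (Jser (\<lambda>k. w i ^ k) ?X - Jser (\<lambda>k. z i ^ k) ?X)"
  proof -
    have "(\<lambda>k. (\<Sum>j<Suc i. w j ^ k) - (\<Sum>j<Suc i. z j ^ k)) = (\<lambda>k. ?c k + (w i ^ k + - (z i ^ k)))"
      by (rule ext) simp
    then show ?thesis unfolding Jser_add Jser_uminus by (simp only: diff_conv_add_uminus Jser_add Jser_uminus)
  qed
  have "size_op ?X = strip_op z w (Suc i) (size_op f) + scl (of_nat n) (Jser ?c ?X) -
      scl (of_nat n) (Jser (\<lambda>k. z i ^ k) ?X) + scl (of_nat n) (Jser (\<lambda>k. w i ^ k) ?X)"
    unfolding strip_op.simps size_op_Vop size_op_Hop Suc.IH lin_add[OF lin_Hop] lin_add[OF lin_Vop] lin_diff[OF lin_Vop]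
      lin_scl[OF lin_Hop] lin_scl[OF lin_Vop] Hop_Jser_commute Vop_Jser_commute ..
  then show ?case unfolding c scl.scale_right_distrib scl.scale_right_diff_distrib by (simp only: algebra_simps)
qed

lemma strip_op_top: "supported (below (Suc s)) f \<Longrightarrow> supported (below s) (strip_op z w i f - f)"
proof (induction i)
  case 0
  show ?case by (simp add: supported_0)
next
  case (Suc i)
  let ?g = "strip_op z w i f"
  have up: "supported (below (Suc s)) h" if "supported (below s) (h - g)" "supported (below (Suc s)) g" for g h
  proof -
    have "supported (below (Suc s)) ((h - g) + g)"
      by (rule supported_add[OF supported_mono[OF that(1)] that(2)]) auto
    then show ?thesis by simp
  qed
  have 1: "supported (below s) (?g - f)" using Suc by simp
  then have g: "supported (below (Suc s)) ?g" using Suc.prems by (rule up)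
  then have 2: "supported (below s) (Hop (z i) ?g - ?g)" by (rule Hop_top)
  then have "supported (below (Suc s)) (Hop (z i) ?g)" using g by (rule up)
  then have 3: "supported (below s) (Vop (- w i) (Hop (z i) ?g) - Hop (z i) ?g)" by (rule Vop_top)
  have "supported (below s) ((Vop (- w i) (Hop (z i) ?g) - Hop (z i) ?g) + ((Hop (z i) ?g - ?g) + (?g - f)))"
    by (intro supported_add 1 2 3)
  then show ?case by simp
qed

text \<open>The factor \<open>1 / k\<close> in the exponents cancels against the degree
  \<open>n k\<close> of \<open>J_k\<close>, which leaves the same power sums as for the strip
  operators; \<open>size_op_uniq\<close> then applies to the difference.\<close>

lemma Jexp_strip_op:
  fixes lam :: int_partition
  defines "K \<equiv> Suc (partition_size lam)"
  shows "Jexp (\<lambda>k. 1 / of_nat k * (\<Sum>i<r. z i ^ k)) K (Jexp (\<lambda>k. - (1 / of_nat k * (\<Sum>i<r. w i ^ k))) K (basis lam)) =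
    strip_op z w r (basis lam)" (is "Jexp ?a K (Jexp ?b K ?e) = ?T")
proof -
  let ?s = "partition_size lam"
  let ?c = "\<lambda>k. (\<Sum>j<r. w j ^ k) - (\<Sum>j<r. z j ^ k)"
  let ?B = "Jexp ?b K ?e"
  let ?E = "Jexp ?a K ?B"
  have e: "supported (below (Suc ?s)) ?e" by (rule supported_single) simp
  have B1: "supported (below ?s) (?B - ?e)" unfolding K_def by (rule Jexp_top[OF e])
  have "supported (below (Suc ?s)) ((?B - ?e) + ?e)"
    by (rule supported_add[OF supported_mono[OF B1] e]) auto
  then have B: "supported (below (Suc ?s)) ?B" by simp
  have E1: "supported (below ?s) (?E - ?B)" unfolding K_def by (rule Jexp_top[OF B[unfolded K_def]])
  have T1: "supported (below ?s) (?T - ?e)" by (rule strip_op_top[OF e])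
  have sB: "size_op ?B = scl (of_nat ?s) ?B - scl (of_nat n) (Jser (\<lambda>k. of_nat k * ?b k) ?B)"
    unfolding K_def size_op_Jexp[OF e] size_op_basis lin_scl[OF lin_Jexp] ..
  have "size_op ?E = Jexp ?a K (size_op ?B) - scl (of_nat n) (Jser (\<lambda>k. of_nat k * ?a k) ?E)"
    using size_op_Jexp[OF B, of ?a] unfolding K_def .
  also have "\<dots> = scl (of_nat ?s) ?E - scl (of_nat n) (Jser (\<lambda>k. of_nat k * ?b k) ?E) -
      scl (of_nat n) (Jser (\<lambda>k. of_nat k * ?a k) ?E)"
    unfolding sB lin_diff[OF lin_Jexp] lin_scl[OF lin_Jexp] Jexp_Jser_commute ..
  also have "\<dots> = scl (of_nat ?s) ?E + scl (of_nat n) (Jser ?c ?E)"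
  proof -
    have "Jser ?c ?E = Jser (\<lambda>k. - (of_nat k * ?b k + of_nat k * ?a k)) ?E" by (rule Jser_cong) simp
    also have "\<dots> = - (Jser (\<lambda>k. of_nat k * ?b k) ?E + Jser (\<lambda>k. of_nat k * ?a k) ?E)"
      unfolding Jser_uminus Jser_add ..
    finally have c: "Jser ?c ?E = - (Jser (\<lambda>k. of_nat k * ?b k) ?E + Jser (\<lambda>k. of_nat k * ?a k) ?E)" .
    show ?thesis unfolding c scl.scale_minus_right scl.scale_right_distrib diff_diff_eq by (rule diff_conv_add_uminus)
  qed
  finally have sE: "size_op ?E = scl (of_nat ?s) ?E + scl (of_nat n) (Jser ?c ?E)" .
  have sT: "size_op ?T = scl (of_nat ?s) ?T + scl (of_nat n) (Jser ?c ?T)"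
  proof -
    have l: "lin (strip_op z w i)" for i
    proof (induction i)
      case (Suc i)
      have "lin (\<lambda>f. Vop (- w i) (Hop (z i) (strip_op z w i f)))"
        by (rule lin_comp[OF lin_Vop lin_comp[OF lin_Hop Suc]])
      then show ?case by simp
    qed (simp add: lin_id)
    show ?thesis unfolding size_op_strip_op size_op_basis lin_scl[OF l] ..
  qed
  have "?E - ?T = 0"
  proof (rule size_op_uniq)
    show "size_op (?E - ?T) = scl (of_nat ?s) (?E - ?T) + scl (of_nat n) (Jser ?c (?E - ?T))"
      unfolding lin_diff[OF lin_size_op] sE sT lin_diff[OF lin_Jser] scl.scale_right_diff_distrib
      by (simp only: algebra_simps)
    fix \<mu> assume "(of_nat (partition_size \<mu>) :: complex) = of_nat ?s"
    then have "\<mu> \<notin> below ?s" by simp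
    moreover have "supported (below ?s) ((?E - ?B) + (?B - ?e) - (?T - ?e))"
      by (intro supported_diff supported_add E1 B1 T1)
    ultimately show "Poly_Mapping.lookup (?E - ?T) \<mu> = 0" by (simp add: supported_lookup)
  qed
  then show ?thesis by simp
qed

end

section \<open>Super ribbon functions as matrix coefficients\<close>

text \<open>Peeling off the two innermost strips corresponds to the last two operators applied by
  \<open>strip_op\<close>.\<close>

lemma super_ribbon_tableau_Suc:
  "super_ribbon_tableau n (Suc r) lam \<mu> T \<longleftrightarrow>
    (\<exists>\<kappa> \<nu> T'. T = T' @ [\<nu>, \<mu>] \<and> super_ribbon_tableau n r lam \<kappa> T' \<and>
      horizontal_strip n \<kappa> \<nu> \<and> vertical_strip n \<nu> \<mu>)"
proof
  assume T: "super_ribbon_tableau n (Suc r) lam \<mu> T"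
  then have len: "length T = Suc (Suc (Suc (2 * r)))" and m: "T ! Suc (Suc (2 * r)) = \<mu>" by (auto simp: super_ribbon_tableau_def)
  have "T = take (Suc (2 * r)) T @ [T ! Suc (2 * r), \<mu>]"
    using take_Suc_conv_app_nth[of "Suc (2 * r)" T] take_Suc_conv_app_nth[of "Suc (Suc (2 * r))" T] len m by simp
  moreover have "super_ribbon_tableau n r lam (T ! (2 * r)) (take (Suc (2 * r)) T)"
    using T by (auto simp: super_ribbon_tableau_def)
  moreover have "horizontal_strip n (T ! (2 * r)) (T ! Suc (2 * r))" "vertical_strip n (T ! Suc (2 * r)) \<mu>"
    using T m by (auto simp: super_ribbon_tableau_def)
  ultimately show "\<exists>\<kappa> \<nu> T'. T = T' @ [\<nu>, \<mu>] \<and> super_ribbon_tableau n r lam \<kappa> T' \<and>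
      horizontal_strip n \<kappa> \<nu> \<and> vertical_strip n \<nu> \<mu>" by blast
next
  assume "\<exists>\<kappa> \<nu> T'. T = T' @ [\<nu>, \<mu>] \<and> super_ribbon_tableau n r lam \<kappa> T' \<and>
      horizontal_strip n \<kappa> \<nu> \<and> vertical_strip n \<nu> \<mu>"
  then show "super_ribbon_tableau n (Suc r) lam \<mu> T"
    by (auto simp: super_ribbon_tableau_def nth_append less_Suc_eq)
qed

lemma super_ribbon_tableau_0: "super_ribbon_tableau n 0 lam \<mu> T \<longleftrightarrow> T = [lam] \<and> lam = \<mu>"
  by (cases T) (auto simp: super_ribbon_tableau_def)

lemma super_ribbon_tableau_subset: "super_ribbon_tableau n r lam \<mu> T \<Longrightarrow> diagram \<mu> \<subseteq> diagram lam"
  by (induction r arbitrary: \<mu> T)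
    (auto simp: super_ribbon_tableau_0 super_ribbon_tableau_Suc, (metis horizontal_strip_subset vertical_strip_subset subsetD)+)

definition tableau_term :: "nat \<Rightarrow> complex \<Rightarrow> (nat \<Rightarrow> complex) \<Rightarrow> (nat \<Rightarrow> complex) \<Rightarrow> nat \<Rightarrow> int_partition list \<Rightarrow> complex" where
  "tableau_term n c z w r T =
    c ^ tableau_spin n r T * (\<Prod>i<r. z i ^ tableau_wt n T i) * (\<Prod>i<r. (- w i) ^ tableau_wt' n T i)"

lemma tableau_term_append:
  assumes T: "super_ribbon_tableau n r lam \<kappa> T" and "horizontal_strip n \<kappa> \<nu>" "vertical_strip n \<nu> \<mu>"
  shows "tableau_term n c z w (Suc r) (T @ [\<nu>, \<mu>]) =
    tableau_term n c z w r T * hcoeff n c (z r) \<kappa> \<nu> * vcoeff n c (- w r) \<nu> \<mu>"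
proof -
  have len: "length T = Suc (2 * r)" and last: "T ! (2 * r) = \<kappa>" using T by (auto simp: super_ribbon_tableau_def)
  show ?thesis
    using assms(2,3) len last
    by (simp add: tableau_term_def tableau_spin_def tableau_wt_def tableau_wt'_def hcoeff_def vcoeff_def nth_append power_add)
qed

lemma finite_super_ribbon_tableaux: "finite {T. super_ribbon_tableau n r lam \<mu> T}"
proof (induction r arbitrary: \<mu>)
  case (Suc r)
  let ?S = "{\<nu>. diagram \<nu> \<subseteq> diagram lam}"
  have "{T. super_ribbon_tableau n (Suc r) lam \<mu> T} \<subseteq>
      (\<Union>\<kappa>\<in>?S. (\<lambda>(\<nu>, T). T @ [\<nu>, \<mu>]) ` (?S \<times> {T. super_ribbon_tableau n r lam \<kappa> T}))"
  proof
    fix T assume "T \<in> {T. super_ribbon_tableau n (Suc r) lam \<mu> T}"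
    then obtain \<kappa> \<nu> T' where *: "T = T' @ [\<nu>, \<mu>]" "super_ribbon_tableau n r lam \<kappa> T'" "horizontal_strip n \<kappa> \<nu>"
      unfolding super_ribbon_tableau_Suc by blast
    moreover have "\<kappa> \<in> ?S" "\<nu> \<in> ?S"
      using super_ribbon_tableau_subset[OF *(2)] horizontal_strip_subset[OF *(3)] by auto
    ultimately show "T \<in> (\<Union>\<kappa>\<in>?S. (\<lambda>(\<nu>, T). T @ [\<nu>, \<mu>]) ` (?S \<times> {T. super_ribbon_tableau n r lam \<kappa> T}))"
      by auto
  qed
  then show ?case
    by (rule finite_subset) (intro finite_UN_I finite_imageI finite_cartesian_product finite_subpartitions Suc.IH)
next
  case 0
  show ?case by (rule finite_subset[of _ "{[lam]}"]) (auto simp: super_ribbon_tableau_0)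
qed

lemma super_ribbon_function_not_subset:
  "\<not> diagram \<mu> \<subseteq> diagram lam \<Longrightarrow> super_ribbon_function n r lam \<mu> z w c = 0"
  using super_ribbon_tableau_subset[of n r lam \<mu>] by (auto simp: super_ribbon_function_def intro!: sum.neutral)

lemma super_ribbon_function_0: "super_ribbon_function n 0 lam \<mu> z w c = (if lam = \<mu> then 1 else 0)"
  by (simp add: super_ribbon_function_def super_ribbon_tableau_0 tableau_spin_def)

text \<open>The coefficients are 0 where there is no strip, so both sums may run over all partitions
  contained in \<open>lam\<close>, and the recursion reads as a product of matrices.\<close>

lemma super_ribbon_function_Suc:
  fixes n r :: nat and lam \<mu> :: int_partition
  defines "S \<equiv> {\<nu>. diagram \<nu> \<subseteq> diagram lam}"
  shows "super_ribbon_function n (Suc r) lam \<mu> z w c =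
    (\<Sum>\<nu>\<in>S. (\<Sum>\<kappa>\<in>S. super_ribbon_function n r lam \<kappa> z w c * hcoeff n c (z r) \<kappa> \<nu>) * vcoeff n c (- w r) \<nu> \<mu>)"
proof -
  let ?TT = "\<lambda>\<kappa>. {T. super_ribbon_tableau n r lam \<kappa> T}"
  let ?F = "\<lambda>(\<nu>, \<kappa>, T). tableau_term n c z w r T * hcoeff n c (z r) \<kappa> \<nu> * vcoeff n c (- w r) \<nu> \<mu>"
  define P where "P = Sigma S (\<lambda>\<nu>. Sigma S ?TT)"
  have finS: "finite S" unfolding S_def by (rule finite_subpartitions)
  have finP: "finite P" unfolding P_def by (intro finite_SigmaI finS finite_super_ribbon_tableaux)
  have srf: "super_ribbon_function n r lam \<kappa> z w c =
      (\<Sum>T | super_ribbon_tableau n r lam \<kappa> T. tableau_term n c z w r T)" for r \<kappa>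
    by (simp add: super_ribbon_function_def tableau_term_def)
  let ?good = "\<lambda>(\<nu>, \<kappa>, T :: int_partition list). horizontal_strip n \<kappa> \<nu> \<and> vertical_strip n \<nu> \<mu>"
  have "(\<Sum>\<nu>\<in>S. (\<Sum>\<kappa>\<in>S. super_ribbon_function n r lam \<kappa> z w c * hcoeff n c (z r) \<kappa> \<nu>) * vcoeff n c (- w r) \<nu> \<mu>) =
      (\<Sum>\<nu>\<in>S. \<Sum>\<kappa>\<in>S. \<Sum>T\<in>?TT \<kappa>. ?F (\<nu>, \<kappa>, T))"
    unfolding srf sum_distrib_right by simp
  also have "\<dots> = (\<Sum>\<nu>\<in>S. \<Sum>(\<kappa>, T)\<in>Sigma S ?TT. ?F (\<nu>, \<kappa>, T))"
    using finS finite_super_ribbon_tableaux by (intro sum.cong refl) (subst sum.Sigma, auto)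
  also have "\<dots> = sum ?F P"
    unfolding P_def using finS finite_super_ribbon_tableaux by (subst sum.Sigma) (auto intro!: sum.cong)
  also have "\<dots> = sum ?F {p \<in> P. ?good p}"
    by (rule sum.mono_neutral_right[OF finP])
      (auto simp: hcoeff_def vcoeff_def split: prod.splits if_splits)
  also have "\<dots> = (\<Sum>T | super_ribbon_tableau n (Suc r) lam \<mu> T. tableau_term n c z w (Suc r) T)"
  proof (rule sum.reindex_bij_witness[where i = "\<lambda>T. (T ! Suc (2 * r), T ! (2 * r), take (Suc (2 * r)) T)"
        and j = "\<lambda>(\<nu>, \<kappa>, T). T @ [\<nu>, \<mu>]"])
    fix p assume "p \<in> {p \<in> P. ?good p}"
    then obtain \<nu> \<kappa> T where p: "p = (\<nu>, \<kappa>, T)" "super_ribbon_tableau n r lam \<kappa> T" "horizontal_strip n \<kappa> \<nu>"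
      "vertical_strip n \<nu> \<mu>" unfolding P_def by auto
    then have "length T = Suc (2 * r)" "T ! (2 * r) = \<kappa>" by (auto simp: super_ribbon_tableau_def)
    then show "(\<lambda>T. (T ! Suc (2 * r), T ! (2 * r), take (Suc (2 * r)) T)) ((\<lambda>(\<nu>, \<kappa>, T). T @ [\<nu>, \<mu>]) p) = p"
      by (simp add: p(1) nth_append)
    show "(\<lambda>(\<nu>, \<kappa>, T). T @ [\<nu>, \<mu>]) p \<in> {T. super_ribbon_tableau n (Suc r) lam \<mu> T}"
      using p by (auto simp: super_ribbon_tableau_Suc)
  next
    fix T assume "T \<in> {T. super_ribbon_tableau n (Suc r) lam \<mu> T}"
    then obtain \<kappa> \<nu> T' where T: "T = T' @ [\<nu>, \<mu>]" "super_ribbon_tableau n r lam \<kappa> T'" "horizontal_strip n \<kappa> \<nu>"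
      "vertical_strip n \<nu> \<mu>" by (auto simp: super_ribbon_tableau_Suc)
    have l: "length T' = Suc (2 * r)" "T' ! (2 * r) = \<kappa>" using T(2) by (auto simp: super_ribbon_tableau_def)
    have S: "\<kappa> \<in> S" "\<nu> \<in> S"
      unfolding S_def using super_ribbon_tableau_subset[OF T(2)] horizontal_strip_subset[OF T(3)] by auto
    have i: "(T ! Suc (2 * r), T ! (2 * r), take (Suc (2 * r)) T) = (\<nu>, \<kappa>, T')"
      using l by (simp add: T(1) nth_append)
    show "(\<lambda>(\<nu>, \<kappa>, T). T @ [\<nu>, \<mu>]) (T ! Suc (2 * r), T ! (2 * r), take (Suc (2 * r)) T) = T"
      unfolding i by (simp add: T(1))
    show "(T ! Suc (2 * r), T ! (2 * r), take (Suc (2 * r)) T) \<in> {p \<in> P. ?good p}"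
      unfolding i using T(2-4) S by (simp add: P_def)
  next
    fix p assume "p \<in> {p \<in> P. ?good p}"
    then show "tableau_term n c z w (Suc r) ((\<lambda>(\<nu>, \<kappa>, T). T @ [\<nu>, \<mu>]) p) = ?F p"
      by (auto simp: P_def tableau_term_append)
  qed
  finally show ?thesis by (simp add: srf)
qed

context fock
begin

lemma lookup_strip_op:
  "Poly_Mapping.lookup (strip_op z w r (basis lam)) \<mu> = super_ribbon_function n r lam \<mu> z w (- q)"
proof (induction r arbitrary: \<mu>)
  case 0
  show ?case by (simp add: super_ribbon_function_0 lookup_single when_def)
next
  case (Suc r)
  let ?S = "{\<nu>. diagram \<nu> \<subseteq> diagram lam}"
  let ?f = "strip_op z w r (basis lam)"
  have ex: "Poly_Mapping.lookup (F f) \<nu> = (\<Sum>\<kappa>\<in>?S. Poly_Mapping.lookup f \<kappa> * Poly_Mapping.lookup (F (basis \<kappa>)) \<nu>)"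
    if "lin F" "Poly_Mapping.keys f \<subseteq> ?S" for F :: "(int_partition \<Rightarrow>\<^sub>0 complex) \<Rightarrow> (int_partition \<Rightarrow>\<^sub>0 complex)" and f \<nu>
    unfolding lin_expand[OF that(1), of f] lookup_sum lookup_scl
    by (rule sum.mono_neutral_left) (use that(2) finite_subpartitions in \<open>auto simp: in_keys_iff\<close>)
  have kf: "Poly_Mapping.keys ?f \<subseteq> ?S"
  proof
    fix \<kappa> assume "\<kappa> \<in> Poly_Mapping.keys ?f"
    then have "super_ribbon_function n r lam \<kappa> z w (- q) \<noteq> 0" by (simp add: in_keys_iff Suc)
    then show "\<kappa> \<in> ?S" using super_ribbon_function_not_subset by blast
  qed
  have h: "Poly_Mapping.lookup (Hop (z r) ?f) \<nu> =
      (\<Sum>\<kappa>\<in>?S. super_ribbon_function n r lam \<kappa> z w (- q) * hcoeff n (- q) (z r) \<kappa> \<nu>)" for \<nu>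
    unfolding ex[OF lin_Hop kf] lookup_Hop_basis Suc ..
  have "Poly_Mapping.keys (Hop (z r) ?f) \<subseteq> ?S"
  proof
    fix \<nu> assume "\<nu> \<in> Poly_Mapping.keys (Hop (z r) ?f)"
    then have "(\<Sum>\<kappa>\<in>?S. super_ribbon_function n r lam \<kappa> z w (- q) * hcoeff n (- q) (z r) \<kappa> \<nu>) \<noteq> 0"
      by (simp add: in_keys_iff h)
    then obtain \<kappa> where "\<kappa> \<in> ?S" "hcoeff n (- q) (z r) \<kappa> \<nu> \<noteq> 0" by (metis (no_types, lifting) mult_zero_right sum.neutral)
    then show "\<nu> \<in> ?S" using hcoeff_not_subset by blast
  qed
  then show ?case
    unfolding strip_op.simps ex[OF lin_Vop \<open>Poly_Mapping.keys (Hop (z r) ?f) \<subseteq> ?S\<close>] h lookup_Vop_basis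
      super_ribbon_function_Suc by simp
qed

text \<open>The inner exponential keeps the support below \<open>?K\<close>, so the same truncation
  is exact for the outer one.\<close>

lemma matrix_coeff_vertex_operators:
  "matrix_coeff n q \<mu> (exp_op n q (L_plus n q r z) \<circ> exp_op n q (\<lambda>x. - L_plus n q r w x)) lam =
    super_ribbon_function n r lam \<mu> z w (- q)"
proof -
  let ?a = "\<lambda>z k. 1 / of_nat k * (\<Sum>i<r. z i ^ k) :: complex"
  let ?K = "Suc (partition_size lam)"
  let ?y = "exp_op n q (\<lambda>x. - L_plus n q r w x) (ket lam)"
  have ket: "coords (ket lam) = basis lam" by (simp add: ket_def wedge_eq_basis wcoords_partition_seq)
  have s: "supported (below ?K) (coords (ket lam))" unfolding ket by (rule supported_single) simp
  have y: "coords ?y = Jexp (\<lambda>k. - ?a w k) ?K (basis lam)"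
    unfolding ket[symmetric]
    by (rule coords_exp_op[OF _ s]) (simp only: lin_uminus[OF lin_coords] coords_L_plus Jser_uminus)
  have "supported (below ?K) (coords ?y - basis lam + basis lam)"
    unfolding y by (rule supported_add[OF supported_mono[OF Jexp_top]]) (auto intro: supported_single)
  then have "supported (below ?K) (coords ?y)" by simp
  then have "coords (exp_op n q (L_plus n q r z) ?y) = Jexp (?a z) ?K (coords ?y)"
    by (rule coords_exp_op[OF coords_L_plus])
  then show ?thesis
    unfolding matrix_coeff_def comp_apply y Jexp_strip_op by (simp only: lookup_strip_op)
qed

end

theorem theorem5p8:
  fixes n r :: nat and q :: complex
    and lam \<mu> :: int_partition and z w :: "nat \<Rightarrow> complex"
  assumes "n \<ge> 1"
    and "q \<noteq> 0" and "\<And>m::nat. m \<ge> 1 \<Longrightarrow> q ^ m \<noteq> 1"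
    and "diagram \<mu> \<subseteq> diagram lam"
  shows "matrix_coeff n q \<mu>
           (exp_op n q (L_plus n q r z) \<circ> exp_op n q (\<lambda>x. - L_plus n q r w x)) lam =
         super_ribbon_function n r lam \<mu> z w (- q) \<and>
         (n_core n lam \<noteq> n_core n \<mu> \<longrightarrow> super_ribbon_function n r lam \<mu> z w q = 0)"
proof
  interpret fock n q using assms(1-3) by unfold_locales auto
  show "matrix_coeff n q \<mu> (exp_op n q (L_plus n q r z) \<circ> exp_op n q (\<lambda>x. - L_plus n q r w x)) lam =
      super_ribbon_function n r lam \<mu> z w (- q)" by (rule matrix_coeff_vertex_operators)
  \<comment> \<open>Different cores exclude any tableau at all, so the sum is empty whatever the
    value of the spin parameter.\<close>
  show "n_core n lam \<noteq> n_core n \<mu> \<longrightarrow> super_ribbon_function n r lam \<mu> z w q = 0"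
    using super_ribbon_tableau_same_runners[OF assms(1)] n_core_eq_of_same_runners[OF assms(1)]
    by (auto simp: super_ribbon_function_def intro!: sum.neutral)
qed

end
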